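(* Let $\Omega\subset\mathbb R^n$ be open and let $u\in C^{1,1}_{\rm loc}(\Omega)$ satisfy $u\ge0$ in $\Omega$ and $\Delta u=\chi_{\{u>0\}}$ a.e. in $\Omega$. For each $m\in\{0,\dots,n-1\}$, the set $\Sigma_m$ is locally contained in an $m$-dimensional manifold of class $C^1$.
   Context: Let $\mathcal P$ be the set of polynomials $p(x)=\frac12\langle Ax,x\rangle$ with $A\in\mathbb R^{n\times n}$ symmetric, nonnegative definite, $\mathrm{tr}(A)=1$. A point $x_0\in\partial\{u>0\}$ is a singular point if there exist $r_k\to0^+$ and $p\in\mathcal P$ such that $u(x_0+r_kx)/r_k^2\to p(x)$ in $C^1_{\rm loc}(\mathbb R^n)$; $\Sigma$ denotes the set of singular points. At each $x_0\in\Sigma$ the full limit $p_{*,x_0}(x):=\lim_{r\to0^+}u(x_0+rx)/r^2$ exists and belongs to $\mathcal P$. For $m\in\{0,\dots,n-1\}$, $\Sigma_m:=\{x_0\in\Sigma:\ \dim\ker D^2p_{*,x_0}=m\}$. *)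

theory Defs
  imports "HOL-Analysis.Analysis"
begin

definition grad :: "(real^'n \<Rightarrow> real) \<Rightarrow> real^'n \<Rightarrow> real^'n" where
  "grad f x = (\<chi> i. frechet_derivative f (at x) (axis i 1))"

definition C11_loc :: "(real^'n) set \<Rightarrow> (real^'n \<Rightarrow> real) \<Rightarrow> bool" where
  "C11_loc \<Omega> u \<longleftrightarrow> (\<forall>x\<in>\<Omega>. u differentiable (at x)) \<and>
     (\<forall>K. compact K \<and> K \<subseteq> \<Omega> \<longrightarrow>
        (\<exists>L. \<forall>x\<in>K. \<forall>y\<in>K. norm (grad u x - grad u y) \<le> L * dist x y))"

definition laplacian_eq_indicator_ae :: "(real^'n) set \<Rightarrow> (real^'n \<Rightarrow> real) \<Rightarrow> bool" where
  "laplacian_eq_indicator_ae \<Omega> u \<longleftrightarrow>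
     (AE x in lebesgue. x \<in> \<Omega> \<longrightarrow>
        (\<exists>G. (grad u has_derivative G) (at x) \<and>
             (\<Sum>i\<in>UNIV. G (axis i 1) $ i) = indicator {y. u y > 0} x))"

definition admissible_matrix :: "real^'n^'n \<Rightarrow> bool" where
  "admissible_matrix A \<longleftrightarrow> transpose A = A \<and> (\<forall>x. 0 \<le> x \<bullet> (A *v x)) \<and> trace A = 1"

definition quad_poly :: "real^'n^'n \<Rightarrow> real^'n \<Rightarrow> real" where
  "quad_poly A x = (1/2) * ((A *v x) \<bullet> x)"

definition conv_C1_loc :: "('i \<Rightarrow> real^'n \<Rightarrow> real) \<Rightarrow> (real^'n \<Rightarrow> real) \<Rightarrow> 'i filter \<Rightarrow> bool" where
  "conv_C1_loc f p F \<longleftrightarrow> (\<forall>K. compact K \<longrightarrow> (\<forall>e>0. eventually (\<lambda>i. \<forall>x\<in>K.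
      \<bar>f i x - p x\<bar> < e \<and> norm (grad (f i) x - grad p x) < e) F))"

definition rescale :: "(real^'n \<Rightarrow> real) \<Rightarrow> real^'n \<Rightarrow> real \<Rightarrow> real^'n \<Rightarrow> real" where
  "rescale u x0 r x = u (x0 + r *\<^sub>R x) / r^2"

definition singular_set :: "(real^'n) set \<Rightarrow> (real^'n \<Rightarrow> real) \<Rightarrow> (real^'n) set" where
  "singular_set \<Omega> u = {x0. x0 \<in> \<Omega> \<and> x0 \<in> frontier {x \<in> \<Omega>. u x > 0} \<and>
     (\<exists>rk A. (\<forall>k. rk k > 0) \<and> rk \<longlonglongrightarrow> 0 \<and> admissible_matrix A \<and>
        conv_C1_loc (\<lambda>k. rescale u x0 (rk k)) (quad_poly A) sequentially)}"

text \<open>Sigma_m: singular points whose (full) blow-up p_* = quad_poly A has dim ker D^2 p_* = dim ker A = m.\<close>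
definition singular_stratum :: "(real^'n) set \<Rightarrow> (real^'n \<Rightarrow> real) \<Rightarrow> nat \<Rightarrow> (real^'n) set" where
  "singular_stratum \<Omega> u m = {x0 \<in> singular_set \<Omega> u. \<exists>A. admissible_matrix A \<and>
     conv_C1_loc (\<lambda>r. rescale u x0 r) (quad_poly A) (at_right 0) \<and>
     dim {v. A *v v = 0} = m}"

definition C1_submanifold :: "nat \<Rightarrow> (real^'n) set \<Rightarrow> bool" where
  "C1_submanifold m M \<longleftrightarrow> (\<forall>p\<in>M. \<exists>V L g G. open V \<and> p \<in> V \<and> subspace L \<and> dim L = m \<and>
     (\<forall>x. (g has_derivative blinfun_apply (G x)) (at x)) \<and> continuous_on UNIV G \<and>
     (\<forall>x. \<forall>v\<in>L. g x \<bullet> v = 0) \<and>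
     M \<inter> V = {y + g y | y. y \<in> L} \<inter> V)"

end

theory Submission
  imports Defs
begin

text \<open>
  Let \<open>u\<^sub>r(x) = u(x\<^sub>0 + r x) / r\<^sup>2\<close> be the rescalings at a singular point and let \<open>p\<close> be an admissible
  quadratic polynomial.  With radial weights \<open>\<phi>, \<psi>\<close> satisfying \<open>\<nabla>\<phi> = - \<psi> x\<close> in place of balls and
  spheres, Weiss' energy of \<open>u\<^sub>r\<close> is nondecreasing in \<open>r\<close>, and hence so is Monneau's integral
  \<open>\<integral> \<psi> (u\<^sub>r - p)\<^sup>2\<close>, for every admissible \<open>p\<close>.

  Since the energy of \<open>u\<^sub>r\<close> is at least that of an admissible polynomial, the weighted measure of the
  contact set of \<open>u\<^sub>r\<close> is bounded by the logarithmic derivative in \<open>r\<close> of a bounded quantity.  So it is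
  small at some scale bounded below uniformly in \<open>x\<^sub>0\<close>; there the mean value property makes
  \<open>u\<^sub>r\<close> close to a mollification of itself and therefore, after zooming in, close to an admissible
  polynomial.  By Monneau's monotonicity the blow-ups \<open>p\<^sub>x\<close> then depend uniformly continuously on the
  singular point \<open>x\<close> and are attained at a uniform rate, although the singular set is not known to be
  closed.

  If \<open>x, y\<close> are singular, then \<open>u(y) = 0\<close> gives \<open>p\<^sub>x(y - x) = o(|y - x|\<^sup>2)\<close>, so \<open>y - x\<close> is almost in the kernel
  of \<open>D\<^sup>2p\<^sub>x\<close>.  Near a point of the stratum the projection to the kernel at that point is therefore
  injective on the stratum, and the inverse is a Whitney jet; its extension to a function with
  continuous derivative is the required manifold.
\<close>

section \<open>Weights on the unit ball and the divergence theorem\<close>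

text \<open>The weights \<open>bump 3\<close>, \<open>bump 4\<close>, \<open>bump 5\<close> form a
  chain: the gradient of each is a multiple of its predecessor times the position vector. Boundary
  integrals thus become volume integrals, and every identity follows from a divergence theorem for
  Lipschitz fields, which suits functions with second derivatives only almost everywhere. All
  admissible polynomials have the same energy, since homogeneity 2 and Laplacian 1 determine it. A
  blow-up therefore bounds the energy from below at every scale, whichever polynomial it is, and
  this one fact feeds both the contact estimate and Monneau's inequality. The obstacle is
  uniformity: blow-ups cannot be compared at a limit of singular points. Instead a logarithmic
  pigeonhole finds, for each singular point, a good scale above a bound that depends only on the
  Lipschitz constant \<open>L\<close> of the gradient, the dimension and the tolerance. Compactness
  is applied only to the finitely many coefficients of approximating quadratics, never to the
  solutions. For the same reason the Whitney data carry a uniform modulus on a set that need not be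
  closed.\<close>

text \<open>In the notation of the introduction, \<open>\<phi>\<close> is \<open>bump 4\<close> and \<open>\<psi>\<close> is \<open>8 * bump 3\<close>; also
  \<open>\<phi> x = - \<nabla>(bump 5 / 10)\<close>.\<close>

definition bump :: "nat \<Rightarrow> real^'n \<Rightarrow> real" where
  "bump k x = (max 0 (1 - x \<bullet> x)) ^ k"

text \<open>A restricted measure instead of set integrals: it is finite, so bounded measurable
  functions are integrable at once, and constants can be integrated in the pointwise comparisons
  below.\<close>

definition lborel_ball :: "(real^'n) measure" where
  "lborel_ball = restrict_space lborel (cball 0 1)"

lemma space_B1 [simp]: "space lborel_ball = cball 0 1"
  by (simp add: lborel_ball_def space_restrict_space)

lemma finite_measure_B1: "finite_measure (lborel_ball :: (real^'n) measure)"
proof (rule finite_measureI)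
  have "emeasure lborel_ball (space (lborel_ball :: (real^'n) measure)) = emeasure lborel (cball (0::real^'n) 1)"
    unfolding lborel_ball_def by (simp add: emeasure_restrict_space space_restrict_space)
  also have "\<dots> \<noteq> \<infinity>"
    using emeasure_lborel_cball_finite[of "0::real^'n" 1] by (metis infinity_ennreal_def less_irrefl)
  finally show "emeasure lborel_ball (space (lborel_ball :: (real^'n) measure)) \<noteq> \<infinity>" .
qed

lemma continuous_imp_measurable_B1:
  fixes f :: "real^'n \<Rightarrow> 'b::{second_countable_topology,real_normed_vector}"
  assumes "continuous_on (cball 0 1) f"
  shows "f \<in> borel_measurable lborel_ball"
  using borel_measurable_continuous_on_restrict[OF assms] unfolding lborel_ball_def
  by (subst measurable_cong_sets[OF sets_restrict_space_cong[OF sets_lborel] refl])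

lemma integrable_B1_bounded:
  fixes f :: "real^'n \<Rightarrow> real"
  assumes "f \<in> borel_measurable lborel_ball" "\<And>x. norm x \<le> 1 \<Longrightarrow> \<bar>f x\<bar> \<le> K"
  shows "integrable lborel_ball f"
proof -
  interpret finite_measure "lborel_ball :: (real^'n) measure" by (rule finite_measure_B1)
  show ?thesis
    using assms by (intro integrable_const_bound[where B=K] AE_I2) auto
qed

lemma integrable_B1_continuous:
  fixes f :: "real^'n \<Rightarrow> real"
  assumes "continuous_on (cball 0 1) f"
  shows "integrable lborel_ball f"
proof -
  have "bounded (f ` cball 0 1)"
    by (intro compact_imp_bounded compact_continuous_image assms compact_cball)
  then obtain K where "\<forall>x\<in>cball 0 1. \<bar>f x\<bar> \<le> K" by (auto simp: bounded_iff)
  then show ?thesis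
    by (intro integrable_B1_bounded[where K=K] continuous_imp_measurable_B1 assms) auto
qed

text \<open>Translations and dilations act on \<open>lborel\<close> of the whole space, while the
  estimates live on the ball. Integrands that carry a weight vanish outside the ball, so the passage
  between the two costs nothing.\<close>

lemma lborel_eq_B1:
  fixes f :: "real^'n \<Rightarrow> real"
  assumes "\<And>x. norm x > 1 \<Longrightarrow> f x = 0"
  shows "integral\<^sup>L lborel f = integral\<^sup>L lborel_ball f" "integrable lborel f \<longleftrightarrow> integrable lborel_ball f"
proof -
  have eq: "(\<lambda>x. indicator (cball 0 1) x *\<^sub>R f x) = f"
    using assms by (auto simp: indicator_def fun_eq_iff)
  show "integral\<^sup>L lborel f = integral\<^sup>L lborel_ball f"
    unfolding lborel_ball_def by (subst integral_restrict_space) (auto simp: eq[simplified])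
  show "integrable lborel f \<longleftrightarrow> integrable lborel_ball f"
    unfolding lborel_ball_def by (subst integrable_restrict_space) (auto simp: eq[simplified])
qed

lemma bump_nonneg [simp]: "0 \<le> bump k x" by (simp add: bump_def)

lemma bump_le_1: "bump k x \<le> 1"
  unfolding bump_def by (rule power_le_one) auto

lemma bump_0_outside: "norm x \<ge> 1 \<Longrightarrow> k > 0 \<Longrightarrow> bump k x = 0"
proof -
  assume "norm x \<ge> 1" "k > 0"
  then have "x \<bullet> x \<ge> 1" by (metis dot_square_norm one_le_power)
  then show ?thesis using \<open>k>0\<close> by (simp add: bump_def max_def)
qed

lemma continuous_on_bump [continuous_intros]: 
  "continuous_on S f \<Longrightarrow> continuous_on S (\<lambda>x. bump k (f x))"
  unfolding bump_def by (intro continuous_intros)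

lemma DERIV_pos_part_power:
  fixes s :: real
  assumes "k > 0"
  shows "((\<lambda>s. (max 0 s) ^ Suc k) has_real_derivative (real (Suc k) * (max 0 s)^k)) (at s)"
proof -
  consider "s > 0" | "s < 0" | "s = 0" by linarith
  then show ?thesis
  proof cases
    case 1
    have "((\<lambda>s. s ^ Suc k) has_real_derivative (real (Suc k) * s^k)) (at s)"
      using DERIV_pow[of "Suc k" s] by simp
    then have "((\<lambda>s. (max 0 s) ^ Suc k) has_real_derivative (real (Suc k) * s^k)) (at s)"
      by (rule DERIV_cong_ev[THEN iffD1, rotated 3])
         (use 1 eventually_nhds_in_open[of "{0<..}" s] in \<open>auto elim!: eventually_mono\<close>)
    then show ?thesis using 1 by simp
  next
    case 2
    have "((\<lambda>s::real. 0) has_real_derivative 0) (at s)" by simp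
    then have "((\<lambda>s. (max 0 s) ^ Suc k) has_real_derivative 0) (at s)"
      by (rule DERIV_cong_ev[THEN iffD1, rotated 3])
         (use 2 eventually_nhds_in_open[of "{..<0}" s] in \<open>auto elim!: eventually_mono\<close>)
    then show ?thesis using 2 assms by (simp add: max_def power_0_left)
  next
    \<comment> \<open>At the corner the difference quotient is dominated by the \<open>k\<close>-th
      power itself, which tends to 0 because \<open>k\<close> is positive.\<close>
    case 3
    have "isCont (\<lambda>h::real. (max 0 h)^k) 0" by (intro continuous_intros)
    then have lim: "((\<lambda>h::real. (max 0 h)^k) \<longlongrightarrow> 0) (at 0)"
      using assms unfolding isCont_def by (simp only: max.idem zero_power)
    have le: "\<bar>((max 0 h) ^ Suc k) / h\<bar> \<le> (max 0 h)^k" for h :: real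
    proof (cases "h > 0")
      case True
      then show ?thesis by simp
    next
      case False
      then have "max 0 h = 0" by simp
      then show ?thesis by simp
    qed
    have "((\<lambda>h::real. ((max 0 h) ^ Suc k) / h) \<longlongrightarrow> 0) (at 0)"
      by (rule Lim_null_comparison[OF _ lim]) (use le in \<open>simp only: real_norm_def eventually_True simp_thms\<close>)
    then show ?thesis using 3 assms by (simp add: DERIV_def zero_power del: power_Suc)
  qed
qed

text \<open>Differentiation lowers the exponent by one and produces the radial field. The factor
  \<open>2 * real (Suc k)\<close> is the origin of the 8 and the 10 in the identities for exponents
  4 and 5.\<close>

lemma bump_has_derivative:
  fixes x :: "real^'n"
  assumes "k > 0"
  shows "(bump (Suc k) has_derivative (\<lambda>h. - (2 * real (Suc k)) * bump k x * (x \<bullet> h))) (at x)"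
proof -
  have "((\<lambda>y::real^'n. 1 - y \<bullet> y) has_derivative (\<lambda>h. - 2 * (x \<bullet> h))) (at x)"
    by (auto intro!: derivative_eq_intros simp: inner_commute)
  from DERIV_compose_FDERIV[OF DERIV_pos_part_power[OF assms] this]
  show ?thesis unfolding bump_def[abs_def] by (simp add: algebra_simps)
qed

lemma has_derivative_quotient_seq:
  fixes X :: "real^'n \<Rightarrow> real^'n"
  assumes "(X has_derivative D) (at x)"
  shows "(\<lambda>k. (X (x + inverse (real (Suc k)) *\<^sub>R e) $ i - X x $ i) / inverse (real (Suc k))) \<longlonglongrightarrow> D e $ i"
proof -
  have "((\<lambda>t. x + t *\<^sub>R e) has_derivative (\<lambda>t. t *\<^sub>R e)) (at 0)"
    by (auto intro!: derivative_eq_intros)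
  moreover have "(X has_derivative D) (at (x + 0 *\<^sub>R e))" using assms by simp
  ultimately have "((\<lambda>t. X (x + t *\<^sub>R e)) has_derivative (\<lambda>t. D (t *\<^sub>R e))) (at 0)"
    by (rule has_derivative_compose)
  then have "((\<lambda>t. X (x + t *\<^sub>R e) $ i) has_derivative (\<lambda>t. D (t *\<^sub>R e) $ i)) (at 0)"
    by (rule bounded_linear.has_derivative[OF bounded_linear_vec_nth])
  moreover have "(\<lambda>t. D (t *\<^sub>R e) $ i) = (\<lambda>t. t * (D e $ i))"
    using assms has_derivative_linear[OF assms] by (auto simp: linear_cmul)
  ultimately have "((\<lambda>t. X (x + t *\<^sub>R e) $ i) has_real_derivative (D e $ i)) (at 0)"
    by (simp add: has_field_derivative_def mult_commute_abs)
  then have "((\<lambda>h. (X (x + h *\<^sub>R e) $ i - X x $ i) / h) \<longlongrightarrow> D e $ i) (at 0)"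
    by (simp add: DERIV_def)
  moreover have "filterlim (\<lambda>k. inverse (real (Suc k))) (at 0) sequentially"
    by (rule filterlim_atI[OF LIMSEQ_inverse_real_of_nat]) simp
  ultimately show ?thesis by (rule filterlim_compose)
qed

lemma lborel_integral_shift:
  fixes f :: "real^'n \<Rightarrow> real"
  assumes "f \<in> borel_measurable borel"
  shows "integral\<^sup>L lborel (\<lambda>x. f (x + c)) = integral\<^sup>L lborel f"
    and "integrable lborel f \<Longrightarrow> integrable lborel (\<lambda>x. f (x + c))"
proof -
  have "integral\<^sup>L lborel f = integral\<^sup>L (distr lborel borel ((+) c)) f"
    by (simp add: lborel_distr_plus)
  also have "\<dots> = integral\<^sup>L lborel (\<lambda>x. f (c + x))"
    by (rule integral_distr) (use assms in auto)
  finally show "integral\<^sup>L lborel (\<lambda>x. f (x + c)) = integral\<^sup>L lborel f" by (simp add: add.commute)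
  assume "integrable lborel f"
  then have "integrable (distr lborel borel ((+) c)) f" by (simp add: lborel_distr_plus)
  then have "integrable lborel (\<lambda>x. f (c + x))"
    by (subst (asm) integrable_distr_eq) (use assms in auto)
  then show "integrable lborel (\<lambda>x. f (x + c))" by (simp add: add.commute)
qed

text \<open>Integrals of difference quotients vanish by translation invariance; dominated convergence
  then needs differentiability only almost everywhere.\<close>

lemma divergence_integral_zero:
  fixes X :: "real^'n \<Rightarrow> real^'n"
  assumes supp: "\<And>x. norm x \<ge> 1 \<Longrightarrow> X x = 0"
    and lip: "\<And>x y. x \<in> ball 0 2 \<Longrightarrow> y \<in> ball 0 2 \<Longrightarrow> norm (X x - X y) \<le> K * norm (x - y)"
    and K: "K \<ge> 0"
    and d: "AE x in lborel. x \<in> ball 0 2 \<longrightarrow> (\<exists>D. (X has_derivative D) (at x) \<and> (\<Sum>i\<in>UNIV. D (axis i 1) $ i) = d x)"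
    and dm: "d \<in> borel_measurable lborel_ball"
  shows "integral\<^sup>L lborel_ball d = 0"
proof -
  have contX: "continuous_on UNIV X"
  proof -
    have "continuous_on (ball 0 2) X"
      using lip K by (intro lipschitz_on_continuous_on[where L=K] lipschitz_onI) (auto simp: dist_norm)
    moreover have "continuous_on (- cball 0 1) X"
      by (rule continuous_on_eq[where f="\<lambda>_. 0"]) (auto simp: supp)
    ultimately have "continuous_on (ball 0 2 \<union> - cball 0 1) X"
      by (intro continuous_on_open_Un) auto
    moreover have "ball 0 2 \<union> - cball 0 1 = (UNIV :: (real^'n) set)" by auto
    ultimately show ?thesis by simp
  qed
  have Xi: "continuous_on UNIV (\<lambda>x. X x $ i)" for i
    using contX by (intro continuous_intros)
  then have Xm: "(\<lambda>x. X x $ i) \<in> borel_measurable borel" for i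
    by (rule borel_measurable_continuous_onI)
  have Xint: "integrable lborel (\<lambda>x. X x $ i)" for i
    by (subst lborel_eq_B1(2)) (use supp Xi in \<open>auto intro!: integrable_B1_continuous intro: continuous_on_subset\<close>)
  define s where "s k x = (\<Sum>i\<in>UNIV. (X (x + inverse (real (Suc k)) *\<^sub>R axis i 1) $ i - X x $ i) / inverse (real (Suc k)))" for k x
  have sm: "s k \<in> borel_measurable borel" for k
    unfolding s_def[abs_def] using Xi
    by (intro borel_measurable_continuous_onI continuous_intros contX continuous_on_compose2[OF contX]) auto
  have s0: "integral\<^sup>L lborel (s k) = 0" for k
    unfolding s_def[abs_def]
    by (simp add: lborel_integral_shift[OF Xm] Xint Bochner_Integration.integral_diff divide_inverse)
  \<comment> \<open>Off the unit ball the field vanishes, so the quotients tend to 0 there, whatever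
    the values of \<open>d\<close>.\<close>
  define d' where "d' x = indicator (cball 0 1) x * d x" for x
  have d'm: "d' \<in> borel_measurable lborel"
    using dm unfolding lborel_ball_def d'_def[abs_def] by (subst (asm) borel_measurable_restrict_space_iff) (auto simp: mult.commute)
  have lim: "AE x in lborel. (\<lambda>k. s (Suc k) x) \<longlonglongrightarrow> d' x"
    using d
  proof eventually_elim
    case (elim x)
    show ?case
    proof (cases "norm x \<le> 1")
      case True
      then obtain D where D: "(X has_derivative D) (at x)" "(\<Sum>i\<in>UNIV. D (axis i 1) $ i) = d x"
        using elim by auto
      have "(\<lambda>k. s k x) \<longlonglongrightarrow> (\<Sum>i\<in>UNIV. D (axis i 1) $ i)"
        unfolding s_def by (intro tendsto_sum has_derivative_quotient_seq[OF D(1)])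
      from LIMSEQ_Suc[OF this] show ?thesis using True D(2) by (simp add: d'_def)
    next
      case False
      have "(X has_derivative (\<lambda>_. 0)) (at x)"
        using False supp
        by - (rule has_derivative_transform_within_open[where f="\<lambda>_. 0" and s="- cball 0 1"], auto)
      note q = has_derivative_quotient_seq[OF this]
      have "(\<lambda>k. s k x) \<longlonglongrightarrow> (\<Sum>i\<in>UNIV. (0::real^'n) $ i)"
        unfolding s_def by (rule tendsto_sum, rule q)
      from LIMSEQ_Suc[OF this] show ?thesis using False by (simp add: d'_def)
    qed
  qed
  \<comment> \<open>The index \<open>Suc k\<close> keeps the step at most 1/2. A point of norm below
    3/2 and its translate then lie in \<open>ball 0 2\<close>, where the Lipschitz bound holds; a
    point of norm at least 3/2 and its translate both lie where the field is 0.\<close>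
  have bnd: "norm (s (Suc k) x) \<le> real CARD('n) * K * indicator (cball 0 (3/2)) x" for k x
  proof -
    define r where "r = inverse (real (Suc (Suc k)))"
    have r: "0 < r" "r \<le> 1/2" by (auto simp: r_def field_simps)
    have nrm: "norm (r *\<^sub>R (axis i 1 :: real^'n)) \<le> 1/2" for i using r by (simp)
    have "\<bar>X (x + r *\<^sub>R axis i 1) $ i - X x $ i\<bar> / r \<le> K * indicator (cball 0 (3/2)) x" for i
    proof (cases "norm x < 3/2")
      case True
      have "\<bar>X (x + r *\<^sub>R axis i 1) $ i - X x $ i\<bar> \<le> norm (X (x + r *\<^sub>R axis i 1) - X x)"
        using component_le_norm_cart[of "X (x + r *\<^sub>R axis i 1) - X x" i] by simp
      also have "\<dots> \<le> K * norm (r *\<^sub>R (axis i 1 :: real^'n))"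
      proof -
        have "norm (x + r *\<^sub>R axis i 1) < 2" using True nrm[of i] norm_triangle_ineq[of x "r *\<^sub>R axis i 1"] by linarith
        then show ?thesis using lip[of "x + r *\<^sub>R axis i 1" x] True by simp
      qed
      also have "\<dots> = K * r" using r by (simp)
      finally show ?thesis using r True by (simp add: field_simps)
    next
      case False
      have "norm x \<ge> 1" "norm (x + r *\<^sub>R axis i 1) \<ge> 1"
        using False nrm[of i] norm_triangle_ineq4[of "x + r *\<^sub>R axis i 1" "r *\<^sub>R axis i 1"] by auto
      then show ?thesis using K supp by (simp add: indicator_def)
    qed
    then have "(\<Sum>i\<in>(UNIV::'n set). \<bar>(X (x + r *\<^sub>R axis i 1) $ i - X x $ i) / r\<bar>) \<le> (\<Sum>i\<in>(UNIV::'n set). K * indicator (cball 0 (3/2)) x)"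
      using r by (intro sum_mono) simp
    then show ?thesis unfolding s_def real_norm_def r_def[symmetric]
      by (intro order_trans[OF sum_abs]) simp
  qed
  have "(\<lambda>k. integral\<^sup>L lborel (s (Suc k))) \<longlonglongrightarrow> integral\<^sup>L lborel d'"
    by (rule integral_dominated_convergence[where w="\<lambda>x. real CARD('n) * K * indicator (cball 0 (3/2)) x"])
       (use d'm sm bnd lim in \<open>auto intro!: integrable_real_indicator emeasure_lborel_cball_finite\<close>)
  then have "integral\<^sup>L lborel d' = 0" by (simp add: s0 LIMSEQ_const_iff)
  moreover have "integral\<^sup>L lborel d' = integral\<^sup>L lborel_ball d'"
    by (rule lborel_eq_B1) (auto simp: d'_def)
  moreover have "integral\<^sup>L lborel_ball d' = integral\<^sup>L lborel_ball d"
    by (rule Bochner_Integration.integral_cong) (auto simp: d'_def)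
  ultimately show ?thesis by simp
qed

text \<open>Here \<open>dv\<close> is the gradient and \<open>l\<close> the almost everywhere Laplacian of \<open>v\<close>.\<close>

definition c11 :: "(real^'n \<Rightarrow> real) \<Rightarrow> (real^'n \<Rightarrow> real^'n) \<Rightarrow> (real^'n \<Rightarrow> real) \<Rightarrow> real \<Rightarrow> bool" where
  "c11 v dv l K \<longleftrightarrow>
     (\<forall>x\<in>ball 0 2. (v has_derivative (\<lambda>h. dv x \<bullet> h)) (at x)) \<and>
     (\<forall>x\<in>ball 0 2. \<forall>y\<in>ball 0 2. norm (dv x - dv y) \<le> K * norm (x - y)) \<and>
     (\<forall>x\<in>ball 0 2. \<bar>v x\<bar> \<le> K \<and> norm (dv x) \<le> K) \<and>
     (AE x in lborel. x \<in> ball 0 2 \<longrightarrow>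
        (\<exists>G. (dv has_derivative G) (at x) \<and> (\<Sum>i\<in>UNIV. G (axis i 1) $ i) = l x)) \<and>
     l \<in> borel_measurable lborel_ball \<and> (\<forall>x\<in>cball 0 1. \<bar>l x\<bar> \<le> K)"

lemma c11_K_nonneg: "c11 v dv l K \<Longrightarrow> 0 \<le> K"
proof -
  assume "c11 v dv l K"
  then have "\<bar>v 0\<bar> \<le> K" unfolding c11_def by auto
  then show ?thesis by linarith
qed

lemma c11D:
  assumes "c11 v dv l K"
  shows "x \<in> ball 0 2 \<Longrightarrow> (v has_derivative (\<lambda>h. dv x \<bullet> h)) (at x)"
    "x \<in> ball 0 2 \<Longrightarrow> y \<in> ball 0 2 \<Longrightarrow> norm (dv x - dv y) \<le> K * norm (x - y)"
    "x \<in> ball 0 2 \<Longrightarrow> \<bar>v x\<bar> \<le> K"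
    "x \<in> ball 0 2 \<Longrightarrow> norm (dv x) \<le> K"
    "AE x in lborel. x \<in> ball 0 2 \<longrightarrow>
        (\<exists>G. (dv has_derivative G) (at x) \<and> (\<Sum>i\<in>UNIV. G (axis i 1) $ i) = l x)"
    "l \<in> borel_measurable lborel_ball"
    "norm x \<le> 1 \<Longrightarrow> \<bar>l x\<bar> \<le> K"
  using assms unfolding c11_def by simp_all

lemma c11_add:
  fixes v :: "real^'n \<Rightarrow> real"
  assumes "c11 v dv l K" "c11 v' dv' l' K'"
  shows "c11 (\<lambda>x. v x + v' x) (\<lambda>x. dv x + dv' x) (\<lambda>x. l x + l' x) (K + K')"
  unfolding c11_def
proof (intro conjI ballI)
  fix x :: "real^'n" assume x: "x \<in> ball 0 2"
  show "((\<lambda>x. v x + v' x) has_derivative (\<lambda>h. (dv x + dv' x) \<bullet> h)) (at x)"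
    unfolding inner_add_left by (intro has_derivative_add c11D(1)[OF assms(1) x] c11D(1)[OF assms(2) x])
  show "\<bar>v x + v' x\<bar> \<le> K + K'" "norm (dv x + dv' x) \<le> K + K'"
    using c11D(3)[OF assms(1) x] c11D(3)[OF assms(2) x] c11D(4)[OF assms(1) x] c11D(4)[OF assms(2) x]
      norm_triangle_ineq[of "dv x" "dv' x"] by linarith+
  fix y :: "real^'n" assume y: "y \<in> ball 0 2"
  have "norm (dv x + dv' x - (dv y + dv' y)) \<le> norm (dv x - dv y) + norm (dv' x - dv' y)"
    by norm
  also have "\<dots> \<le> K * norm (x - y) + K' * norm (x - y)"
    by (intro add_mono c11D(2)[OF assms(1) x y] c11D(2)[OF assms(2) x y])
  finally show "norm (dv x + dv' x - (dv y + dv' y)) \<le> (K + K') * norm (x - y)"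
    by (simp add: algebra_simps)
next
  have "AE x in lborel. x \<in> ball 0 2 \<longrightarrow>
        (\<exists>G. (dv has_derivative G) (at x) \<and> (\<Sum>i\<in>UNIV. G (axis i 1) $ i) = l x)"
    "AE x in lborel. x \<in> ball 0 2 \<longrightarrow>
        (\<exists>G. (dv' has_derivative G) (at x) \<and> (\<Sum>i\<in>UNIV. G (axis i 1) $ i) = l' x)"
    by (rule c11D(5)[OF assms(1)], rule c11D(5)[OF assms(2)])
  then show "AE x in lborel. x \<in> ball 0 2 \<longrightarrow>
        (\<exists>G. ((\<lambda>x. dv x + dv' x) has_derivative G) (at x) \<and> (\<Sum>i\<in>UNIV. G (axis i 1) $ i) = l x + l' x)"
  proof eventually_elim
    case (elim x)
    show ?case
    proof
      assume "x \<in> ball 0 2"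
      then obtain G G' where G: "(dv has_derivative G) (at x)" "(\<Sum>i\<in>UNIV. G (axis i 1) $ i) = l x"
        "(dv' has_derivative G') (at x)" "(\<Sum>i\<in>UNIV. G' (axis i 1) $ i) = l' x"
        using elim by blast
      then have "((\<lambda>x. dv x + dv' x) has_derivative (\<lambda>h. G h + G' h)) (at x)"
        by (intro has_derivative_add)
      then show "\<exists>G. ((\<lambda>x. dv x + dv' x) has_derivative G) (at x) \<and> (\<Sum>i\<in>UNIV. G (axis i 1) $ i) = l x + l' x"
        using G by (intro exI[of _ "\<lambda>h. G h + G' h"]) (simp add: sum.distrib)
    qed
  qed
next
  show "(\<lambda>x. l x + l' x) \<in> borel_measurable lborel_ball"
    by (intro borel_measurable_add c11D(6)[OF assms(1)] c11D(6)[OF assms(2)])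
next
  fix x :: "real^'n" assume "x \<in> cball 0 1"
  then have "\<bar>l x\<bar> \<le> K" "\<bar>l' x\<bar> \<le> K'" using c11D(7)[OF assms(1)] c11D(7)[OF assms(2)] by simp_all
  then show "\<bar>l x + l' x\<bar> \<le> K + K'" by linarith
qed

lemma c11_minus:
  fixes v :: "real^'n \<Rightarrow> real"
  assumes "c11 v dv l K"
  shows "c11 (\<lambda>x. - v x) (\<lambda>x. - dv x) (\<lambda>x. - l x) K"
  unfolding c11_def
proof (intro conjI ballI)
  fix x :: "real^'n" assume x: "x \<in> ball 0 2"
  show "((\<lambda>x. - v x) has_derivative (\<lambda>h. - dv x \<bullet> h)) (at x)"
    unfolding inner_minus_left by (intro has_derivative_minus c11D(1)[OF assms x])
  show "\<bar>- v x\<bar> \<le> K" "norm (- dv x) \<le> K"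
    using c11D(3,4)[OF assms x] by simp_all
  fix y :: "real^'n" assume y: "y \<in> ball 0 2"
  show "norm (- dv x - - dv y) \<le> K * norm (x - y)"
    using c11D(2)[OF assms x y] by (simp add: norm_minus_commute)
next
  have "AE x in lborel. x \<in> ball 0 2 \<longrightarrow>
        (\<exists>G. (dv has_derivative G) (at x) \<and> (\<Sum>i\<in>UNIV. G (axis i 1) $ i) = l x)"
    by (rule c11D(5)[OF assms])
  then show "AE x in lborel. x \<in> ball 0 2 \<longrightarrow>
        (\<exists>G. ((\<lambda>x. - dv x) has_derivative G) (at x) \<and> (\<Sum>i\<in>UNIV. G (axis i 1) $ i) = - l x)"
  proof eventually_elim
    case (elim x)
    show ?case
    proof
      assume "x \<in> ball 0 2"
      then obtain G where G: "(dv has_derivative G) (at x)" "(\<Sum>i\<in>UNIV. G (axis i 1) $ i) = l x"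
        using elim by blast
      then have "((\<lambda>x. - dv x) has_derivative (\<lambda>h. - G h)) (at x)"
        by (intro has_derivative_minus)
      then show "\<exists>G. ((\<lambda>x. - dv x) has_derivative G) (at x) \<and> (\<Sum>i\<in>UNIV. G (axis i 1) $ i) = - l x"
        using G by (intro exI[of _ "\<lambda>h. - G h"]) (simp add: sum_negf)
    qed
  qed
next
  show "(\<lambda>x. - l x) \<in> borel_measurable lborel_ball"
    by (intro borel_measurable_uminus c11D(6)[OF assms])
qed (use c11D(7)[OF assms] in simp)

lemma c11_diff:
  fixes v :: "real^'n \<Rightarrow> real"
  assumes "c11 v dv l K" "c11 v' dv' l' K'"
  shows "c11 (\<lambda>x. v x - v' x) (\<lambda>x. dv x - dv' x) (\<lambda>x. l x - l' x) (K + K')"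
  using c11_add[OF assms(1) c11_minus[OF assms(2)]] by simp

lemma c11_continuous:
  fixes v :: "real^'n \<Rightarrow> real"
  assumes "c11 v dv l K"
  shows "continuous_on (ball 0 2) v" "continuous_on (ball 0 2) dv"
    "continuous_on (cball 0 1) v" "continuous_on (cball 0 1) dv"
proof -
  show 1: "continuous_on (ball 0 2) v"
    by (intro continuous_at_imp_continuous_on ballI has_derivative_continuous[OF c11D(1)[OF assms]])
  show 2: "continuous_on (ball 0 2) dv"
    using c11D(2)[OF assms] c11_K_nonneg[OF assms]
    by (intro lipschitz_on_continuous_on[where L=K] lipschitz_onI) (auto simp: dist_norm)
  have "cball 0 1 \<subseteq> ball (0::real^'n) 2" by auto
  then show "continuous_on (cball 0 1) v" "continuous_on (cball 0 1) dv"
    using 1 2 continuous_on_subset by blast+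
qed

lemma c11_const: "c11 (\<lambda>_. c) (\<lambda>_. 0) (\<lambda>_. 0) \<bar>c\<bar>"
  unfolding c11_def by (auto intro!: exI[of _ "\<lambda>_. 0"] AE_I2 derivative_eq_intros)

section \<open>Green's identities with polynomial weights\<close>

lemma onorm_inner_le:
  fixes a :: "real^'n"
  assumes "norm a \<le> K"
  shows "onorm (\<lambda>h. a \<bullet> h) \<le> K"
proof (rule onorm_le)
  fix h :: "real^'n"
  have "norm (a \<bullet> h) \<le> norm a * norm h" using Cauchy_Schwarz_ineq2[of a h] by simp
  also have "\<dots> \<le> K * norm h" using assms by (intro mult_right_mono) auto
  finally show "norm (a \<bullet> h) \<le> K * norm h" .
qed

lemma c11_lipschitz:
  fixes v :: "real^'n \<Rightarrow> real"
  assumes "c11 v dv l K" "x \<in> ball 0 2" "y \<in> ball 0 2"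
  shows "\<bar>v x - v y\<bar> \<le> K * norm (x - y)"
proof -
  have "norm (v x - v y) \<le> K * norm (x - y)"
  proof (rule differentiable_bound[where f'="\<lambda>x h. dv x \<bullet> h" and S="ball 0 2"])
    fix z :: "real^'n" assume "z \<in> ball 0 2"
    then show "(v has_derivative (\<lambda>h. dv z \<bullet> h)) (at z within ball 0 2)"
      by (rule has_derivative_at_withinI[OF c11D(1)[OF assms(1)]])
    have "norm (dv z) \<le> K" by (rule c11D(4)[OF assms(1) \<open>z \<in> _\<close>])
    then show "onorm (\<lambda>h. dv z \<bullet> h) \<le> K"
      by (rule onorm_inner_le)
  qed (use assms in auto)
  then show ?thesis by simp
qed

text \<open>The divergence theorem is applied to the field \<open>\<eta> x *\<^sub>R dv x\<close>.
  It is a product of bounded Lipschitz maps, hence Lipschitz, and the cut-off \<eta> gives it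
  support in the unit ball.\<close>

lemma green_aux:
  fixes v \<eta> :: "real^'n \<Rightarrow> real"
  assumes v: "c11 v dv l K" 
    and supp: "\<And>x. norm x \<ge> 1 \<Longrightarrow> \<eta> x = 0"
    and der: "\<And>x. x \<in> ball 0 2 \<Longrightarrow> (\<eta> has_derivative (\<lambda>h. d\<eta> x \<bullet> h)) (at x)"
    and bd: "\<And>x. x \<in> ball 0 2 \<Longrightarrow> \<bar>\<eta> x\<bar> \<le> C \<and> norm (d\<eta> x) \<le> C"
    and dc: "continuous_on (cball 0 1) d\<eta>"
  shows "integral\<^sup>L lborel_ball (\<lambda>x. \<eta> x * l x + d\<eta> x \<bullet> dv x) = 0"
proof -
  have K0: "0 \<le> K" by (rule c11_K_nonneg[OF v])
  have C0: "0 \<le> C" using bd[of 0] by auto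
  have cd: "continuous_on (cball 0 1) dv" by (rule c11_continuous[OF v])
  have \<eta>c: "continuous_on (cball 0 1) \<eta>"
    by (rule continuous_at_imp_continuous_on) (auto intro!: has_derivative_continuous[OF der])
  show ?thesis
  proof (rule divergence_integral_zero[where X="\<lambda>x. \<eta> x *\<^sub>R dv x" and K="2 * C * K"])
    fix x y :: "real^'n" assume xy: "x \<in> ball 0 2" "y \<in> ball 0 2"
    have e: "\<bar>\<eta> x - \<eta> y\<bar> \<le> C * norm (x - y)"
    proof -
      have "norm (\<eta> x - \<eta> y) \<le> C * norm (x - y)"
      proof (rule differentiable_bound[where f'="\<lambda>x h. d\<eta> x \<bullet> h" and S="ball 0 2"])
        fix z :: "real^'n" assume "z \<in> ball 0 2"
        then show "(\<eta> has_derivative (\<lambda>h. d\<eta> z \<bullet> h)) (at z within ball 0 2)"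
          by (rule has_derivative_at_withinI[OF der])
        have "norm (d\<eta> z) \<le> C" using \<open>z \<in> _\<close> bd by auto
        then show "onorm (\<lambda>h. d\<eta> z \<bullet> h) \<le> C"
          by (rule onorm_inner_le)
      qed (use xy in auto)
      then show ?thesis by simp
    qed
    have "norm (\<eta> x *\<^sub>R dv x - \<eta> y *\<^sub>R dv y) = norm (\<eta> x *\<^sub>R (dv x - dv y) + (\<eta> x - \<eta> y) *\<^sub>R dv y)"
      by (simp add: algebra_simps)
    also have "\<dots> \<le> \<bar>\<eta> x\<bar> * norm (dv x - dv y) + \<bar>\<eta> x - \<eta> y\<bar> * norm (dv y)"
      by (metis norm_scaleR norm_triangle_ineq)
    also have "\<dots> \<le> C * (K * norm (x - y)) + (C * norm (x - y)) * K"
      using bd[OF xy(1)] e c11D(2)[OF v xy] c11D(4)[OF v xy(2)] C0 K0 by (intro add_mono mult_mono) auto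
    finally show "norm (\<eta> x *\<^sub>R dv x - \<eta> y *\<^sub>R dv y) \<le> 2 * C * K * norm (x - y)"
      by (simp add: algebra_simps)
  next
    have "AE x in lborel. x \<in> ball 0 2 \<longrightarrow>
        (\<exists>G. (dv has_derivative G) (at x) \<and> (\<Sum>i\<in>UNIV. G (axis i 1) $ i) = l x)"
      by (rule c11D(5)[OF v])
    then show "AE x in lborel. x \<in> ball 0 2 \<longrightarrow>
        (\<exists>D. ((\<lambda>x. \<eta> x *\<^sub>R dv x) has_derivative D) (at x) \<and> (\<Sum>i\<in>UNIV. D (axis i 1) $ i) = \<eta> x * l x + d\<eta> x \<bullet> dv x)"
    proof eventually_elim
      case (elim x)
      show ?case
      proof
        assume x: "x \<in> ball 0 2"
        then obtain G where G: "(dv has_derivative G) (at x)" "(\<Sum>i\<in>UNIV. G (axis i 1) $ i) = l x"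
          using elim by blast
        have 1: "((\<lambda>x. \<eta> x *\<^sub>R dv x) has_derivative (\<lambda>h. \<eta> x *\<^sub>R G h + (d\<eta> x \<bullet> h) *\<^sub>R dv x)) (at x)"
          by (rule has_derivative_scaleR[OF der[OF x] G(1)])
        have 2: "(\<Sum>i\<in>UNIV. (\<eta> x *\<^sub>R G (axis i 1) + (d\<eta> x \<bullet> axis i 1) *\<^sub>R dv x) $ i) = \<eta> x * l x + d\<eta> x \<bullet> dv x"
          by (simp add: sum.distrib sum_distrib_left[symmetric] G(2) inner_axis) (simp add: inner_vec_def)
        show "\<exists>D. ((\<lambda>x. \<eta> x *\<^sub>R dv x) has_derivative D) (at x) \<and> (\<Sum>i\<in>UNIV. D (axis i 1) $ i) = \<eta> x * l x + d\<eta> x \<bullet> dv x"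
          by (intro exI[of _ "\<lambda>h. \<eta> x *\<^sub>R G h + (d\<eta> x \<bullet> h) *\<^sub>R dv x"] conjI 1 2)
      qed
    qed
  next
    have "l \<in> borel_measurable lborel_ball" by (rule c11D(6)[OF v])
    moreover have "\<eta> \<in> borel_measurable lborel_ball" "(\<lambda>x. d\<eta> x \<bullet> dv x) \<in> borel_measurable lborel_ball"
      using \<eta>c cd dc by (auto intro!: continuous_imp_measurable_B1 continuous_intros)
    ultimately show "(\<lambda>x. \<eta> x * l x + d\<eta> x \<bullet> dv x) \<in> borel_measurable lborel_ball"
      by (intro borel_measurable_add borel_measurable_times)
  qed (use supp C0 K0 in auto)
qed

text \<open>This is \<open>green_aux\<close> for \<eta> = \<open>bump (Suc k)\<close> times
  \<open>g\<close>. The derivative of the weight produces the term with \<open>bump k\<close> and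
  the radial derivative of \<open>v\<close>, which takes the place of the boundary integral in the
  classical formula.\<close>

lemma green:
  fixes v g :: "real^'n \<Rightarrow> real"
  assumes v: "c11 v dv l K" and g: "c11 g dg l' K'" and k: "k > 0"
  shows "integral\<^sup>L lborel_ball (\<lambda>x. bump (Suc k) x * g x * l x) =
    2 * real (Suc k) * integral\<^sup>L lborel_ball (\<lambda>x. bump k x * g x * (x \<bullet> dv x))
      - integral\<^sup>L lborel_ball (\<lambda>x. bump (Suc k) x * (dg x \<bullet> dv x))"
proof -
  note cv = c11_continuous[OF v] and cg = c11_continuous[OF g]
  define d\<eta> where "d\<eta> x = (- (2 * real (Suc k)) * bump k x * g x) *\<^sub>R x + bump (Suc k) x *\<^sub>R dg x" for x
  have 0: "integral\<^sup>L lborel_ball (\<lambda>x. (bump (Suc k) x * g x) * l x + d\<eta> x \<bullet> dv x) = 0"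
  proof (rule green_aux[OF v, where C="2 * real (Suc k) * K' * 2 + K'"])
    have K'0: "0 \<le> K'" by (rule c11_K_nonneg[OF g])
    fix x :: "real^'n" assume x: "x \<in> ball 0 2"
    have dgx: "(g has_derivative (\<lambda>h. dg x \<bullet> h)) (at x)" and gb: "\<bar>g x\<bar> \<le> K'" "norm (dg x) \<le> K'"
      by (rule c11D(1,3,4)[OF g x])+
    show "((\<lambda>x. bump (Suc k) x * g x) has_derivative (\<lambda>h. d\<eta> x \<bullet> h)) (at x)"
      using has_derivative_mult[OF bump_has_derivative[OF k] dgx]
      by (rule has_derivative_eq_rhs) (auto simp: d\<eta>_def fun_eq_iff algebra_simps inner_add_left)
    have "norm (d\<eta> x) \<le> norm ((- (2 * real (Suc k)) * bump k x * g x) *\<^sub>R x) + norm (bump (Suc k) x *\<^sub>R dg x)"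
      unfolding d\<eta>_def by (rule norm_triangle_ineq)
    also have "\<dots> = 2 * real (Suc k) * (bump k x * \<bar>g x\<bar>) * norm x + bump (Suc k) x * norm (dg x)"
      by (simp add: abs_mult)
    also have "\<dots> \<le> 2 * real (Suc k) * (1 * K') * 2 + 1 * K'"
      using x gb K'0 by (intro add_mono mult_mono bump_le_1) auto
    finally have n: "norm (d\<eta> x) \<le> 2 * real (Suc k) * K' * 2 + K'" by simp
    have "\<bar>bump (Suc k) x * g x\<bar> \<le> 1 * K'"
      unfolding abs_mult using gb K'0 by (intro mult_mono) (auto simp: bump_le_1)
    then show "\<bar>bump (Suc k) x * g x\<bar> \<le> 2 * real (Suc k) * K' * 2 + K' \<and> norm (d\<eta> x) \<le> 2 * real (Suc k) * K' * 2 + K'"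
      using n K'0 by (auto intro: order_trans[of _ K'])
  qed (use k cg cv in \<open>auto simp: bump_0_outside d\<eta>_def[abs_def] intro!: continuous_intros\<close>)
  have lm: "l \<in> borel_measurable lborel_ball" "\<And>x. norm x \<le> 1 \<Longrightarrow> \<bar>l x\<bar> \<le> K" by (rule c11D(6)[OF v], rule c11D(7)[OF v])
  have gm: "(\<lambda>x. bump (Suc k) x * g x) \<in> borel_measurable lborel_ball"
    using cg by (intro continuous_imp_measurable_B1 continuous_intros)
  have gb: "\<bar>g x\<bar> \<le> K'" if "norm x \<le> 1" for x by (rule c11D(3)[OF g]) (use that in simp)
  have i1: "integrable lborel_ball (\<lambda>x. bump (Suc k) x * g x * l x)"
  proof (rule integrable_B1_bounded[where K="1 * K' * K"])
    fix x :: "real^'n" assume x: "norm x \<le> 1"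
    show "\<bar>bump (Suc k) x * g x * l x\<bar> \<le> 1 * K' * K"
      unfolding abs_mult using lm(2)[OF x] gb[OF x] c11_K_nonneg[OF v] c11_K_nonneg[OF g]
      by (intro mult_mono) (auto simp: bump_le_1)
  qed (intro borel_measurable_times gm lm)
  have i2: "integrable lborel_ball (\<lambda>x. bump k x * g x * (x \<bullet> dv x))"
    and i3: "integrable lborel_ball (\<lambda>x. bump (Suc k) x * (dg x \<bullet> dv x))"
    using cv cg by (auto intro!: integrable_B1_continuous continuous_intros)
  have "0 = integral\<^sup>L lborel_ball (\<lambda>x. bump (Suc k) x * g x * l x + (- 2 * real (Suc k)) * (bump k x * g x * (x \<bullet> dv x))
      + bump (Suc k) x * (dg x \<bullet> dv x))"
    unfolding 0[symmetric] by (rule Bochner_Integration.integral_cong) (auto simp: d\<eta>_def inner_add_left algebra_simps)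
  also have "\<dots> = integral\<^sup>L lborel_ball (\<lambda>x. bump (Suc k) x * g x * l x) + (- 2 * real (Suc k)) * integral\<^sup>L lborel_ball (\<lambda>x. bump k x * g x * (x \<bullet> dv x))
      + integral\<^sup>L lborel_ball (\<lambda>x. bump (Suc k) x * (dg x \<bullet> dv x))"
    using i1 i2 i3 by simp
  finally show ?thesis by linarith
qed

section \<open>Rescaled solutions of the obstacle problem\<close>

definition drescale :: "(real^'n \<Rightarrow> real^'n) \<Rightarrow> real^'n \<Rightarrow> real \<Rightarrow> real^'n \<Rightarrow> real^'n" where
  "drescale du x0 r x = inverse r *\<^sub>R du (x0 + r *\<^sub>R x)"

text \<open>The problem normalized to unit scale. Radius 2 leaves room around the unit ball for
  dilations by factors up to 3/2 and for difference quotients. Rescaling does not change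
  \<open>L\<close>, so apart from dimension and tolerances all later constants depend on it alone.
  The base point is only required to be a zero; that it is singular is expressed through
  \<open>blows_up_to\<close>.\<close>

definition obstacle_sol :: "real \<Rightarrow> (real^'n \<Rightarrow> real) \<Rightarrow> (real^'n \<Rightarrow> real^'n) \<Rightarrow> bool" where
  "obstacle_sol L v dv \<longleftrightarrow> 0 \<le> L \<and>
     (\<forall>x\<in>ball 0 2. (v has_derivative (\<lambda>h. dv x \<bullet> h)) (at x)) \<and>
     (\<forall>x\<in>ball 0 2. \<forall>y\<in>ball 0 2. norm (dv x - dv y) \<le> L * norm (x - y)) \<and>
     (\<forall>x\<in>ball 0 2. 0 \<le> v x) \<and> v 0 = 0 \<and>
     (AE x in lborel. x \<in> ball 0 2 \<longrightarrow>
        (\<exists>G. (dv has_derivative G) (at x) \<and> (\<Sum>i\<in>UNIV. G (axis i 1) $ i) = indicator {y. v y > 0} x))"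

lemma solD:
  assumes "obstacle_sol L v dv"
  shows "0 \<le> L"
    "x \<in> ball 0 2 \<Longrightarrow> (v has_derivative (\<lambda>h. dv x \<bullet> h)) (at x)"
    "x \<in> ball 0 2 \<Longrightarrow> y \<in> ball 0 2 \<Longrightarrow> norm (dv x - dv y) \<le> L * norm (x - y)"
    "x \<in> ball 0 2 \<Longrightarrow> 0 \<le> v x"
    "v 0 = 0"
    "AE x in lborel. x \<in> ball 0 2 \<longrightarrow>
        (\<exists>G. (dv has_derivative G) (at x) \<and> (\<Sum>i\<in>UNIV. G (axis i 1) $ i) = indicator {y. v y > 0} x)"
  using assms unfolding obstacle_sol_def by simp_all

lemma inner_fun_zeroD: "(\<lambda>h. a \<bullet> h) = (\<lambda>h. 0) \<Longrightarrow> a = (0 :: real^'n)"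
  by (metis inner_eq_zero_iff)

lemma sol_zero_grad:
  assumes "obstacle_sol L v dv" "x \<in> ball 0 2" "v x = 0"
  shows "dv x = 0"
proof -
  have "\<forall>y\<in>ball 0 2. v x \<le> v y" using solD(4)[OF assms(1)] assms(3) by simp
  then have "(\<lambda>h. dv x \<bullet> h) = (\<lambda>h. 0)"
    using differential_zero_maxmin[OF assms(2) open_ball solD(2)[OF assms(1,2)]] by blast
  then show ?thesis by (rule inner_fun_zeroD)
qed

lemma sol_taylor:
  fixes v :: "real^'n \<Rightarrow> real"
  assumes s: "obstacle_sol L v dv" and x: "x \<in> ball 0 2" and y: "y \<in> ball 0 2"
  shows "\<bar>v y - v x - dv x \<bullet> (y - x)\<bar> \<le> L * (norm (y - x))\<^sup>2"
proof -
  have seg: "closed_segment x y \<subseteq> ball 0 2" using x y by (simp add: closed_segment_subset)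
  have "norm (v y - v x - dv x \<bullet> (y - x)) \<le> norm (y - x) * (L * norm (y - x))"
  proof (rule differentiable_bound_linearization[where f'="\<lambda>x h. dv x \<bullet> h" and S="closed_segment x y"])
    fix t :: real assume "t \<in> {0..1}"
    then show "x + t *\<^sub>R (y - x) \<in> closed_segment x y"
      unfolding in_segment by (intro exI[of _ t]) (auto simp: algebra_simps)
  next
    fix z assume z: "z \<in> closed_segment x y"
    then have zb: "z \<in> ball 0 2" using seg by blast
    show "(v has_derivative (\<lambda>h. dv z \<bullet> h)) (at z within closed_segment x y)"
      by (rule has_derivative_at_withinI[OF solD(2)[OF s zb]])
    have "norm (dv z - dv x) \<le> L * norm (z - x)" by (rule solD(3)[OF s zb x])
    also have "\<dots> \<le> L * norm (y - x)"
      using segment_bound(1)[OF z] solD(1)[OF s] by (intro mult_left_mono) auto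
    finally have "onorm (\<lambda>h. (dv z - dv x) \<bullet> h) \<le> L * norm (y - x)" by (rule onorm_inner_le)
    then show "onorm ((\<lambda>h. dv z \<bullet> h) - (\<lambda>h. dv x \<bullet> h)) \<le> L * norm (y - x)" by (simp add: fun_diff_def inner_diff_left)
  qed auto
  then show ?thesis by (simp add: power2_eq_square algebra_simps)
qed

lemma sol_bounds:
  fixes v :: "real^'n \<Rightarrow> real"
  assumes s: "obstacle_sol L v dv" and x: "x \<in> ball 0 2"
  shows "norm (dv x) \<le> L * norm x" "v x \<le> L * (norm x)\<^sup>2" "norm (dv x) \<le> 2 * L" "v x \<le> 4 * L"
proof -
  have 0: "(0::real^'n) \<in> ball 0 2" by simp
  have d0: "dv 0 = 0" by (rule sol_zero_grad[OF s 0 solD(5)[OF s]])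
  show 1: "norm (dv x) \<le> L * norm x" using solD(3)[OF s x 0] d0 by simp
  show 2: "v x \<le> L * (norm x)\<^sup>2" using sol_taylor[OF s 0 x] d0 solD(5)[OF s] by simp
  have nx: "norm x \<le> 2" using x by simp
  show "norm (dv x) \<le> 2 * L" using 1 mult_left_mono[OF nx solD(1)[OF s]] by simp
  have "(norm x)\<^sup>2 \<le> 2\<^sup>2" using nx by (intro power_mono) auto
  then show "v x \<le> 4 * L" using 2 mult_left_mono[of "(norm x)\<^sup>2" 4 L] solD(1)[OF s] by simp
qed

text \<open>Quadratic growth from the zero at the origin bounds \<open>v\<close> by
  \<open>4 * L\<close> up to distance 2; the summand 1 accounts for the Laplacian.\<close>

lemma sol_c11:
  fixes v :: "real^'n \<Rightarrow> real"
  assumes s: "obstacle_sol L v dv"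
  shows "c11 v dv (indicator {y. v y > 0}) (4 * L + 1)"
  unfolding c11_def
proof (intro conjI ballI)
  note L0 = solD(1)[OF s]
  fix x :: "real^'n" assume x: "x \<in> ball 0 2"
  show "(v has_derivative (\<lambda>h. dv x \<bullet> h)) (at x)" by (rule solD(2)[OF s x])
  show "\<bar>v x\<bar> \<le> 4 * L + 1" "norm (dv x) \<le> 4 * L + 1"
    using sol_bounds[OF s x] solD(4)[OF s x] L0 by linarith+
  fix y :: "real^'n" assume y: "y \<in> ball 0 2"
  have "norm (dv x - dv y) \<le> L * norm (x - y)" by (rule solD(3)[OF s x y])
  also have "\<dots> \<le> (4 * L + 1) * norm (x - y)" using L0 by (intro mult_right_mono) auto
  finally show "norm (dv x - dv y) \<le> (4 * L + 1) * norm (x - y)" .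
next
  have "continuous_on (cball 0 1) v"
    by (intro continuous_at_imp_continuous_on ballI has_derivative_continuous[OF solD(2)[OF s]]) auto
  then have "v \<in> borel_measurable lborel_ball" by (rule continuous_imp_measurable_B1)
  then have "(\<lambda>x. indicator {0<..} (v x) :: real) \<in> borel_measurable lborel_ball"
    by (rule measurable_compose) simp
  moreover have "(\<lambda>x. indicator {0<..} (v x) :: real) = indicator {y. v y > 0}"
    by (auto simp: indicator_def)
  ultimately show "(indicator {y. v y > 0} :: real^'n \<Rightarrow> real) \<in> borel_measurable lborel_ball" by simp
next
  fix x show "\<bar>indicator {y. v y > 0} x\<bar> \<le> 4 * L + 1"
    using solD(1)[OF s] by (auto simp: indicator_def)
qed (rule solD(6)[OF s])

lemma AE_lborel_affine:
  fixes t :: "real^'n"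
  assumes "AE x in lborel. P x" "c \<noteq> 0"
  shows "AE x in lborel. P (t + c *\<^sub>R x)"
proof -
  obtain N where N: "N \<in> null_sets lborel" "{x. \<not> P x} \<subseteq> N"
    using assms(1) unfolding eventually_ae_filter by auto
  then have Ns: "N \<in> sets borel" and N0: "emeasure lborel N = 0" by (auto simp: null_sets_def)
  let ?T = "\<lambda>x. t + c *\<^sub>R x"
  have Tm: "?T \<in> borel_measurable lborel" by simp
  have "emeasure lborel N = emeasure (density (distr lborel borel ?T) (\<lambda>_. \<bar>c\<bar>^DIM(real^'n))) N"
    using lborel_affine[OF assms(2), of t] by simp
  also have "\<dots> = \<bar>c\<bar>^DIM(real^'n) * emeasure (distr lborel borel ?T) N"
    by (rule emeasure_density_const) (use Ns in simp)
  also have "emeasure (distr lborel borel ?T) N = emeasure lborel (?T -` N)"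
    using emeasure_distr[OF Tm Ns] by simp
  finally have "ennreal (\<bar>c\<bar>^DIM(real^'n)) * emeasure lborel (?T -` N) = 0" using N0 by simp
  then have "emeasure lborel (?T -` N) = 0" using assms(2) by simp
  moreover have "?T -` N \<in> sets lborel" using measurable_sets[OF Tm Ns] by simp
  ultimately have "?T -` N \<in> null_sets lborel" by (simp add: null_sets_def)
  then show ?thesis by (rule AE_I') (use N(2) in auto)
qed

text \<open>Two chain rule factors \<open>r\<close> cancel the division by r^2 in second
  derivatives, so neither the Lipschitz constant nor the Laplacian changes. The value at the centre
  is left free, because the lemma also serves centres in the positivity set.\<close>

lemma rescale_regular:
  fixes u :: "real^'n \<Rightarrow> real"
  assumes r: "0 < r" and L: "0 \<le> L"
    and der: "\<And>x. x \<in> ball x1 (2*r) \<Longrightarrow> (u has_derivative (\<lambda>h. du x \<bullet> h)) (at x)"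
    and lip: "\<And>x y. x \<in> ball x1 (2*r) \<Longrightarrow> y \<in> ball x1 (2*r) \<Longrightarrow> norm (du x - du y) \<le> L * norm (x - y)"
    and nonneg: "\<And>x. x \<in> ball x1 (2*r) \<Longrightarrow> 0 \<le> u x"
    and ae: "AE x in lborel. x \<in> ball x1 (2*r) \<longrightarrow>
        (\<exists>G. (du has_derivative G) (at x) \<and> (\<Sum>i\<in>UNIV. G (axis i 1) $ i) = indicator {y. u y > 0} x)"
  shows "\<forall>x\<in>ball 0 2. (rescale u x1 r has_derivative (\<lambda>h. drescale du x1 r x \<bullet> h)) (at x)"
    and "\<forall>x\<in>ball 0 2. \<forall>y\<in>ball 0 2. norm (drescale du x1 r x - drescale du x1 r y) \<le> L * norm (x - y)"
    and "\<forall>x\<in>ball 0 2. 0 \<le> rescale u x1 r x"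
    and "AE x in lborel. x \<in> ball 0 2 \<longrightarrow>
        (\<exists>G. (drescale du x1 r has_derivative G) (at x) \<and>
             (\<Sum>i\<in>UNIV. G (axis i 1) $ i) = indicator {y. rescale u x1 r y > 0} x)"
proof -
  have T: "x1 + r *\<^sub>R x \<in> ball x1 (2*r)" if "x \<in> ball 0 2" for x
    using that r by (simp add: dist_norm)
  {
  fix x :: "real^'n" assume x: "x \<in> ball 0 2"
  have "((\<lambda>x. x1 + r *\<^sub>R x) has_derivative (\<lambda>h. r *\<^sub>R h)) (at x)"
    by (auto intro!: derivative_eq_intros)
  from has_derivative_compose[OF this der[OF T[OF x]]]
  have "((\<lambda>x. u (x1 + r *\<^sub>R x)) has_derivative (\<lambda>h. du (x1 + r *\<^sub>R x) \<bullet> (r *\<^sub>R h))) (at x)" .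
  from has_derivative_mult_right[OF this, of "inverse (r^2)"]
  have "((\<lambda>x. inverse (r^2) * u (x1 + r *\<^sub>R x)) has_derivative
      (\<lambda>h. inverse (r^2) * (du (x1 + r *\<^sub>R x) \<bullet> (r *\<^sub>R h)))) (at x)" .
  moreover have "(\<lambda>x. inverse (r^2) * u (x1 + r *\<^sub>R x)) = rescale u x1 r"
    by (simp add: fun_eq_iff rescale_def divide_inverse)
  moreover have "(\<lambda>h. inverse (r^2) * (du (x1 + r *\<^sub>R x) \<bullet> (r *\<^sub>R h))) = (\<lambda>h. drescale du x1 r x \<bullet> h)"
    using r by (simp add: fun_eq_iff drescale_def power2_eq_square)
  ultimately have "(rescale u x1 r has_derivative (\<lambda>h. drescale du x1 r x \<bullet> h)) (at x)"
    by simp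
  }
  then show "\<forall>x\<in>ball 0 2. (rescale u x1 r has_derivative (\<lambda>h. drescale du x1 r x \<bullet> h)) (at x)" by blast
  show "\<forall>x\<in>ball 0 2. 0 \<le> rescale u x1 r x" unfolding rescale_def using nonneg[OF T] by simp
  {
  fix x y :: "real^'n" assume x: "x \<in> ball 0 2" and y: "y \<in> ball 0 2"
  have "norm (drescale du x1 r x - drescale du x1 r y) = inverse r * norm (du (x1 + r *\<^sub>R x) - du (x1 + r *\<^sub>R y))"
    unfolding drescale_def using r by (simp flip: scaleR_diff_right)
  also have "\<dots> \<le> inverse r * (L * norm ((x1 + r *\<^sub>R x) - (x1 + r *\<^sub>R y)))"
    using r by (intro mult_left_mono lip T x y) auto
  also have "\<dots> = L * norm (x - y)"
    using r by (simp flip: scaleR_diff_right)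
  finally have "norm (drescale du x1 r x - drescale du x1 r y) \<le> L * norm (x - y)" .
  }
  then show "\<forall>x\<in>ball 0 2. \<forall>y\<in>ball 0 2. norm (drescale du x1 r x - drescale du x1 r y) \<le> L * norm (x - y)" by blast
  have "AE x in lborel. x1 + r *\<^sub>R x \<in> ball x1 (2*r) \<longrightarrow>
        (\<exists>G. (du has_derivative G) (at (x1 + r *\<^sub>R x)) \<and> (\<Sum>i\<in>UNIV. G (axis i 1) $ i) = indicator {y. u y > 0} (x1 + r *\<^sub>R x))"
    using AE_lborel_affine[OF ae] r by simp
  then show "AE x in lborel. x \<in> ball 0 2 \<longrightarrow>
        (\<exists>G. (drescale du x1 r has_derivative G) (at x) \<and> (\<Sum>i\<in>UNIV. G (axis i 1) $ i) = indicator {y. rescale u x1 r y > 0} x)"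
  proof eventually_elim
    case (elim x)
    show ?case
    proof
      assume "x \<in> ball 0 2"
      then have "x1 + r *\<^sub>R x \<in> ball x1 (2*r)" using r by (simp add: dist_norm)
      with elim obtain G where G: "(du has_derivative G) (at (x1 + r *\<^sub>R x))"
        "(\<Sum>i\<in>UNIV. G (axis i 1) $ i) = indicator {y. u y > 0} (x1 + r *\<^sub>R x)" by blast
      have "((\<lambda>x. x1 + r *\<^sub>R x) has_derivative (\<lambda>h. r *\<^sub>R h)) (at x)"
        by (auto intro!: derivative_eq_intros)
      from has_derivative_compose[OF this G(1)]
      have "((\<lambda>x. du (x1 + r *\<^sub>R x)) has_derivative (\<lambda>h. G (r *\<^sub>R h))) (at x)" .
      from has_derivative_scaleR_right[OF this, of "inverse r"]
      have "(drescale du x1 r has_derivative (\<lambda>h. inverse r *\<^sub>R G (r *\<^sub>R h))) (at x)"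
        unfolding drescale_def[abs_def] .
      moreover have "(\<lambda>h. inverse r *\<^sub>R G (r *\<^sub>R h)) = G"
        using has_derivative_linear[OF G(1)] r by (simp add: linear_cmul)
      ultimately have "(drescale du x1 r has_derivative G) (at x)" by simp
      moreover have "(indicator {y. u y > 0} (x1 + r *\<^sub>R x) :: real) = indicator {y. rescale u x1 r y > 0} x"
        using r by (simp add: indicator_def rescale_def zero_less_divide_iff)
      ultimately show "\<exists>G. (drescale du x1 r has_derivative G) (at x) \<and> (\<Sum>i\<in>UNIV. G (axis i 1) $ i) = indicator {y. rescale u x1 r y > 0} x"
        using G(2) by auto
    qed
  qed
qed

lemma sol_rescale:
  fixes u :: "real^'n \<Rightarrow> real"
  assumes r: "0 < r" and L: "0 \<le> L"
    and der: "\<And>x. x \<in> ball x1 (2*r) \<Longrightarrow> (u has_derivative (\<lambda>h. du x \<bullet> h)) (at x)"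
    and lip: "\<And>x y. x \<in> ball x1 (2*r) \<Longrightarrow> y \<in> ball x1 (2*r) \<Longrightarrow> norm (du x - du y) \<le> L * norm (x - y)"
    and nonneg: "\<And>x. x \<in> ball x1 (2*r) \<Longrightarrow> 0 \<le> u x" and u0: "u x1 = 0"
    and ae: "AE x in lborel. x \<in> ball x1 (2*r) \<longrightarrow>
        (\<exists>G. (du has_derivative G) (at x) \<and> (\<Sum>i\<in>UNIV. G (axis i 1) $ i) = indicator {y. u y > 0} x)"
  shows "obstacle_sol L (rescale u x1 r) (drescale du x1 r)"
  unfolding obstacle_sol_def using rescale_regular[OF r L der lip nonneg ae] L u0 by (simp add: rescale_def)

lemma sol_rescale_0:
  fixes v :: "real^'n \<Rightarrow> real"
  assumes s: "obstacle_sol L v dv" and r: "0 < r" "r \<le> 1"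
  shows "obstacle_sol L (rescale v 0 r) (drescale dv 0 r)"
proof (rule sol_rescale)
  have sub: "ball 0 (2*r) \<subseteq> ball (0::real^'n) 2" using r by (simp add: subset_ball)
  fix x :: "real^'n" assume x: "x \<in> ball 0 (2*r)"
  then show "(v has_derivative (\<lambda>h. dv x \<bullet> h)) (at x)" using sub by (intro solD(2)[OF s]) blast
  show "0 \<le> v x" using sub x by (intro solD(4)[OF s]) blast
  fix y :: "real^'n" assume y: "y \<in> ball 0 (2*r)"
  show "norm (dv x - dv y) \<le> L * norm (x - y)" using sub x y by (intro solD(3)[OF s]) blast+
next
  have sub: "x \<in> ball 0 (2*r) \<Longrightarrow> x \<in> ball 0 2" for x :: "real^'n" using r by simp
  show "AE x in lborel. x \<in> ball 0 (2*r) \<longrightarrow>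
        (\<exists>G. (dv has_derivative G) (at x) \<and> (\<Sum>i\<in>UNIV. G (axis i 1) $ i) = indicator {y. v y > 0} x)"
    using solD(6)[OF s] by (rule eventually_mono) (use sub in blast)
qed (use solD(1,5)[OF s] r in auto)

lemma rescale_rescale: "rescale (rescale v x r) 0 s = rescale v x (s * r)"
  by (auto simp: rescale_def fun_eq_iff power_mult_distrib mult.commute)

lemma drescale_drescale: "drescale (drescale v x r) 0 s = drescale v x (s * r)"
  by (auto simp: drescale_def fun_eq_iff mult.commute)

text \<open>Second derivatives of \<open>u\<close> exist only almost everywhere, so the functionals below are not
  differentiated in \<open>r\<close>; a quadratic lower bound on their increments suffices.\<close>

lemma mono_of_quadratic_defect:
  fixes f :: "real \<Rightarrow> real"
  assumes f: "\<And>r t. 0 < r \<Longrightarrow> 1 \<le> t \<Longrightarrow> t \<le> 3/2 \<Longrightarrow> a \<le> r \<Longrightarrow> t * r \<le> 1 \<Longrightarrow> f (t * r) - f r \<ge> - C * (t - 1)\<^sup>2"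
    and rs: "0 < r" "a \<le> r" "r \<le> s" "s \<le> 1" and C: "C \<ge> 0"
  shows "f r \<le> f s"
proof (rule ccontr)
  assume "\<not> f r \<le> f s"
  define d where "d = f r - f s"
  have d: "d > 0" using \<open>\<not> _\<close> by (simp add: d_def)
  define b where "b = ln (s / r)"
  have b: "b \<ge> 0" unfolding b_def using rs by (intro ln_ge_zero) auto
  obtain N :: nat where N: "real N > max (max 1 (4 * b)) (4 * C * b\<^sup>2 / d)"
    using reals_Archimedean2 by blast
  \<comment> \<open>The interval from \<open>r\<close> to \<open>s\<close> is cut into N steps of
    equal ratio \<open>t\<close>. Each step loses at most C (t - 1)^2, which is of order 1/N^2, so
    the total loss of order 1/N falls below the supposed drop \<open>d\<close>; the choice of N
    makes this quantitative.\<close>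
  define t where "t = exp (b / N)"
  have N0: "real N > 0" using N by linarith
  have bN: "0 \<le> b / N" "b / N \<le> 1/4" using N b N0 by (auto simp: field_simps)
  have t1: "1 \<le> t" unfolding t_def using bN by simp
  have t2: "t \<le> 1 + 2 * (b / N)" unfolding t_def using bN by (intro real_exp_bound_lemma) linarith+
  have tle: "t \<le> 3/2" using t2 bN by linarith
  have tN: "t ^ N = s / r" unfolding t_def
    using N0 rs by (simp add: exp_of_nat_mult[symmetric] b_def)
  have step: "f (t ^ Suc k * r) - f (t ^ k * r) \<ge> - C * (t - 1)\<^sup>2" if "k < N" for k
  proof -
    have k0: "t ^ k * r > 0" using t1 rs by simp
    have "t ^ k \<ge> 1" using t1 by simp
    then have "1 * r \<le> t ^ k * r" using rs by (intro mult_right_mono) auto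
    then have ka: "t ^ k * r \<ge> a" using rs by linarith
    have "t ^ Suc k \<le> t ^ N" using that t1 by (intro power_increasing) auto
    then have "t ^ Suc k * r \<le> s" using tN rs by (simp add: field_simps)
    then have "t * (t ^ k * r) \<le> 1" using rs by (simp add: mult.assoc)
    from f[OF k0 t1 tle ka this] show ?thesis by (simp add: mult.assoc)
  qed
  have "f (t ^ N * r) - f (t ^ 0 * r) = (\<Sum>k<N. f (t ^ Suc k * r) - f (t ^ k * r))"
    by (rule sum_lessThan_telescope[symmetric])
  also have "\<dots> \<ge> (\<Sum>k<N. - C * (t - 1)\<^sup>2)" by (rule sum_mono) (use step in blast)
  finally have 1: "f s - f r \<ge> - (real N * (C * (t - 1)\<^sup>2))" using tN rs by simp
  have "(t - 1)\<^sup>2 \<le> (2 * (b / N))\<^sup>2" using t1 t2 by (intro power_mono) auto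
  then have "real N * (C * (t - 1)\<^sup>2) \<le> real N * (C * (2 * (b / N))\<^sup>2)" 
    using C by (intro mult_left_mono) auto
  also have "\<dots> = 4 * C * b\<^sup>2 / N" using N0 by (simp add: power2_eq_square field_simps)
  also have "\<dots> < d" using N N0 d by (simp add: field_simps)
  finally show False using 1 by (simp add: d_def)
qed

abbreviation vol_ball :: "'n::finite itself \<Rightarrow> real" where
  "vol_ball T \<equiv> measure (lborel_ball :: (real^'n) measure) (cball 0 1)"

lemma integral_B1_ge:
  fixes f :: "real^'n \<Rightarrow> real"
  assumes "integrable lborel_ball f" "\<And>x. norm x \<le> 1 \<Longrightarrow> c \<le> f x"
  shows "c * vol_ball TYPE('n) \<le> integral\<^sup>L lborel_ball f"
proof -
  interpret finite_measure "lborel_ball :: (real^'n) measure" by (rule finite_measure_B1)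
  have "integral\<^sup>L lborel_ball (\<lambda>x::real^'n. c) \<le> integral\<^sup>L lborel_ball f"
    by (rule integral_mono) (use assms in auto)
  then show ?thesis by (simp add: mult.commute)
qed

lemma integral_B1_le:
  fixes f :: "real^'n \<Rightarrow> real"
  assumes "integrable lborel_ball f" "\<And>x. norm x \<le> 1 \<Longrightarrow> f x \<le> c"
  shows "integral\<^sup>L lborel_ball f \<le> c * vol_ball TYPE('n)"
proof -
  interpret finite_measure "lborel_ball :: (real^'n) measure" by (rule finite_measure_B1)
  have "integral\<^sup>L lborel_ball f \<le> integral\<^sup>L lborel_ball (\<lambda>x::real^'n. c)"
    by (rule integral_mono) (use assms in auto)
  then show ?thesis by (simp add: mult.commute)
qed

lemma integral_B1_diff_le:
  fixes f g :: "real^'n \<Rightarrow> real"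
  assumes "integrable lborel_ball f" "integrable lborel_ball g" "\<And>x. norm x \<le> 1 \<Longrightarrow> \<bar>f x - g x\<bar> \<le> c"
  shows "\<bar>integral\<^sup>L lborel_ball f - integral\<^sup>L lborel_ball g\<bar> \<le> c * vol_ball TYPE('n)"
proof -
  have i: "integrable lborel_ball (\<lambda>x. f x - g x)" using assms by simp
  have "integral\<^sup>L lborel_ball (\<lambda>x. f x - g x) \<le> c * vol_ball TYPE('n)"
    by (rule integral_B1_le[OF i]) (use assms(3) in \<open>auto simp: abs_le_iff\<close>)
  moreover have "(- c) * vol_ball TYPE('n) \<le> integral\<^sup>L lborel_ball (\<lambda>x. f x - g x)"
  proof (rule integral_B1_ge[OF i])
    fix x :: "real^'n" assume "norm x \<le> 1"
    then show "- c \<le> f x - g x" using assms(3)[of x] by linarith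
  qed
  ultimately show ?thesis using assms by (simp add: abs_le_iff)
qed

lemma integrable_times_laplacian:
  fixes g :: "real^'n \<Rightarrow> real"
  assumes v: "c11 v dv l K" and g: "continuous_on (cball 0 1) g"
  shows "integrable lborel_ball (\<lambda>x. g x * l x)"
proof -
  have "bounded (g ` cball 0 1)"
    by (intro compact_imp_bounded compact_continuous_image g compact_cball)
  then obtain C where "\<forall>x\<in>cball 0 1. \<bar>g x\<bar> \<le> C" by (auto simp: bounded_iff)
  then have C: "\<And>x. norm x \<le> 1 \<Longrightarrow> \<bar>g x\<bar> \<le> C" by simp
  have C0: "0 \<le> C" using C[of 0] by simp
  show ?thesis
  proof (rule integrable_B1_bounded)
    show "(\<lambda>x. g x * l x) \<in> borel_measurable lborel_ball"
      by (intro borel_measurable_times continuous_imp_measurable_B1 g c11D(6)[OF v])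
    fix x :: "real^'n" assume x: "norm x \<le> 1"
    show "\<bar>g x * l x\<bar> \<le> C * K" unfolding abs_mult
      by (intro mult_mono C c11D(7)[OF v] x C0) auto
  qed
qed

lemma green4:
  fixes v g :: "real^'n \<Rightarrow> real"
  assumes "c11 v dv l K" "c11 g dg l' K'"
  shows "integral\<^sup>L lborel_ball (\<lambda>x. bump 4 x * g x * l x) =
    8 * integral\<^sup>L lborel_ball (\<lambda>x. bump 3 x * g x * (x \<bullet> dv x)) - integral\<^sup>L lborel_ball (\<lambda>x. bump 4 x * (dg x \<bullet> dv x))"
  using green[OF assms, of 3] by simp

lemma green5:
  fixes v :: "real^'n \<Rightarrow> real"
  assumes "c11 v dv l K"
  shows "integral\<^sup>L lborel_ball (\<lambda>x. bump 5 x * l x) = 10 * integral\<^sup>L lborel_ball (\<lambda>x. bump 4 x * (x \<bullet> dv x))"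
  using green[OF assms c11_const[of 1], of 4] by simp

section \<open>Admissible matrices and their quadratic polynomials\<close>

lemma quad_poly_alt: "quad_poly A x = (x \<bullet> (A *v x)) / 2"
  by (simp add: quad_poly_def inner_commute)

lemma admissible_sym: "admissible_matrix A \<Longrightarrow> (A *v x) \<bullet> y = x \<bullet> (A *v y)"
  unfolding admissible_matrix_def by (metis dot_lmul_matrix transpose_matrix_vector)

lemma admissible_nonneg: "admissible_matrix A \<Longrightarrow> 0 \<le> quad_poly A x"
  unfolding admissible_matrix_def quad_poly_alt by simp

lemma matrix_entry_inner: "A $ i $ j = axis i 1 \<bullet> (A *v axis j (1::real))"
  by (simp add: inner_axis' matrix_vector_mult_basis column_def)

text \<open>The diagonal is nonnegative with sum 1, and nonnegativity of the form at the sum and at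
  the difference of two basis vectors bounds twice an entry by the sum of two diagonal
  entries.\<close>

lemma admissible_entry_le:
  fixes A :: "real^'n^'n"
  assumes A: "admissible_matrix A"
  shows "\<bar>A $ i $ j\<bar> \<le> 1"
proof -
  have nn: "0 \<le> x \<bullet> (A *v x)" for x using A unfolding admissible_matrix_def by blast
  have d0: "0 \<le> A $ k $ k" for k using nn[of "axis k 1"] by (simp add: matrix_entry_inner)
  have "(\<Sum>k\<in>UNIV. A $ k $ k) = 1" using A unfolding admissible_matrix_def trace_def by blast
  then have d1: "A $ k $ k \<le> 1" for k
    using member_le_sum[of k UNIV "\<lambda>k. A $ k $ k"] d0 by simp
  have sym: "A $ j $ i = A $ i $ j" using A unfolding admissible_matrix_def transpose_def by (metis vec_lambda_beta)
  have "0 \<le> A $ i $ i + A $ j $ j + 2 * A $ i $ j"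
    using nn[of "axis i 1 + axis j 1"] sym
    by (simp add: matrix_vector_right_distrib inner_add_left inner_add_right flip: matrix_entry_inner)
  moreover have "0 \<le> A $ i $ i + A $ j $ j - 2 * A $ i $ j"
    using nn[of "axis i 1 - axis j 1"] sym
    by (simp add: matrix_vector_mult_diff_distrib inner_diff_left inner_diff_right flip: matrix_entry_inner)
  ultimately show ?thesis using d1[of i] d1[of j] by linarith
qed

text \<open>A crude operator norm bound for matrices with entries at most 1, which avoids any use of
  eigenvalues.\<close>

abbreviation dim_sq :: "'n::finite itself \<Rightarrow> real" where "dim_sq T \<equiv> (real CARD('n))\<^sup>2"

lemma NB_ge1: "1 \<le> dim_sq TYPE('n::finite)"
  by simp

lemma entries_le_imp_norm_le:
  fixes A :: "real^'n^'n"
  assumes "\<And>i j. \<bar>A $ i $ j\<bar> \<le> c"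
  shows "norm (A *v x) \<le> c * dim_sq TYPE('n) * norm x"
proof -
  have c: "0 \<le> c" using assms[of undefined undefined] by linarith
  have "norm (A *v x) \<le> (\<Sum>i\<in>UNIV. \<bar>(A *v x) $ i\<bar>)" by (rule norm_le_l1_cart)
  also have "\<dots> \<le> (\<Sum>i\<in>(UNIV::'n set). \<Sum>j\<in>(UNIV::'n set). c * norm x)"
  proof (rule sum_mono)
    fix i :: 'n
    have "\<bar>(A *v x) $ i\<bar> \<le> (\<Sum>j\<in>UNIV. \<bar>A $ i $ j * x $ j\<bar>)"
      unfolding matrix_vector_mult_def by (simp add: sum_abs)
    also have "\<dots> \<le> (\<Sum>j\<in>(UNIV::'n set). c * norm x)"
      by (rule sum_mono, unfold abs_mult, rule mult_mono[OF assms component_le_norm_cart c]) simp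
    finally show "\<bar>(A *v x) $ i\<bar> \<le> (\<Sum>j\<in>(UNIV::'n set). c * norm x)" .
  qed
  also have "\<dots> = c * dim_sq TYPE('n) * norm x" by (simp add: power2_eq_square)
  finally show ?thesis .
qed

lemma admissible_norm_le:
  fixes A :: "real^'n^'n"
  assumes "admissible_matrix A"
  shows "norm (A *v x) \<le> dim_sq TYPE('n) * norm x"
  using entries_le_imp_norm_le[of A 1] admissible_entry_le[OF assms] by simp

lemma quad_poly_le:
  fixes A :: "real^'n^'n"
  assumes "admissible_matrix A"
  shows "quad_poly A x \<le> dim_sq TYPE('n) * (norm x)\<^sup>2 / 2"
proof -
  have "x \<bullet> (A *v x) \<le> norm x * norm (A *v x)" by (rule norm_cauchy_schwarz)
  also have "\<dots> \<le> norm x * (dim_sq TYPE('n) * norm x)"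
    by (intro mult_left_mono admissible_norm_le assms) simp
  finally show ?thesis by (simp add: quad_poly_alt power2_eq_square algebra_simps)
qed

lemma c11_quad_poly:
  fixes A :: "real^'n^'n"
  assumes A: "admissible_matrix A"
  shows "c11 (quad_poly A) (\<lambda>x. A *v x) (\<lambda>_. 1) (2 * dim_sq TYPE('n))"
  unfolding c11_def
proof (intro conjI ballI)
  have lin: "((*v) A has_derivative (*v) A) (at x)" for x
    by (rule bounded_linear_imp_has_derivative[OF matrix_vector_mul_bounded_linear])
  fix x :: "real^'n" assume x: "x \<in> ball 0 2"
  have "((\<lambda>y. (1/2) * ((A *v y) \<bullet> y)) has_derivative (\<lambda>h. (1/2) * ((A *v x) \<bullet> h + (A *v h) \<bullet> x))) (at x)"
    by (intro has_derivative_mult_right has_derivative_inner lin has_derivative_ident)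
  moreover have "(1/2) * ((A *v x) \<bullet> h + (A *v h) \<bullet> x) = (A *v x) \<bullet> h" for h
    using admissible_sym[OF A, of h x] by (simp add: inner_commute)
  ultimately show "(quad_poly A has_derivative (\<lambda>h. (A *v x) \<bullet> h)) (at x)"
    unfolding quad_poly_def[abs_def] by simp
  have nx: "norm x \<le> 2" using x by simp
  show n: "norm (A *v x) \<le> 2 * dim_sq TYPE('n)"
    using order_trans[OF admissible_norm_le[OF A, of x] mult_left_mono[OF nx, of "dim_sq TYPE('n)"]] by simp
  have "(norm x)\<^sup>2 \<le> 2\<^sup>2" using nx by (intro power_mono) auto
  then have "(norm x)\<^sup>2 \<le> 4" by simp
  then have "dim_sq TYPE('n) * (norm x)\<^sup>2 \<le> dim_sq TYPE('n) * 4" by (rule mult_left_mono) simp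
  then show "\<bar>quad_poly A x\<bar> \<le> 2 * dim_sq TYPE('n)"
    using quad_poly_le[OF A, of x] admissible_nonneg[OF A, of x] by linarith
  fix y :: "real^'n"
  have "norm (A *v x - A *v y) \<le> dim_sq TYPE('n) * norm (x - y)"
    unfolding matrix_vector_mult_diff_distrib[symmetric] by (rule admissible_norm_le[OF A])
  also have "\<dots> \<le> 2 * dim_sq TYPE('n) * norm (x - y)" by (intro mult_right_mono) auto
  finally show "norm (A *v x - A *v y) \<le> 2 * dim_sq TYPE('n) * norm (x - y)" .
next
  have lin: "((*v) A has_derivative (*v) A) (at x)" for x
    by (rule bounded_linear_imp_has_derivative[OF matrix_vector_mul_bounded_linear])
  have tr: "(\<Sum>i\<in>UNIV. (A *v axis i 1) $ i) = 1"
    using A unfolding admissible_matrix_def trace_def by (simp add: matrix_vector_mult_basis column_def)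
  show "AE x in lborel. x \<in> ball 0 2 \<longrightarrow>
        (\<exists>G. ((*v) A has_derivative G) (at x) \<and> (\<Sum>i\<in>UNIV. G (axis i 1) $ i) = 1)"
    by (rule AE_I2) (use lin tr in blast)
next
  fix x :: "real^'n"
  show "\<bar>1\<bar> \<le> 2 * dim_sq TYPE('n)" using NB_ge1[where 'n='n] by linarith
qed simp

lemma quad_poly_cont: "continuous_on S (quad_poly A)" "continuous_on S (\<lambda>x. A *v x)"
  unfolding quad_poly_def[abs_def]
  by (auto intro!: continuous_intros matrix_vector_mult_linear_continuous_on)

section \<open>Monotonicity formulas\<close>

text \<open>In terms of \<phi> and \<psi> the last term is twice the \<psi>-integral of v^2; the
  factor 2 is the degree of homogeneity, as in the classical energy on balls.\<close>

definition weiss :: "(real^'n \<Rightarrow> real) \<Rightarrow> (real^'n \<Rightarrow> real^'n) \<Rightarrow> real" where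
  "weiss v dv = integral\<^sup>L lborel_ball (\<lambda>x. bump 4 x * (dv x \<bullet> dv x + 2 * v x)) - 16 * integral\<^sup>L lborel_ball (\<lambda>x. bump 3 x * (v x)\<^sup>2)"

definition monneau :: "real^'n^'n \<Rightarrow> (real^'n \<Rightarrow> real) \<Rightarrow> real" where
  "monneau A v = 8 * integral\<^sup>L lborel_ball (\<lambda>x. bump 3 x * (v x - quad_poly A x)\<^sup>2)"

text \<open>The quantity \<open>e\<close> is the derivative at t = 1 of the rescaling and measures
  the failure of 2-homogeneity. Only the Lipschitz bound on the gradient enters, so the error is
  quadratic in t - 1 for values but merely linear for the radial derivative; since the latter gets
  multiplied by a first-order increment, this is enough.\<close>

lemma sol_expansion:
  fixes a :: "real^'n \<Rightarrow> real"
  assumes s: "obstacle_sol L a da" and t: "1 \<le> t" "t \<le> 3/2" and x: "norm x \<le> 1"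
  defines "e \<equiv> x \<bullet> da x - 2 * a x"
  shows "\<bar>e\<bar> \<le> 3 * L"
    "\<bar>rescale a 0 t x - a x - (t - 1) * e\<bar> \<le> 6 * L * (t - 1)\<^sup>2"
    "\<bar>x \<bullet> drescale da 0 t x - 2 * rescale a 0 t x - e\<bar> \<le> 14 * L * (t - 1)"
    "rescale a 0 t x = 0 \<Longrightarrow> a x \<le> L * (t - 1)\<^sup>2"
proof -
  note L0 = solD(1)[OF s]
  have xb: "x \<in> ball 0 2" using x by simp
  have txb: "t *\<^sub>R x \<in> ball 0 2" using x t mult_mono[of t "3/2" "norm x" 1] by simp
  define \<tau> where "\<tau> = t - 1"
  have \<tau>: "0 \<le> \<tau>" "\<tau> \<le> 1/2" "t = 1 + \<tau>" using t by (auto simp: \<tau>_def)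
  have ax: "0 \<le> a x" "a x \<le> L"
    using sol_bounds(2)[OF s xb] solD(4)[OF s xb] mult_left_mono[of "(norm x)\<^sup>2" 1 L] L0 x power_le_one[of "norm x" 2] by auto
  have dax: "norm (da x) \<le> L" using sol_bounds(1)[OF s xb] mult_left_mono[OF x L0] by simp
  define p where "p = x \<bullet> da x"
  have p: "\<bar>p\<bar> \<le> L"
    using Cauchy_Schwarz_ineq2[of x "da x"] mult_mono[OF x dax] by (auto simp: p_def)
  show eb: "\<bar>e\<bar> \<le> 3 * L" using p ax by (auto simp: e_def p_def)
  have diff: "t *\<^sub>R x - x = \<tau> *\<^sub>R x" by (simp add: \<tau>(3) algebra_simps)
  have nd: "norm (\<tau> *\<^sub>R x) \<le> \<tau>" using x \<tau> mult_left_mono[OF x \<tau>(1)] by simp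
  have nd2: "(norm (\<tau> *\<^sub>R x))\<^sup>2 \<le> \<tau>\<^sup>2" using nd by (intro power_mono) auto
  define R where "R = a (t *\<^sub>R x) - a x - \<tau> * p"
  have R: "\<bar>R\<bar> \<le> L * \<tau>\<^sup>2"
  proof -
    have "\<bar>R\<bar> \<le> L * (norm (\<tau> *\<^sub>R x))\<^sup>2"
      using sol_taylor[OF s xb txb] unfolding diff by (simp add: R_def p_def inner_commute)
    also have "\<dots> \<le> L * \<tau>\<^sup>2" by (rule mult_left_mono[OF nd2 L0])
    finally show ?thesis .
  qed
  define c where "c = 1 / t\<^sup>2"
  have t0: "t > 0" using t by simp
  have c01: "0 \<le> c" "c \<le> 1" using t unfolding c_def by (auto simp: divide_simps)
  have c1: "\<bar>c - 1\<bar> \<le> 2 * \<tau>"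
  proof -
    have "1 - c = (t\<^sup>2 - 1) * c" using t0 by (simp add: c_def field_simps)
    also have "\<dots> = \<tau> * ((t + 1) * c)" by (simp add: \<tau>_def power2_eq_square algebra_simps)
    also have "\<dots> \<le> \<tau> * 2"
    proof (rule mult_left_mono[OF _ \<tau>(1)])
      have "t * 1 \<le> t * t" using t by (intro mult_left_mono) auto
      then have "t + 1 \<le> 2 * t\<^sup>2" using t unfolding power2_eq_square by linarith
      then show "(t + 1) * c \<le> 2" using t0 by (simp add: c_def field_simps)
    qed
    finally show ?thesis using c01 by simp
  qed
  \<comment> \<open>The factor 1/t^2 multiplies \<open>a x\<close>, which carries no factor \<tau>,
    and hence must be expanded to second order; for the other terms the bound \<open>c1\<close> or
    \<open>c \<le> 1\<close> suffices. The resulting constant 6 is 3 + 2 + 1.\<close>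
  have c2: "\<bar>c - 1 + 2 * \<tau>\<bar> \<le> 3 * \<tau>\<^sup>2"
  proof -
    have "c - 1 + 2 * \<tau> = (1 - t\<^sup>2 + 2 * \<tau> * t\<^sup>2) * c" using t0 by (simp add: c_def field_simps)
    also have "1 - t\<^sup>2 + 2 * \<tau> * t\<^sup>2 = \<tau>\<^sup>2 * (3 + 2 * \<tau>)" by (simp add: \<tau>(3) power2_eq_square algebra_simps)
    finally have e: "c - 1 + 2 * \<tau> = \<tau>\<^sup>2 * ((3 + 2 * \<tau>) * c)" by (simp add: mult.assoc)
    have "3 + 2 * \<tau> \<le> 3 * t\<^sup>2" using \<tau> by (simp add: power2_eq_square algebra_simps)
    then have "(3 + 2 * \<tau>) * c \<le> 3" using t0 by (simp add: c_def field_simps)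
    then have "\<tau>\<^sup>2 * ((3 + 2 * \<tau>) * c) \<le> \<tau>\<^sup>2 * 3" by (intro mult_left_mono) auto
    moreover have "0 \<le> \<tau>\<^sup>2 * ((3 + 2 * \<tau>) * c)" using c01 \<tau> by simp
    ultimately show ?thesis unfolding e by simp
  qed
  have resc: "rescale a 0 t x = c * (a x + \<tau> * p + R)"
    by (simp add: rescale_def R_def c_def)
  have "rescale a 0 t x - a x - \<tau> * e = a x * (c - 1 + 2 * \<tau>) + \<tau> * p * (c - 1) + R * c"
    unfolding resc e_def p_def[symmetric] by (simp add: algebra_simps)
  also have "\<bar>\<dots>\<bar> \<le> \<bar>a x\<bar> * \<bar>c - 1 + 2 * \<tau>\<bar> + \<tau> * \<bar>p\<bar> * \<bar>c - 1\<bar> + \<bar>R\<bar> * c"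
    using \<tau> c01 by (intro order_trans[OF abs_triangle_ineq] add_mono) (auto simp: abs_mult)
  also have "\<dots> \<le> L * (3 * \<tau>\<^sup>2) + \<tau> * L * (2 * \<tau>) + L * \<tau>\<^sup>2 * 1"
    using ax p c1 c2 c01 R \<tau> L0 by (intro add_mono mult_mono) auto
  finally show 2: "\<bar>rescale a 0 t x - a x - (t - 1) * e\<bar> \<le> 6 * L * (t - 1)\<^sup>2"
    by (simp add: \<tau>_def power2_eq_square algebra_simps)
  have "\<bar>rescale a 0 t x - a x\<bar> \<le> \<tau> * \<bar>e\<bar> + 6 * L * \<tau>\<^sup>2"
  proof -
    have "\<bar>\<tau> * e\<bar> = \<tau> * \<bar>e\<bar>" using \<tau> by (simp add: abs_mult)
    then show ?thesis using 2 unfolding \<tau>_def[symmetric] by linarith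
  qed
  also have "\<dots> \<le> \<tau> * (3 * L) + 6 * L * (\<tau> * (1/2))"
    using eb \<tau> L0 unfolding power2_eq_square by (intro add_mono mult_left_mono) auto
  finally have b1: "\<bar>rescale a 0 t x - a x\<bar> \<le> 6 * L * \<tau>" by (simp add: algebra_simps)
  have "x \<bullet> drescale da 0 t x - p = inverse t * (x \<bullet> (da (t *\<^sub>R x) - da x)) + (inverse t - 1) * p"
    by (simp add: drescale_def p_def inner_diff_right algebra_simps)
  also have "\<bar>\<dots>\<bar> \<le> inverse t * \<bar>x \<bullet> (da (t *\<^sub>R x) - da x)\<bar> + \<bar>inverse t - 1\<bar> * \<bar>p\<bar>"
    using t0 by (intro order_trans[OF abs_triangle_ineq] add_mono) (auto simp: abs_mult)
  also have "\<dots> \<le> 1 * (L * \<tau>) + \<tau> * L"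
  proof (intro add_mono mult_mono)
    have "\<bar>x \<bullet> (da (t *\<^sub>R x) - da x)\<bar> \<le> norm x * norm (da (t *\<^sub>R x) - da x)" by (rule Cauchy_Schwarz_ineq2)
    also have "\<dots> \<le> 1 * (L * norm (t *\<^sub>R x - x))"
      by (intro mult_mono x solD(3)[OF s txb xb]) auto
    also have "\<dots> \<le> L * \<tau>" unfolding diff using mult_left_mono[OF nd L0] by simp
    finally show "\<bar>x \<bullet> (da (t *\<^sub>R x) - da x)\<bar> \<le> L * \<tau>" .
    have "1 - inverse t \<le> t - 1"
    proof -
      have "t * (2 - t) \<le> 1" using zero_le_square[of "t - 1"] by (simp add: algebra_simps)
      then show ?thesis using t0 by (simp add: field_simps)
    qed
    moreover have "inverse t \<le> 1" using t by (simp add: field_simps)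
    ultimately show "\<bar>inverse t - 1\<bar> \<le> \<tau>" by (simp add: \<tau>_def)
  qed (use t0 t p L0 \<tau> in \<open>auto simp: field_simps\<close>)
  finally have "\<bar>x \<bullet> drescale da 0 t x - p\<bar> \<le> 2 * L * \<tau>" by (simp add: algebra_simps)
  with b1 show "\<bar>x \<bullet> drescale da 0 t x - 2 * rescale a 0 t x - e\<bar> \<le> 14 * L * (t - 1)"
    unfolding e_def p_def[symmetric] \<tau>_def[symmetric] by (simp add: abs_le_iff)
  \<comment> \<open>A zero of the rescaling at \<open>x\<close> is a minimum of \<open>a\<close> at
    \<open>t *\<^sub>R x\<close>, and from there \<open>a\<close> grows at most quadratically. This
    controls the points of \<open>weiss_step\<close> at which only \<open>a\<close> is
    positive.\<close>
  assume z: "rescale a 0 t x = 0"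
  then have at0: "a (t *\<^sub>R x) = 0" using t0 by (simp add: rescale_def)
  have "da (t *\<^sub>R x) = 0" by (rule sol_zero_grad[OF s txb at0])
  then have "\<bar>a x\<bar> \<le> L * (norm (x - t *\<^sub>R x))\<^sup>2"
    using sol_taylor[OF s txb xb] at0 by simp
  also have "\<dots> \<le> L * \<tau>\<^sup>2"
    using mult_left_mono[OF nd2 L0] diff by (metis norm_minus_commute)
  finally show "a x \<le> L * (t - 1)\<^sup>2" using ax by (simp add: \<tau>_def)
qed

text \<open>The quadratic part of the energy has an increment bilinear in b - a and b + a. Green's
  identity for a + b, tested with b - a, removes the gradients. What remains is, to first order, 16
  (t - 1) times the \<open>bump 3\<close> integral of e^2, and a term living where exactly one of
  \<open>a\<close> and \<open>b\<close> is positive.\<close>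

lemma weiss_step:
  fixes a :: "real^'n \<Rightarrow> real"
  assumes sa: "obstacle_sol L a da" and sb: "obstacle_sol L (rescale a 0 t) (drescale da 0 t)" and t: "1 \<le> t" "t \<le> 3/2"
  shows "weiss (rescale a 0 t) (drescale da 0 t) - weiss a da \<ge> - ((960 * L\<^sup>2 + L) * vol_ball TYPE('n)) * (t - 1)\<^sup>2"
proof -
  define b db where "b = rescale a 0 t" and "db = drescale da 0 t"
  note sb' = sb[folded b_def db_def]
  note L0 = solD(1)[OF sa]
  define la lb :: "real^'n \<Rightarrow> real" where "la = indicator {y. a y > 0}" and "lb = indicator {y. b y > 0}"
  have ca: "c11 a da la (4*L+1)" and cb: "c11 b db lb (4*L+1)"
    unfolding la_def lb_def by (rule sol_c11[OF sa], rule sol_c11[OF sb'])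
  note cd = c11_diff[OF cb ca] and cs = c11_add[OF ca cb]
  note ct = c11_continuous(3,4)[OF ca] c11_continuous(3,4)[OF cb]
  define F1 where "F1 x = bump 4 x * ((db x - da x) \<bullet> (da x + db x))" for x
  define F2 where "F2 x = bump 3 x * (b x - a x) * (x \<bullet> (da x + db x))" for x
  define F3 where "F3 x = bump 4 x * (b x - a x) * (la x + lb x)" for x
  define F4 where "F4 x = bump 4 x * (2 * (b x - a x))" for x
  define F5 where "F5 x = bump 3 x * ((b x)\<^sup>2 - (a x)\<^sup>2)" for x
  have i: "integrable lborel_ball F1" "integrable lborel_ball F2" "integrable lborel_ball F4" "integrable lborel_ball F5"
    unfolding F1_def[abs_def] F2_def[abs_def] F4_def[abs_def] F5_def[abs_def]
    by (intro integrable_B1_continuous continuous_intros ct)+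
  have i3: "integrable lborel_ball F3"
    unfolding F3_def[abs_def] by (rule integrable_times_laplacian[OF cs]) (intro continuous_intros ct)
  have g: "integral\<^sup>L lborel_ball F3 = 8 * integral\<^sup>L lborel_ball F2 - integral\<^sup>L lborel_ball F1"
    unfolding F1_def F2_def F3_def by (rule green4[OF cs cd])
  have w1: "integral\<^sup>L lborel_ball (\<lambda>x. bump 4 x * (db x \<bullet> db x + 2 * b x)) - integral\<^sup>L lborel_ball (\<lambda>x. bump 4 x * (da x \<bullet> da x + 2 * a x))
    = integral\<^sup>L lborel_ball F1 + integral\<^sup>L lborel_ball F4"
  proof -
    have "integral\<^sup>L lborel_ball (\<lambda>x. bump 4 x * (db x \<bullet> db x + 2 * b x)) - integral\<^sup>L lborel_ball (\<lambda>x. bump 4 x * (da x \<bullet> da x + 2 * a x))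
     = integral\<^sup>L lborel_ball (\<lambda>x. bump 4 x * (db x \<bullet> db x + 2 * b x) - bump 4 x * (da x \<bullet> da x + 2 * a x))"
      by (rule Bochner_Integration.integral_diff[symmetric]) (intro integrable_B1_continuous continuous_intros ct)+
    also have "\<dots> = integral\<^sup>L lborel_ball (\<lambda>x. F1 x + F4 x)"
      by (rule Bochner_Integration.integral_cong)
         (auto simp: F1_def F4_def inner_add_left inner_add_right inner_diff_left inner_commute algebra_simps)
    also have "\<dots> = integral\<^sup>L lborel_ball F1 + integral\<^sup>L lborel_ball F4" using i by simp
    finally show ?thesis .
  qed
  have w2: "integral\<^sup>L lborel_ball (\<lambda>x. bump 3 x * (b x)\<^sup>2) - integral\<^sup>L lborel_ball (\<lambda>x. bump 3 x * (a x)\<^sup>2) = integral\<^sup>L lborel_ball F5"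
  proof -
    have "integral\<^sup>L lborel_ball (\<lambda>x. bump 3 x * (b x)\<^sup>2) - integral\<^sup>L lborel_ball (\<lambda>x. bump 3 x * (a x)\<^sup>2)
     = integral\<^sup>L lborel_ball (\<lambda>x. bump 3 x * (b x)\<^sup>2 - bump 3 x * (a x)\<^sup>2)"
      by (rule Bochner_Integration.integral_diff[symmetric]) (intro integrable_B1_continuous continuous_intros ct)+
    then show ?thesis by (simp add: F5_def[abs_def] algebra_simps)
  qed
  have W: "weiss b db - weiss a da = integral\<^sup>L lborel_ball (\<lambda>x. (8 * F2 x - 16 * F5 x) + (F4 x - F3 x))"
    unfolding weiss_def using w1 w2 g i i3 by simp
  have "(- (960 * L\<^sup>2 + L) * (t - 1)\<^sup>2) * vol_ball TYPE('n) \<le> integral\<^sup>L lborel_ball (\<lambda>x. (8 * F2 x - 16 * F5 x) + (F4 x - F3 x))"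
  proof (rule integral_B1_ge)
    show "integrable lborel_ball (\<lambda>x. (8 * F2 x - 16 * F5 x) + (F4 x - F3 x))" using i i3 by simp
    fix x :: "real^'n" assume x: "norm x \<le> 1"
    then have xb: "x \<in> ball 0 2" by simp
    define \<tau> where "\<tau> = t - 1"
    have \<tau>: "0 \<le> \<tau>" "\<tau> \<le> 1" using t by (auto simp: \<tau>_def)
    define e where "e = x \<bullet> da x - 2 * a x"
    define \<alpha> where "\<alpha> = b x - a x - \<tau> * e"
    define \<beta> where "\<beta> = x \<bullet> db x - 2 * b x - e"
    note ex = sol_expansion[OF sa t x, folded e_def b_def db_def \<tau>_def, folded \<alpha>_def \<beta>_def]
    have "(b x - a x) * (x \<bullet> (da x + db x) - 2 * (a x + b x)) = (\<tau> * e + \<alpha>) * (2 * e + \<beta>)"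
      by (simp add: \<alpha>_def \<beta>_def e_def inner_add_right)
    also have "\<dots> = 2 * \<tau> * (e * e) + (\<tau> * e * \<beta> + 2 * (\<alpha> * e) + \<alpha> * \<beta>)"
      by (simp add: algebra_simps)
    \<comment> \<open>The leading term is \<tau> times a square and is dropped. The mixed terms cost
      42 + 36 + 42, the last one by \<tau> being at most 1/2.\<close>
    also have "\<dots> \<ge> - (120 * L\<^sup>2 * \<tau>\<^sup>2)"
    proof -
      have "\<bar>\<tau> * e * \<beta>\<bar> \<le> \<tau> * (3 * L) * (14 * L * \<tau>)"
        unfolding abs_mult using ex L0 \<tau> by (intro mult_mono) auto
      moreover have "\<bar>\<alpha> * e\<bar> \<le> (6 * L * \<tau>\<^sup>2) * (3 * L)"
        unfolding abs_mult using ex L0 \<tau> by (intro mult_mono) auto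
      moreover have "\<bar>\<alpha> * \<beta>\<bar> \<le> (6 * L * \<tau>\<^sup>2) * (14 * L * \<tau>)"
        unfolding abs_mult using ex L0 \<tau> by (intro mult_mono) auto
      moreover have "(6 * L * \<tau>\<^sup>2) * (14 * L * \<tau>) \<le> (6 * L * \<tau>\<^sup>2) * (14 * L * (1/2))"
        using L0 \<tau> t by (intro mult_left_mono) (auto simp: \<tau>_def)
      moreover have "0 \<le> 2 * \<tau> * (e * e)" using \<tau> by simp
      ultimately show ?thesis by (simp add: power2_eq_square abs_le_iff algebra_simps)
    qed
    finally have p1: "(b x - a x) * (x \<bullet> (da x + db x) - 2 * (a x + b x)) \<ge> - (120 * L\<^sup>2 * \<tau>\<^sup>2)" .
    have "8 * F2 x - 16 * F5 x = 8 * (bump 3 x * ((b x - a x) * (x \<bullet> (da x + db x) - 2 * (a x + b x))))"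
      by (simp add: F2_def F5_def power2_eq_square algebra_simps)
    moreover have "bump 3 x * ((b x - a x) * (x \<bullet> (da x + db x) - 2 * (a x + b x))) \<ge> - (120 * L\<^sup>2 * \<tau>\<^sup>2)"
    proof -
      have "bump 3 x * (- (120 * L\<^sup>2 * \<tau>\<^sup>2)) \<le> bump 3 x * ((b x - a x) * (x \<bullet> (da x + db x) - 2 * (a x + b x)))"
        by (rule mult_left_mono[OF p1]) simp
      moreover have "bump 3 x * (120 * L\<^sup>2 * \<tau>\<^sup>2) \<le> 1 * (120 * L\<^sup>2 * \<tau>\<^sup>2)"
        by (intro mult_right_mono bump_le_1) simp
      ultimately show ?thesis by simp
    qed
    ultimately have q1: "8 * F2 x - 16 * F5 x \<ge> - (960 * L\<^sup>2 * \<tau>\<^sup>2)" by linarith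
    \<comment> \<open>The product is 0 if both functions are positive or both vanish, and positive
      if only \<open>b\<close> is positive. The one bad case, \<open>b x = 0\<close> with
      \<open>a x\<close> positive, is of second order by the last part of
      \<open>sol_expansion\<close>.\<close>
    have p2: "(b x - a x) * (2 - la x - lb x) \<ge> - (L * \<tau>\<^sup>2)"
    proof -
      have a0: "0 \<le> a x" and b0: "0 \<le> b x" by (rule solD(4)[OF sa xb], rule solD(4)[OF sb' xb])
      have n: "0 \<le> L * \<tau>\<^sup>2" using L0 by simp
      show ?thesis
      proof (cases "b x = 0")
        case True
        then have "a x \<le> L * \<tau>\<^sup>2" using ex(4) by (simp add: b_def)
        then show ?thesis using True a0 n by (auto simp: la_def lb_def indicator_def)
      next
        case False
        then show ?thesis using a0 b0 n by (auto simp: la_def lb_def indicator_def)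
      qed
    qed
    have "F4 x - F3 x = bump 4 x * ((b x - a x) * (2 - la x - lb x))"
      by (simp add: F4_def F3_def algebra_simps)
    moreover have "bump 4 x * (- (L * \<tau>\<^sup>2)) \<le> bump 4 x * ((b x - a x) * (2 - la x - lb x))"
      by (rule mult_left_mono[OF p2]) simp
    moreover have "bump 4 x * (L * \<tau>\<^sup>2) \<le> 1 * (L * \<tau>\<^sup>2)"
      using L0 by (intro mult_right_mono bump_le_1) simp
    ultimately have q2: "F4 x - F3 x \<ge> - (L * \<tau>\<^sup>2)" by simp
    show "- (960 * L\<^sup>2 + L) * (t - 1)\<^sup>2 \<le> (8 * F2 x - 16 * F5 x) + (F4 x - F3 x)"
      using q1 q2 unfolding \<tau>_def by (simp add: algebra_simps)
  qed
  then show ?thesis unfolding W[unfolded b_def db_def] by (simp add: algebra_simps)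
qed

lemma weiss_mono:
  fixes v :: "real^'n \<Rightarrow> real"
  assumes s: "obstacle_sol L v dv" and r: "0 < r" "r \<le> q" "q \<le> 1"
  shows "weiss (rescale v 0 r) (drescale dv 0 r) \<le> weiss (rescale v 0 q) (drescale dv 0 q)"
proof (rule mono_of_quadratic_defect[where a=0 and C="(960 * L\<^sup>2 + L) * vol_ball TYPE('n)" and
      f="\<lambda>r. weiss (rescale v 0 r) (drescale dv 0 r)"])
  fix r t :: real assume r: "0 < r" and t: "1 \<le> t" "t \<le> 3/2" and tr: "t * r \<le> 1"
  have "1 * r \<le> t * r" using r t by (intro mult_right_mono) auto
  then have r1: "r \<le> 1" using tr by linarith
  have s1: "obstacle_sol L (rescale v 0 r) (drescale dv 0 r)" by (rule sol_rescale_0[OF s r r1])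
  have s2: "obstacle_sol L (rescale v 0 (t*r)) (drescale dv 0 (t*r))" by (rule sol_rescale_0[OF s _ tr]) (use r t in simp)
  show "weiss (rescale v 0 (t * r)) (drescale dv 0 (t * r)) - weiss (rescale v 0 r) (drescale dv 0 r)
    \<ge> - ((960 * L\<^sup>2 + L) * vol_ball TYPE('n)) * (t - 1)\<^sup>2"
    using weiss_step[OF s1, of t] s2 t by (simp add: rescale_rescale drescale_drescale)
qed (use r solD(1)[OF s] in auto)

text \<open>Homogeneity makes the radial derivative of p equal to 2 p. Green's identity of p with
  itself then cancels the gradient and square terms and leaves the \<open>bump 4\<close> integral of
  p, which \<open>green5\<close> evaluates from the Laplacian alone; that is 1 for every admissible
  matrix.\<close>

lemma weiss_quad_poly:
  fixes A :: "real^'n^'n"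
  assumes A: "admissible_matrix A"
  shows "weiss (quad_poly A) (\<lambda>x. A *v x) = integral\<^sup>L lborel_ball (bump 5 :: real^'n \<Rightarrow> real) / 20"
proof -
  note c = c11_quad_poly[OF A]
  have h: "x \<bullet> (A *v x) = 2 * quad_poly A x" for x by (simp add: quad_poly_alt)
  have g4: "integral\<^sup>L lborel_ball (\<lambda>x. bump 4 x * quad_poly A x) =
    16 * integral\<^sup>L lborel_ball (\<lambda>x. bump 3 x * (quad_poly A x)\<^sup>2) - integral\<^sup>L lborel_ball (\<lambda>x. bump 4 x * ((A *v x) \<bullet> (A *v x)))"
    using green4[OF c c] by (simp add: h power2_eq_square mult.assoc mult.left_commute[of _ 2])
  have g5: "integral\<^sup>L lborel_ball (bump 5 :: real^'n \<Rightarrow> real) = 20 * integral\<^sup>L lborel_ball (\<lambda>x. bump 4 x * quad_poly A x)"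
    using green5[OF c] by (simp add: h mult.left_commute[of _ 2])
  have "integral\<^sup>L lborel_ball (\<lambda>x. bump 4 x * ((A *v x) \<bullet> (A *v x) + 2 * quad_poly A x)) =
    integral\<^sup>L lborel_ball (\<lambda>x. bump 4 x * ((A *v x) \<bullet> (A *v x))) + 2 * integral\<^sup>L lborel_ball (\<lambda>x. bump 4 x * quad_poly A x)"
  proof -
    have i: "integrable lborel_ball (\<lambda>x. bump 4 x * ((A *v x) \<bullet> (A *v x)))" "integrable lborel_ball (\<lambda>x. bump 4 x * quad_poly A x)"
      by (intro integrable_B1_continuous continuous_intros quad_poly_cont)+
    have "integral\<^sup>L lborel_ball (\<lambda>x. bump 4 x * ((A *v x) \<bullet> (A *v x) + 2 * quad_poly A x)) =
      integral\<^sup>L lborel_ball (\<lambda>x. bump 4 x * ((A *v x) \<bullet> (A *v x)) + 2 * (bump 4 x * quad_poly A x))"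
      by (simp add: algebra_simps)
    also have "\<dots> = integral\<^sup>L lborel_ball (\<lambda>x. bump 4 x * ((A *v x) \<bullet> (A *v x))) + 2 * integral\<^sup>L lborel_ball (\<lambda>x. bump 4 x * quad_poly A x)"
      using i by simp
    finally show ?thesis .
  qed
  then show ?thesis unfolding weiss_def using g4 g5 by simp
qed

text \<open>The gradient is an explicit argument, in keeping with \<open>obstacle_sol\<close>, and
  only the unit ball occurs because all weights live there.\<close>

definition blows_up_to :: "(real^'n \<Rightarrow> real) \<Rightarrow> (real^'n \<Rightarrow> real^'n) \<Rightarrow> real^'n^'n \<Rightarrow> bool" where
  "blows_up_to v dv A \<longleftrightarrow> (\<forall>e>0. \<forall>\<^sub>F r in at_right 0. \<forall>x\<in>cball 0 1.
      \<bar>rescale v 0 r x - quad_poly A x\<bar> < e \<and> norm (drescale dv 0 r x - A *v x) < e)"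

lemma blows_ex:
  assumes "blows_up_to v dv A" "e > 0" "s > 0"
  obtains r where "0 < r" "r < s" "\<And>x. norm x \<le> 1 \<Longrightarrow> \<bar>rescale v 0 r x - quad_poly A x\<bar> < e"
    "\<And>x. norm x \<le> 1 \<Longrightarrow> norm (drescale dv 0 r x - A *v x) < e"
proof -
  have "\<forall>\<^sub>F r in at_right 0. \<forall>x\<in>cball 0 1.
      \<bar>rescale v 0 r x - quad_poly A x\<bar> < e \<and> norm (drescale dv 0 r x - A *v x) < e"
    using assms(1,2) unfolding blows_up_to_def by blast
  moreover have "\<forall>\<^sub>F r in at_right 0. r \<in> {0<..<s}"
    using eventually_at_right_real[OF assms(3)] .
  ultimately have "\<forall>\<^sub>F r in at_right (0::real). r \<in> {0<..<s} \<and> (\<forall>x\<in>cball 0 1.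
      \<bar>rescale v 0 r x - quad_poly A x\<bar> < e \<and> norm (drescale dv 0 r x - A *v x) < e)"
    by eventually_elim auto
  then obtain r where "r \<in> {0<..<s} \<and> (\<forall>x\<in>cball 0 1.
      \<bar>rescale v 0 r x - quad_poly A x\<bar> < e \<and> norm (drescale dv 0 r x - A *v x) < e)"
    using eventually_happens[of _ "at_right (0::real)"] by fastforce
  then show ?thesis by (intro that[of r]) auto
qed

lemma sq_diff_le:
  fixes a b :: real
  assumes "\<bar>a - b\<bar> \<le> e" "\<bar>a\<bar> \<le> K" "\<bar>b\<bar> \<le> K"
  shows "\<bar>a\<^sup>2 - b\<^sup>2\<bar> \<le> e * (2 * K)"
proof -
  have "a\<^sup>2 - b\<^sup>2 = (a - b) * (a + b)" by (simp add: power2_eq_square algebra_simps)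
  then have "\<bar>a\<^sup>2 - b\<^sup>2\<bar> = \<bar>a - b\<bar> * \<bar>a + b\<bar>" by (simp add: abs_mult)
  also have "\<dots> \<le> e * (2 * K)" using assms by (intro mult_mono) auto
  finally show ?thesis .
qed

text \<open>The energy is continuous under C1 convergence, so at small scales it approaches the
  common energy of the polynomials, and \<open>weiss_mono\<close> carries this bound up to scale
  \<open>q\<close>. Here \<open>K\<close> bounds all functions and gradients on the unit ball, and
  \<open>C\<close> is the resulting Lipschitz constant of the energy.\<close>

lemma weiss_ge:
  fixes v :: "real^'n \<Rightarrow> real"
  assumes s: "obstacle_sol L v dv" and A: "admissible_matrix A" and b: "blows_up_to v dv A" and q: "0 < q" "q \<le> 1"
  shows "integral\<^sup>L lborel_ball (bump 5 :: real^'n \<Rightarrow> real) / 20 \<le> weiss (rescale v 0 q) (drescale dv 0 q)"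
proof -
  define K where "K = 4 * L + 1 + 2 * dim_sq TYPE('n)"
  have K0: "0 < K" unfolding K_def using solD(1)[OF s] NB_ge1[where 'n='n] by linarith
  define C where "C = (2 * K + 2) * vol_ball TYPE('n) + 16 * (2 * K * vol_ball TYPE('n))"
  have C0: "0 \<le> C" unfolding C_def using K0 by simp
  have "integral\<^sup>L lborel_ball (bump 5 :: real^'n \<Rightarrow> real) / 20 \<le> weiss (rescale v 0 q) (drescale dv 0 q) + e * C" if e: "e > 0" for e
  proof -
    obtain r where r: "0 < r" "r < q" and r1: "\<And>x. norm x \<le> 1 \<Longrightarrow> \<bar>rescale v 0 r x - quad_poly A x\<bar> < e"
      and r2: "\<And>x. norm x \<le> 1 \<Longrightarrow> norm (drescale dv 0 r x - A *v x) < e"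
      using blows_ex[OF b e q(1)] by metis
    define a da where "a = rescale v 0 r" and "da = drescale dv 0 r"
    have sa: "obstacle_sol L a da" unfolding a_def da_def by (rule sol_rescale_0[OF s r(1)]) (use r q in simp)
    note ca = sol_c11[OF sa] and cp = c11_quad_poly[OF A]
    note ct = c11_continuous(3,4)[OF ca]
    have bd: "\<bar>a x\<bar> \<le> K" "norm (da x) \<le> K" "\<bar>quad_poly A x\<bar> \<le> K" "norm (A *v x) \<le> K" if "norm x \<le> 1" for x
    proof -
      have xb: "x \<in> ball 0 2" using that by simp
      show "\<bar>a x\<bar> \<le> K" "norm (da x) \<le> K" "\<bar>quad_poly A x\<bar> \<le> K" "norm (A *v x) \<le> K"
        using c11D(3)[OF ca xb] c11D(4)[OF ca xb] c11D(3)[OF cp xb] c11D(4)[OF cp xb] solD(1)[OF s] NB_ge1[where 'n='n]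
        unfolding K_def by linarith+
    qed
    have 1: "\<bar>integral\<^sup>L lborel_ball (\<lambda>x. bump 4 x * (da x \<bullet> da x + 2 * a x)) - integral\<^sup>L lborel_ball (\<lambda>x. bump 4 x * ((A *v x) \<bullet> (A *v x) + 2 * quad_poly A x))\<bar>
       \<le> (e * (2 * K + 2)) * vol_ball TYPE('n)"
    proof (rule integral_B1_diff_le)
      fix x :: "real^'n" assume x: "norm x \<le> 1"
      have "\<bar>norm (da x) - norm (A *v x)\<bar> \<le> e"
        using r2[OF x] norm_triangle_ineq3[of "da x" "A *v x"] unfolding da_def by linarith
      then have "\<bar>(norm (da x))\<^sup>2 - (norm (A *v x))\<^sup>2\<bar> \<le> e * (2 * K)"
        by (rule sq_diff_le) (use bd[OF x] in auto)
      then have "\<bar>da x \<bullet> da x - (A *v x) \<bullet> (A *v x)\<bar> \<le> e * (2 * K)" by (simp add: power2_norm_eq_inner)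
      moreover have "\<bar>a x - quad_poly A x\<bar> \<le> e" using r1[OF x] by (simp add: a_def)
      ultimately have "\<bar>(da x \<bullet> da x + 2 * a x) - ((A *v x) \<bullet> (A *v x) + 2 * quad_poly A x)\<bar> \<le> e * (2 * K + 2)"
        by (simp add: abs_le_iff algebra_simps)
      then have "bump 4 x * \<bar>(da x \<bullet> da x + 2 * a x) - ((A *v x) \<bullet> (A *v x) + 2 * quad_poly A x)\<bar> \<le> 1 * (e * (2 * K + 2))"
        by (intro mult_mono bump_le_1) auto
      then show "\<bar>bump 4 x * (da x \<bullet> da x + 2 * a x) - bump 4 x * ((A *v x) \<bullet> (A *v x) + 2 * quad_poly A x)\<bar> \<le> e * (2 * K + 2)"
        by (simp add: right_diff_distrib[symmetric] abs_mult)
    qed (intro integrable_B1_continuous continuous_intros ct quad_poly_cont)+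
    have 2: "\<bar>integral\<^sup>L lborel_ball (\<lambda>x. bump 3 x * (a x)\<^sup>2) - integral\<^sup>L lborel_ball (\<lambda>x. bump 3 x * (quad_poly A x)\<^sup>2)\<bar>
       \<le> (e * (2 * K)) * vol_ball TYPE('n)"
    proof (rule integral_B1_diff_le)
      fix x :: "real^'n" assume x: "norm x \<le> 1"
      have "\<bar>(a x)\<^sup>2 - (quad_poly A x)\<^sup>2\<bar> \<le> e * (2 * K)"
        by (rule sq_diff_le) (use bd[OF x] r1[OF x] in \<open>auto simp: a_def\<close>)
      then have "bump 3 x * \<bar>(a x)\<^sup>2 - (quad_poly A x)\<^sup>2\<bar> \<le> 1 * (e * (2 * K))"
        by (intro mult_mono bump_le_1) auto
      then show "\<bar>bump 3 x * (a x)\<^sup>2 - bump 3 x * (quad_poly A x)\<^sup>2\<bar> \<le> e * (2 * K)"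
        by (simp add: right_diff_distrib[symmetric] abs_mult)
    qed (intro integrable_B1_continuous continuous_intros ct quad_poly_cont)+
    have "weiss (quad_poly A) (\<lambda>x. A *v x) \<le> weiss a da + e * C"
      using 1 2 unfolding weiss_def C_def by (simp add: abs_le_iff algebra_simps)
    also have "weiss a da \<le> weiss (rescale v 0 q) (drescale dv 0 q)"
      unfolding a_def da_def by (rule weiss_mono[OF s r(1)]) (use r q in auto)
    finally show ?thesis using weiss_quad_poly[OF A] by simp
  qed
  note * = this
  show ?thesis
  proof (rule field_le_epsilon)
    fix d :: real assume d: "d > 0"
    have "d / (C + 1) * C \<le> d" using C0 d by (simp add: field_simps)
    then show "integral\<^sup>L lborel_ball (bump 5 :: real^'n \<Rightarrow> real) / 20 \<le> weiss (rescale v 0 q) (drescale dv 0 q) + d"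
      using *[OF divide_pos_pos[OF d, of "C + 1"]] C0 by linarith
  qed
qed

lemma sol_unit_bounds:
  fixes a :: "real^'n \<Rightarrow> real"
  assumes s: "obstacle_sol L a da" and x: "norm x \<le> 1"
  shows "0 \<le> a x" "a x \<le> L" "norm (da x) \<le> L"
proof -
  have xb: "x \<in> ball 0 2" using x by simp
  show "0 \<le> a x" by (rule solD(4)[OF s xb])
  have "L * (norm x)\<^sup>2 \<le> L * 1" using x by (intro mult_left_mono solD(1)[OF s] power_le_one) auto
  then show "a x \<le> L" using sol_bounds(2)[OF s xb] by linarith
  have "L * norm x \<le> L * 1" using x by (intro mult_left_mono solD(1)[OF s])
  then show "norm (da x) \<le> L" using sol_bounds(1)[OF s xb] by linarith
qed

lemma weighted_ge:
  fixes y c :: real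
  assumes "- c \<le> y" "0 \<le> c"
  shows "- c \<le> bump k x * y"
proof -
  have "bump k x * (- c) \<le> bump k x * y" by (rule mult_left_mono[OF assms(1)]) simp
  moreover have "bump k x * c \<le> 1 * c" by (intro mult_right_mono bump_le_1 assms)
  ultimately show ?thesis by linarith
qed

section \<open>Smallness of the contact set at some scale\<close>

text \<open>The weight is \<open>bump 5\<close> because \<open>green5\<close> expresses the
  correspondingly weighted measure of the positivity set by first derivatives.\<close>

definition contact :: "(real^'n \<Rightarrow> real) \<Rightarrow> real" where
  "contact v = integral\<^sup>L lborel_ball (\<lambda>x. bump 5 x * (1 - indicator {y. v y > 0} x))"

text \<open>Up to the energy gap, \<open>contact u\<^sub>r / 20\<close> is \<open>r\<close> times the derivative of this quantity along the
  rescalings \<open>u\<^sub>r\<close>.\<close>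

definition contact_potential :: "(real^'n \<Rightarrow> real) \<Rightarrow> real" where
  "contact_potential a = 4 * integral\<^sup>L lborel_ball (\<lambda>x. bump 3 x * (a x)\<^sup>2) - integral\<^sup>L lborel_ball (\<lambda>x. bump 4 x * a x) / 2"

text \<open>The left side is the derivative at t = 1 of \<open>contact_potential\<close> along the
  rescalings. Green's identity of \<open>a\<close> with itself produces the energy and
  \<open>green5\<close> the measure of the positivity set. The coefficient 1/2 of the linear part of
  the potential is the one that completes the term 2 v of the energy.\<close>

lemma weiss_minus_positivity:
  fixes a :: "real^'n \<Rightarrow> real"
  assumes s: "obstacle_sol L a da"
  shows "8 * integral\<^sup>L lborel_ball (\<lambda>x. bump 3 x * (a x * (x \<bullet> da x - 2 * a x))) - integral\<^sup>L lborel_ball (\<lambda>x. bump 4 x * (x \<bullet> da x - 2 * a x)) / 2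
    = weiss a da - integral\<^sup>L lborel_ball (bump 5 :: real^'n \<Rightarrow> real) / 20 + contact a / 20"
proof -
  define l :: "real^'n \<Rightarrow> real" where "l = indicator {y. a y > 0}"
  have c: "c11 a da l (4*L+1)" unfolding l_def by (rule sol_c11[OF s])
  note ct = c11_continuous(3,4)[OF c]
  define I1 where "I1 = integral\<^sup>L lborel_ball (\<lambda>x. bump 3 x * a x * (x \<bullet> da x))"
  define I2 where "I2 = integral\<^sup>L lborel_ball (\<lambda>x. bump 3 x * (a x)\<^sup>2)"
  define I3 where "I3 = integral\<^sup>L lborel_ball (\<lambda>x. bump 4 x * (da x \<bullet> da x))"
  define I4 where "I4 = integral\<^sup>L lborel_ball (\<lambda>x. bump 4 x * a x)"
  define I5 where "I5 = integral\<^sup>L lborel_ball (\<lambda>x. bump 4 x * (x \<bullet> da x))"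
  define I6 where "I6 = integral\<^sup>L lborel_ball (\<lambda>x. bump 5 x * l x)"
  have i: "integrable lborel_ball (\<lambda>x. bump 3 x * a x * (x \<bullet> da x))" "integrable lborel_ball (\<lambda>x. bump 3 x * (a x)\<^sup>2)"
    "integrable lborel_ball (\<lambda>x. bump 4 x * (da x \<bullet> da x))" "integrable lborel_ball (\<lambda>x. bump 4 x * a x)"
    "integrable lborel_ball (\<lambda>x. bump 4 x * (x \<bullet> da x))" "integrable lborel_ball (bump 5 :: real^'n \<Rightarrow> real)"
    by (intro integrable_B1_continuous continuous_intros ct)+
  have i6: "integrable lborel_ball (\<lambda>x. bump 5 x * l x)"
    by (rule integrable_times_laplacian[OF c]) (intro continuous_intros)
  have al: "a x * l x = a x" if "norm x \<le> 1" for x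
    using sol_unit_bounds(1)[OF s that] by (auto simp: l_def indicator_def)
  have "integral\<^sup>L lborel_ball (\<lambda>x. bump 4 x * a x * l x) = I4"
    unfolding I4_def by (rule Bochner_Integration.integral_cong) (auto simp: al mult.assoc)
  then have g4: "I4 = 8 * I1 - I3" using green4[OF c c] unfolding I1_def I3_def by simp
  have g5: "I6 = 10 * I5" unfolding I5_def I6_def by (rule green5[OF c])
  have w: "weiss a da = I3 + 2 * I4 - 16 * I2"
  proof -
    have "integral\<^sup>L lborel_ball (\<lambda>x. bump 4 x * (da x \<bullet> da x + 2 * a x)) = integral\<^sup>L lborel_ball (\<lambda>x. bump 4 x * (da x \<bullet> da x) + 2 * (bump 4 x * a x))"
      by (simp add: algebra_simps)
    then show ?thesis unfolding weiss_def I2_def I3_def I4_def using i by simp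
  qed
  have e1: "integral\<^sup>L lborel_ball (\<lambda>x. bump 3 x * (a x * (x \<bullet> da x - 2 * a x))) = I1 - 2 * I2"
  proof -
    have "integral\<^sup>L lborel_ball (\<lambda>x. bump 3 x * (a x * (x \<bullet> da x - 2 * a x))) = integral\<^sup>L lborel_ball (\<lambda>x. bump 3 x * a x * (x \<bullet> da x) - 2 * (bump 3 x * (a x)\<^sup>2))"
      by (simp add: algebra_simps power2_eq_square)
    then show ?thesis unfolding I1_def I2_def using i by simp
  qed
  have e2: "integral\<^sup>L lborel_ball (\<lambda>x. bump 4 x * (x \<bullet> da x - 2 * a x)) = I5 - 2 * I4"
  proof -
    have "integral\<^sup>L lborel_ball (\<lambda>x. bump 4 x * (x \<bullet> da x - 2 * a x)) = integral\<^sup>L lborel_ball (\<lambda>x. bump 4 x * (x \<bullet> da x) - 2 * (bump 4 x * a x))"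
      by (simp add: algebra_simps)
    then show ?thesis unfolding I5_def I4_def using i by simp
  qed
  have e3: "contact a = integral\<^sup>L lborel_ball (bump 5 :: real^'n \<Rightarrow> real) - I6"
    unfolding contact_def I6_def l_def[symmetric] right_diff_distrib using i i6 by simp
  show ?thesis unfolding e1 e2 e3 w using g4 g5 by (simp add: field_simps)
qed

text \<open>By convexity of the square, b^2 - a^2 is at least 2 a (b - a), so a lower bound requires
  only the first-order expansion of \<open>b\<close>. The energy gap in
  \<open>weiss_minus_positivity\<close> is nonnegative by the last assumption and is
  discarded.\<close>

lemma Qf_step:
  fixes a :: "real^'n \<Rightarrow> real"
  assumes sa: "obstacle_sol L a da" and sb: "obstacle_sol L (rescale a 0 t) (drescale da 0 t)" and t: "1 \<le> t" "t \<le> 3/2"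
    and w: "integral\<^sup>L lborel_ball (bump 5 :: real^'n \<Rightarrow> real) / 20 \<le> weiss a da"
  shows "contact_potential (rescale a 0 t) - contact_potential a \<ge> (t - 1) * (contact a / 20) - ((48 * L\<^sup>2 + 3 * L) * vol_ball TYPE('n)) * (t - 1)\<^sup>2"
proof -
  define b where "b = rescale a 0 t"
  note L0 = solD(1)[OF sa]
  note ct = c11_continuous(3,4)[OF sol_c11[OF sa]] c11_continuous(3)[OF sol_c11[OF sb], folded b_def]
  define \<tau> where "\<tau> = t - 1"
  define e where "e x = x \<bullet> da x - 2 * a x" for x
  define E1 where "E1 x = bump 3 x * (a x * e x)" for x
  define E2 where "E2 x = bump 4 x * e x" for x
  define H where "H x = bump 3 x * (4 * ((b x)\<^sup>2 - (a x)\<^sup>2 - 2 * \<tau> * (a x * e x))) + bump 4 x * (- (b x - a x - \<tau> * e x) / 2)" for x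
  have i: "integrable lborel_ball (\<lambda>x. bump 3 x * (b x)\<^sup>2)" "integrable lborel_ball (\<lambda>x. bump 3 x * (a x)\<^sup>2)"
    "integrable lborel_ball (\<lambda>x. bump 4 x * b x)" "integrable lborel_ball (\<lambda>x. bump 4 x * a x)" "integrable lborel_ball H"
    "integrable lborel_ball E1" "integrable lborel_ball E2"
    unfolding H_def[abs_def] E1_def[abs_def] E2_def[abs_def] e_def[abs_def]
    by (intro integrable_B1_continuous continuous_intros ct | simp)+
  have "integral\<^sup>L lborel_ball H = integral\<^sup>L lborel_ball (\<lambda>x. 4 * (bump 3 x * (b x)\<^sup>2) - 4 * (bump 3 x * (a x)\<^sup>2) - (bump 4 x * b x) / 2 + (bump 4 x * a x) / 2
     - 8 * \<tau> * E1 x + \<tau> / 2 * E2 x)"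
    by (rule Bochner_Integration.integral_cong) (auto simp: H_def E1_def E2_def field_simps)
  also have "\<dots> = contact_potential b - contact_potential a - 8 * \<tau> * integral\<^sup>L lborel_ball E1 + \<tau> / 2 * integral\<^sup>L lborel_ball E2"
    unfolding contact_potential_def using i by simp
  finally have h1: "integral\<^sup>L lborel_ball H = contact_potential b - contact_potential a - 8 * \<tau> * integral\<^sup>L lborel_ball E1 + \<tau> / 2 * integral\<^sup>L lborel_ball E2" .
  have "(- ((48 * L\<^sup>2 + 3 * L) * \<tau>\<^sup>2)) * vol_ball TYPE('n) \<le> integral\<^sup>L lborel_ball H"
  proof (rule integral_B1_ge[OF i(5)])
    fix x :: "real^'n" assume x: "norm x \<le> 1"
    define \<alpha> where "\<alpha> = b x - a x - \<tau> * e x"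
    have \<alpha>: "\<bar>\<alpha>\<bar> \<le> 6 * L * \<tau>\<^sup>2" unfolding \<alpha>_def b_def \<tau>_def e_def by (rule sol_expansion(2)[OF sa t x])
    note ab = sol_unit_bounds[OF sa x]
    have "\<bar>a x * \<alpha>\<bar> \<le> L * (6 * L * \<tau>\<^sup>2)" unfolding abs_mult using ab \<alpha> L0 by (intro mult_mono) auto
    moreover have "(b x)\<^sup>2 - (a x)\<^sup>2 - 2 * \<tau> * (a x * e x) = 2 * (a x * \<alpha>) + (b x - a x)\<^sup>2"
      by (simp add: \<alpha>_def power2_eq_square algebra_simps)
    moreover have "0 \<le> (b x - a x)\<^sup>2" by simp
    ultimately have "4 * ((b x)\<^sup>2 - (a x)\<^sup>2 - 2 * \<tau> * (a x * e x)) \<ge> - (8 * (L * (6 * L * \<tau>\<^sup>2)))" by argo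
    moreover have "8 * (L * (6 * L * \<tau>\<^sup>2)) = 48 * L\<^sup>2 * \<tau>\<^sup>2" by (simp add: power2_eq_square)
    ultimately have "- (48 * L\<^sup>2 * \<tau>\<^sup>2) \<le> 4 * ((b x)\<^sup>2 - (a x)\<^sup>2 - 2 * \<tau> * (a x * e x))" by simp
    from weighted_ge[OF this, of 3 x] have 1: "- (48 * L\<^sup>2 * \<tau>\<^sup>2) \<le> bump 3 x * (4 * ((b x)\<^sup>2 - (a x)\<^sup>2 - 2 * \<tau> * (a x * e x)))" by simp
    have "- (3 * L * \<tau>\<^sup>2) \<le> - \<alpha> / 2" using \<alpha> by (simp add: abs_le_iff)
    from weighted_ge[OF this, of 4 x] have 2: "- (3 * L * \<tau>\<^sup>2) \<le> bump 4 x * (- \<alpha> / 2)" using L0 by simp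
    have "(48 * L\<^sup>2 + 3 * L) * \<tau>\<^sup>2 = 48 * L\<^sup>2 * \<tau>\<^sup>2 + 3 * L * \<tau>\<^sup>2" by (rule distrib_right)
    then show "- ((48 * L\<^sup>2 + 3 * L) * \<tau>\<^sup>2) \<le> H x"
      using 1 2 unfolding H_def \<alpha>_def by linarith
  qed
  moreover have "8 * integral\<^sup>L lborel_ball E1 - integral\<^sup>L lborel_ball E2 / 2 \<ge> contact a / 20"
    using weiss_minus_positivity[OF sa] w unfolding E1_def[abs_def] E2_def[abs_def] e_def by linarith
  then have "\<tau> * (8 * integral\<^sup>L lborel_ball E1 - integral\<^sup>L lborel_ball E2 / 2) \<ge> \<tau> * (contact a / 20)"
    using t by (intro mult_left_mono) (auto simp: \<tau>_def)
  ultimately show ?thesis using h1 unfolding b_def[symmetric] \<tau>_def[symmetric] by (simp add: algebra_simps)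
qed

lemma Qf_bound:
  fixes a :: "real^'n \<Rightarrow> real"
  assumes s: "obstacle_sol L a da"
  shows "\<bar>contact_potential a\<bar> \<le> (4 * L\<^sup>2 + L) * vol_ball TYPE('n)"
proof -
  note L0 = solD(1)[OF s]
  note ct = c11_continuous(3,4)[OF sol_c11[OF s]]
  have 1: "\<bar>integral\<^sup>L lborel_ball (\<lambda>x. bump 3 x * (a x)\<^sup>2) - integral\<^sup>L lborel_ball (\<lambda>x::real^'n. 0::real)\<bar> \<le> L\<^sup>2 * vol_ball TYPE('n)"
  proof (rule integral_B1_diff_le)
    fix x :: "real^'n" assume x: "norm x \<le> 1"
    have "\<bar>bump 3 x * (a x)\<^sup>2\<bar> \<le> 1 * L\<^sup>2" unfolding abs_mult
      using sol_unit_bounds[OF s x] by (intro mult_mono) (auto simp: bump_le_1 power_mono)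
    then show "\<bar>bump 3 x * (a x)\<^sup>2 - 0\<bar> \<le> L\<^sup>2" by simp
  qed (intro integrable_B1_continuous continuous_intros ct)+
  have 2: "\<bar>integral\<^sup>L lborel_ball (\<lambda>x. bump 4 x * a x) - integral\<^sup>L lborel_ball (\<lambda>x::real^'n. 0::real)\<bar> \<le> L * vol_ball TYPE('n)"
  proof (rule integral_B1_diff_le)
    fix x :: "real^'n" assume x: "norm x \<le> 1"
    have "\<bar>bump 4 x * a x\<bar> \<le> 1 * L" unfolding abs_mult
      using sol_unit_bounds[OF s x] by (intro mult_mono) (auto simp: bump_le_1)
    then show "\<bar>bump 4 x * a x - 0\<bar> \<le> L" by simp
  qed (intro integrable_B1_continuous continuous_intros ct)+
  have 3: "0 \<le> L * vol_ball TYPE('n)" using L0 by simp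
  have n1: "\<bar>integral\<^sup>L lborel_ball (\<lambda>x. bump 3 x * (a x)\<^sup>2)\<bar> \<le> L\<^sup>2 * vol_ball TYPE('n)" using 1 by simp
  have n2: "\<bar>integral\<^sup>L lborel_ball (\<lambda>x. bump 4 x * a x)\<bar> \<le> L * vol_ball TYPE('n)" using 2 by simp
  have "(4 * L\<^sup>2 + L) * vol_ball TYPE('n) = 4 * (L\<^sup>2 * vol_ball TYPE('n)) + L * vol_ball TYPE('n)" by (simp add: algebra_simps)
  then show ?thesis using n1 n2 3 unfolding contact_potential_def by linarith
qed

text \<open>If the contact measure exceeded \<eta> at all scales from \<rho> to 1, the contact
  potential would grow at least like \<eta>/20 times the logarithm of the scale, although it is
  bounded in terms of \<open>L\<close>.\<close>

lemma small_contact_scale: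
  assumes \<eta>: "\<eta> > 0" and L: "L \<ge> 0"
  obtains \<rho> where "0 < \<rho>" "\<rho> \<le> 1"
    "\<And>(v :: real^'n \<Rightarrow> real) dv A. obstacle_sol L v dv \<Longrightarrow> admissible_matrix A \<Longrightarrow> blows_up_to v dv A \<Longrightarrow>
       \<exists>r. \<rho> \<le> r \<and> r \<le> 1 \<and> contact (rescale v 0 r) \<le> \<eta>"
proof -
  define K where "K = (4 * L\<^sup>2 + L) * vol_ball TYPE('n)"
  define C where "C = (48 * L\<^sup>2 + 3 * L) * vol_ball TYPE('n)"
  have K0: "0 \<le> K" and C0: "0 \<le> C" using L by (auto simp: K_def C_def)
  \<comment> \<open>\<open>K\<close> bounds the potential in absolute value, so its growth is at
    most \<open>2 * K\<close>; over the range from this \<rho> to 1 the growth would be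
    \<open>2 * K + 1\<close>.\<close>
  define \<rho> where "\<rho> = exp (- (20 * (2 * K + 1) / \<eta>))"
  have \<rho>: "0 < \<rho>" "\<rho> \<le> 1" using K0 \<eta> by (auto simp: \<rho>_def)
  show ?thesis
  proof (rule that[OF \<rho>])
    fix v :: "real^'n \<Rightarrow> real" and dv A
    assume s: "obstacle_sol L v dv" and A: "admissible_matrix A" and b: "blows_up_to v dv A"
    show "\<exists>r. \<rho> \<le> r \<and> r \<le> 1 \<and> contact (rescale v 0 r) \<le> \<eta>"
    proof (rule ccontr)
      assume "\<not> ?thesis"
      then have ct: "contact (rescale v 0 r) > \<eta>" if "\<rho> \<le> r" "r \<le> 1" for r using that by force
      let ?f = "\<lambda>r. contact_potential (rescale v 0 r) - \<eta> / 20 * ln r"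
      have "?f \<rho> \<le> ?f 1"
      proof (rule mono_of_quadratic_defect[where a=\<rho> and C=C and f="?f"])
        fix r t :: real assume r: "0 < r" "\<rho> \<le> r" and t: "1 \<le> t" "t \<le> 3/2" and tr: "t * r \<le> 1"
        have "1 * r \<le> t * r" using r t by (intro mult_right_mono) auto
        then have r1: "r \<le> 1" using tr by linarith
        have s1: "obstacle_sol L (rescale v 0 r) (drescale dv 0 r)" by (rule sol_rescale_0[OF s r(1) r1])
        have s2: "obstacle_sol L (rescale v 0 (t*r)) (drescale dv 0 (t*r))" by (rule sol_rescale_0[OF s _ tr]) (use r t in simp)
        have "contact_potential (rescale v 0 (t*r)) - contact_potential (rescale v 0 r) \<ge> (t - 1) * (contact (rescale v 0 r) / 20) - C * (t - 1)\<^sup>2"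
          unfolding C_def
          using Qf_step[OF s1 _ t weiss_ge[OF s A b r(1) r1]] s2 by (simp add: rescale_rescale drescale_drescale)
        moreover have "(t - 1) * (contact (rescale v 0 r) / 20) \<ge> (t - 1) * (\<eta> / 20)"
          using ct[OF r(2) r1] t by (intro mult_left_mono) auto
        moreover have "ln (t * r) = ln t + ln r" using r t by (simp add: ln_mult)
        moreover have "\<eta> / 20 * ln t \<le> \<eta> / 20 * (t - 1)"
          using t \<eta> by (intro mult_left_mono ln_le_minus_one) auto
        moreover from calculation(3) have "\<eta> / 20 * ln (t * r) = \<eta> / 20 * ln t + \<eta> / 20 * ln r" by (simp add: algebra_simps)
        moreover have "(t - 1) * (\<eta> / 20) = \<eta> / 20 * (t - 1)" by simp
        ultimately show "?f (t * r) - ?f r \<ge> - C * (t - 1)\<^sup>2" by linarith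
      qed (use \<rho> C0 in auto)
      then have "- (\<eta> / 20 * ln \<rho>) \<le> contact_potential (rescale v 0 1) - contact_potential (rescale v 0 \<rho>)" by simp
      also have "\<dots> \<le> 2 * K"
        using Qf_bound[OF sol_rescale_0[OF s, of 1]] Qf_bound[OF sol_rescale_0[OF s \<rho>]] unfolding K_def by simp
      finally show False using \<eta> by (simp add: \<rho>_def field_simps)
    qed
  qed
qed

section \<open>Monotonicity of Monneau's integral\<close>

text \<open>The polynomial p is a critical point of the energy: \<open>g2\<close> cancels all
  first-order terms, so the energy gap is the quadratic part evaluated at a - p. As p is
  2-homogeneous, the deviation from homogeneity is the same for a and for a - p. The remaining term
  \<open>J3\<close> has a sign, for it is supported where a = 0, and there it is the weighted
  p.\<close>

lemma monneau_identity:
  fixes a :: "real^'n \<Rightarrow> real"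
  assumes s: "obstacle_sol L a da" and A: "admissible_matrix A"
    and w: "integral\<^sup>L lborel_ball (bump 5 :: real^'n \<Rightarrow> real) / 20 \<le> weiss a da"
  shows "0 \<le> integral\<^sup>L lborel_ball (\<lambda>x. bump 3 x * ((a x - quad_poly A x) * (x \<bullet> da x - 2 * a x)))"
proof -
  define l :: "real^'n \<Rightarrow> real" where "l = indicator {y. a y > 0}"
  define p where "p = quad_poly A"
  have ca: "c11 a da l (4*L+1)" unfolding l_def by (rule sol_c11[OF s])
  note cp = c11_quad_poly[OF A, folded p_def]
  note cw = c11_diff[OF ca cp]
  note ct = c11_continuous(3,4)[OF ca] quad_poly_cont[of _ A, folded p_def]
  have h: "x \<bullet> (A *v x) = 2 * p x" for x by (simp add: quad_poly_alt p_def)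
  define J1 where "J1 x = bump 3 x * (a x - p x) * (x \<bullet> (da x - A *v x))" for x
  define J2 where "J2 x = bump 4 x * ((da x - A *v x) \<bullet> (da x - A *v x))" for x
  define J3 where "J3 x = bump 4 x * (a x - p x) * (l x - 1)" for x
  define J4 where "J4 x = bump 4 x * (a x - p x)" for x
  define J5 where "J5 x = bump 3 x * ((a x - p x) * p x)" for x
  define J6 where "J6 x = bump 4 x * ((da x - A *v x) \<bullet> (A *v x))" for x
  define J7 where "J7 x = bump 3 x * (a x - p x)\<^sup>2" for x
  have i: "integrable lborel_ball J1" "integrable lborel_ball J2" "integrable lborel_ball J4" "integrable lborel_ball J5" "integrable lborel_ball J6" "integrable lborel_ball J7"
    unfolding J1_def[abs_def] J2_def[abs_def] J4_def[abs_def] J5_def[abs_def] J6_def[abs_def] J7_def[abs_def]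
    by (intro integrable_B1_continuous continuous_intros ct)+
  have g1: "integral\<^sup>L lborel_ball J3 = 8 * integral\<^sup>L lborel_ball J1 - integral\<^sup>L lborel_ball J2"
    unfolding J1_def J2_def J3_def by (rule green4[OF cw cw])
  have g2: "integral\<^sup>L lborel_ball J4 = 16 * integral\<^sup>L lborel_ball J5 - integral\<^sup>L lborel_ball J6"
    using green4[OF cp cw] unfolding J4_def J5_def J6_def h by (simp add: mult.assoc mult.left_commute[of _ 2])
  have wd: "weiss a da - weiss p (\<lambda>x. A *v x) = integral\<^sup>L lborel_ball J2 - 16 * integral\<^sup>L lborel_ball J7"
  proof -
    have j: "integrable lborel_ball (\<lambda>x. bump 4 x * (da x \<bullet> da x + 2 * a x))" "integrable lborel_ball (\<lambda>x. bump 4 x * ((A *v x) \<bullet> (A *v x) + 2 * p x))"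
      "integrable lborel_ball (\<lambda>x. bump 3 x * (a x)\<^sup>2)" "integrable lborel_ball (\<lambda>x. bump 3 x * (p x)\<^sup>2)"
      by (intro integrable_B1_continuous continuous_intros ct)+
    have "integral\<^sup>L lborel_ball (\<lambda>x. bump 4 x * (da x \<bullet> da x + 2 * a x)) - integral\<^sup>L lborel_ball (\<lambda>x. bump 4 x * ((A *v x) \<bullet> (A *v x) + 2 * p x))
      = integral\<^sup>L lborel_ball (\<lambda>x. bump 4 x * (da x \<bullet> da x + 2 * a x) - bump 4 x * ((A *v x) \<bullet> (A *v x) + 2 * p x))"
      using j by simp
    also have "\<dots> = integral\<^sup>L lborel_ball (\<lambda>x. J2 x + 2 * J6 x + 2 * J4 x)"
      by (rule Bochner_Integration.integral_cong)
         (auto simp: J2_def J6_def J4_def inner_diff_left inner_diff_right inner_commute algebra_simps)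
    also have "\<dots> = integral\<^sup>L lborel_ball J2 + 2 * integral\<^sup>L lborel_ball J6 + 2 * integral\<^sup>L lborel_ball J4" using i by simp
    finally have k1: "integral\<^sup>L lborel_ball (\<lambda>x. bump 4 x * (da x \<bullet> da x + 2 * a x)) - integral\<^sup>L lborel_ball (\<lambda>x. bump 4 x * ((A *v x) \<bullet> (A *v x) + 2 * p x))
      = integral\<^sup>L lborel_ball J2 + 2 * integral\<^sup>L lborel_ball J6 + 2 * integral\<^sup>L lborel_ball J4" .
    have "integral\<^sup>L lborel_ball (\<lambda>x. bump 3 x * (a x)\<^sup>2) - integral\<^sup>L lborel_ball (\<lambda>x. bump 3 x * (p x)\<^sup>2)
      = integral\<^sup>L lborel_ball (\<lambda>x. bump 3 x * (a x)\<^sup>2 - bump 3 x * (p x)\<^sup>2)" using j by simp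
    also have "\<dots> = integral\<^sup>L lborel_ball (\<lambda>x. J7 x + 2 * J5 x)"
      by (rule Bochner_Integration.integral_cong) (auto simp: J7_def J5_def power2_eq_square algebra_simps)
    also have "\<dots> = integral\<^sup>L lborel_ball J7 + 2 * integral\<^sup>L lborel_ball J5" using i by simp
    finally have k2: "integral\<^sup>L lborel_ball (\<lambda>x. bump 3 x * (a x)\<^sup>2) - integral\<^sup>L lborel_ball (\<lambda>x. bump 3 x * (p x)\<^sup>2)
      = integral\<^sup>L lborel_ball J7 + 2 * integral\<^sup>L lborel_ball J5" .
    show ?thesis unfolding weiss_def using k1 k2 g2 by simp
  qed
  have p3: "0 * vol_ball TYPE('n) \<le> integral\<^sup>L lborel_ball J3"
  proof (rule integral_B1_ge)
    show "integrable lborel_ball J3" unfolding J3_def[abs_def]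
      by (rule integrable_times_laplacian[OF cw]) (intro continuous_intros ct)
    fix x :: "real^'n" assume x: "norm x \<le> 1"
    have "0 \<le> (a x - p x) * (l x - 1)"
      using sol_unit_bounds(1)[OF s x] admissible_nonneg[OF A, of x] by (auto simp: l_def indicator_def p_def)
    then have "0 \<le> bump 4 x * ((a x - p x) * (l x - 1))" by (rule mult_nonneg_nonneg[OF bump_nonneg])
    then show "0 \<le> J3 x" by (simp add: J3_def mult.assoc)
  qed
  have "integral\<^sup>L lborel_ball (\<lambda>x. bump 3 x * ((a x - p x) * (x \<bullet> da x - 2 * a x))) = integral\<^sup>L lborel_ball (\<lambda>x. J1 x - 2 * J7 x)"
    by (rule Bochner_Integration.integral_cong)
       (auto simp: J1_def J7_def inner_diff_right h power2_eq_square algebra_simps)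
  also have "\<dots> = integral\<^sup>L lborel_ball J1 - 2 * integral\<^sup>L lborel_ball J7" using i by simp
  finally have "8 * integral\<^sup>L lborel_ball (\<lambda>x. bump 3 x * ((a x - p x) * (x \<bullet> da x - 2 * a x)))
     = weiss a da - weiss p (\<lambda>x. A *v x) + integral\<^sup>L lborel_ball J3"
    using wd g1 by simp
  moreover have "weiss p (\<lambda>x. A *v x) = integral\<^sup>L lborel_ball (bump 5 :: real^'n \<Rightarrow> real) / 20"
    unfolding p_def by (rule weiss_quad_poly[OF A])
  ultimately show ?thesis using p3 w unfolding p_def by linarith
qed

text \<open>As in \<open>Qf_step\<close>, the square of b - a is dropped, so that the first-order
  expansion is enough; the first variation is nonnegative by
  \<open>monneau_identity\<close>.\<close>

lemma monneau_step:
  fixes a :: "real^'n \<Rightarrow> real"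
  assumes sa: "obstacle_sol L a da" and sb: "obstacle_sol L (rescale a 0 t) (drescale da 0 t)" and t: "1 \<le> t" "t \<le> 3/2"
    and A: "admissible_matrix A"
    and w: "integral\<^sup>L lborel_ball (bump 5 :: real^'n \<Rightarrow> real) / 20 \<le> weiss a da"
  shows "monneau A (rescale a 0 t) - monneau A a \<ge> - (96 * (L * (L + dim_sq TYPE('n))) * vol_ball TYPE('n)) * (t - 1)\<^sup>2"
proof -
  define b where "b = rescale a 0 t"
  define p where "p = quad_poly A"
  note L0 = solD(1)[OF sa]
  note ct = c11_continuous(3,4)[OF sol_c11[OF sa]] c11_continuous(3)[OF sol_c11[OF sb], folded b_def] quad_poly_cont(1)[of _ A, folded p_def]
  define \<tau> where "\<tau> = t - 1"
  define e where "e x = x \<bullet> da x - 2 * a x" for x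
  define E where "E x = bump 3 x * ((a x - p x) * e x)" for x
  define H where "H x = bump 3 x * ((b x - p x)\<^sup>2 - (a x - p x)\<^sup>2 - 2 * \<tau> * ((a x - p x) * e x))" for x
  have i: "integrable lborel_ball (\<lambda>x. bump 3 x * (b x - p x)\<^sup>2)" "integrable lborel_ball (\<lambda>x. bump 3 x * (a x - p x)\<^sup>2)"
    "integrable lborel_ball H" "integrable lborel_ball E"
    unfolding H_def[abs_def] E_def[abs_def] e_def[abs_def]
    by (intro integrable_B1_continuous continuous_intros ct)+
  have "integral\<^sup>L lborel_ball H = integral\<^sup>L lborel_ball (\<lambda>x. bump 3 x * (b x - p x)\<^sup>2 - bump 3 x * (a x - p x)\<^sup>2 - 2 * \<tau> * E x)"
    by (rule Bochner_Integration.integral_cong) (auto simp: H_def E_def algebra_simps)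
  also have "\<dots> = (monneau A b - monneau A a) / 8 - 2 * \<tau> * integral\<^sup>L lborel_ball E"
    unfolding monneau_def p_def[symmetric] using i by simp
  finally have h1: "integral\<^sup>L lborel_ball H = (monneau A b - monneau A a) / 8 - 2 * \<tau> * integral\<^sup>L lborel_ball E" .
  have "(- (12 * (L * (L + dim_sq TYPE('n))) * \<tau>\<^sup>2)) * vol_ball TYPE('n) \<le> integral\<^sup>L lborel_ball H"
  proof (rule integral_B1_ge[OF i(3)])
    fix x :: "real^'n" assume x: "norm x \<le> 1"
    define \<alpha> where "\<alpha> = b x - a x - \<tau> * e x"
    have \<alpha>: "\<bar>\<alpha>\<bar> \<le> 6 * L * \<tau>\<^sup>2" unfolding \<alpha>_def b_def \<tau>_def e_def by (rule sol_expansion(2)[OF sa t x])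
    note ab = sol_unit_bounds[OF sa x]
    have "dim_sq TYPE('n) * (norm x)\<^sup>2 \<le> dim_sq TYPE('n) * 1" using x by (intro mult_left_mono power_le_one) auto
    then have "p x \<le> dim_sq TYPE('n)" "0 \<le> p x"
      using quad_poly_le[OF A, of x] admissible_nonneg[OF A, of x] NB_ge1[where 'n='n] unfolding p_def by linarith+
    then have "\<bar>a x - p x\<bar> \<le> L + dim_sq TYPE('n)" using ab NB_ge1[where 'n='n] L0 by linarith
    then have "\<bar>(a x - p x) * \<alpha>\<bar> \<le> (L + dim_sq TYPE('n)) * (6 * L * \<tau>\<^sup>2)"
      unfolding abs_mult using \<alpha> L0 by (intro mult_mono) auto
    moreover have "(b x - p x)\<^sup>2 - (a x - p x)\<^sup>2 - 2 * \<tau> * ((a x - p x) * e x) = 2 * ((a x - p x) * \<alpha>) + (b x - a x)\<^sup>2"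
      by (simp add: \<alpha>_def power2_eq_square algebra_simps)
    moreover have "0 \<le> (b x - a x)\<^sup>2" by simp
    moreover have "(L + dim_sq TYPE('n)) * (6 * L * \<tau>\<^sup>2) = 6 * (L * (L + dim_sq TYPE('n)) * \<tau>\<^sup>2)"
      "12 * (L * (L + dim_sq TYPE('n))) * \<tau>\<^sup>2 = 12 * (L * (L + dim_sq TYPE('n)) * \<tau>\<^sup>2)" by (simp_all only: ac_simps)
    ultimately have "- (12 * (L * (L + dim_sq TYPE('n))) * \<tau>\<^sup>2) \<le> (b x - p x)\<^sup>2 - (a x - p x)\<^sup>2 - 2 * \<tau> * ((a x - p x) * e x)"
      by linarith
    from weighted_ge[OF this, of 3 x] show "- (12 * (L * (L + dim_sq TYPE('n))) * \<tau>\<^sup>2) \<le> H x"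
      using L0 unfolding H_def by simp
  qed
  moreover have "integral\<^sup>L lborel_ball E \<ge> 0"
    using monneau_identity[OF sa A w] unfolding E_def[abs_def] e_def p_def .
  then have "2 * \<tau> * integral\<^sup>L lborel_ball E \<ge> 0" using t by (simp add: \<tau>_def)
  ultimately show ?thesis using h1 unfolding b_def[symmetric] \<tau>_def[symmetric] by (simp add: algebra_simps)
qed

text \<open>The blow-up \<open>B\<close> only supplies the lower energy bound. The polynomial
  \<open>A\<close> is independent of it, which is what lets one polynomial control all smaller
  scales.\<close>

lemma monneau_mono:
  fixes v :: "real^'n \<Rightarrow> real"
  assumes s: "obstacle_sol L v dv" and B: "admissible_matrix B" and b: "blows_up_to v dv B" and A: "admissible_matrix A"
    and r: "0 < r" "r \<le> q" "q \<le> 1"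
  shows "monneau A (rescale v 0 r) \<le> monneau A (rescale v 0 q)"
proof (rule mono_of_quadratic_defect[where a=0 and C="96 * (L * (L + dim_sq TYPE('n))) * vol_ball TYPE('n)" and
      f="\<lambda>r. monneau A (rescale v 0 r)"])
  fix r t :: real assume r: "0 < r" and t: "1 \<le> t" "t \<le> 3/2" and tr: "t * r \<le> 1"
  have "1 * r \<le> t * r" using r t by (intro mult_right_mono) auto
  then have r1: "r \<le> 1" using tr by linarith
  have s1: "obstacle_sol L (rescale v 0 r) (drescale dv 0 r)" by (rule sol_rescale_0[OF s r r1])
  have s2: "obstacle_sol L (rescale v 0 (t*r)) (drescale dv 0 (t*r))" by (rule sol_rescale_0[OF s _ tr]) (use r t in simp)
  show "monneau A (rescale v 0 (t * r)) - monneau A (rescale v 0 r)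
    \<ge> - (96 * (L * (L + dim_sq TYPE('n))) * vol_ball TYPE('n)) * (t - 1)\<^sup>2"
    using monneau_step[OF s1 _ t A weiss_ge[OF s B b r r1]] s2 by (simp add: rescale_rescale drescale_drescale)
qed (use r solD(1)[OF s] in auto)

text \<open>This is \<open>monneau_mono\<close> in the limit of scale 0. Consequently a polynomial
  that is close to \<open>v\<close> at a single scale is also close to the blow-up.\<close>

lemma monneau_blowup_le:
  fixes v :: "real^'n \<Rightarrow> real"
  assumes s: "obstacle_sol L v dv" and B: "admissible_matrix B" and b: "blows_up_to v dv B" and A: "admissible_matrix A"
    and q: "0 < q" "q \<le> 1"
  shows "monneau A (quad_poly B) \<le> monneau A (rescale v 0 q)"
proof -
  define K where "K = L + 2 * dim_sq TYPE('n)"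
  have L0: "0 \<le> L" by (rule solD(1)[OF s])
  define C where "C = 8 * (2 * K * vol_ball TYPE('n))"
  have C0: "0 \<le> C" unfolding C_def K_def using L0 by simp
  have "monneau A (quad_poly B) \<le> monneau A (rescale v 0 q) + e * C" if e: "e > 0" for e
  proof -
    obtain r where r: "0 < r" "r < q" and r1: "\<And>x. norm x \<le> 1 \<Longrightarrow> \<bar>rescale v 0 r x - quad_poly B x\<bar> < e"
      using blows_ex[OF b e q(1)] by metis
    define a da where "a = rescale v 0 r" and "da = drescale dv 0 r"
    have sa: "obstacle_sol L a da" unfolding a_def da_def by (rule sol_rescale_0[OF s r(1)]) (use r q in simp)
    note ct = c11_continuous(3,4)[OF sol_c11[OF sa]]
    have 2: "\<bar>integral\<^sup>L lborel_ball (\<lambda>x. bump 3 x * (a x - quad_poly A x)\<^sup>2) - integral\<^sup>L lborel_ball (\<lambda>x. bump 3 x * (quad_poly B x - quad_poly A x)\<^sup>2)\<bar>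
       \<le> (e * (2 * K)) * vol_ball TYPE('n)"
    proof (rule integral_B1_diff_le)
      fix x :: "real^'n" assume x: "norm x \<le> 1"
      have xb: "x \<in> ball 0 2" using x by simp
      have n: "dim_sq TYPE('n) * (norm x)\<^sup>2 \<le> dim_sq TYPE('n) * 1" using x by (intro mult_left_mono power_le_one) auto
      have "\<bar>(a x - quad_poly A x)\<^sup>2 - (quad_poly B x - quad_poly A x)\<^sup>2\<bar> \<le> e * (2 * K)"
      proof (rule sq_diff_le)
        show "\<bar>a x - quad_poly A x - (quad_poly B x - quad_poly A x)\<bar> \<le> e" using r1[OF x] by (simp add: a_def)
        show "\<bar>a x - quad_poly A x\<bar> \<le> K" "\<bar>quad_poly B x - quad_poly A x\<bar> \<le> K"
          using sol_unit_bounds[OF sa x] n quad_poly_le[OF A, of x] admissible_nonneg[OF A, of x]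
            quad_poly_le[OF B, of x] admissible_nonneg[OF B, of x] NB_ge1[where 'n='n] L0 unfolding K_def by linarith+
      qed
      then have "bump 3 x * \<bar>(a x - quad_poly A x)\<^sup>2 - (quad_poly B x - quad_poly A x)\<^sup>2\<bar> \<le> 1 * (e * (2 * K))"
        by (intro mult_mono bump_le_1) auto
      then show "\<bar>bump 3 x * (a x - quad_poly A x)\<^sup>2 - bump 3 x * (quad_poly B x - quad_poly A x)\<^sup>2\<bar> \<le> e * (2 * K)"
        by (simp add: right_diff_distrib[symmetric] abs_mult)
    qed (intro integrable_B1_continuous continuous_intros ct quad_poly_cont)+
    have "monneau A (quad_poly B) \<le> monneau A a + e * C"
      using 2 unfolding monneau_def C_def by (simp add: abs_le_iff algebra_simps)
    also have "monneau A a \<le> monneau A (rescale v 0 q)"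
      unfolding a_def by (rule monneau_mono[OF s B b A r(1)]) (use r q in auto)
    finally show ?thesis by simp
  qed
  note * = this
  show ?thesis
  proof (rule field_le_epsilon)
    fix d :: real assume d: "d > 0"
    have "d / (C + 1) * C \<le> d" using C0 d by (simp add: field_simps)
    moreover have "0 < d / (C + 1)" using C0 d by simp
    ultimately show "monneau A (quad_poly B) \<le> monneau A (rescale v 0 q) + d"
      using *[of "d / (C + 1)"] by linarith
  qed
qed

section \<open>Almost harmonic solutions are almost quadratic\<close>

text \<open>The fourth power of the positive part has third derivative \<open>24 * max 0 t\<close>,
  at most 24 for t up to 1; division by 3! gives the constant 4.\<close>

lemma pos_part_taylor:
  fixes s u :: real
  assumes "s \<le> 1" "u \<le> 1"
  shows "\<bar>(max 0 u)^4 - (max 0 s)^4 - 4 * (max 0 s)^3 * (u - s) - 6 * (max 0 s)^2 * (u - s)^2\<bar> \<le> 4 * \<bar>u - s\<bar>^3"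
proof (cases "u = s")
  case True
  then show ?thesis by simp
next
  case False
  \<comment> \<open>The successive derivatives of the fourth power. The last branch also catches m >
    3, but Taylor's formula asks for the derivative relation only for m < 3.\<close>
  define D :: "nat \<Rightarrow> real \<Rightarrow> real" where
    "D m = (\<lambda>s. if m = 0 then (max 0 s)^4 else if m = 1 then 4 * (max 0 s)^3 else if m = 2 then 12 * (max 0 s)^2 else 24 * (max 0 s))" for m
  have D0: "DERIV (D 0) t :> D (Suc 0) t" for t
    unfolding D_def using DERIV_pos_part_power[of 3 t] by simp
  have D1: "DERIV (D 1) t :> D (Suc 1) t" for t
    unfolding D_def using DERIV_cmult[OF DERIV_pos_part_power[of 2 t], of 4] by (simp add: numeral_eq_Suc)
  have D2: "DERIV (D 2) t :> D (Suc 2) t" for t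
    unfolding D_def using DERIV_cmult[OF DERIV_pos_part_power[of 1 t], of 12] by (simp add: numeral_eq_Suc)
  have D: "\<forall>m t. m < 3 \<and> min s u \<le> t \<and> t \<le> max s u \<longrightarrow> DERIV (D m) t :> D (Suc m) t"
  proof (intro allI impI)
    fix m t assume "m < (3::nat) \<and> min s u \<le> t \<and> t \<le> max s u"
    then have "m = 0 \<or> m = 1 \<or> m = 2" by linarith
    then show "DERIV (D m) t :> D (Suc m) t" using D0 D1 D2 by blast
  qed
  have "\<exists>t. (if u < s then u < t \<and> t < s else s < t \<and> t < u) \<and>
    D 0 u = (\<Sum>m<3. (D m s / fact m) * (u - s)^m) + (D 3 t / fact 3) * (u - s)^3"
    using Taylor[OF _ refl D, of s u] False by simp
  then obtain t where t: "if u < s then u < t \<and> t < s else s < t \<and> t < u"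
    and eq: "D 0 u = (\<Sum>m<3. (D m s / fact m) * (u - s)^m) + (D 3 t / fact 3) * (u - s)^3"
    by blast
  have t1: "max 0 t \<le> 1" using t assms by (auto split: if_splits)
  have "(max 0 u)^4 - (max 0 s)^4 - 4 * (max 0 s)^3 * (u - s) - 6 * (max 0 s)^2 * (u - s)^2 = 4 * max 0 t * (u - s)^3"
    using eq by (simp add: D_def eval_nat_numeral)
  also have "\<bar>\<dots>\<bar> = 4 * max 0 t * \<bar>u - s\<bar>^3" by (simp add: abs_mult power_abs)
  also have "\<dots> \<le> 4 * 1 * \<bar>u - s\<bar>^3" using t1 by (intro mult_right_mono mult_left_mono) auto
  finally show ?thesis by simp
qed

text \<open>The Taylor polynomial of degree 2 in \<open>h\<close> of \<open>bump 4 (y - h)\<close>: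
  the argument 1 - |y|^2 of the positive part changes by 2 y.h - |h|^2, and terms of degree three
  and four in \<open>h\<close> are dropped.\<close>

definition bump4_poly :: "real^'n \<Rightarrow> real^'n \<Rightarrow> real" where
  "bump4_poly h y = bump 4 y + 8 * bump 3 y * (y \<bullet> h) + 24 * bump 2 y * (y \<bullet> h)\<^sup>2 - 4 * bump 3 y * (h \<bullet> h)"

lemma bump4_poly_outside: "norm y \<ge> 1 \<Longrightarrow> bump4_poly h y = 0"
  by (simp add: bump4_poly_def bump_0_outside)

lemma bump4_expand:
  assumes h: "norm h \<le> 1"
  shows "\<bar>bump 4 (y - h) - bump4_poly h y\<bar> \<le> 530 * (norm h)^3 * indicator (cball 0 2) y"
proof (cases "norm y \<le> 2")
  case False
  have "norm (y - h) \<ge> 1" using False h norm_triangle_ineq2[of y h] by linarith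
  then show ?thesis using False by (simp add: bump4_poly_outside bump_0_outside)
next
  case True
  define p where "p = y \<bullet> h"
  define q where "q = h \<bullet> h"
  define s where "s = 1 - y \<bullet> y"
  define u where "u = 1 - (y - h) \<bullet> (y - h)"
  have us: "u - s = 2 * p - q"
    by (simp add: u_def s_def p_def q_def inner_diff_left inner_diff_right inner_commute algebra_simps)
  have q: "q = (norm h)^2" by (simp add: q_def power2_norm_eq_inner)
  have qh: "q \<le> norm h" using mult_left_mono[OF h norm_ge_zero[of h]] by (simp add: q power2_eq_square)
  have q0: "0 \<le> q" by (simp add: q)
  have pb: "\<bar>p\<bar> \<le> norm y * norm h" unfolding p_def by (rule Cauchy_Schwarz_ineq2)
  also have "\<dots> \<le> 2 * norm h" by (rule mult_right_mono[OF True]) simp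
  finally have p2: "\<bar>p\<bar> \<le> 2 * norm h" .
  have "\<bar>u - s\<bar> \<le> 5 * norm h" unfolding us using p2 qh q0 by linarith
  then have "\<bar>u - s\<bar>^3 \<le> (5 * norm h)^3" by (rule power_mono) simp
  then have d3: "4 * \<bar>u - s\<bar>^3 \<le> 500 * (norm h)^3" by (simp add: power_mult_distrib)
  have "s \<le> 1" "u \<le> 1" by (simp_all add: s_def u_def)
  from pos_part_taylor[OF this] have t: "\<bar>bump 4 (y - h) - bump 4 y - 4 * bump 3 y * (u - s) - 6 * bump 2 y * (u - s)^2\<bar> \<le> 4 * \<bar>u - s\<bar>^3"
    unfolding bump_def s_def u_def .
  have b: "bump 4 y + 4 * bump 3 y * (u - s) + 6 * bump 2 y * (u - s)^2 = bump4_poly h y + 6 * (bump 2 y * (q * q - 4 * (p * q)))"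
    unfolding us bump4_poly_def p_def[symmetric] q_def[symmetric] by (simp add: power2_eq_square algebra_simps)
  have hh: "q * q \<le> (norm h)^3"
  proof -
    have "q * q \<le> q * norm h" by (rule mult_left_mono[OF qh q0])
    then show ?thesis by (simp add: q power3_eq_cube power2_eq_square)
  qed
  have "\<bar>bump 2 y * (q * q - 4 * (p * q))\<bar> \<le> 5 * (norm h)^3"
  proof (cases "norm y \<le> 1")
    case True
    have "\<bar>p\<bar> \<le> 1 * norm h" using pb mult_right_mono[OF True norm_ge_zero[of h]] by linarith
    then have "\<bar>p\<bar> * q \<le> (1 * norm h) * q" by (rule mult_right_mono[OF _ q0])
    then have "\<bar>p * q\<bar> \<le> (norm h)^3" using q0 by (simp add: abs_mult q power3_eq_cube power2_eq_square mult.assoc)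
    moreover have "0 \<le> q * q" using q0 by simp
    ultimately have "\<bar>q * q - 4 * (p * q)\<bar> \<le> 5 * (norm h)^3" using hh by linarith
    then have "bump 2 y * \<bar>q * q - 4 * (p * q)\<bar> \<le> 1 * (5 * (norm h)^3)"
      by (intro mult_mono bump_le_1) auto
    then show ?thesis by (simp add: abs_mult)
  next
    case False
    then show ?thesis by (simp add: bump_0_outside)
  qed
  \<comment> \<open>530 is 4 * 5^3 from the Taylor remainder plus 6 * 5 from the dropped
    terms.\<close>
  then have "\<bar>bump 4 (y - h) - bump4_poly h y\<bar> \<le> 530 * (norm h)^3" using t b d3 by linarith
  then show ?thesis using True by simp
qed

lemma bump4_poly_cont: "continuous_on S (bump4_poly h)"
  unfolding bump4_poly_def[abs_def] by (intro continuous_intros)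

text \<open>The translation is moved from \<open>g\<close> to the weight, so a merely continuous
  \<open>g\<close> yields an expansion in \<open>h\<close> with a cubic error.\<close>

lemma moll_expand:
  fixes g :: "real^'n \<Rightarrow> real"
  assumes g: "continuous_on UNIV g" and G: "\<And>y. norm y \<le> 2 \<Longrightarrow> \<bar>g y\<bar> \<le> G" and h: "norm h \<le> 1"
  shows "\<bar>integral\<^sup>L lborel_ball (\<lambda>y. bump 4 y * g (y + h)) - integral\<^sup>L lborel_ball (\<lambda>y. bump4_poly h y * g y)\<bar>
    \<le> 530 * (norm h)^3 * G * measure lborel (cball (0::real^'n) 2)"
proof -
  define f where "f y = bump 4 (y - h) * g y" for y
  have fc: "continuous_on UNIV f" unfolding f_def[abs_def] by (intro continuous_intros g)
  then have fm: "f \<in> borel_measurable borel" by (rule borel_measurable_continuous_onI)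
  have f0: "f y = 0" if "norm y \<ge> 2" for y
  proof -
    have "norm (y - h) \<ge> 1" using that h norm_triangle_ineq2[of y h] by linarith
    then show ?thesis by (simp add: f_def bump_0_outside)
  qed
  have "f = (\<lambda>y. indicator (cball 0 2) y *\<^sub>R f y)" using f0 by (auto simp: fun_eq_iff indicator_def)
  moreover have "integrable lborel (\<lambda>y. indicator (cball 0 2) y *\<^sub>R f y)"
    by (rule borel_integrable_compact) (use fc continuous_on_subset in auto)
  ultimately have fi: "integrable lborel f" by simp
  have "integral\<^sup>L lborel_ball (\<lambda>y. bump 4 y * g (y + h)) = integral\<^sup>L lborel (\<lambda>y. bump 4 y * g (y + h))"
    by (rule lborel_eq_B1(1)[symmetric]) (simp add: bump_0_outside)
  also have "\<dots> = integral\<^sup>L lborel (\<lambda>y. f (y + h))" by (simp add: f_def)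
  also have "\<dots> = integral\<^sup>L lborel f" by (rule lborel_integral_shift(1)[OF fm])
  finally have 1: "integral\<^sup>L lborel_ball (\<lambda>y. bump 4 y * g (y + h)) = integral\<^sup>L lborel f" .
  have 2: "integral\<^sup>L lborel (\<lambda>y. bump4_poly h y * g y) = integral\<^sup>L lborel_ball (\<lambda>y. bump4_poly h y * g y)"
    "integrable lborel (\<lambda>y. bump4_poly h y * g y)"
  proof -
    have z: "\<And>x. norm x > 1 \<Longrightarrow> bump4_poly h x * g x = 0" by (simp add: bump4_poly_outside)
    show "integral\<^sup>L lborel (\<lambda>y. bump4_poly h y * g y) = integral\<^sup>L lborel_ball (\<lambda>y. bump4_poly h y * g y)"
      by (rule lborel_eq_B1(1)[OF z])
    have "integrable lborel_ball (\<lambda>y. bump4_poly h y * g y)"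
      by (intro integrable_B1_continuous continuous_intros bump4_poly_cont continuous_on_subset[OF g]) simp
    then show "integrable lborel (\<lambda>y. bump4_poly h y * g y)"
      by (subst lborel_eq_B1(2)) (auto simp: bump4_poly_outside)
  qed
  have i2: "integrable lborel (indicat_real (cball (0::real^'n) 2))"
    by (auto intro!: integrable_real_indicator emeasure_lborel_cball_finite)
  have "\<bar>integral\<^sup>L lborel f - integral\<^sup>L lborel (\<lambda>y. bump4_poly h y * g y)\<bar> = \<bar>integral\<^sup>L lborel (\<lambda>y. f y - bump4_poly h y * g y)\<bar>"
    using fi 2 by simp
  also have "\<dots> \<le> integral\<^sup>L lborel (\<lambda>y. \<bar>f y - bump4_poly h y * g y\<bar>)"
    using integral_norm_bound[of lborel "\<lambda>y. f y - bump4_poly h y * g y"] by simp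
  also have "\<dots> \<le> integral\<^sup>L lborel (\<lambda>y::real^'n. (530 * (norm h)^3 * G) * indicat_real (cball 0 2) y)"
  proof (rule integral_mono)
    show "integrable lborel (\<lambda>y. \<bar>f y - bump4_poly h y * g y\<bar>)" using fi 2 by simp
    show "integrable lborel (\<lambda>y. (530 * (norm h)^3 * G) * indicat_real (cball (0::real^'n) 2) y)" using i2 by simp
    fix y :: "real^'n"
    have "f y - bump4_poly h y * g y = (bump 4 (y - h) - bump4_poly h y) * g y" by (simp add: f_def left_diff_distrib)
    then have "\<bar>f y - bump4_poly h y * g y\<bar> = \<bar>bump 4 (y - h) - bump4_poly h y\<bar> * \<bar>g y\<bar>" by (simp add: abs_mult)
    also have "\<dots> \<le> (530 * (norm h)^3 * indicator (cball 0 2) y) * \<bar>g y\<bar>"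
      by (rule mult_right_mono[OF bump4_expand[OF h]]) simp
    also have "\<dots> \<le> (530 * (norm h)^3 * G) * indicator (cball 0 2) y"
      using G[of y] by (auto simp: indicator_def intro!: mult_left_mono)
    finally show "\<bar>f y - bump4_poly h y * g y\<bar> \<le> (530 * (norm h)^3 * G) * indicat_real (cball 0 2) y" .
  qed
  also have "\<dots> = 530 * (norm h)^3 * G * measure lborel (cball (0::real^'n) 2)" using i2 by simp
  finally show ?thesis using 1 2 by simp
qed

lemma lborel_integral_affine:
  fixes f :: "real^'n \<Rightarrow> real"
  assumes f: "f \<in> borel_measurable borel" and c: "c \<noteq> 0"
  shows "integral\<^sup>L lborel f = \<bar>c\<bar>^CARD('n) * integral\<^sup>L lborel (\<lambda>x. f (t + c *\<^sub>R x))"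
    and "integrable lborel f \<Longrightarrow> integrable lborel (\<lambda>x. f (t + c *\<^sub>R x))"
proof -
  let ?T = "\<lambda>x::real^'n. t + c *\<^sub>R x"
  have Tm: "?T \<in> borel_measurable lborel" by simp
  have "integral\<^sup>L lborel f = integral\<^sup>L (density (distr lborel borel ?T) (\<lambda>_. ennreal (\<bar>c\<bar>^DIM(real^'n)))) f"
    using lborel_affine[OF c, of t] by simp
  also have "\<dots> = integral\<^sup>L (distr lborel borel ?T) (\<lambda>x. (\<bar>c\<bar>^DIM(real^'n)) *\<^sub>R f x)"
    by (rule integral_density) (use f in auto)
  also have "\<dots> = \<bar>c\<bar>^CARD('n) * integral\<^sup>L (distr lborel borel ?T) f" by simp
  also have "integral\<^sup>L (distr lborel borel ?T) f = integral\<^sup>L lborel (\<lambda>x. f (t + c *\<^sub>R x))"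
    by (rule integral_distr[OF Tm]) (use f in simp)
  finally show "integral\<^sup>L lborel f = \<bar>c\<bar>^CARD('n) * integral\<^sup>L lborel (\<lambda>x. f (t + c *\<^sub>R x))" .
  assume "integrable lborel f"
  then have "integrable (density (distr lborel borel ?T) (\<lambda>_. ennreal (\<bar>c\<bar>^DIM(real^'n)))) f"
    using lborel_affine[OF c, of t] by simp
  then have "integrable (distr lborel borel ?T) (\<lambda>x. (\<bar>c\<bar>^DIM(real^'n)) *\<^sub>R f x)"
    by (subst (asm) integrable_density) (use f in auto)
  then have "integrable (distr lborel borel ?T) f" using c by simp
  then show "integrable lborel (\<lambda>x. f (t + c *\<^sub>R x))"
    by (subst (asm) integrable_distr_eq[OF Tm]) (use f in auto)
qed

lemma has_derivative_of_quadratic: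
  fixes f :: "'a::real_normed_vector \<Rightarrow> real"
  assumes D: "bounded_linear D" and d: "d > 0"
    and q: "\<And>h. norm h < d \<Longrightarrow> \<bar>f (x + h) - f x - D h\<bar> \<le> C * (norm h)\<^sup>2"
  shows "(f has_derivative D) (at x)"
  unfolding has_derivative_iff_norm
proof (intro conjI D)
  have lim: "((\<lambda>y. \<bar>C\<bar> * norm (y - x)) \<longlongrightarrow> 0) (at x)"
  proof -
    have "((\<lambda>y. \<bar>C\<bar> * norm (y - x)) \<longlongrightarrow> \<bar>C\<bar> * norm (x - x)) (at x)" by (intro tendsto_intros)
    then show ?thesis by simp
  qed
  show "((\<lambda>y. norm (f y - f x - D (y - x)) / norm (y - x)) \<longlongrightarrow> 0) (at x)"
  proof (rule Lim_null_comparison[OF _ lim])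
    have "\<forall>\<^sub>F y in at x. y \<in> ball x d \<and> y \<noteq> x"
      using d by (auto simp: eventually_at dist_commute intro!: exI[of _ d])
    then show "\<forall>\<^sub>F y in at x. norm (norm (f y - f x - D (y - x)) / norm (y - x)) \<le> \<bar>C\<bar> * norm (y - x)"
    proof eventually_elim
      case (elim y)
      then have n: "norm (y - x) > 0" "norm (y - x) < d" by (auto simp: dist_norm norm_minus_commute)
      have "\<bar>f y - f x - D (y - x)\<bar> \<le> C * (norm (y - x))\<^sup>2" using q[OF n(2)] by simp
      also have "\<dots> \<le> \<bar>C\<bar> * (norm (y - x))\<^sup>2" by (intro mult_right_mono) auto
      finally show ?case using n by (simp add: field_simps power2_eq_square)
    qed
  qed
qed

lemma integral_bump_pos: "0 < integral\<^sup>L lborel_ball (bump k :: real^'n \<Rightarrow> real)"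
proof -
  have "0 < (3/4)^k * measure lborel (cball (0::real^'n) (1/2))"
    by (simp add: content_cball_pos)
  also have "\<dots> = integral\<^sup>L lborel (\<lambda>x::real^'n. (3/4)^k * indicator (cball 0 (1/2)) x)" by simp
  also have "\<dots> = integral\<^sup>L lborel_ball (\<lambda>x::real^'n. (3/4)^k * indicator (cball 0 (1/2)) x)"
    by (rule lborel_eq_B1) (auto simp: indicator_def)
  also have "\<dots> \<le> integral\<^sup>L lborel_ball (bump k :: real^'n \<Rightarrow> real)"
  proof (rule integral_mono)
    have "integrable lborel (\<lambda>x::real^'n. (3/4)^k * indicator (cball 0 (1/2)) x :: real)"
      by (intro integrable_mult_right integrable_real_indicator emeasure_lborel_cball_finite) simp
    then show "integrable lborel_ball (\<lambda>x::real^'n. (3/4)^k * indicator (cball 0 (1/2)) x :: real)"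
      by (subst (asm) lborel_eq_B1(2)) (auto simp: indicator_def)
    show "integrable lborel_ball (bump k :: real^'n \<Rightarrow> real)"
      by (intro integrable_B1_continuous continuous_on_bump[of _ "\<lambda>x. x"] continuous_on_id)
    fix x :: "real^'n"
    show "(3/4)^k * indicator (cball 0 (1/2)) x \<le> bump k x"
    proof (cases "norm x \<le> 1/2")
      case True
      then have "(norm x)\<^sup>2 \<le> (1/2)\<^sup>2" by (intro power_mono) auto
      then have "x \<bullet> x \<le> 1/4" unfolding power2_norm_eq_inner by (simp add: power2_eq_square)
      then show ?thesis using True unfolding bump_def by (simp add: power_mono)
    qed simp
  qed
  finally show ?thesis .
qed

section \<open>The mean value property at shifted centres\<close>

text \<open>At a centre \<open>z\<close> where \<open>v\<close> may be positive the rescaling is not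
  an \<open>obstacle_sol\<close>, but the regularity of \<open>c11\<close> survives. The constant
  degenerates as \<open>r\<close> tends to 0, which is harmless because Green's identities are exact
  and do not mention it.\<close>

lemma shifted_c11:
  fixes v :: "real^'n \<Rightarrow> real"
  assumes s: "obstacle_sol L v dv" and z: "norm z \<le> 1/2" and r: "0 < r" "r \<le> 1/2"
  shows "\<exists>K. c11 (rescale v z r) (drescale dv z r) (indicator {y. rescale v z r y > 0}) K"
proof -
  have sub: "x \<in> ball 0 2" if "x \<in> ball z (2*r)" for x
  proof -
    have "norm x \<le> norm z + norm (x - z)" using norm_triangle_ineq[of z "x - z"] by simp
    then show ?thesis using that z r by (simp add: dist_norm norm_minus_commute)
  qed
  note L0 = solD(1)[OF s]
  have ae: "AE x in lborel. x \<in> ball z (2*r) \<longrightarrow>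
        (\<exists>G. (dv has_derivative G) (at x) \<and> (\<Sum>i\<in>UNIV. G (axis i 1) $ i) = indicator {y. v y > 0} x)"
    using solD(6)[OF s] by (rule eventually_mono) (use sub in blast)
  note reg = rescale_regular[OF r(1) L0, of z v dv, OF solD(2)[OF s sub] solD(3)[OF s sub sub] solD(4)[OF s sub] ae]
  define K where "K = 4 * L / r\<^sup>2 + inverse r * (2 * L) + L + 1"
  have p: "0 \<le> 4 * L / r\<^sup>2" "0 \<le> inverse r * (2 * L)" using L0 r by auto
  have T: "z + r *\<^sub>R x \<in> ball 0 2" if "x \<in> ball 0 2" for x
    by (rule sub) (use that r in \<open>simp add: dist_norm\<close>)
  have "c11 (rescale v z r) (drescale dv z r) (indicator {y. rescale v z r y > 0}) K"
    unfolding c11_def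
  proof (intro conjI)
    show "\<forall>x\<in>ball 0 2. (rescale v z r has_derivative (\<lambda>h. drescale dv z r x \<bullet> h)) (at x)" by (rule reg)
    show "\<forall>x\<in>ball 0 2. \<forall>y\<in>ball 0 2. norm (drescale dv z r x - drescale dv z r y) \<le> K * norm (x - y)"
    proof (intro ballI)
      fix x y :: "real^'n" assume "x \<in> ball 0 2" "y \<in> ball 0 2"
      then have "norm (drescale dv z r x - drescale dv z r y) \<le> L * norm (x - y)" using reg(2) by blast
      also have "\<dots> \<le> K * norm (x - y)" unfolding K_def using p by (intro mult_right_mono) auto
      finally show "norm (drescale dv z r x - drescale dv z r y) \<le> K * norm (x - y)" .
    qed
    show "\<forall>x\<in>ball 0 2. \<bar>rescale v z r x\<bar> \<le> K \<and> norm (drescale dv z r x) \<le> K"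
    proof (intro ballI conjI)
      fix x :: "real^'n" assume x: "x \<in> ball 0 2"
      note b = sol_bounds(3,4)[OF s T[OF x]] solD(4)[OF s T[OF x]]
      have "\<bar>rescale v z r x\<bar> \<le> 4 * L / r\<^sup>2" unfolding rescale_def using b r by (simp add: divide_right_mono)
      then show "\<bar>rescale v z r x\<bar> \<le> K" unfolding K_def using p L0 by linarith
      have "norm (drescale dv z r x) \<le> inverse r * (2 * L)" unfolding drescale_def using b r
        by simp
      then show "norm (drescale dv z r x) \<le> K" unfolding K_def using p L0 by linarith
    qed
    show "AE x in lborel. x \<in> ball 0 2 \<longrightarrow> (\<exists>G. (drescale dv z r has_derivative G) (at x) \<and>
             (\<Sum>i\<in>UNIV. G (axis i 1) $ i) = indicator {y. rescale v z r y > 0} x)" by (rule reg)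
    have "continuous_on (cball 0 1) (rescale v z r)"
      using reg(1) by (intro continuous_at_imp_continuous_on ballI has_derivative_continuous[where f'="\<lambda>h. drescale dv z r x \<bullet> h" for x]) auto
    then have "rescale v z r \<in> borel_measurable lborel_ball" by (rule continuous_imp_measurable_B1)
    then have "(\<lambda>x. indicator {0<..} (rescale v z r x) :: real) \<in> borel_measurable lborel_ball"
      by (rule measurable_compose) simp
    moreover have "(\<lambda>x. indicator {0<..} (rescale v z r x) :: real) = indicator {y. rescale v z r y > 0}"
      by (auto simp: indicator_def)
    ultimately show "(indicator {y. rescale v z r y > 0} :: real^'n \<Rightarrow> real) \<in> borel_measurable lborel_ball" by simp
    show "\<forall>x\<in>cball 0 1. \<bar>indicator {y. rescale v z r y > 0} x\<bar> \<le> K"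
      unfolding K_def using p L0 by (auto simp: indicator_def)
  qed
  then show ?thesis by blast
qed

lemma indicator_rescale:
  "0 < r \<Longrightarrow> indicator {y. rescale v z r y > 0} y = (indicator {x. v x > 0} (z + r *\<^sub>R y) :: real)"
  by (simp add: indicator_def rescale_def zero_less_divide_iff)

lemma shifted_integrable:
  fixes v f :: "real^'n \<Rightarrow> real"
  assumes s: "obstacle_sol L v dv" and z: "norm z \<le> 1/2" and r: "0 < r" "r \<le> 1/2" and f: "continuous_on (cball 0 1) f"
  shows "integrable lborel_ball (\<lambda>y. f y * indicator {x. v x > 0} (z + r *\<^sub>R y))"
proof -
  obtain K where c: "c11 (rescale v z r) (drescale dv z r) (indicator {y. rescale v z r y > 0}) K"
    using shifted_c11[OF s z r] by blast
  show ?thesis using integrable_times_laplacian[OF c f] by (simp add: indicator_rescale[OF r(1)])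
qed

lemma green5_shift:
  fixes v :: "real^'n \<Rightarrow> real"
  assumes s: "obstacle_sol L v dv" and z: "norm z \<le> 1/2" and r: "0 < r" "r \<le> 1/2"
  shows "integral\<^sup>L lborel_ball (\<lambda>y. bump 4 y * (y \<bullet> dv (z + r *\<^sub>R y))) = r / 10 * integral\<^sup>L lborel_ball (\<lambda>y. bump 5 y * indicator {x. v x > 0} (z + r *\<^sub>R y))"
proof -
  obtain K where c: "c11 (rescale v z r) (drescale dv z r) (indicator {y. rescale v z r y > 0}) K"
    using shifted_c11[OF s z r] by blast
  have "integral\<^sup>L lborel_ball (\<lambda>y. bump 4 y * (y \<bullet> drescale dv z r y)) = inverse r * integral\<^sup>L lborel_ball (\<lambda>y. bump 4 y * (y \<bullet> dv (z + r *\<^sub>R y)))"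
    unfolding drescale_def by (simp add: mult.left_commute[of _ "inverse r"])
  then show ?thesis using green5[OF c] r by (simp add: indicator_rescale[OF r(1)] field_simps)
qed

text \<open>Lower bound of \<open>bump 5\<close> on the ball of radius 3/4, where 1 - |x|^2 is at
  least 7/16.\<close>

abbreviation kap :: real where "kap \<equiv> (7/16)^5"

text \<open>The ball of radius \<open>r\<close> about \<open>z\<close> stays within distance 3/4 of
  the origin, where \<open>bump 5\<close> is at least \<open>kap\<close>; the change of variables
  costs \<open>r\<close> to the power of the dimension.\<close>

lemma contact_shift:
  fixes v :: "real^'n \<Rightarrow> real"
  assumes s: "obstacle_sol L v dv" and z: "norm z \<le> 1/4" and r: "0 < r" "r \<le> 1/2" and k: "k > 0"
  shows "integral\<^sup>L lborel_ball (\<lambda>y. bump k y * (1 - indicator {x. v x > 0} (z + r *\<^sub>R y))) \<le> contact v / (kap * r^CARD('n))"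
proof -
  define l :: "real^'n \<Rightarrow> real" where "l = indicator {x. v x > 0}"
  have l01: "0 \<le> l x" "l x \<le> 1" for x by (auto simp: l_def indicator_def)
  have z2: "norm z \<le> 1/2" using z by simp
  define f where "f x = bump 5 x * (1 - l x)" for x
  have f0: "0 \<le> f x" for x using l01 by (simp add: f_def)
  have c: "c11 v dv l (4*L+1)" unfolding l_def by (rule sol_c11[OF s])
  have fB: "integrable lborel_ball f"
  proof -
    have "integrable lborel_ball (\<lambda>x. bump 5 x - bump 5 x * l x)"
      by (intro Bochner_Integration.integrable_diff integrable_times_laplacian[OF c] integrable_B1_continuous continuous_intros)
    then show ?thesis unfolding f_def[abs_def] by (simp add: algebra_simps)
  qed
  have fz: "f x = 0" if "norm x > 1" for x using that by (simp add: f_def bump_0_outside)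
  have fi: "integrable lborel f" using fB lborel_eq_B1(2)[of f, OF fz] by blast
  have fm: "f \<in> borel_measurable borel" using borel_measurable_integrable[OF fi] by simp
  have cf: "contact v = integral\<^sup>L lborel f"
    unfolding contact_def using lborel_eq_B1(1)[of f, OF fz] by (simp add: f_def[abs_def] l_def)
  have r0: "r \<noteq> 0" using r by simp
  have aff: "integral\<^sup>L lborel f = r^CARD('n) * integral\<^sup>L lborel (\<lambda>y. f (z + r *\<^sub>R y))"
    using lborel_integral_affine(1)[OF fm r0, of z] r by simp
  have affi: "integrable lborel (\<lambda>y. f (z + r *\<^sub>R y))" by (rule lborel_integral_affine(2)[OF fm r0 fi])
  define h where "h y = bump k y * (1 - l (z + r *\<^sub>R y))" for y
  have hB: "integrable lborel_ball h"
  proof -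
    have "integrable lborel_ball (\<lambda>y. bump k y - bump k y * l (z + r *\<^sub>R y))" unfolding l_def
      by (intro Bochner_Integration.integrable_diff shifted_integrable[OF s z2 r] integrable_B1_continuous continuous_intros)
    then show ?thesis unfolding h_def[abs_def] by (simp add: algebra_simps)
  qed
  have hz: "h y = 0" if "norm y > 1" for y using that k by (simp add: h_def bump_0_outside)
  have hi: "integrable lborel h" using hB lborel_eq_B1(2)[of h, OF hz] by blast
  have "kap * integral\<^sup>L lborel h = integral\<^sup>L lborel (\<lambda>y. kap * h y)" by simp
  also have "\<dots> \<le> integral\<^sup>L lborel (\<lambda>y. f (z + r *\<^sub>R y))"
  proof (rule integral_mono)
    show "integrable lborel (\<lambda>y. kap * h y)" using hi by simp
    fix y :: "real^'n"
    show "kap * h y \<le> f (z + r *\<^sub>R y)"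
    proof (cases "norm y \<le> 1")
      case True
      have "norm (z + r *\<^sub>R y) \<le> norm z + r * norm y" using norm_triangle_ineq[of z "r *\<^sub>R y"] r by simp
      also have "\<dots> \<le> 1/4 + 1/2 * 1" using z True r by (intro add_mono mult_mono) auto
      finally have "(norm (z + r *\<^sub>R y))\<^sup>2 \<le> (3/4)\<^sup>2" by (intro power_mono) auto
      then have "(z + r *\<^sub>R y) \<bullet> (z + r *\<^sub>R y) \<le> 9/16" unfolding power2_norm_eq_inner by (simp add: power2_eq_square)
      then have "kap \<le> bump 5 (z + r *\<^sub>R y)" unfolding bump_def by (intro power_mono) auto
      then have "kap * (1 - l (z + r *\<^sub>R y)) \<le> f (z + r *\<^sub>R y)" unfolding f_def using l01 by (intro mult_right_mono) auto
      moreover have "h y \<le> 1 * (1 - l (z + r *\<^sub>R y))" unfolding h_def using l01 by (intro mult_right_mono bump_le_1) auto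
      then have "kap * h y \<le> kap * (1 - l (z + r *\<^sub>R y))" by (intro mult_left_mono) auto
      ultimately show ?thesis by linarith
    next
      case False
      then show ?thesis using hz[of y] f0 by simp
    qed
  qed (rule affi)
  finally have 1: "kap * integral\<^sup>L lborel h \<le> integral\<^sup>L lborel (\<lambda>y. f (z + r *\<^sub>R y))" .
  have rp: "0 < r^CARD('n)" using r by simp
  have "r^CARD('n) * (kap * integral\<^sup>L lborel h) \<le> contact v"
    unfolding cf aff by (rule mult_left_mono[OF 1]) (use rp in simp)
  then have "integral\<^sup>L lborel h \<le> contact v / (kap * r^CARD('n))"
    using rp by (simp add: pos_le_divide_eq mult.commute mult.left_commute)
  moreover have "integral\<^sup>L lborel h = integral\<^sup>L lborel_ball h" by (rule lborel_eq_B1(1)[of h, OF hz])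
  ultimately show ?thesis unfolding h_def[abs_def] l_def by simp
qed

text \<open>Where \<open>v\<close> is positive its Laplacian is 1, so the weighted mean over radius
  r has derivative r N / 10 up to the contribution m r of the contact set. Integration up to 1/2
  gives N / 80. Below \<delta> only the trivial bound by N is available for m r, at the cost
  \<delta>^2 N / 20; above \<delta> it is \<open>contact_shift\<close> that controls it.\<close>

lemma mean_value_approx:
  fixes v :: "real^'n \<Rightarrow> real"
  assumes s: "obstacle_sol L v dv" and z: "norm z \<le> 1/4" and \<delta>: "0 < \<delta>" "\<delta> \<le> 1/2"
  defines "N \<equiv> integral\<^sup>L lborel_ball (bump 5 :: real^'n \<Rightarrow> real)"
  shows "\<bar>integral\<^sup>L lborel_ball (\<lambda>y. bump 4 y * v (z + (1/2) *\<^sub>R y)) - integral\<^sup>L lborel_ball (bump 4 :: real^'n \<Rightarrow> real) * v z - N / 80\<bar>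
    \<le> \<delta>\<^sup>2 * N / 20 + contact v / (kap * \<delta>^CARD('n)) / 80"
proof -
  note L0 = solD(1)[OF s]
  have z2: "norm z \<le> 1/2" using z by simp
  have inb: "z + r *\<^sub>R y \<in> ball 0 2" if "norm y \<le> 1" "\<bar>r\<bar> \<le> 1" for r y
  proof -
    have "norm (z + r *\<^sub>R y) \<le> norm z + \<bar>r\<bar> * norm y" using norm_triangle_ineq[of z "r *\<^sub>R y"] by simp
    also have "\<dots> \<le> 1/4 + 1 * 1" using z that by (intro add_mono mult_mono) auto
    finally show ?thesis by simp
  qed
  note cv = c11_continuous(1,2)[OF sol_c11[OF s]]
  have ct: "continuous_on (cball 0 1) (\<lambda>y. v (z + r *\<^sub>R y))" "continuous_on (cball 0 1) (\<lambda>y. dv (z + r *\<^sub>R y))" if "\<bar>r\<bar> \<le> 1" for r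
    by (rule continuous_on_compose2[OF cv(1)], intro continuous_intros, use inb that in auto)
       (rule continuous_on_compose2[OF cv(2)], intro continuous_intros, use inb that in auto)
  define G where "G r = integral\<^sup>L lborel_ball (\<lambda>y. bump 4 y * v (z + r *\<^sub>R y))" for r
  define G' where "G' r = integral\<^sup>L lborel_ball (\<lambda>y. bump 4 y * (y \<bullet> dv (z + r *\<^sub>R y)))" for r
  have der: "DERIV G r :> G' r" if r: "\<bar>r\<bar> \<le> 1/2" for r
  proof -
    have "(G has_derivative (\<lambda>h. G' r * h)) (at r)"
    proof (rule has_derivative_of_quadratic[where d="1/2" and C="L * vol_ball TYPE('n)"])
      fix h :: real assume h: "norm h < 1/2"
      have r1: "\<bar>r\<bar> \<le> 1" "\<bar>r + h\<bar> \<le> 1" using r h by auto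
      have i: "integrable lborel_ball (\<lambda>y. bump 4 y * v (z + (r + h) *\<^sub>R y))" "integrable lborel_ball (\<lambda>y. bump 4 y * v (z + r *\<^sub>R y))"
        "integrable lborel_ball (\<lambda>y. bump 4 y * (y \<bullet> dv (z + r *\<^sub>R y)))"
        by (intro integrable_B1_continuous continuous_intros ct r1)+
      have "\<bar>integral\<^sup>L lborel_ball (\<lambda>y. bump 4 y * v (z + (r + h) *\<^sub>R y)) - integral\<^sup>L lborel_ball (\<lambda>y. bump 4 y * v (z + r *\<^sub>R y) + h * (bump 4 y * (y \<bullet> dv (z + r *\<^sub>R y))))\<bar>
         \<le> (L * h\<^sup>2) * vol_ball TYPE('n)"
      proof (rule integral_B1_diff_le)
        fix y :: "real^'n" assume y: "norm y \<le> 1"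
        have d: "z + (r + h) *\<^sub>R y - (z + r *\<^sub>R y) = h *\<^sub>R y" by (simp add: algebra_simps)
        have "\<bar>v (z + (r + h) *\<^sub>R y) - v (z + r *\<^sub>R y) - dv (z + r *\<^sub>R y) \<bullet> (h *\<^sub>R y)\<bar> \<le> L * (norm (h *\<^sub>R y))\<^sup>2"
          using sol_taylor[OF s inb[OF y r1(1)] inb[OF y r1(2)]] unfolding d .
        also have "\<dots> \<le> L * h\<^sup>2"
        proof (rule mult_left_mono[OF _ L0])
          have "norm (h *\<^sub>R y) \<le> \<bar>h\<bar> * 1" unfolding norm_scaleR by (rule mult_left_mono[OF y]) simp
          then show "(norm (h *\<^sub>R y))\<^sup>2 \<le> h\<^sup>2" using power_mono[of "norm (h *\<^sub>R y)" "\<bar>h\<bar>" 2] by simp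
        qed
        finally have "bump 4 y * \<bar>v (z + (r + h) *\<^sub>R y) - v (z + r *\<^sub>R y) - h * (y \<bullet> dv (z + r *\<^sub>R y))\<bar> \<le> 1 * (L * h\<^sup>2)"
          by (intro mult_mono bump_le_1) (auto simp: inner_commute)
        moreover have "bump 4 y * v (z + (r + h) *\<^sub>R y) - (bump 4 y * v (z + r *\<^sub>R y) + h * (bump 4 y * (y \<bullet> dv (z + r *\<^sub>R y))))
          = bump 4 y * (v (z + (r + h) *\<^sub>R y) - v (z + r *\<^sub>R y) - h * (y \<bullet> dv (z + r *\<^sub>R y)))" by (simp add: algebra_simps)
        ultimately show "\<bar>bump 4 y * v (z + (r + h) *\<^sub>R y) - (bump 4 y * v (z + r *\<^sub>R y) + h * (bump 4 y * (y \<bullet> dv (z + r *\<^sub>R y))))\<bar> \<le> L * h\<^sup>2"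
          by (simp add: abs_mult)
      qed (use i in simp_all)
      then show "\<bar>G (r + h) - G r - G' r * h\<bar> \<le> L * vol_ball TYPE('n) * (norm h)\<^sup>2"
        using i unfolding G_def G'_def by (simp add: algebra_simps)
    qed (auto intro: bounded_linear_mult_right)
    then show ?thesis by (simp add: has_field_derivative_def)
  qed
  have cont: "continuous_on {a..b} G" if "0 \<le> a" "b \<le> 1/2" for a b
    using that by (intro continuous_at_imp_continuous_on ballI DERIV_isCont[OF der]) auto
  define m where "m r = integral\<^sup>L lborel_ball (\<lambda>y. bump 5 y * (1 - indicator {x. v x > 0} (z + r *\<^sub>R y)))" for r
  define ms where "ms = contact v / (kap * \<delta>^CARD('n))"
  have G'eq: "G' r = r / 10 * (N - m r)" if "0 < r" "r \<le> 1/2" for r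
  proof -
    have "integrable lborel_ball (\<lambda>y. bump 5 y * indicator {x. v x > 0} (z + r *\<^sub>R y))"
      by (rule shifted_integrable[OF s z2 that]) (intro continuous_intros)
    moreover have "integrable lborel_ball (bump 5 :: real^'n \<Rightarrow> real)"
      by (intro integrable_B1_continuous continuous_on_bump[of _ "\<lambda>x. x"] continuous_on_id)
    ultimately have "m r = N - integral\<^sup>L lborel_ball (\<lambda>y. bump 5 y * indicator {x. v x > 0} (z + r *\<^sub>R y))"
      unfolding m_def N_def right_diff_distrib by simp
    then show ?thesis unfolding G'_def using green5_shift[OF s z2 that] by simp
  qed
  have m0: "0 \<le> m r" for r unfolding m_def
    by (rule Bochner_Integration.integral_nonneg) (auto simp: indicator_def)
  have mN: "m r \<le> N" if "0 < r" "r \<le> 1/2" for r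
  proof -
    have "integrable lborel_ball (\<lambda>y. bump 5 y * indicator {x. v x > 0} (z + r *\<^sub>R y))"
      by (rule shifted_integrable[OF s z2 that]) (intro continuous_intros)
    moreover have i5: "integrable lborel_ball (bump 5 :: real^'n \<Rightarrow> real)"
      by (intro integrable_B1_continuous continuous_on_bump[of _ "\<lambda>x. x"] continuous_on_id)
    ultimately have "integrable lborel_ball (\<lambda>y. bump 5 y * (1 - indicator {x. v x > 0} (z + r *\<^sub>R y)))"
      unfolding right_diff_distrib by simp
    then show ?thesis unfolding m_def N_def by (rule integral_mono[OF _ i5]) (auto simp: indicator_def)
  qed
  have mms: "m r \<le> ms" if "\<delta> \<le> r" "r \<le> 1/2" for r
  proof -
    have r0: "0 < r" using that \<delta> by linarith
    have "0 \<le> contact v" unfolding contact_def by (rule Bochner_Integration.integral_nonneg) (auto simp: indicator_def)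
    then have "contact v / (kap * r^CARD('n)) \<le> ms" unfolding ms_def using \<delta> that
      by (intro divide_left_mono mult_left_mono power_mono mult_pos_pos) auto
    then show ?thesis using contact_shift[OF s z r0 that(2), of 5] unfolding m_def by simp
  qed
  have ms0: "0 \<le> ms" using mms[of \<delta>] m0[of \<delta>] \<delta> by simp
  \<comment> \<open>The three comparisons integrate the formula for \<open>G'\<close>:
    \<open>up\<close> uses that \<open>m\<close> is nonnegative, \<open>lo1\<close> that it is at
    most \<open>N\<close>, and \<open>lo2\<close> that it is at most \<open>ms\<close> beyond
    \<delta>.\<close>
  have up: "G 0 - 0\<^sup>2 / 20 * N \<ge> G (1/2) - (1/2)\<^sup>2 / 20 * N"
  proof (rule DERIV_nonpos_imp_decreasing_open[of 0 "1/2" "\<lambda>r. G r - r\<^sup>2 / 20 * N"])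
    fix r :: real assume r: "0 < r" "r < 1/2"
    have "DERIV (\<lambda>r. G r - r\<^sup>2 / 20 * N) r :> G' r - 2 * r / 20 * N"
      using r by (intro DERIV_diff der) (auto intro!: derivative_eq_intros)
    moreover have "G' r - 2 * r / 20 * N = - (r / 10 * m r)" using G'eq[of r] r by (simp add: field_simps)
    moreover have "0 \<le> r / 10 * m r" using r m0 by simp
    ultimately show "\<exists>y. DERIV (\<lambda>r. G r - r\<^sup>2 / 20 * N) r :> y \<and> y \<le> 0" by auto
  qed (auto intro!: continuous_intros cont)
  have lo1: "G 0 \<le> G \<delta>"
  proof (rule DERIV_nonneg_imp_increasing_open[of 0 \<delta> G])
    fix r :: real assume r: "0 < r" "r < \<delta>"
    then have r2: "r \<le> 1/2" using \<delta> by linarith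
    have "0 \<le> r / 10 * (N - m r)" using r r2 mN[of r] by simp
    then have "0 \<le> G' r" using G'eq[of r] r r2 by simp
    then show "\<exists>y. DERIV G r :> y \<and> 0 \<le> y" using der[of r] r r2 by auto
  qed (use \<delta> in \<open>auto intro!: cont\<close>)
  have lo2: "G \<delta> - \<delta>\<^sup>2 / 20 * (N - ms) \<le> G (1/2) - (1/2)\<^sup>2 / 20 * (N - ms)"
  proof (rule DERIV_nonneg_imp_increasing_open[of \<delta> "1/2" "\<lambda>r. G r - r\<^sup>2 / 20 * (N - ms)"])
    fix r :: real assume r: "\<delta> < r" "r < 1/2"
    have r0: "0 < r" using r \<delta> by linarith
    have "DERIV (\<lambda>r. G r - r\<^sup>2 / 20 * (N - ms)) r :> G' r - 2 * r / 20 * (N - ms)"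
      using r r0 by (intro DERIV_diff der) (auto intro!: derivative_eq_intros)
    moreover have "G' r - 2 * r / 20 * (N - ms) = r / 10 * (ms - m r)" using G'eq[of r] r r0 by (simp add: field_simps)
    moreover have "0 \<le> r / 10 * (ms - m r)" using r r0 mms[of r] by simp
    ultimately show "\<exists>y. DERIV (\<lambda>r. G r - r\<^sup>2 / 20 * (N - ms)) r :> y \<and> 0 \<le> y" by auto
  qed (use \<delta> in \<open>auto intro!: continuous_intros cont\<close>)
  have "\<delta>\<^sup>2 / 20 * (N - ms) \<le> \<delta>\<^sup>2 / 20 * N" using ms0 by (intro mult_left_mono) auto
  then have low: "G 0 - \<delta>\<^sup>2 * N / 20 + (N - ms) / 80 \<le> G (1/2)" using lo1 lo2 by (simp add: power2_eq_square)
  have G0: "G 0 = integral\<^sup>L lborel_ball (bump 4 :: real^'n \<Rightarrow> real) * v z" unfolding G_def by simp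
  have N0: "0 \<le> \<delta>\<^sup>2 * N / 20" unfolding N_def using integral_bump_pos[of 5, where 'n='n] by simp
  have "\<bar>G (1/2) - G 0 - N / 80\<bar> \<le> \<delta>\<^sup>2 * N / 20 + ms / 80"
    using up low N0 ms0 by (simp add: power2_eq_square abs_le_iff field_simps)
  then show ?thesis unfolding G_def ms_def G0[unfolded G_def] .
qed

lemma quad_poly_sum: "quad_poly A h = (\<Sum>i\<in>UNIV. \<Sum>j\<in>UNIV. A $ i $ j * (h $ i * h $ j)) / 2"
  by (simp add: quad_poly_def matrix_vector_mult_def inner_vec_def sum_distrib_left ac_simps)

lemma quad_poly_scale: "quad_poly A (t *\<^sub>R h) = t\<^sup>2 * quad_poly A h"
  unfolding quad_poly_sum by (simp add: sum_distrib_left power2_eq_square ac_simps)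

lemma quad_poly_scaleR: "quad_poly (t *\<^sub>R A) h = t * quad_poly A h"
  unfolding quad_poly_sum by (simp add: sum_distrib_left ac_simps)

lemma quad_poly_diff: "quad_poly (A - B) h = quad_poly A h - quad_poly B h"
  unfolding quad_poly_sum by (simp add: sum_subtractf left_diff_distrib diff_divide_distrib)

lemma admissible_identity:
  "admissible_matrix ((1 / real CARD('n)) *\<^sub>R mat 1 :: real^'n^'n)"
  "((1 / real CARD('n)) *\<^sub>R mat 1 :: real^'n^'n) *v x = (1 / real CARD('n)) *\<^sub>R x"
proof -
  show e: "((1 / real CARD('n)) *\<^sub>R mat 1 :: real^'n^'n) *v x = (1 / real CARD('n)) *\<^sub>R x" for x
    by (simp add: scaleR_matrix_vector_assoc[symmetric])
  show "admissible_matrix ((1 / real CARD('n)) *\<^sub>R mat 1 :: real^'n^'n)"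
    unfolding admissible_matrix_def e
  proof (intro conjI allI)
    show "transpose ((1 / real CARD('n)) *\<^sub>R mat 1 :: real^'n^'n) = (1 / real CARD('n)) *\<^sub>R mat 1"
      by (simp add: transpose_def mat_def vec_eq_iff)
    show "trace ((1 / real CARD('n)) *\<^sub>R mat 1 :: real^'n^'n) = 1" by (simp add: trace_def mat_def)
    show "0 \<le> x \<bullet> (1 / real CARD('n)) *\<^sub>R x" for x :: "real^'n" by simp
  qed
qed

text \<open>Two integrations by parts move the Laplacian onto the weight. The second one applies
  \<open>green\<close> to the polynomial of the admissible matrix 1/n, whose gradient is x/n, with
  \<open>v\<close> as test function.\<close>

lemma moll_laplacian:
  fixes v :: "real^'n \<Rightarrow> real"
  assumes c: "c11 v dv l K"
  shows "integral\<^sup>L lborel_ball (\<lambda>y. bump 4 y * l y) = 8 * (6 * integral\<^sup>L lborel_ball (\<lambda>y. bump 2 y * v y * (y \<bullet> y)) - real CARD('n) * integral\<^sup>L lborel_ball (\<lambda>y. bump 3 y * v y))"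
proof -
  let ?n = "real CARD('n)"
  have n: "?n > 0" by simp
  define I :: "real^'n^'n" where "I = (1 / ?n) *\<^sub>R mat 1"
  have I: "admissible_matrix I" "I *v x = (1 / ?n) *\<^sub>R x" for x
    unfolding I_def by (rule admissible_identity(1), rule admissible_identity(2))
  have "integral\<^sup>L lborel_ball (\<lambda>x. bump 3 x * v x) = 6 * integral\<^sup>L lborel_ball (\<lambda>x. bump 2 x * v x * (x \<bullet> (I *v x)))
      - integral\<^sup>L lborel_ball (\<lambda>x. bump 3 x * (dv x \<bullet> (I *v x)))"
    using green[OF c11_quad_poly[OF I(1)] c, of 2] by simp
  then have 1: "?n * integral\<^sup>L lborel_ball (\<lambda>x. bump 3 x * v x) = 6 * integral\<^sup>L lborel_ball (\<lambda>x. bump 2 x * v x * (x \<bullet> x))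
      - integral\<^sup>L lborel_ball (\<lambda>x. bump 3 x * (dv x \<bullet> x))"
    using n unfolding I(2) by (simp add: field_simps)
  have "integral\<^sup>L lborel_ball (\<lambda>x. bump 4 x * l x) = 8 * integral\<^sup>L lborel_ball (\<lambda>x. bump 3 x * (x \<bullet> dv x))"
    using green4[OF c c11_const[of 1]] by simp
  then show ?thesis using 1 by (simp add: inner_commute)
qed

text \<open>\<open>b\<close> and \<open>A\<close> play the part of gradient and Hessian at 0 of the
  mollification in \<open>moll_expand\<close>. The factors 48 and 8 are twice the 24 and 4 of
  \<open>bump4_poly\<close>, since \<open>quad_poly\<close> carries a factor 1/2.\<close>

lemma bump4_poly_integral:
  fixes g :: "real^'n \<Rightarrow> real"
  assumes g: "continuous_on (cball 0 1) g"
  defines "b \<equiv> \<chi> i. 8 * integral\<^sup>L lborel_ball (\<lambda>y. bump 3 y * y $ i * g y)"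
    and "A \<equiv> \<chi> i j. integral\<^sup>L lborel_ball (\<lambda>y. (48 * bump 2 y * (y $ i * y $ j) - (if i = j then 8 * bump 3 y else 0)) * g y)"
  shows "integral\<^sup>L lborel_ball (\<lambda>y. bump4_poly h y * g y) = integral\<^sup>L lborel_ball (\<lambda>y. bump 4 y * g y) + b \<bullet> h + quad_poly A h"
proof -
  define t1 where "t1 i y = bump 3 y * y $ i * g y" for i and y :: "real^'n"
  define t2 where "t2 i j y = (48 * bump 2 y * (y $ i * y $ j) - (if i = j then 8 * bump 3 y else 0)) * g y" for i j and y :: "real^'n"
  have i0: "integrable lborel_ball (\<lambda>y. bump 4 y * g y)"
    by (intro integrable_B1_continuous continuous_intros g)
  have i1: "integrable lborel_ball (t1 i)" for i
    unfolding t1_def[abs_def] by (intro integrable_B1_continuous continuous_intros g)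
  have i2: "integrable lborel_ball (t2 i j)" for i j
    unfolding t2_def[abs_def] by (cases "i = j") (simp_all, (intro integrable_B1_continuous continuous_intros g)+)
  have pw: "bump4_poly h y * g y = bump 4 y * g y + (\<Sum>i\<in>UNIV. (8 * h $ i) * t1 i y) + (\<Sum>i\<in>UNIV. \<Sum>j\<in>UNIV. (h $ i * h $ j / 2) * t2 i j y)" for y
  proof -
    have e1: "(\<Sum>i\<in>UNIV. (8 * h $ i) * t1 i y) = 8 * bump 3 y * (y \<bullet> h) * g y"
      unfolding t1_def inner_vec_def by (simp add: sum_distrib_left sum_distrib_right ac_simps)
    have "(\<Sum>i\<in>UNIV. \<Sum>j\<in>UNIV. (h $ i * h $ j / 2) * t2 i j y)
       = (\<Sum>i\<in>UNIV. \<Sum>j\<in>UNIV. 24 * bump 2 y * g y * ((y $ i * h $ i) * (y $ j * h $ j)))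
         - (\<Sum>i\<in>UNIV. \<Sum>j\<in>UNIV. (if i = j then h $ i * h $ j * 4 * bump 3 y * g y else 0))"
      unfolding sum_subtractf[symmetric] t2_def
      by (intro sum.cong refl) (auto simp: algebra_simps)
    also have "(\<Sum>i\<in>UNIV. \<Sum>j\<in>UNIV. 24 * bump 2 y * g y * ((y $ i * h $ i) * (y $ j * h $ j))) = 24 * bump 2 y * g y * (y \<bullet> h)\<^sup>2"
      unfolding inner_vec_def power2_eq_square inner_real_def sum_product by (simp only: sum_distrib_left)
    also have "(\<Sum>i\<in>UNIV. \<Sum>j\<in>UNIV. (if i = j then h $ i * h $ j * 4 * bump 3 y * g y else 0)) = 4 * bump 3 y * (h \<bullet> h) * g y"
      unfolding inner_vec_def by (simp add: sum.delta sum_distrib_left sum_distrib_right ac_simps)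
    finally show ?thesis unfolding e1 bump4_poly_def by (simp add: algebra_simps)
  qed
  have "integral\<^sup>L lborel_ball (\<lambda>y. bump4_poly h y * g y) = integral\<^sup>L lborel_ball (\<lambda>y. bump 4 y * g y)
     + (\<Sum>i\<in>UNIV. (8 * h $ i) * integral\<^sup>L lborel_ball (t1 i)) + (\<Sum>i\<in>UNIV. \<Sum>j\<in>UNIV. (h $ i * h $ j / 2) * integral\<^sup>L lborel_ball (t2 i j))"
    unfolding pw using i0 i1 i2 by simp
  moreover have "(\<Sum>i\<in>UNIV. (8 * h $ i) * integral\<^sup>L lborel_ball (t1 i)) = b \<bullet> h"
    unfolding b_def inner_vec_def t1_def[abs_def] by (simp add: ac_simps)
  moreover have "(\<Sum>i\<in>UNIV. \<Sum>j\<in>UNIV. (h $ i * h $ j / 2) * integral\<^sup>L lborel_ball (t2 i j)) = quad_poly A h"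
    unfolding quad_poly_sum A_def t2_def[abs_def] by (simp add: sum_divide_distrib ac_simps)
  ultimately show ?thesis by simp
qed

text \<open>\<open>moll_expand\<close> calls for a globally continuous function, whereas
  \<open>v\<close> is controlled near the unit ball only. Halving followed by radial retraction onto
  the unit ball extends it, and arguments up to norm 2 are not affected by the retraction.\<close>

lemma sol_clamp:
  fixes v :: "real^'n \<Rightarrow> real"
  assumes s: "obstacle_sol L v dv"
  obtains g where "continuous_on UNIV g" "\<And>y. \<bar>g y\<bar> \<le> L" "\<And>y. norm y \<le> 2 \<Longrightarrow> g y = v ((1/2) *\<^sub>R y)"
proof -
  define pr where "pr y = (1 / max 2 (norm y)) *\<^sub>R y" for y :: "real^'n"
  have pr1: "norm (pr y) \<le> 1" for y by (auto simp: pr_def field_simps)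
  have prc: "continuous_on UNIV pr" unfolding pr_def[abs_def] by (intro continuous_intros) (auto simp: max_def)
  have vc: "continuous_on (cball 0 1) v" by (rule c11_continuous(3)[OF sol_c11[OF s]])
  show ?thesis
  proof (rule that[of "\<lambda>y. v (pr y)"])
    show "continuous_on UNIV (\<lambda>y. v (pr y))" by (rule continuous_on_compose2[OF vc prc]) (use pr1 in auto)
    show "\<bar>v (pr y)\<bar> \<le> L" for y using sol_unit_bounds(1,2)[OF s pr1[of y]] by simp
    show "v (pr y) = v ((1/2) *\<^sub>R y)" if "norm y \<le> 2" for y using that by (simp add: pr_def)
  qed
qed

section \<open>Approximation by quadratic polynomials\<close>

text \<open>By \<open>mean_value_approx\<close> the value at \<open>z\<close> is a weighted mean
  over radius 1/2 minus a constant, and by \<open>moll_expand\<close> this mean is quadratic in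
  \<open>z\<close> up to a cubic error. The trace of the matrix turns out to be the weighted
  proportion of the positivity set in the half ball, hence near 1 if the contact set is
  small.\<close>

lemma quad_approx_one:
  fixes v :: "real^'n \<Rightarrow> real"
  assumes s: "obstacle_sol L v dv" and \<delta>: "0 < \<delta>" "\<delta> \<le> 1/2"
  defines "N \<equiv> integral\<^sup>L lborel_ball (bump 5 :: real^'n \<Rightarrow> real)" and "c4 \<equiv> integral\<^sup>L lborel_ball (bump 4 :: real^'n \<Rightarrow> real)"
    and "V2 \<equiv> measure lborel (cball (0::real^'n) 2)"
  defines "C \<equiv> (L * vol_ball TYPE('n) + N + 16 * real CARD('n) * L * vol_ball TYPE('n) + 224 * L * vol_ball TYPE('n) + 4240 * L * V2) / c4"
  shows "\<exists>\<alpha> \<beta> A. \<bar>\<alpha>\<bar> \<le> C \<and> norm \<beta> \<le> C \<and> (\<forall>i j. \<bar>A $ i $ j\<bar> \<le> C) \<and> transpose A = A \<and>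
     \<bar>trace A - 1\<bar> \<le> contact v / (kap * \<delta>^CARD('n)) / c4 \<and>
     (\<forall>z. norm z \<le> 1/4 \<longrightarrow> \<bar>v z - \<alpha> - \<beta> \<bullet> z - quad_poly A z\<bar> \<le>
        (\<delta>\<^sup>2 * N / 20 + contact v / (kap * \<delta>^CARD('n)) / 80) / c4 + C * (norm z)^3)"
proof -
  note L0 = solD(1)[OF s]
  have c4: "c4 > 0" unfolding c4_def by (rule integral_bump_pos)
  have N0: "N > 0" unfolding N_def by (rule integral_bump_pos)
  have V20: "0 \<le> V2" unfolding V2_def by simp
  obtain g where gc: "continuous_on UNIV g" and gL: "\<And>y. \<bar>g y\<bar> \<le> L" and gv: "\<And>y. norm y \<le> 2 \<Longrightarrow> g y = v ((1/2) *\<^sub>R y)"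
    using sol_clamp[OF s] by blast
  have gc1: "continuous_on (cball 0 1) g" using gc by (rule continuous_on_subset) simp
  define a0 where "a0 = integral\<^sup>L lborel_ball (\<lambda>y. bump 4 y * g y)"
  define b where "b = (\<chi> i. 8 * integral\<^sup>L lborel_ball (\<lambda>y. bump 3 y * y $ i * g y))"
  define Am where "Am = (\<chi> i j. integral\<^sup>L lborel_ball (\<lambda>y. (48 * bump 2 y * (y $ i * y $ j) - (if i = j then 8 * bump 3 y else 0)) * g y))"
  define V where "V = vol_ball TYPE('n)"
  have V0: "0 \<le> V" unfolding V_def by simp
  have LV0: "0 \<le> L * V" using L0 V0 by simp
  have LV2: "0 \<le> L * V2" using L0 V20 by simp
  have nLV: "0 \<le> real CARD('n) * L * V" using L0 V0 by simp
  have absint: "\<bar>integral\<^sup>L lborel_ball f\<bar> \<le> K * V" if "continuous_on (cball 0 1) f" "\<And>y. norm y \<le> 1 \<Longrightarrow> \<bar>f y\<bar> \<le> K" for f :: "real^'n \<Rightarrow> real" and K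
    using integral_B1_diff_le[of f "\<lambda>_. 0" K] that integrable_B1_continuous[of f] unfolding V_def by simp
  have comp: "\<bar>y $ i\<bar> \<le> 1" if "norm y \<le> 1" for y :: "real^'n" and i
    using component_le_norm_cart[of y i] that by linarith
  have ba0: "\<bar>a0\<bar> \<le> L * V" unfolding a0_def
  proof (rule absint)
    fix y :: "real^'n"
    have "\<bar>bump 4 y * g y\<bar> \<le> 1 * L" unfolding abs_mult by (intro mult_mono) (auto simp: bump_le_1 gL)
    then show "\<bar>bump 4 y * g y\<bar> \<le> L" by simp
  qed (intro continuous_intros gc1)
  have bb: "\<bar>b $ i\<bar> \<le> 8 * (L * V)" for i
  proof -
    have "\<bar>integral\<^sup>L lborel_ball (\<lambda>y. bump 3 y * y $ i * g y)\<bar> \<le> L * V"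
    proof (rule absint)
      fix y :: "real^'n" assume y: "norm y \<le> 1"
      have "\<bar>bump 3 y * y $ i * g y\<bar> \<le> 1 * 1 * L" unfolding abs_mult
        by (intro mult_mono) (auto simp: bump_le_1 gL comp[OF y])
      then show "\<bar>bump 3 y * y $ i * g y\<bar> \<le> L" by simp
    qed (intro continuous_intros gc1)
    then show ?thesis unfolding b_def by (simp add: abs_mult)
  qed
  have bA: "\<bar>Am $ i $ j\<bar> \<le> 56 * (L * V)" for i j
  proof -
    have "\<bar>integral\<^sup>L lborel_ball (\<lambda>y. (48 * bump 2 y * (y $ i * y $ j) - (if i = j then 8 * bump 3 y else 0)) * g y)\<bar> \<le> (56 * L) * V"
    proof (rule absint)
      fix y :: "real^'n" assume y: "norm y \<le> 1"
      have "\<bar>bump 2 y * (y $ i * y $ j)\<bar> \<le> 1 * (1 * 1)" unfolding abs_mult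
        by (intro mult_mono) (auto simp: bump_le_1 comp[OF y])
      moreover have "\<bar>if i = j then 8 * bump 3 y else 0\<bar> \<le> 8" using bump_le_1[of 3 y] by simp
      ultimately have "\<bar>48 * bump 2 y * (y $ i * y $ j) - (if i = j then 8 * bump 3 y else 0)\<bar> \<le> 56" unfolding mult.assoc by linarith
      then show "\<bar>(48 * bump 2 y * (y $ i * y $ j) - (if i = j then 8 * bump 3 y else 0)) * g y\<bar> \<le> 56 * L"
        unfolding abs_mult by (intro mult_mono) (auto simp: gL)
    qed (cases "i = j", simp_all, (intro continuous_intros gc1)+)
    then show ?thesis unfolding Am_def by simp
  qed
  \<comment> \<open>The mean at \<open>z\<close> is the mollification of \<open>g\<close> at
    \<open>2 *\<^sub>R z\<close>, so the coefficients of degree one and two get the factors 2 and 4.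
    Division by \<open>c4\<close> normalizes the weight, and \<open>N / 80\<close> is the correction
    from \<open>mean_value_approx\<close>.\<close>
  define \<alpha> where "\<alpha> = (a0 - N / 80) / c4"
  define \<beta> where "\<beta> = (2 / c4) *\<^sub>R b"
  define A where "A = (4 / c4) *\<^sub>R Am"
  have nb: "norm b \<le> real CARD('n) * (8 * (L * V))"
  proof -
    have "norm b \<le> (\<Sum>i\<in>UNIV. \<bar>b $ i\<bar>)" by (rule norm_le_l1_cart)
    also have "\<dots> \<le> (\<Sum>i\<in>(UNIV::'n set). 8 * (L * V))" by (rule sum_mono) (rule bb)
    finally show ?thesis by simp
  qed
  \<comment> \<open>The five summands serve, in this order, \<open>a0\<close>, the correction
    \<open>N / 80\<close>, \<beta> with 2 * 8 n, the matrix with 4 * 56, and the cubic error with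
    530 * 2^3.\<close>
  have Cdef: "C = (L * V + N + 16 * (real CARD('n) * L * V) + 224 * (L * V) + 4240 * (L * V2)) / c4"
    unfolding C_def V_def by (simp add: algebra_simps)
  have 1: "\<bar>\<alpha>\<bar> \<le> C"
  proof -
    have "\<bar>a0 - N / 80\<bar> \<le> L * V + N + 16 * (real CARD('n) * L * V) + 224 * (L * V) + 4240 * (L * V2)"
      using ba0 N0 LV0 LV2 nLV by linarith
    then show ?thesis unfolding \<alpha>_def Cdef using c4 by (simp add: divide_right_mono)
  qed
  have 2: "norm \<beta> \<le> C"
  proof -
    have "2 * norm b \<le> L * V + N + 16 * (real CARD('n) * L * V) + 224 * (L * V) + 4240 * (L * V2)"
      using nb N0 LV0 LV2 nLV by (simp add: mult.assoc mult.left_commute[of _ 8])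
    then show ?thesis unfolding \<beta>_def Cdef using c4 by (simp add: divide_right_mono)
  qed
  have 3: "\<bar>A $ i $ j\<bar> \<le> C" for i j
  proof -
    have "4 * \<bar>Am $ i $ j\<bar> \<le> L * V + N + 16 * (real CARD('n) * L * V) + 224 * (L * V) + 4240 * (L * V2)"
      using bA[of i j] N0 LV0 LV2 nLV by linarith
    then show ?thesis unfolding A_def Cdef using c4 by (simp add: abs_mult divide_right_mono)
  qed
  have "Am $ j $ i = Am $ i $ j" for i j
    by (cases "i = j") (simp_all add: Am_def ac_simps)
  then have 4: "transpose A = A" unfolding A_def transpose_def by (simp add: vec_eq_iff)
  have 5: "\<bar>trace A - 1\<bar> \<le> contact v / (kap * \<delta>^CARD('n)) / c4"
  proof -
    \<comment> \<open>On the unit ball \<open>w\<close> is \<open>4 * g\<close>, and it is again a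
      solution, so \<open>moll_laplacian\<close> evaluates the trace of \<open>Am\<close>.\<close>
    define w where "w = rescale v 0 (1/2)"
    have sw: "obstacle_sol L w (drescale dv 0 (1/2))" unfolding w_def by (rule sol_rescale_0[OF s]) auto
    have wg: "w y = 4 * g y" if "norm y \<le> 1" for y
      using gv[of y] that by (simp add: w_def rescale_def power2_eq_square)
    note cw = sol_c11[OF sw]
    have "trace Am = (\<Sum>i\<in>UNIV. integral\<^sup>L lborel_ball (\<lambda>y. (48 * bump 2 y * (y $ i * y $ i) - 8 * bump 3 y) * g y))"
      unfolding trace_def Am_def by simp
    also have "\<dots> = integral\<^sup>L lborel_ball (\<lambda>y. \<Sum>i\<in>UNIV. (48 * bump 2 y * (y $ i * y $ i) - 8 * bump 3 y) * g y)"
      by (rule Bochner_Integration.integral_sum[symmetric]) (intro integrable_B1_continuous continuous_intros gc1)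
    also have "\<dots> = integral\<^sup>L lborel_ball (\<lambda>y. 12 * (bump 2 y * w y * (y \<bullet> y)) - 2 * real CARD('n) * (bump 3 y * w y))"
    proof (rule Bochner_Integration.integral_cong)
      fix y :: "real^'n" assume "y \<in> space lborel_ball"
      then have w: "w y = 4 * g y" using wg by simp
      have "(\<Sum>i\<in>UNIV. (48 * bump 2 y * (y $ i * y $ i) - 8 * bump 3 y) * g y) = 48 * bump 2 y * (y \<bullet> y) * g y - real CARD('n) * (8 * bump 3 y * g y)"
        unfolding inner_vec_def left_diff_distrib sum_subtractf by (simp add: sum_distrib_left sum_distrib_right ac_simps)
      then show "(\<Sum>i\<in>UNIV. (48 * bump 2 y * (y $ i * y $ i) - 8 * bump 3 y) * g y) = 12 * (bump 2 y * w y * (y \<bullet> y)) - 2 * real CARD('n) * (bump 3 y * w y)"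
        unfolding w by (simp add: algebra_simps)
    qed simp
    also have "\<dots> = 12 * integral\<^sup>L lborel_ball (\<lambda>y. bump 2 y * w y * (y \<bullet> y)) - 2 * real CARD('n) * integral\<^sup>L lborel_ball (\<lambda>y. bump 3 y * w y)"
    proof -
      note ct = c11_continuous(3)[OF cw]
      have "integrable lborel_ball (\<lambda>y. bump 2 y * w y * (y \<bullet> y))" "integrable lborel_ball (\<lambda>y. bump 3 y * w y)"
        by (intro integrable_B1_continuous continuous_intros ct)+
      then show ?thesis by simp
    qed
    also have "\<dots> = integral\<^sup>L lborel_ball (\<lambda>y. bump 4 y * indicator {y. w y > 0} y) / 4"
      using moll_laplacian[OF cw] by simp
    finally have "trace Am = integral\<^sup>L lborel_ball (\<lambda>y. bump 4 y * indicator {y. w y > 0} y) / 4" .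
    moreover have "trace A = (4 / c4) * trace Am" unfolding A_def trace_def by (simp add: sum_distrib_left)
    ultimately have tA: "trace A = integral\<^sup>L lborel_ball (\<lambda>y. bump 4 y * indicator {y. w y > 0} y) / c4" by simp
    define m where "m = integral\<^sup>L lborel_ball (\<lambda>y. bump 4 y * (1 - indicator {x. v x > 0} (0 + (1/2) *\<^sub>R y)))"
    have ie: "(indicator {y. w y > 0} y :: real) = indicator {x. v x > 0} (0 + (1/2) *\<^sub>R y)" for y
      unfolding w_def by (rule indicator_rescale) simp
    have i: "integrable lborel_ball (\<lambda>y. bump 4 y * indicator {y. w y > 0} y)"
      by (rule integrable_times_laplacian[OF cw]) (intro continuous_intros)
    have i4: "integrable lborel_ball (bump 4 :: real^'n \<Rightarrow> real)"
      by (intro integrable_B1_continuous continuous_on_bump[of _ "\<lambda>x. x"] continuous_on_id)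
    have "m = c4 - integral\<^sup>L lborel_ball (\<lambda>y. bump 4 y * indicator {y. w y > 0} y)"
      unfolding m_def c4_def ie[symmetric] right_diff_distrib using i i4 by simp
    then have tm: "trace A = (c4 - m) / c4" unfolding tA by simp
    then have "trace A - 1 = - (m / c4)" using c4 by (simp add: field_simps)
    moreover have "0 \<le> m" unfolding m_def by (rule Bochner_Integration.integral_nonneg) (auto simp: indicator_def)
    ultimately have "\<bar>trace A - 1\<bar> = m / c4" using c4 by simp
    also have "\<dots> \<le> contact v / (kap * (1/2)^CARD('n)) / c4"
      using contact_shift[OF s, of 0 "1/2" 4] c4 unfolding m_def by (intro divide_right_mono) auto
    also have "\<dots> \<le> contact v / (kap * \<delta>^CARD('n)) / c4"
    proof -
      have "0 \<le> contact v" unfolding contact_def by (rule Bochner_Integration.integral_nonneg) (auto simp: indicator_def)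
      then have "contact v / (kap * (1/2)^CARD('n)) \<le> contact v / (kap * \<delta>^CARD('n))" using \<delta>
        by (intro divide_left_mono mult_left_mono power_mono mult_pos_pos) auto
      then show ?thesis using c4 by (intro divide_right_mono) auto
    qed
    finally show ?thesis .
  qed
  have 6: "\<bar>v z - \<alpha> - \<beta> \<bullet> z - quad_poly A z\<bar> \<le>
        (\<delta>\<^sup>2 * N / 20 + contact v / (kap * \<delta>^CARD('n)) / 80) / c4 + C * (norm z)^3" if z: "norm z \<le> 1/4" for z
  proof -
    define err where "err = \<delta>\<^sup>2 * N / 20 + contact v / (kap * \<delta>^CARD('n)) / 80"
    have h1: "norm (2 *\<^sub>R z) \<le> 1" using z by simp
    have "integral\<^sup>L lborel_ball (\<lambda>y. bump 4 y * g (y + 2 *\<^sub>R z)) = integral\<^sup>L lborel_ball (\<lambda>y. bump 4 y * v (z + (1/2) *\<^sub>R y))"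
    proof (rule Bochner_Integration.integral_cong)
      fix y :: "real^'n" assume "y \<in> space lborel_ball"
      then have "norm (y + 2 *\<^sub>R z) \<le> 2" using norm_triangle_ineq[of y "2 *\<^sub>R z"] h1 by simp
      from gv[OF this] show "bump 4 y * g (y + 2 *\<^sub>R z) = bump 4 y * v (z + (1/2) *\<^sub>R y)"
        by (simp add: algebra_simps)
    qed simp
    then have e1: "\<bar>integral\<^sup>L lborel_ball (\<lambda>y. bump 4 y * v (z + (1/2) *\<^sub>R y)) - (a0 + b \<bullet> (2 *\<^sub>R z) + quad_poly Am (2 *\<^sub>R z))\<bar>
       \<le> 530 * (norm (2 *\<^sub>R z))^3 * L * V2"
      using moll_expand[OF gc gL h1] bump4_poly_integral[OF gc1, of "2 *\<^sub>R z"]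
      unfolding a0_def b_def Am_def V2_def by simp
    have e2: "\<bar>integral\<^sup>L lborel_ball (\<lambda>y. bump 4 y * v (z + (1/2) *\<^sub>R y)) - c4 * v z - N / 80\<bar> \<le> err"
      unfolding err_def N_def c4_def by (rule mean_value_approx[OF s z \<delta>])
    have q: "quad_poly Am (2 *\<^sub>R z) = 4 * quad_poly Am z" by (simp add: quad_poly_scale power2_eq_square)
    have n3: "530 * (norm (2 *\<^sub>R z))^3 * L * V2 = 4240 * (L * V2) * (norm z)^3" by (simp add: power_mult_distrib)
    have "\<bar>c4 * v z - (a0 - N / 80 + 2 * (b \<bullet> z) + 4 * quad_poly Am z)\<bar> \<le> err + 4240 * (L * V2) * (norm z)^3"
      using e1 e2 unfolding q n3 by (simp add: abs_le_iff)
    moreover have "c4 * (v z - \<alpha> - \<beta> \<bullet> z - quad_poly A z) = c4 * v z - (a0 - N / 80 + 2 * (b \<bullet> z) + 4 * quad_poly Am z)"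
      unfolding \<alpha>_def \<beta>_def A_def quad_poly_scaleR using c4 by (simp add: field_simps)
    ultimately have "c4 * \<bar>v z - \<alpha> - \<beta> \<bullet> z - quad_poly A z\<bar> \<le> err + 4240 * (L * V2) * (norm z)^3"
      using c4 by (metis abs_mult abs_of_pos)
    also have "\<dots> \<le> err + (C * c4) * (norm z)^3"
    proof -
      have "4240 * (L * V2) \<le> C * c4" unfolding Cdef using c4 LV0 nLV N0 by simp
      then show ?thesis by (intro add_left_mono mult_right_mono) auto
    qed
    finally have "\<bar>v z - \<alpha> - \<beta> \<bullet> z - quad_poly A z\<bar> \<le> (err + (C * c4) * (norm z)^3) / c4"
      using c4 by (simp add: pos_le_divide_eq mult.commute)
    also have "\<dots> = err / c4 + C * (norm z)^3" using c4 by (simp add: add_divide_distrib)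
    finally show ?thesis unfolding err_def .
  qed
  show ?thesis using 1 2 3 4 5 6 by blast
qed

text \<open>\<open>C\<close> is chosen before \<open>e\<close>, so that coefficients stay in a fixed
  compact set while the tolerance tends to 0.\<close>

lemma quad_approx:
  assumes L: "0 \<le> L"
  obtains C where "0 \<le> C" "\<And>e. e > 0 \<Longrightarrow> \<exists>\<eta>>0. \<forall>(v :: real^'n \<Rightarrow> real) dv. obstacle_sol L v dv \<and> contact v \<le> \<eta> \<longrightarrow>
     (\<exists>\<alpha> \<beta> A. \<bar>\<alpha>\<bar> \<le> C \<and> norm \<beta> \<le> C \<and> (\<forall>i j. \<bar>A $ i $ j\<bar> \<le> C) \<and> transpose A = A \<and> \<bar>trace A - 1\<bar> \<le> e \<and>
     (\<forall>z. norm z \<le> 1/4 \<longrightarrow> \<bar>v z - \<alpha> - \<beta> \<bullet> z - quad_poly A z\<bar> \<le> e + C * (norm z)^3))"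
proof -
  define N where "N = integral\<^sup>L lborel_ball (bump 5 :: real^'n \<Rightarrow> real)"
  define c4 where "c4 = integral\<^sup>L lborel_ball (bump 4 :: real^'n \<Rightarrow> real)"
  define V2 where "V2 = measure lborel (cball (0::real^'n) 2)"
  define C where "C = (L * vol_ball TYPE('n) + N + 16 * real CARD('n) * L * vol_ball TYPE('n) + 224 * L * vol_ball TYPE('n) + 4240 * L * V2) / c4"
  have c4: "c4 > 0" unfolding c4_def by (rule integral_bump_pos)
  have N0: "N > 0" unfolding N_def by (rule integral_bump_pos)
  have "0 \<le> V2" unfolding V2_def by simp
  then have C0: "0 \<le> C" unfolding C_def using L N0 c4 by simp
  show ?thesis
  proof (rule that[OF C0])
    fix e :: real assume e: "e > 0"
    \<comment> \<open>\<delta> takes care of the term with \<open>N\<close>, which then is at most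
      half of \<open>c4 * e\<close>. Only afterwards can \<eta> be fixed, because the contact term
      is divided by a power of \<delta>.\<close>
    define \<delta> where "\<delta> = min (1/2) (10 * c4 * e / N)"
    have \<delta>: "0 < \<delta>" "\<delta> \<le> 1/2" "\<delta> \<le> 10 * c4 * e / N" unfolding \<delta>_def using c4 e N0 by auto
    define \<eta> where "\<eta> = c4 * e / 2 * (kap * \<delta>^CARD('n))"
    have kp: "0 < kap * \<delta>^CARD('n)" using \<delta> by simp
    have "0 < c4 * e / 2" using c4 e by simp
    then have \<eta>: "\<eta> > 0" unfolding \<eta>_def by (rule mult_pos_pos[OF _ kp])
    have "\<delta> * N \<le> 10 * c4 * e" using \<delta>(3) N0 by (simp add: pos_le_divide_eq)
    moreover have "\<delta> * \<delta> * N \<le> 1 * \<delta> * N" using \<delta> N0 by (intro mult_right_mono) auto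
    ultimately have d2: "\<delta>\<^sup>2 * N / 20 \<le> c4 * e / 2" unfolding power2_eq_square by linarith
    have main: "\<exists>\<alpha> \<beta> A. \<bar>\<alpha>\<bar> \<le> C \<and> norm \<beta> \<le> C \<and> (\<forall>i j. \<bar>A $ i $ j\<bar> \<le> C) \<and> transpose A = A \<and> \<bar>trace A - 1\<bar> \<le> e \<and>
     (\<forall>z. norm z \<le> 1/4 \<longrightarrow> \<bar>v z - \<alpha> - \<beta> \<bullet> z - quad_poly A z\<bar> \<le> e + C * (norm z)^3)"
      if s: "obstacle_sol L v dv" and ct: "contact v \<le> \<eta>" for v :: "real^'n \<Rightarrow> real" and dv
    proof -
      define q where "q = contact v / (kap * \<delta>^CARD('n))"
      have q: "q \<le> c4 * e / 2" unfolding q_def using ct kp unfolding \<eta>_def by (simp add: pos_divide_le_eq)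
      have "q / c4 \<le> (c4 * e / 2) / c4" using q c4 by (intro divide_right_mono) auto
      moreover have "(c4 * e / 2) / c4 = e / 2" using c4 by simp
      ultimately have t1: "q / c4 \<le> e" using e by linarith
      have "\<delta>\<^sup>2 * N / 20 + q / 80 \<le> c4 * e" using d2 q c4 e mult_pos_pos[OF c4 e] by linarith
      then have "(\<delta>\<^sup>2 * N / 20 + q / 80) / c4 \<le> (c4 * e) / c4" using c4 by (intro divide_right_mono) auto
      then have t2: "(\<delta>\<^sup>2 * N / 20 + q / 80) / c4 \<le> e" using c4 by simp
      obtain \<alpha> \<beta> A where h: "\<bar>\<alpha>\<bar> \<le> C" "norm \<beta> \<le> C" "\<forall>i j. \<bar>A $ i $ j\<bar> \<le> C" "transpose A = A"
        "\<bar>trace A - 1\<bar> \<le> q / c4"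
        "\<forall>z. norm z \<le> 1/4 \<longrightarrow> \<bar>v z - \<alpha> - \<beta> \<bullet> z - quad_poly A z\<bar> \<le> (\<delta>\<^sup>2 * N / 20 + q / 80) / c4 + C * (norm z)^3"
        using quad_approx_one[OF s \<delta>(1,2)] unfolding q_def C_def N_def c4_def V2_def by blast
      show ?thesis
      proof (intro exI conjI)
        show "\<bar>trace A - 1\<bar> \<le> e" using h(5) t1 by linarith
        show "\<forall>z. norm z \<le> 1/4 \<longrightarrow> \<bar>v z - \<alpha> - \<beta> \<bullet> z - quad_poly A z\<bar> \<le> e + C * (norm z)^3"
        proof (intro allI impI)
          fix z :: "real^'n" assume "norm z \<le> 1/4"
          then have "\<bar>v z - \<alpha> - \<beta> \<bullet> z - quad_poly A z\<bar> \<le> (\<delta>\<^sup>2 * N / 20 + q / 80) / c4 + C * (norm z)^3" using h(6) by blast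
          then show "\<bar>v z - \<alpha> - \<beta> \<bullet> z - quad_poly A z\<bar> \<le> e + C * (norm z)^3" using t2 by linarith
        qed
      qed (use h in auto)
    qed
    then show "\<exists>\<eta>>0. \<forall>(v :: real^'n \<Rightarrow> real) dv. obstacle_sol L v dv \<and> contact v \<le> \<eta> \<longrightarrow>
     (\<exists>\<alpha> \<beta> A. \<bar>\<alpha>\<bar> \<le> C \<and> norm \<beta> \<le> C \<and> (\<forall>i j. \<bar>A $ i $ j\<bar> \<le> C) \<and> transpose A = A \<and> \<bar>trace A - 1\<bar> \<le> e \<and>
     (\<forall>z. norm z \<le> 1/4 \<longrightarrow> \<bar>v z - \<alpha> - \<beta> \<bullet> z - quad_poly A z\<bar> \<le> e + C * (norm z)^3))"
      using \<eta> by blast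
  qed
qed

section \<open>Compactness of the approximating polynomials\<close>

lemma matrix_norm_le:
  fixes A :: "real^'n^'n"
  assumes "\<And>i j. \<bar>A $ i $ j\<bar> \<le> C"
  shows "norm A \<le> real CARD('n) * (real CARD('n) * C)"
proof -
  have "norm A \<le> (\<Sum>i\<in>UNIV. norm (A $ i))" unfolding norm_vec_def by (rule L2_set_le_sum) simp
  also have "\<dots> \<le> (\<Sum>i\<in>(UNIV::'n set). real CARD('n) * C)"
  proof (rule sum_mono)
    fix i :: 'n
    have "norm (A $ i) \<le> (\<Sum>j\<in>UNIV. \<bar>A $ i $ j\<bar>)" by (rule norm_le_l1_cart)
    also have "\<dots> \<le> (\<Sum>j\<in>(UNIV::'n set). C)" by (rule sum_mono) (rule assms)
    finally show "norm (A $ i) \<le> real CARD('n) * C" by simp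
  qed
  finally show ?thesis by simp
qed

lemma entry_le_norm: "\<bar>A $ i $ j\<bar> \<le> norm (A :: real^'n^'n)"
proof -
  have "norm (A $ i) \<le> norm A" unfolding norm_vec_def[of A] by (rule member_le_L2_set) auto
  then show ?thesis using component_le_norm_cart[of "A $ i" j] by linarith
qed

lemma quad_poly_le_norm:
  fixes A :: "real^'n^'n"
  assumes "norm x \<le> 1"
  shows "\<bar>quad_poly A x\<bar> \<le> norm A * dim_sq TYPE('n)"
proof -
  have n: "norm (A *v x) \<le> norm A * dim_sq TYPE('n) * norm x" by (rule entries_le_imp_norm_le) (rule entry_le_norm)
  also have "\<dots> \<le> norm A * dim_sq TYPE('n) * 1" by (rule mult_left_mono[OF assms]) simp
  finally have n1: "norm (A *v x) \<le> norm A * dim_sq TYPE('n)" by simp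
  have "\<bar>(A *v x) \<bullet> x\<bar> \<le> norm (A *v x) * norm x" by (rule Cauchy_Schwarz_ineq2)
  also have "\<dots> \<le> (norm A * dim_sq TYPE('n)) * 1" using n1 assms by (intro mult_mono) auto
  finally have h: "\<bar>(A *v x) \<bullet> x\<bar> \<le> norm A * dim_sq TYPE('n)" by simp
  have "0 \<le> norm A * dim_sq TYPE('n)" by simp
  then show ?thesis using h unfolding quad_poly_def by (simp add: abs_mult)
qed

lemma tendsto_quad_poly:
  assumes "(A \<longlongrightarrow> B) F"
  shows "((\<lambda>k. quad_poly (A k) z) \<longlongrightarrow> quad_poly B z) F"
  unfolding quad_poly_sum by (intro tendsto_intros tendsto_vec_nth assms) simp

text \<open>For small arguments the term of lowest order dominates: testing at small multiples of
  -\<beta> excludes a linear part, and then testing at small multiples of \<open>x\<close> excludes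
  a negative value of the form.\<close>

lemma nonneg_cubic_imp_admissible:
  fixes A :: "real^'n^'n"
  assumes C: "0 \<le> C" and sym: "transpose A = A" and tr: "trace A = 1"
    and ge: "\<And>z. norm z \<le> 1/4 \<Longrightarrow> \<beta> \<bullet> z + quad_poly A z \<ge> - C * (norm z)^3"
  shows "\<beta> = 0" "admissible_matrix A"
proof -
  show b0: "\<beta> = 0"
  proof (rule ccontr)
    assume "\<beta> \<noteq> 0"
    then have nb: "norm \<beta> > 0" by simp
    define K where "K = \<bar>quad_poly A \<beta>\<bar> + C * (norm \<beta>)^3 + 1"
    have K: "K > 0" unfolding K_def using C by (simp add: add_nonneg_pos)
    define t where "t = min 1 (min (1 / (4 * norm \<beta>)) ((norm \<beta>)\<^sup>2 / (2 * K)))"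
    have t: "0 < t" "t \<le> 1" "t \<le> 1 / (4 * norm \<beta>)" "t \<le> (norm \<beta>)\<^sup>2 / (2 * K)" unfolding t_def using nb K by auto
    have n: "norm ((- t) *\<^sub>R \<beta>) = t * norm \<beta>" using t by simp
    have "t * norm \<beta> \<le> 1/4" using t(3) nb by (simp add: field_simps)
    from ge[of "(- t) *\<^sub>R \<beta>", unfolded n, OF this]
    have "- (t * (norm \<beta>)\<^sup>2) + t\<^sup>2 * quad_poly A \<beta> \<ge> - C * (t * norm \<beta>)^3"
      unfolding quad_poly_scale by (simp add: power2_norm_eq_inner)
    then have "t * (norm \<beta>)\<^sup>2 \<le> t * (t * quad_poly A \<beta> + C * t\<^sup>2 * (norm \<beta>)^3)"
      by (simp add: power_mult_distrib power2_eq_square power3_eq_cube algebra_simps)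
    then have "(norm \<beta>)\<^sup>2 \<le> t * quad_poly A \<beta> + C * t\<^sup>2 * (norm \<beta>)^3" using t(1) by simp
    also have "\<dots> \<le> t * \<bar>quad_poly A \<beta>\<bar> + t * (C * (norm \<beta>)^3)"
    proof -
      have "t * t \<le> t * 1" using t by (intro mult_left_mono) auto
      then have "C * (norm \<beta>)^3 * (t * t) \<le> C * (norm \<beta>)^3 * (t * 1)" by (rule mult_left_mono) (use C in simp)
      moreover have "t * quad_poly A \<beta> \<le> t * \<bar>quad_poly A \<beta>\<bar>" using t by (intro mult_left_mono) auto
      ultimately show ?thesis by (simp add: power2_eq_square ac_simps)
    qed
    also have "\<dots> < t * K" unfolding K_def using t(1) by (simp add: algebra_simps)
    also have "\<dots> \<le> (norm \<beta>)\<^sup>2 / 2" using t(4) K by (simp add: field_simps)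
    finally show False using nb by simp
  qed
  have "0 \<le> quad_poly A x" for x
  proof (rule ccontr)
    assume neg: "\<not> 0 \<le> quad_poly A x"
    then have x0: "x \<noteq> 0" by (auto simp: quad_poly_def)
    define K where "K = C * (norm x)^3 + 1"
    have K: "K > 0" unfolding K_def using C by (simp add: add_nonneg_pos)
    define t where "t = min (1 / (4 * norm x)) (- quad_poly A x / (2 * K))"
    have nx: "norm x > 0" using x0 by simp
    have t: "0 < t" "t \<le> 1 / (4 * norm x)" "t \<le> - quad_poly A x / (2 * K)" unfolding t_def using nx K neg by (auto simp: divide_neg_pos)
    have n: "norm (t *\<^sub>R x) = t * norm x" using t by simp
    have "t * norm x \<le> 1/4" using t(2) nx by (simp add: field_simps)
    from ge[of "t *\<^sub>R x", unfolded n, OF this]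
    have "t\<^sup>2 * quad_poly A x \<ge> - C * (t * norm x)^3"
      unfolding quad_poly_scale b0 by simp
    then have "t\<^sup>2 * (- quad_poly A x) \<le> t\<^sup>2 * (t * (C * (norm x)^3))"
      by (simp add: power_mult_distrib power2_eq_square power3_eq_cube algebra_simps)
    then have "- quad_poly A x \<le> t * (C * (norm x)^3)" by (rule mult_left_le_imp_le) (use t(1) in simp)
    also have "\<dots> < t * K" unfolding K_def using t(1) by (simp add: algebra_simps)
    also have "\<dots> \<le> - quad_poly A x / 2" using t(3) K by (simp add: field_simps)
    finally show False using neg by simp
  qed
  then show "admissible_matrix A" unfolding admissible_matrix_def using sym tr
    by (simp add: quad_poly_alt)
qed

text \<open>By contradiction, with tolerances tending to 0. Only the coefficients have to converge,
  which happens in finite dimension. Nonnegativity of the solutions passes to the limit polynomial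
  and makes it admissible; zooming in by \<rho> then suppresses the cubic remainder.\<close>

lemma small_contact_close:
  assumes e: "e > 0" and L: "0 \<le> L"
  obtains \<rho> \<eta> where "0 < \<rho>" "\<rho> \<le> 1" "\<eta> > 0"
    "\<And>(v :: real^'n \<Rightarrow> real) dv. obstacle_sol L v dv \<Longrightarrow> contact v \<le> \<eta> \<Longrightarrow> \<exists>A. admissible_matrix A \<and> monneau A (rescale v 0 \<rho>) \<le> e"
proof -
  obtain C where C: "0 \<le> C" and approx: "\<And>e. e > 0 \<Longrightarrow> \<exists>\<eta>>0. \<forall>(v :: real^'n \<Rightarrow> real) dv. obstacle_sol L v dv \<and> contact v \<le> \<eta> \<longrightarrow>
     (\<exists>\<alpha> \<beta> A. \<bar>\<alpha>\<bar> \<le> C \<and> norm \<beta> \<le> C \<and> (\<forall>i j. \<bar>A $ i $ j\<bar> \<le> C) \<and> transpose A = A \<and> \<bar>trace A - 1\<bar> \<le> e \<and>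
     (\<forall>z. norm z \<le> 1/4 \<longrightarrow> \<bar>v z - \<alpha> - \<beta> \<bullet> z - quad_poly A z\<bar> \<le> e + C * (norm z)^3))"
    using quad_approx[OF L] by metis
  define V where "V = vol_ball TYPE('n)"
  have V0: "0 \<le> V" unfolding V_def by simp
  \<comment> \<open>The uniform distance on the unit ball below which Monneau's integral is at most
    \<open>e\<close>.\<close>
  define \<theta> where "\<theta> = min 1 (e / (8 * (V + 1)))"
  have \<theta>: "0 < \<theta>" "\<theta> \<le> 1" "\<theta> \<le> e / (8 * (V + 1))" unfolding \<theta>_def using e V0 by auto
  have \<theta>e: "8 * (\<theta>\<^sup>2 * V) \<le> e"
  proof -
    have "\<theta> * \<theta> \<le> \<theta> * 1" using \<theta> by (intro mult_left_mono) auto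
    then have "\<theta>\<^sup>2 * V \<le> \<theta> * V" using V0 by (intro mult_right_mono) (auto simp: power2_eq_square)
    moreover have "\<theta> * (8 * (V + 1)) \<le> e" using \<theta>(3) V0 by (simp add: pos_le_divide_eq)
    ultimately show ?thesis using \<theta>(1) by (simp add: algebra_simps)
  qed
  \<comment> \<open>Divided by \<rho>^2, the cubic remainder is at most \<open>C * \<rho>\<close>;
    it may take half of \<theta>.\<close>
  define \<rho> where "\<rho> = min (1/4) (\<theta> / (2 * (C + 1)))"
  have \<rho>: "0 < \<rho>" "\<rho> \<le> 1/4" "\<rho> \<le> \<theta> / (2 * (C + 1))"
    unfolding \<rho>_def using \<theta>(1) C by (simp_all only: min_less_iff_conj min.cobounded1 min.cobounded2) simp
  have "\<rho> * (2 * (C + 1)) \<le> \<theta>" using \<rho>(3) C by (simp add: pos_le_divide_eq)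
  then have C\<rho>: "C * \<rho> \<le> \<theta> / 2" using \<rho>(1) by (simp add: algebra_simps)
  have "\<exists>\<eta>>0. \<forall>(v :: real^'n \<Rightarrow> real) dv. obstacle_sol L v dv \<and> contact v \<le> \<eta> \<longrightarrow> (\<exists>A. admissible_matrix A \<and> monneau A (rescale v 0 \<rho>) \<le> e)"
  proof (rule ccontr)
    assume no: "\<not> ?thesis"
    define ek where "ek k = 1 / real (Suc k)" for k :: nat
    have ek: "ek k > 0" for k by (simp add: ek_def)
    have ek0: "ek \<longlonglongrightarrow> 0" unfolding ek_def[abs_def] by (rule LIMSEQ_Suc[OF lim_1_over_n])
    have "\<exists>v dv \<alpha> \<beta> A. obstacle_sol L v dv \<and> (\<nexists>A. admissible_matrix A \<and> monneau A (rescale v 0 \<rho>) \<le> e) \<and>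
       \<bar>\<alpha>\<bar> \<le> C \<and> norm \<beta> \<le> C \<and> (\<forall>i j. \<bar>A $ i $ j\<bar> \<le> C) \<and> transpose A = A \<and> \<bar>trace A - 1\<bar> \<le> ek k \<and>
     (\<forall>z. norm z \<le> 1/4 \<longrightarrow> \<bar>(v :: real^'n \<Rightarrow> real) z - \<alpha> - \<beta> \<bullet> z - quad_poly A z\<bar> \<le> ek k + C * (norm z)^3)" for k
    proof -
      obtain \<eta> where \<eta>: "\<eta> > 0" and ap: "\<forall>(v :: real^'n \<Rightarrow> real) dv. obstacle_sol L v dv \<and> contact v \<le> \<eta> \<longrightarrow>
        (\<exists>\<alpha> \<beta> A. \<bar>\<alpha>\<bar> \<le> C \<and> norm \<beta> \<le> C \<and> (\<forall>i j. \<bar>A $ i $ j\<bar> \<le> C) \<and> transpose A = A \<and> \<bar>trace A - 1\<bar> \<le> ek k \<and>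
         (\<forall>z. norm z \<le> 1/4 \<longrightarrow> \<bar>v z - \<alpha> - \<beta> \<bullet> z - quad_poly A z\<bar> \<le> ek k + C * (norm z)^3))"
        using approx[OF ek[of k]] by blast
      obtain v :: "real^'n \<Rightarrow> real" and dv where v: "obstacle_sol L v dv" "contact v \<le> \<eta>" "\<nexists>A. admissible_matrix A \<and> monneau A (rescale v 0 \<rho>) \<le> e"
        using no \<eta> by blast
      then obtain \<alpha> \<beta> A where "\<bar>\<alpha>\<bar> \<le> C" "norm \<beta> \<le> C" "\<forall>i j. \<bar>A $ i $ j\<bar> \<le> C" "transpose A = A" "\<bar>trace A - 1\<bar> \<le> ek k"
         "\<forall>z. norm z \<le> 1/4 \<longrightarrow> \<bar>v z - \<alpha> - \<beta> \<bullet> z - quad_poly A z\<bar> \<le> ek k + C * (norm z)^3"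
        using ap by blast
      then show ?thesis using v by blast
    qed
    then obtain v dv \<alpha> \<beta> A where s: "\<And>k. obstacle_sol L (v k) (dv k)"
      and nA: "\<And>k. \<nexists>A. admissible_matrix A \<and> monneau A (rescale (v k) 0 \<rho>) \<le> e"
      and \<alpha>: "\<And>k. \<bar>\<alpha> k\<bar> \<le> C" and \<beta>: "\<And>k. norm (\<beta> k) \<le> C" and A: "\<And>k i j. \<bar>A k $ i $ j\<bar> \<le> C"
      and sym: "\<And>k. transpose (A k) = A k" and tr: "\<And>k. \<bar>trace (A k) - 1\<bar> \<le> ek k"
      and ap: "\<And>k z. norm z \<le> 1/4 \<Longrightarrow> \<bar>(v k :: real^'n \<Rightarrow> real) z - \<alpha> k - \<beta> k \<bullet> z - quad_poly (A k) z\<bar> \<le> ek k + C * (norm z)^3"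
      by metis
    have "bounded (range (\<lambda>k. (\<beta> k, A k)))"
    proof -
      have "bounded (range \<beta>)" unfolding bounded_iff using \<beta> by auto
      moreover have "bounded (range A)" unfolding bounded_iff using matrix_norm_le[OF A] by blast
      ultimately have "bounded (range \<beta> \<times> range A)" by (rule bounded_Times)
      then show ?thesis by (rule bounded_subset) auto
    qed
    then obtain l f where f: "strict_mono f" and lim: "((\<lambda>k. (\<beta> k, A k)) \<circ> f) \<longlonglongrightarrow> l"
      using bounded_imp_convergent_subsequence by blast
    define B where "B = snd l"
    have lb: "(\<lambda>k. \<beta> (f k)) \<longlonglongrightarrow> fst l" and lA: "(\<lambda>k. A (f k)) \<longlonglongrightarrow> B"
      using tendsto_fst[OF lim] tendsto_snd[OF lim] by (simp_all add: o_def B_def)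
    have ekf: "(\<lambda>k. ek (f k)) \<longlonglongrightarrow> 0" using LIMSEQ_subseq_LIMSEQ[OF ek0 f] by (simp add: o_def)
    \<comment> \<open>All solutions vanish at 0, so the constant term is within the
      tolerance.\<close>
    have al: "\<bar>\<alpha> k\<bar> \<le> ek k" for k using ap[of 0 k] solD(5)[OF s[of k]] by (simp add: quad_poly_def)
    have la: "(\<lambda>k. \<alpha> (f k)) \<longlonglongrightarrow> 0"
      by (rule Lim_null_comparison[OF _ ekf]) (simp add: al)
    have symB: "transpose B = B"
    proof -
      have "B $ j $ i = B $ i $ j" for i j
      proof (rule LIMSEQ_unique)
        show "(\<lambda>k. A (f k) $ j $ i) \<longlonglongrightarrow> B $ j $ i" by (intro tendsto_vec_nth lA)
        have "A (f k) $ j $ i = A (f k) $ i $ j" for k using sym[of "f k"] unfolding transpose_def by (metis vec_lambda_beta)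
        then show "(\<lambda>k. A (f k) $ j $ i) \<longlonglongrightarrow> B $ i $ j" by (simp add: tendsto_vec_nth lA)
      qed
      then show ?thesis by (simp add: transpose_def vec_eq_iff)
    qed
    have trB: "trace B = 1"
    proof (rule LIMSEQ_unique)
      show "(\<lambda>k. trace (A (f k))) \<longlonglongrightarrow> trace B" unfolding trace_def by (intro tendsto_intros tendsto_vec_nth lA)
      have "(\<lambda>k. trace (A (f k)) - 1) \<longlonglongrightarrow> 0" by (rule Lim_null_comparison[OF _ ekf]) (simp add: tr)
      then show "(\<lambda>k. trace (A (f k))) \<longlonglongrightarrow> 1" by (simp add: LIM_zero_iff)
    qed
    have ge: "fst l \<bullet> z + quad_poly B z \<ge> - C * (norm z)^3" if z: "norm z \<le> 1/4" for z
    proof -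
      have lim: "(\<lambda>k. \<alpha> (f k) + \<beta> (f k) \<bullet> z + quad_poly (A (f k)) z + ek (f k)) \<longlonglongrightarrow> 0 + fst l \<bullet> z + quad_poly B z + 0"
        by (intro tendsto_intros la lb tendsto_quad_poly lA ekf)
      have "- C * (norm z)^3 \<le> \<alpha> (f k) + \<beta> (f k) \<bullet> z + quad_poly (A (f k)) z + ek (f k)" for k
      proof -
        have "z \<in> ball 0 2" using z by simp
        then have "0 \<le> v (f k) z" by (rule solD(4)[OF s])
        then show ?thesis using ap[OF z, of "f k"] by (simp add: abs_le_iff)
      qed
      then show ?thesis using LIMSEQ_le_const[OF lim] by simp
    qed
    note adm = nonneg_cubic_imp_admissible[OF C symB trB ge]
    have lb0: "(\<lambda>k. norm (\<beta> (f k))) \<longlonglongrightarrow> 0" using tendsto_norm[OF lb] adm(1) by simp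
    have lAn: "(\<lambda>k. norm (A (f k) - B)) \<longlonglongrightarrow> 0" using tendsto_norm_zero[OF LIM_zero[OF lA]] .
    \<comment> \<open>Division by \<rho>^2 magnifies the errors in the coefficients, but \<rho> is
      fixed while they tend to 0; they may take the other half of \<theta>.\<close>
    have "(\<lambda>k. (2 * ek (f k) / \<rho>\<^sup>2) + norm (\<beta> (f k)) / \<rho> + norm (A (f k) - B) * dim_sq TYPE('n)) \<longlonglongrightarrow> 2 * 0 / \<rho>\<^sup>2 + 0 / \<rho> + 0 * dim_sq TYPE('n)"
      using \<rho>(1) by (intro tendsto_intros ekf lb0 lAn) auto
    then have "\<forall>\<^sub>F k in sequentially. (2 * ek (f k) / \<rho>\<^sup>2) + norm (\<beta> (f k)) / \<rho> + norm (A (f k) - B) * dim_sq TYPE('n) < \<theta> / 2"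
      by (rule order_tendstoD(2)) (use \<theta> in simp)
    then obtain k where k: "(2 * ek (f k) / \<rho>\<^sup>2) + norm (\<beta> (f k)) / \<rho> + norm (A (f k) - B) * dim_sq TYPE('n) < \<theta> / 2"
      using eventually_happens by fastforce
    have close: "\<bar>rescale (v (f k)) 0 \<rho> x - quad_poly B x\<bar> \<le> \<theta>" if x: "norm x \<le> 1" for x
    proof -
      have r2: "\<rho>\<^sup>2 > 0" using \<rho>(1) by simp
      have nz: "norm (\<rho> *\<^sub>R x) \<le> \<rho>" using x \<rho>(1) by simp
      then have nz4: "norm (\<rho> *\<^sub>R x) \<le> 1/4" using \<rho>(2) by linarith
      have c3: "C * (norm (\<rho> *\<^sub>R x))^3 \<le> C * \<rho>^3" using nz C by (intro mult_left_mono power_mono) auto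
      have bz: "\<bar>\<beta> (f k) \<bullet> (\<rho> *\<^sub>R x)\<bar> \<le> norm (\<beta> (f k)) * \<rho>"
        by (rule order_trans[OF Cauchy_Schwarz_ineq2]) (rule mult_left_mono[OF nz], simp)
      have "\<bar>v (f k) (\<rho> *\<^sub>R x) - quad_poly (A (f k)) (\<rho> *\<^sub>R x)\<bar> \<le> 2 * ek (f k) + norm (\<beta> (f k)) * \<rho> + C * \<rho>^3"
        using ap[OF nz4, of "f k"] al[of "f k"] bz c3 by linarith
      then have "\<bar>v (f k) (\<rho> *\<^sub>R x) - quad_poly (A (f k)) (\<rho> *\<^sub>R x)\<bar> / \<rho>\<^sup>2 \<le> (2 * ek (f k) + norm (\<beta> (f k)) * \<rho> + C * \<rho>^3) / \<rho>\<^sup>2"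
        using r2 by (intro divide_right_mono) auto
      also have "\<dots> = 2 * ek (f k) / \<rho>\<^sup>2 + norm (\<beta> (f k)) / \<rho> + C * \<rho>"
        using \<rho>(1) by (simp add: add_divide_distrib power2_eq_square power3_eq_cube)
      finally have "\<bar>v (f k) (\<rho> *\<^sub>R x) - quad_poly (A (f k)) (\<rho> *\<^sub>R x)\<bar> / \<rho>\<^sup>2 \<le> 2 * ek (f k) / \<rho>\<^sup>2 + norm (\<beta> (f k)) / \<rho> + C * \<rho>" .
      moreover have "\<bar>v (f k) (\<rho> *\<^sub>R x) - quad_poly (A (f k)) (\<rho> *\<^sub>R x)\<bar> / \<rho>\<^sup>2 = \<bar>rescale (v (f k)) 0 \<rho> x - quad_poly (A (f k)) x\<bar>"
      proof -
        have "rescale (v (f k)) 0 \<rho> x - quad_poly (A (f k)) x = (v (f k) (\<rho> *\<^sub>R x) - quad_poly (A (f k)) (\<rho> *\<^sub>R x)) / \<rho>\<^sup>2"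
          unfolding rescale_def quad_poly_scale using r2 by (simp add: diff_divide_distrib)
        then show ?thesis by simp
      qed
      moreover have "\<bar>quad_poly (A (f k)) x - quad_poly B x\<bar> \<le> norm (A (f k) - B) * dim_sq TYPE('n)"
        unfolding quad_poly_diff[symmetric] by (rule quad_poly_le_norm[OF x])
      ultimately show ?thesis using k C\<rho> by linarith
    qed
    have sr: "obstacle_sol L (rescale (v (f k)) 0 \<rho>) (drescale (dv (f k)) 0 \<rho>)"
      by (rule sol_rescale_0[OF s \<rho>(1)]) (use \<rho> in linarith)
    note ct = c11_continuous(3)[OF sol_c11[OF sr]]
    have "integral\<^sup>L lborel_ball (\<lambda>x. bump 3 x * (rescale (v (f k)) 0 \<rho> x - quad_poly B x)\<^sup>2) \<le> \<theta>\<^sup>2 * V"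
      unfolding V_def
    proof (rule integral_B1_le)
      fix x :: "real^'n" assume x: "norm x \<le> 1"
      have "\<bar>rescale (v (f k)) 0 \<rho> x - quad_poly B x\<bar>\<^sup>2 \<le> \<theta>\<^sup>2" using close[OF x] by (intro power_mono) auto
      then have "bump 3 x * (rescale (v (f k)) 0 \<rho> x - quad_poly B x)\<^sup>2 \<le> 1 * \<theta>\<^sup>2"
        by (intro mult_mono bump_le_1) auto
      then show "bump 3 x * (rescale (v (f k)) 0 \<rho> x - quad_poly B x)\<^sup>2 \<le> \<theta>\<^sup>2" by simp
    qed (intro integrable_B1_continuous continuous_intros ct quad_poly_cont)
    then have "monneau B (rescale (v (f k)) 0 \<rho>) \<le> 8 * (\<theta>\<^sup>2 * V)" unfolding monneau_def by simp
    then have "monneau B (rescale (v (f k)) 0 \<rho>) \<le> e" using \<theta>e by linarith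
    then show False using nA[of "f k"] adm(2) by blast
  qed
  then obtain \<eta> where "\<eta> > 0" "\<And>(v :: real^'n \<Rightarrow> real) dv. obstacle_sol L v dv \<Longrightarrow> contact v \<le> \<eta> \<Longrightarrow> \<exists>A. admissible_matrix A \<and> monneau A (rescale v 0 \<rho>) \<le> e"
    by blast
  then show ?thesis using that[OF \<rho>(1)] \<rho>(2) by simp
qed

section \<open>Uniform convergence of blow-ups\<close>

text \<open>A Lipschitz function exceeding \<delta> in size at a point of the half ball keeps half
  of this size on a ball of fixed radius \<open>r\<close>, at most 1/4. That ball lies within
  distance 3/4 of the origin, where \<open>bump 3\<close> is at least (7/16)^3, so the integral
  cannot be small.\<close>

lemma sup_of_weighted_L2:
  assumes d: "\<delta> > 0" and \<Lambda>: "\<Lambda> > 0"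
  obtains e where "e > 0"
    "\<And>w :: real^'n \<Rightarrow> real. (\<forall>x y. norm x \<le> 1 \<longrightarrow> norm y \<le> 1 \<longrightarrow> \<bar>w x - w y\<bar> \<le> \<Lambda> * norm (x - y)) \<Longrightarrow>
      8 * integral\<^sup>L lborel_ball (\<lambda>x. bump 3 x * (w x)\<^sup>2) \<le> e \<Longrightarrow> (\<And>x. norm x \<le> 1/2 \<Longrightarrow> \<bar>w x\<bar> \<le> \<delta>)"
proof -
  define r where "r = min (1/4) (\<delta> / (2 * \<Lambda>))"
  have r: "0 < r" "r \<le> 1/4" "r \<le> \<delta> / (2 * \<Lambda>)" unfolding r_def using d \<Lambda> by auto
  then have r\<Lambda>: "\<Lambda> * r \<le> \<delta> / 2" using \<Lambda> by (simp add: field_simps)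
  define m where "m = measure lborel (cball (0::real^'n) r)"
  have m: "m > 0" unfolding m_def by (rule content_cball_pos[OF r(1)])
  define e where "e = (7/16)^3 * (\<delta>/2)\<^sup>2 * m"
  have e: "e > 0" unfolding e_def using m d by simp
  show ?thesis
  proof (rule that[OF e])
    fix w :: "real^'n \<Rightarrow> real" and x :: "real^'n"
    assume lip0: "\<forall>x y. norm x \<le> 1 \<longrightarrow> norm y \<le> 1 \<longrightarrow> \<bar>w x - w y\<bar> \<le> \<Lambda> * norm (x - y)"
      and int: "8 * integral\<^sup>L lborel_ball (\<lambda>x. bump 3 x * (w x)\<^sup>2) \<le> e" and x: "norm x \<le> 1/2"
    have lip: "\<bar>w x - w y\<bar> \<le> \<Lambda> * norm (x - y)" if "norm x \<le> 1" "norm y \<le> 1" for x y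
      using lip0 that by blast
    have wc: "continuous_on (cball 0 1) w"
      using lip \<Lambda> by (intro lipschitz_on_continuous_on[where L=\<Lambda>] lipschitz_onI) (auto simp: dist_norm)
    show "\<bar>w x\<bar> \<le> \<delta>"
    proof (rule ccontr)
      assume big: "\<not> \<bar>w x\<bar> \<le> \<delta>"
      have mx: "measure lborel (cball x r) = m" unfolding m_def using r by (simp add: content_cball)
      have ix: "integrable lborel (indicat_real (cball x r))"
        by (auto intro!: integrable_real_indicator emeasure_lborel_cball_finite)
      have z: "(7/16)^3 * (\<delta>/2)\<^sup>2 * indicat_real (cball x r) y = 0" if "norm y > 1" for y
      proof -
        have "y \<notin> cball x r"
        proof
          assume "y \<in> cball x r"
          then have "norm (y - x) \<le> r" by (simp add: dist_norm norm_minus_commute)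
          then show False using norm_triangle_ineq[of "y - x" x] that x r by simp
        qed
        then show ?thesis by simp
      qed
      have "e = integral\<^sup>L lborel (\<lambda>y. (7/16)^3 * (\<delta>/2)\<^sup>2 * indicat_real (cball x r) y)"
        unfolding e_def using mx by simp
      also have "\<dots> = integral\<^sup>L lborel_ball (\<lambda>y. (7/16)^3 * (\<delta>/2)\<^sup>2 * indicat_real (cball x r) y)"
        by (rule lborel_eq_B1(1)[OF z])
      also have "\<dots> \<le> integral\<^sup>L lborel_ball (\<lambda>x. bump 3 x * (w x)\<^sup>2)"
      proof (rule integral_mono)
        have "integrable lborel (\<lambda>y. (7/16)^3 * (\<delta>/2)\<^sup>2 * indicat_real (cball x r) y)" using ix by simp
        then show "integrable lborel_ball (\<lambda>y. (7/16)^3 * (\<delta>/2)\<^sup>2 * indicat_real (cball x r) y)"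
          by (subst (asm) lborel_eq_B1(2)[OF z])
        show "integrable lborel_ball (\<lambda>x. bump 3 x * (w x)\<^sup>2)" by (intro integrable_B1_continuous continuous_intros wc)
        fix y :: "real^'n" assume "y \<in> space lborel_ball"
        then have y1: "norm y \<le> 1" by simp
        show "(7/16)^3 * (\<delta>/2)\<^sup>2 * indicat_real (cball x r) y \<le> bump 3 y * (w y)\<^sup>2"
        proof (cases "y \<in> cball x r")
          case True
          then have n: "norm (x - y) \<le> r" by (simp add: dist_norm)
          have "norm y \<le> norm x + norm (x - y)" using norm_triangle_ineq4[of x "x - y"] by simp
          then have "norm y \<le> 3/4" using x n r by linarith
          then have "(norm y)\<^sup>2 \<le> (3/4)\<^sup>2" by (intro power_mono) auto
          then have "y \<bullet> y \<le> 9/16" unfolding power2_norm_eq_inner by (simp add: power2_eq_square)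
          then have b: "(7/16)^3 \<le> bump 3 y" unfolding bump_def by (intro power_mono) auto
          have "\<bar>w x - w y\<bar> \<le> \<Lambda> * norm (x - y)" by (rule lip) (use x y1 in auto)
          also have "\<dots> \<le> \<Lambda> * r" using n \<Lambda> by (intro mult_left_mono) auto
          finally have "\<delta> / 2 \<le> \<bar>w y\<bar>" using r\<Lambda> big by linarith
          then have "(\<delta>/2)\<^sup>2 \<le> \<bar>w y\<bar>\<^sup>2" using d by (intro power_mono) auto
          then have "(7/16)^3 * (\<delta>/2)\<^sup>2 \<le> bump 3 y * \<bar>w y\<bar>\<^sup>2" using b by (intro mult_mono) auto
          then show ?thesis using True by simp
        qed simp
      qed
      finally show False using int e by linarith
    qed
  qed
qed

lemma monneau_triangle:
  fixes w :: "real^'n \<Rightarrow> real"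
  assumes w: "continuous_on (cball 0 1) w"
  shows "monneau B w \<le> 2 * monneau A w + 2 * monneau A (quad_poly B)"
proof -
  have i: "integrable lborel_ball (\<lambda>x. bump 3 x * (w x - quad_poly A x)\<^sup>2)" "integrable lborel_ball (\<lambda>x. bump 3 x * (quad_poly B x - quad_poly A x)\<^sup>2)"
    "integrable lborel_ball (\<lambda>x. bump 3 x * (w x - quad_poly B x)\<^sup>2)"
    by (intro integrable_B1_continuous continuous_intros w quad_poly_cont)+
  have "integral\<^sup>L lborel_ball (\<lambda>x. bump 3 x * (w x - quad_poly B x)\<^sup>2)
    \<le> integral\<^sup>L lborel_ball (\<lambda>x. 2 * (bump 3 x * (w x - quad_poly A x)\<^sup>2) + 2 * (bump 3 x * (quad_poly B x - quad_poly A x)\<^sup>2))"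
  proof (rule integral_mono[OF i(3)])
    show "integrable lborel_ball (\<lambda>x. 2 * (bump 3 x * (w x - quad_poly A x)\<^sup>2) + 2 * (bump 3 x * (quad_poly B x - quad_poly A x)\<^sup>2))" using i by simp
    fix x :: "real^'n"
    define s t where "s = w x - quad_poly A x" and "t = quad_poly B x - quad_poly A x"
    have "(s - t)\<^sup>2 \<le> 2 * s\<^sup>2 + 2 * t\<^sup>2" using zero_le_power2[of "s + t"] by (simp add: power2_eq_square algebra_simps)
    then have "bump 3 x * (s - t)\<^sup>2 \<le> bump 3 x * (2 * s\<^sup>2 + 2 * t\<^sup>2)" by (rule mult_left_mono) simp
    moreover have "s - t = w x - quad_poly B x" by (simp add: s_def t_def)
    ultimately show "bump 3 x * (w x - quad_poly B x)\<^sup>2 \<le> 2 * (bump 3 x * (w x - quad_poly A x)\<^sup>2) + 2 * (bump 3 x * (quad_poly B x - quad_poly A x)\<^sup>2)"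
      unfolding s_def[symmetric] t_def[symmetric] by (simp add: algebra_simps)
  qed
  then show ?thesis unfolding monneau_def using i by simp
qed

lemma monneau_perturb:
  fixes w w' :: "real^'n \<Rightarrow> real"
  assumes w: "continuous_on (cball 0 1) w" "continuous_on (cball 0 1) w'"
    and c: "\<And>x. norm x \<le> 1 \<Longrightarrow> \<bar>w x - w' x\<bar> \<le> \<theta>"
  shows "monneau A w' \<le> 2 * monneau A w + 16 * (\<theta>\<^sup>2 * vol_ball TYPE('n))"
proof -
  have i: "integrable lborel_ball (\<lambda>x. bump 3 x * (w x - quad_poly A x)\<^sup>2)" "integrable lborel_ball (\<lambda>x. bump 3 x * (w x - w' x)\<^sup>2)"
    "integrable lborel_ball (\<lambda>x. bump 3 x * (w' x - quad_poly A x)\<^sup>2)"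
    by (intro integrable_B1_continuous continuous_intros w quad_poly_cont)+
  have "integral\<^sup>L lborel_ball (\<lambda>x. bump 3 x * (w' x - quad_poly A x)\<^sup>2)
    \<le> integral\<^sup>L lborel_ball (\<lambda>x. 2 * (bump 3 x * (w x - quad_poly A x)\<^sup>2) + 2 * (bump 3 x * (w x - w' x)\<^sup>2))"
  proof (rule integral_mono[OF i(3)])
    show "integrable lborel_ball (\<lambda>x. 2 * (bump 3 x * (w x - quad_poly A x)\<^sup>2) + 2 * (bump 3 x * (w x - w' x)\<^sup>2))" using i by simp
    fix x :: "real^'n"
    define s t where "s = w x - quad_poly A x" and "t = w x - w' x"
    have "(s - t)\<^sup>2 \<le> 2 * s\<^sup>2 + 2 * t\<^sup>2" using zero_le_power2[of "s + t"] by (simp add: power2_eq_square algebra_simps)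
    then have "bump 3 x * (s - t)\<^sup>2 \<le> bump 3 x * (2 * s\<^sup>2 + 2 * t\<^sup>2)" by (rule mult_left_mono) simp
    moreover have "s - t = w' x - quad_poly A x" by (simp add: s_def t_def)
    ultimately show "bump 3 x * (w' x - quad_poly A x)\<^sup>2 \<le> 2 * (bump 3 x * (w x - quad_poly A x)\<^sup>2) + 2 * (bump 3 x * (w x - w' x)\<^sup>2)"
      unfolding s_def[symmetric] t_def[symmetric] by (simp add: algebra_simps)
  qed
  moreover have "integral\<^sup>L lborel_ball (\<lambda>x. bump 3 x * (w x - w' x)\<^sup>2) \<le> \<theta>\<^sup>2 * vol_ball TYPE('n)"
  proof (rule integral_B1_le[OF i(2)])
    fix x :: "real^'n" assume x: "norm x \<le> 1"
    have "\<bar>w x - w' x\<bar>\<^sup>2 \<le> \<theta>\<^sup>2" using c[OF x] by (intro power_mono) auto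
    then have "bump 3 x * (w x - w' x)\<^sup>2 \<le> 1 * \<theta>\<^sup>2" by (intro mult_mono bump_le_1) auto
    then show "bump 3 x * (w x - w' x)\<^sup>2 \<le> \<theta>\<^sup>2" by simp
  qed
  ultimately show ?thesis unfolding monneau_def using i by simp
qed

text \<open>First comes a scale with little contact, then a further zoom by \<open>\<rho>1\<close>.
  Both lower bounds depend only on \<open>L\<close>, \<open>e\<close> and the dimension, and so does
  their product.\<close>

lemma uniform_scale:
  assumes e: "e > 0" and L: "0 \<le> L"
  obtains \<rho> where "0 < \<rho>" "\<rho> \<le> 1"
    "\<And>(v :: real^'n \<Rightarrow> real) dv B. obstacle_sol L v dv \<Longrightarrow> admissible_matrix B \<Longrightarrow> blows_up_to v dv B \<Longrightarrow>
       \<exists>A r. admissible_matrix A \<and> \<rho> \<le> r \<and> r \<le> 1 \<and> monneau A (rescale v 0 r) \<le> e"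
proof -
  obtain \<rho>1 \<eta> where 1: "0 < \<rho>1" "\<rho>1 \<le> 1" "\<eta> > 0"
    "\<And>(v :: real^'n \<Rightarrow> real) dv. obstacle_sol L v dv \<Longrightarrow> contact v \<le> \<eta> \<Longrightarrow> \<exists>A. admissible_matrix A \<and> monneau A (rescale v 0 \<rho>1) \<le> e"
    by (rule small_contact_close[OF e L]) (rule that, assumption+)
  obtain \<rho>2 where 2: "0 < \<rho>2" "\<rho>2 \<le> 1"
    "\<And>(v :: real^'n \<Rightarrow> real) dv A. obstacle_sol L v dv \<Longrightarrow> admissible_matrix A \<Longrightarrow> blows_up_to v dv A \<Longrightarrow>
       \<exists>r. \<rho>2 \<le> r \<and> r \<le> 1 \<and> contact (rescale v 0 r) \<le> \<eta>"
    by (rule small_contact_scale[OF 1(3) L]) (rule that, assumption+)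
  have p: "0 < \<rho>1 * \<rho>2" using 1 2 by simp
  have le1: "\<rho>1 * \<rho>2 \<le> 1" using mult_le_one[OF 1(2) _ 2(2)] 2(1) by simp
  show ?thesis
  proof (rule that[OF p le1])
    fix v :: "real^'n \<Rightarrow> real" and dv B
    assume s: "obstacle_sol L v dv" and B: "admissible_matrix B" "blows_up_to v dv B"
    obtain r where r: "\<rho>2 \<le> r" "r \<le> 1" "contact (rescale v 0 r) \<le> \<eta>" using 2(3)[OF s B] by blast
    have r0: "0 < r" using r 2 by linarith
    obtain A where A: "admissible_matrix A" "monneau A (rescale (rescale v 0 r) 0 \<rho>1) \<le> e"
      using 1(4)[OF sol_rescale_0[OF s r0 r(2)] r(3)] by blast
    have "\<rho>1 * \<rho>2 \<le> \<rho>1 * r" using r(1) 1(1) by (intro mult_left_mono) auto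
    moreover have "\<rho>1 * r \<le> 1" using mult_le_one[OF 1(2) _ r(2)] r0 by simp
    ultimately show "\<exists>A r. admissible_matrix A \<and> \<rho>1 * \<rho>2 \<le> r \<and> r \<le> 1 \<and> monneau A (rescale v 0 r) \<le> e"
      using A unfolding rescale_rescale by blast
  qed
qed

text \<open>The polynomial \<open>A\<close> found at some scale \<open>r\<close> above \<rho> need
  not be the blow-up. By monotonicity it is close to all rescalings below \<rho> and to the blow-up,
  and \<open>monneau_triangle\<close> eliminates it; this is why \<open>e / 4\<close> is
  needed.\<close>

lemma blowup_uniform_rate:
  assumes \<delta>: "\<delta> > 0" and L: "0 \<le> L"
  obtains \<rho> where "0 < \<rho>" "\<rho> \<le> 1"
    "\<And>(v :: real^'n \<Rightarrow> real) dv B s x. obstacle_sol L v dv \<Longrightarrow> admissible_matrix B \<Longrightarrow> blows_up_to v dv B \<Longrightarrow>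
       0 < s \<Longrightarrow> s \<le> \<rho> \<Longrightarrow> norm x \<le> 1/2 \<Longrightarrow> \<bar>rescale v 0 s x - quad_poly B x\<bar> \<le> \<delta>"
proof -
  define \<Lambda> where "\<Lambda> = 4 * L + 1 + 2 * dim_sq TYPE('n)"
  have \<Lambda>: "\<Lambda> > 0" unfolding \<Lambda>_def using L NB_ge1[where 'n='n] by linarith
  obtain e where e: "e > 0" and sup: "\<And>(w :: real^'n \<Rightarrow> real) x. (\<forall>x y. norm x \<le> 1 \<longrightarrow> norm y \<le> 1 \<longrightarrow> \<bar>w x - w y\<bar> \<le> \<Lambda> * norm (x - y)) \<Longrightarrow>
      8 * integral\<^sup>L lborel_ball (\<lambda>x. bump 3 x * (w x)\<^sup>2) \<le> e \<Longrightarrow> norm x \<le> 1/2 \<Longrightarrow> \<bar>w x\<bar> \<le> \<delta>"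
    by (rule sup_of_weighted_L2[OF \<delta> \<Lambda>]) (rule that, assumption+)
  have e4: "e / 4 > 0" using e by simp
  obtain \<rho> where \<rho>: "0 < \<rho>" "\<rho> \<le> 1" and sc: "\<And>(v :: real^'n \<Rightarrow> real) dv B. obstacle_sol L v dv \<Longrightarrow> admissible_matrix B \<Longrightarrow> blows_up_to v dv B \<Longrightarrow>
       \<exists>A r. admissible_matrix A \<and> \<rho> \<le> r \<and> r \<le> 1 \<and> monneau A (rescale v 0 r) \<le> e / 4"
    by (rule uniform_scale[OF e4 L]) (rule that, assumption+)
  show ?thesis
  proof (rule that[OF \<rho>])
    fix v :: "real^'n \<Rightarrow> real" and dv B s and x :: "real^'n"
    assume v: "obstacle_sol L v dv" and B: "admissible_matrix B" and b: "blows_up_to v dv B" and s: "0 < s" "s \<le> \<rho>" and x: "norm x \<le> 1/2"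
    obtain A r where A: "admissible_matrix A" and r: "\<rho> \<le> r" "r \<le> 1" and m: "monneau A (rescale v 0 r) \<le> e / 4"
      using sc[OF v B b] by blast
    have r0: "0 < r" and s1: "s \<le> 1" using r \<rho> s by linarith+
    have "monneau A (rescale v 0 s) \<le> e / 4" using monneau_mono[OF v B b A s(1) _ r(2)] s r m by linarith
    moreover have "monneau A (quad_poly B) \<le> e / 4" using monneau_blowup_le[OF v B b A r0 r(2)] m by linarith
    moreover have ss: "obstacle_sol L (rescale v 0 s) (drescale dv 0 s)" by (rule sol_rescale_0[OF v s(1) s1])
    ultimately have m2: "monneau B (rescale v 0 s) \<le> e"
      using monneau_triangle[OF c11_continuous(3)[OF sol_c11[OF ss]], of B A] by linarith
    show "\<bar>rescale v 0 s x - quad_poly B x\<bar> \<le> \<delta>"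
    proof (rule sup[of "\<lambda>x. rescale v 0 s x - quad_poly B x", OF _ _ x])
      show "8 * integral\<^sup>L lborel_ball (\<lambda>x. bump 3 x * (rescale v 0 s x - quad_poly B x)\<^sup>2) \<le> e" using m2 unfolding monneau_def .
      show "\<forall>y z. norm y \<le> 1 \<longrightarrow> norm z \<le> 1 \<longrightarrow> \<bar>rescale v 0 s y - quad_poly B y - (rescale v 0 s z - quad_poly B z)\<bar> \<le> \<Lambda> * norm (y - z)"
        unfolding \<Lambda>_def by (intro allI impI c11_lipschitz[OF c11_diff[OF sol_c11[OF ss] c11_quad_poly[OF B]]]) auto
    qed
  qed
qed

text \<open>The polynomial \<open>A\<close> that fits \<open>v\<close> at a scale \<open>r\<close>
  above \<rho> also fits \<open>v'\<close>, since functions close on the unit ball stay close at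
  that scale; hence both blow-ups are close to \<open>A\<close>. The factor \<rho>^2 in the
  threshold pays for the division by r^2 in the rescaling.\<close>

lemma blowup_uniform_continuity:
  assumes \<delta>: "\<delta> > 0" and L: "0 \<le> L"
  obtains \<theta> where "0 < \<theta>"
    "\<And>(v :: real^'n \<Rightarrow> real) dv B v' dv' B' x. obstacle_sol L v dv \<Longrightarrow> admissible_matrix B \<Longrightarrow> blows_up_to v dv B \<Longrightarrow>
       obstacle_sol L v' dv' \<Longrightarrow> admissible_matrix B' \<Longrightarrow> blows_up_to v' dv' B' \<Longrightarrow> (\<forall>x. norm x \<le> 1 \<longrightarrow> \<bar>v x - v' x\<bar> \<le> \<theta>) \<Longrightarrow>
       norm x \<le> 1/2 \<Longrightarrow> \<bar>quad_poly B x - quad_poly B' x\<bar> \<le> \<delta>"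
proof -
  define \<Lambda> where "\<Lambda> = 2 * dim_sq TYPE('n) + 2 * dim_sq TYPE('n)"
  have \<Lambda>: "\<Lambda> > 0" unfolding \<Lambda>_def using NB_ge1[where 'n='n] by linarith
  obtain e where e: "e > 0" and sup: "\<And>(w :: real^'n \<Rightarrow> real) x. (\<forall>x y. norm x \<le> 1 \<longrightarrow> norm y \<le> 1 \<longrightarrow> \<bar>w x - w y\<bar> \<le> \<Lambda> * norm (x - y)) \<Longrightarrow>
      8 * integral\<^sup>L lborel_ball (\<lambda>x. bump 3 x * (w x)\<^sup>2) \<le> e \<Longrightarrow> norm x \<le> 1/2 \<Longrightarrow> \<bar>w x\<bar> \<le> \<delta>"
    by (rule sup_of_weighted_L2[OF \<delta> \<Lambda>]) (rule that, assumption+)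
  have e4: "e / 8 > 0" using e by simp
  obtain \<rho> where \<rho>: "0 < \<rho>" "\<rho> \<le> 1" and sc: "\<And>(v :: real^'n \<Rightarrow> real) dv B. obstacle_sol L v dv \<Longrightarrow> admissible_matrix B \<Longrightarrow> blows_up_to v dv B \<Longrightarrow>
       \<exists>A r. admissible_matrix A \<and> \<rho> \<le> r \<and> r \<le> 1 \<and> monneau A (rescale v 0 r) \<le> e / 8"
    by (rule uniform_scale[OF e4 L]) (rule that, assumption+)
  define V where "V = vol_ball TYPE('n)"
  have V0: "0 \<le> V" unfolding V_def by simp
  define \<theta>0 where "\<theta>0 = min 1 (e / (128 * (V + 1)))"
  have \<theta>0: "0 < \<theta>0" "\<theta>0 \<le> 1" "\<theta>0 \<le> e / (128 * (V + 1))" unfolding \<theta>0_def using e V0 by auto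
  have \<theta>e: "16 * (\<theta>0\<^sup>2 * V) \<le> e / 8"
  proof -
    have "\<theta>0 * \<theta>0 \<le> \<theta>0 * 1" using \<theta>0 by (intro mult_left_mono) auto
    then have "\<theta>0\<^sup>2 * V \<le> \<theta>0 * V" using V0 by (intro mult_right_mono) (auto simp: power2_eq_square)
    moreover have "\<theta>0 * (128 * (V + 1)) \<le> e" using \<theta>0(3) V0 by (simp add: pos_le_divide_eq)
    ultimately show ?thesis using \<theta>0(1) by (simp add: algebra_simps)
  qed
  have t0: "0 < \<theta>0 * \<rho>\<^sup>2" using \<theta>0 \<rho> by simp
  show ?thesis
  proof (rule that[OF t0])
    fix v :: "real^'n \<Rightarrow> real" and dv B v' dv' B' and x :: "real^'n"
    assume v: "obstacle_sol L v dv" and B: "admissible_matrix B" and b: "blows_up_to v dv B"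
      and v': "obstacle_sol L v' dv'" and B': "admissible_matrix B'" and b': "blows_up_to v' dv' B'"
      and cl: "\<forall>x. norm x \<le> 1 \<longrightarrow> \<bar>v x - v' x\<bar> \<le> \<theta>0 * \<rho>\<^sup>2" and x: "norm x \<le> 1/2"
    obtain A r where A: "admissible_matrix A" and r: "\<rho> \<le> r" "r \<le> 1" and m: "monneau A (rescale v 0 r) \<le> e / 8"
      using sc[OF v B b] by blast
    have r0: "0 < r" using r \<rho> by linarith
    have ss: "obstacle_sol L (rescale v 0 r) (drescale dv 0 r)" "obstacle_sol L (rescale v' 0 r) (drescale dv' 0 r)"
      by (rule sol_rescale_0[OF v r0 r(2)], rule sol_rescale_0[OF v' r0 r(2)])
    have "monneau A (rescale v' 0 r) \<le> 2 * monneau A (rescale v 0 r) + 16 * (\<theta>0\<^sup>2 * vol_ball TYPE('n))"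
    proof (rule monneau_perturb)
      fix y :: "real^'n" assume y: "norm y \<le> 1"
      have "norm (r *\<^sub>R y) \<le> 1" using y r0 r(2) by (simp add: mult_le_one)
      then have "\<bar>v (r *\<^sub>R y) - v' (r *\<^sub>R y)\<bar> \<le> \<theta>0 * \<rho>\<^sup>2" using cl by blast
      also have "\<dots> \<le> \<theta>0 * r\<^sup>2" using r \<rho> \<theta>0 by (intro mult_left_mono power_mono) auto
      finally have "\<bar>v (r *\<^sub>R y) - v' (r *\<^sub>R y)\<bar> / r\<^sup>2 \<le> \<theta>0" using r0 by (simp add: pos_divide_le_eq)
      then show "\<bar>rescale v 0 r y - rescale v' 0 r y\<bar> \<le> \<theta>0"
        unfolding rescale_def by (simp add: diff_divide_distrib[symmetric])
    qed (rule c11_continuous(3)[OF sol_c11[OF ss(1)]], rule c11_continuous(3)[OF sol_c11[OF ss(2)]])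
    then have "monneau A (rescale v' 0 r) \<le> 3 * (e / 8)" using m \<theta>e unfolding V_def by linarith
    then have 1: "monneau A (quad_poly B') \<le> 3 * (e / 8)" using monneau_blowup_le[OF v' B' b' A r0 r(2)] by linarith
    have 2: "monneau A (quad_poly B) \<le> e / 8" using monneau_blowup_le[OF v B b A r0 r(2)] m by linarith
    have m2: "monneau B' (quad_poly B) \<le> e"
      using monneau_triangle[OF quad_poly_cont(1), of B' B A] 1 2 by linarith
    show "\<bar>quad_poly B x - quad_poly B' x\<bar> \<le> \<delta>"
    proof (rule sup[of "\<lambda>x. quad_poly B x - quad_poly B' x", OF _ _ x])
      show "8 * integral\<^sup>L lborel_ball (\<lambda>x. bump 3 x * (quad_poly B x - quad_poly B' x)\<^sup>2) \<le> e" using m2 unfolding monneau_def .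
      show "\<forall>y z. norm y \<le> 1 \<longrightarrow> norm z \<le> 1 \<longrightarrow> \<bar>quad_poly B y - quad_poly B' y - (quad_poly B z - quad_poly B' z)\<bar> \<le> \<Lambda> * norm (y - z)"
        unfolding \<Lambda>_def by (intro allI impI c11_lipschitz[OF c11_diff[OF c11_quad_poly[OF B] c11_quad_poly[OF B']]]) auto
    qed
  qed
qed

section \<open>The Whitney extension theorem for one derivative\<close>

definition moll :: "real \<Rightarrow> (real^'n \<Rightarrow> real) \<Rightarrow> real^'n \<Rightarrow> real" where
  "moll \<delta> f x = integral\<^sup>L lborel_ball (\<lambda>y. bump 4 y * f (x + \<delta> *\<^sub>R y)) / integral\<^sup>L lborel_ball (bump 4 :: real^'n \<Rightarrow> real)"

text \<open>The derivative falls on the kernel \<open>bump 4\<close>, whose gradient is -8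
  \<open>bump 3\<close> times the position vector; the sign is lost when the translation is moved
  from the kernel back to \<open>f\<close>.\<close>

definition dmoll :: "real \<Rightarrow> (real^'n \<Rightarrow> real) \<Rightarrow> real^'n \<Rightarrow> real^'n" where
  "dmoll \<delta> f x = (\<chi> i. 8 * integral\<^sup>L lborel_ball (\<lambda>y. bump 3 y * y $ i * f (x + \<delta> *\<^sub>R y)) / (\<delta> * integral\<^sup>L lborel_ball (bump 4 :: real^'n \<Rightarrow> real)))"

lemma continuous_affine_arg:
  fixes f :: "real^'n \<Rightarrow> real"
  assumes "continuous_on UNIV f"
  shows "continuous_on S (\<lambda>y. f (x + \<delta> *\<^sub>R y))"
  by (rule continuous_on_compose2[OF assms]) (auto intro!: continuous_intros)

text \<open>The expansion behind \<open>quad_approx_one\<close> is used again, now with its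
  quadratic and cubic parts absorbed into a single quadratic remainder. Continuity of
  \<open>f\<close> is enough because the kernel carries the expansion.\<close>

lemma moll_has_derivative:
  fixes f :: "real^'n \<Rightarrow> real"
  assumes f: "continuous_on UNIV f" and \<delta>: "\<delta> > 0"
  shows "(moll \<delta> f has_derivative (\<lambda>h. dmoll \<delta> f x \<bullet> h)) (at x)"
proof -
  define c4 where "c4 = integral\<^sup>L lborel_ball (bump 4 :: real^'n \<Rightarrow> real)"
  have c4: "c4 > 0" unfolding c4_def by (rule integral_bump_pos)
  define g where "g y = f (x + \<delta> *\<^sub>R y)" for y
  have gc: "continuous_on S g" for S unfolding g_def[abs_def] by (rule continuous_affine_arg[OF f])
  have "bounded (g ` cball 0 2)" by (intro compact_imp_bounded compact_continuous_image gc compact_cball)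
  then obtain G where "\<forall>y\<in>cball 0 2. \<bar>g y\<bar> \<le> G" by (auto simp: bounded_iff)
  then have G: "\<And>y. norm y \<le> 2 \<Longrightarrow> \<bar>g y\<bar> \<le> G" by simp
  have G0: "0 \<le> G" using G[of 0] by simp
  define V2 where "V2 = measure lborel (cball (0::real^'n) 2)"
  have V2: "0 \<le> V2" unfolding V2_def by simp
  define b where "b = (\<chi> i. 8 * integral\<^sup>L lborel_ball (\<lambda>y. bump 3 y * y $ i * g y))"
  define A where "A = (\<chi> i j. integral\<^sup>L lborel_ball (\<lambda>y. (48 * bump 2 y * (y $ i * y $ j) - (if i = j then 8 * bump 3 y else 0)) * g y))"
  define Q where "Q = norm A * dim_sq TYPE('n)"
  have quad: "\<bar>quad_poly A h\<bar> \<le> Q * (norm h)\<^sup>2" for h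
  proof -
    have n: "norm (A *v h) \<le> Q * norm h" unfolding Q_def by (rule entries_le_imp_norm_le) (rule entry_le_norm)
    have "\<bar>(A *v h) \<bullet> h\<bar> \<le> norm (A *v h) * norm h" by (rule Cauchy_Schwarz_ineq2)
    also have "\<dots> \<le> Q * norm h * norm h" by (rule mult_right_mono[OF n]) simp
    finally have "\<bar>(A *v h) \<bullet> h\<bar> \<le> Q * (norm h)\<^sup>2" by (simp add: power2_eq_square mult.assoc)
    then show ?thesis unfolding quad_poly_def by (simp add: abs_mult)
  qed
  have dm: "dmoll \<delta> f x \<bullet> k = (b \<bullet> k) / (\<delta> * c4)" for k
  proof -
    have "dmoll \<delta> f x = (1 / (\<delta> * c4)) *\<^sub>R b" unfolding dmoll_def b_def g_def c4_def by (simp add: vec_eq_iff)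
    then show ?thesis by simp
  qed
  show ?thesis
  proof (rule has_derivative_of_quadratic[where d=\<delta> and C="(530 * G * V2 + Q) / (c4 * \<delta>\<^sup>2)"])
    show "bounded_linear (\<lambda>h. dmoll \<delta> f x \<bullet> h)" by (rule bounded_linear_inner_right)
    fix k :: "real^'n" assume k: "norm k < \<delta>"
    define h where "h = (1 / \<delta>) *\<^sub>R k"
    have nh: "norm h = norm k / \<delta>" using \<delta> by (simp add: h_def)
    have h1: "norm h \<le> 1" using k \<delta> by (simp add: nh)
    have e1: "c4 * moll \<delta> f (x + k) = integral\<^sup>L lborel_ball (\<lambda>y. bump 4 y * g (y + h))"
      unfolding moll_def c4_def[symmetric] g_def h_def using c4 \<delta> by (simp add: algebra_simps)
    have e2: "c4 * moll \<delta> f x = integral\<^sup>L lborel_ball (\<lambda>y. bump 4 y * g y)"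
      unfolding moll_def c4_def[symmetric] g_def using c4 by simp
    have e3: "integral\<^sup>L lborel_ball (\<lambda>y. bump4_poly h y * g y) = integral\<^sup>L lborel_ball (\<lambda>y. bump 4 y * g y) + b \<bullet> h + quad_poly A h"
      unfolding b_def A_def by (rule bump4_poly_integral[OF gc])
    have "\<bar>c4 * moll \<delta> f (x + k) - integral\<^sup>L lborel_ball (\<lambda>y. bump4_poly h y * g y)\<bar> \<le> 530 * (norm h)^3 * G * V2"
      unfolding e1 V2_def by (rule moll_expand[OF gc G h1])
    also have "\<dots> \<le> 530 * (norm h)^2 * G * V2"
      using h1 G0 V2 by (intro mult_right_mono mult_left_mono power_decreasing) auto
    finally have "\<bar>c4 * moll \<delta> f (x + k) - c4 * moll \<delta> f x - b \<bullet> h\<bar> \<le> 530 * (norm h)^2 * G * V2 + Q * (norm h)\<^sup>2"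
      using quad[of h] unfolding e2 e3 by linarith
    also have "\<dots> = (530 * G * V2 + Q) * (norm h)\<^sup>2" by (simp add: algebra_simps)
    finally have m: "\<bar>c4 * moll \<delta> f (x + k) - c4 * moll \<delta> f x - b \<bullet> h\<bar> \<le> (530 * G * V2 + Q) * (norm h)\<^sup>2" .
    have "c4 * (moll \<delta> f (x + k) - moll \<delta> f x - dmoll \<delta> f x \<bullet> k) = c4 * moll \<delta> f (x + k) - c4 * moll \<delta> f x - b \<bullet> h"
      unfolding dm h_def using c4 by (simp add: right_diff_distrib)
    then have "c4 * \<bar>moll \<delta> f (x + k) - moll \<delta> f x - dmoll \<delta> f x \<bullet> k\<bar> \<le> (530 * G * V2 + Q) * (norm h)\<^sup>2"
      using m c4 by (metis abs_mult abs_of_pos)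
    then have "\<bar>moll \<delta> f (x + k) - moll \<delta> f x - dmoll \<delta> f x \<bullet> k\<bar> \<le> ((530 * G * V2 + Q) * (norm h)\<^sup>2) / c4"
      using c4 by (simp add: pos_le_divide_eq mult.commute)
    also have "\<dots> = (530 * G * V2 + Q) / (c4 * \<delta>\<^sup>2) * (norm k)\<^sup>2"
      unfolding nh using \<delta> by (simp add: power_divide)
    finally show "\<bar>moll \<delta> f (x + k) - moll \<delta> f x - dmoll \<delta> f x \<bullet> k\<bar> \<le> (530 * G * V2 + Q) / (c4 * \<delta>\<^sup>2) * (norm k)\<^sup>2" .
  qed (rule \<delta>)
qed

lemma moll_bound:
  fixes f :: "real^'n \<Rightarrow> real"
  assumes f: "continuous_on UNIV f" and b: "\<And>y. norm y \<le> 1 \<Longrightarrow> \<bar>f (x + \<delta> *\<^sub>R y)\<bar> \<le> s"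
  shows "\<bar>moll \<delta> f x\<bar> \<le> s"
proof -
  define c4 where "c4 = integral\<^sup>L lborel_ball (bump 4 :: real^'n \<Rightarrow> real)"
  have c4: "c4 > 0" unfolding c4_def by (rule integral_bump_pos)
  note fc = continuous_affine_arg[OF f, of "cball 0 1" x \<delta>]
  have i: "integrable lborel_ball (\<lambda>y. bump 4 y * f (x + \<delta> *\<^sub>R y))" "integrable lborel_ball (\<lambda>y::real^'n. s * bump 4 y)" "integrable lborel_ball (\<lambda>y::real^'n. - s * bump 4 y)"
    by (intro integrable_B1_continuous continuous_intros fc)+
  have p: "\<bar>bump 4 y * f (x + \<delta> *\<^sub>R y)\<bar> \<le> s * bump 4 y" if "norm y \<le> 1" for y
  proof -
    have "bump 4 y * \<bar>f (x + \<delta> *\<^sub>R y)\<bar> \<le> bump 4 y * s" by (rule mult_left_mono[OF b[OF that]]) simp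
    then show ?thesis by (simp add: abs_mult mult.commute)
  qed
  have "integral\<^sup>L lborel_ball (\<lambda>y. bump 4 y * f (x + \<delta> *\<^sub>R y)) \<le> integral\<^sup>L lborel_ball (\<lambda>y::real^'n. s * bump 4 y)"
  proof (rule integral_mono[OF i(1,2)])
    fix y :: "real^'n" assume "y \<in> space lborel_ball"
    then show "bump 4 y * f (x + \<delta> *\<^sub>R y) \<le> s * bump 4 y" using p[of y] by simp
  qed
  moreover have "integral\<^sup>L lborel_ball (\<lambda>y::real^'n. - s * bump 4 y) \<le> integral\<^sup>L lborel_ball (\<lambda>y. bump 4 y * f (x + \<delta> *\<^sub>R y))"
  proof (rule integral_mono[OF i(3,1)])
    fix y :: "real^'n" assume "y \<in> space lborel_ball"
    then show "- s * bump 4 y \<le> bump 4 y * f (x + \<delta> *\<^sub>R y)" using p[of y] by simp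
  qed
  ultimately have "\<bar>integral\<^sup>L lborel_ball (\<lambda>y. bump 4 y * f (x + \<delta> *\<^sub>R y))\<bar> \<le> s * c4"
    unfolding c4_def by (simp add: abs_le_iff)
  then show ?thesis unfolding moll_def c4_def[symmetric] using c4 by (simp add: pos_divide_le_eq)
qed

lemma dmoll_bound:
  fixes f :: "real^'n \<Rightarrow> real"
  assumes f: "continuous_on UNIV f" and b: "\<And>y. norm y \<le> 1 \<Longrightarrow> \<bar>f (x + \<delta> *\<^sub>R y)\<bar> \<le> s" and \<delta>: "\<delta> > 0"
  shows "norm (dmoll \<delta> f x) \<le> real CARD('n) * (8 * vol_ball TYPE('n) / integral\<^sup>L lborel_ball (bump 4 :: real^'n \<Rightarrow> real)) * (s / \<delta>)"
proof -
  define c4 where "c4 = integral\<^sup>L lborel_ball (bump 4 :: real^'n \<Rightarrow> real)"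
  have c4: "c4 > 0" unfolding c4_def by (rule integral_bump_pos)
  note fc = continuous_affine_arg[OF f, of "cball 0 1" x \<delta>]
  have comp: "\<bar>dmoll \<delta> f x $ i\<bar> \<le> 8 * (s * vol_ball TYPE('n)) / (\<delta> * c4)" for i
  proof -
    have "\<bar>integral\<^sup>L lborel_ball (\<lambda>y. bump 3 y * y $ i * f (x + \<delta> *\<^sub>R y)) - integral\<^sup>L lborel_ball (\<lambda>y::real^'n. 0::real)\<bar> \<le> s * vol_ball TYPE('n)"
    proof (rule integral_B1_diff_le)
      fix y :: "real^'n" assume y: "norm y \<le> 1"
      have yi: "\<bar>y $ i\<bar> \<le> 1" using component_le_norm_cart[of y i] y by linarith
      have "\<bar>bump 3 y * y $ i * f (x + \<delta> *\<^sub>R y)\<bar> \<le> 1 * 1 * s" unfolding abs_mult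
        using b[OF y] yi by (intro mult_mono) (auto simp: bump_le_1)
      then show "\<bar>bump 3 y * y $ i * f (x + \<delta> *\<^sub>R y) - 0\<bar> \<le> s" by simp
    qed (intro integrable_B1_continuous continuous_intros fc)+
    then have "8 * \<bar>integral\<^sup>L lborel_ball (\<lambda>y. bump 3 y * y $ i * f (x + \<delta> *\<^sub>R y))\<bar> / (\<delta> * c4) \<le> 8 * (s * vol_ball TYPE('n)) / (\<delta> * c4)"
      using \<delta> c4 by (intro divide_right_mono) auto
    then show ?thesis unfolding dmoll_def c4_def[symmetric] using \<delta> c4 by (simp add: abs_mult)
  qed
  have "norm (dmoll \<delta> f x) \<le> (\<Sum>i\<in>UNIV. \<bar>dmoll \<delta> f x $ i\<bar>)" by (rule norm_le_l1_cart)
  also have "\<dots> \<le> (\<Sum>i\<in>(UNIV::'n set). 8 * (s * vol_ball TYPE('n)) / (\<delta> * c4))" by (rule sum_mono) (rule comp)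
  also have "\<dots> = real CARD('n) * (8 * vol_ball TYPE('n) / c4) * (s / \<delta>)" by (simp add: ac_simps)
  finally show ?thesis unfolding c4_def .
qed

lemma dmoll_diff:
  fixes f g :: "real^'n \<Rightarrow> real"
  assumes f: "continuous_on UNIV f" and g: "continuous_on UNIV g"
  shows "dmoll \<delta> (\<lambda>x. f x - g x) x = dmoll \<delta> f x - dmoll \<delta> g x" (is ?A)
    and "moll \<delta> (\<lambda>x. f x - g x) x = moll \<delta> f x - moll \<delta> g x" (is ?B)
proof -
  note fc = continuous_affine_arg[OF f, of "cball 0 1" x \<delta>] continuous_affine_arg[OF g, of "cball 0 1" x \<delta>]
  have i: "integrable lborel_ball (\<lambda>y. bump 3 y * y $ i * f (x + \<delta> *\<^sub>R y))" "integrable lborel_ball (\<lambda>y. bump 3 y * y $ i * g (x + \<delta> *\<^sub>R y))"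
    "integrable lborel_ball (\<lambda>y. bump 4 y * f (x + \<delta> *\<^sub>R y))" "integrable lborel_ball (\<lambda>y. bump 4 y * g (x + \<delta> *\<^sub>R y))" for i
    by (intro integrable_B1_continuous continuous_intros fc)+
  show ?A unfolding dmoll_def vec_eq_iff using i by (simp add: right_diff_distrib diff_divide_distrib)
  show ?B unfolding moll_def using i by (simp add: right_diff_distrib diff_divide_distrib)
qed

text \<open>A linear function has Laplacian 0, so \<open>green5\<close> annihilates its weighted
  mean.\<close>

lemma bump4_centered: "integral\<^sup>L lborel_ball (\<lambda>y::real^'n. bump 4 y * (a \<bullet> y)) = 0"
proof -
  have c: "c11 (\<lambda>x. a \<bullet> x) (\<lambda>_. a) (\<lambda>_. 0) (2 * norm a)"
    unfolding c11_def
  proof (intro conjI ballI)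
    fix x y :: "real^'n" assume x: "x \<in> ball 0 2"
    show "((\<lambda>x. a \<bullet> x) has_derivative (\<lambda>h. a \<bullet> h)) (at x)"
      by (rule bounded_linear_imp_has_derivative[OF bounded_linear_inner_right])
    have "\<bar>a \<bullet> x\<bar> \<le> norm a * norm x" by (rule Cauchy_Schwarz_ineq2)
    also have "\<dots> \<le> norm a * 2" using x by (intro mult_left_mono) auto
    finally show "\<bar>a \<bullet> x\<bar> \<le> 2 * norm a" by simp
    show "norm a \<le> 2 * norm a" using norm_ge_zero[of a] by linarith
    show "norm (a - a) \<le> 2 * norm a * norm (x - y)" by simp
  next
    show "AE x in lborel. x \<in> ball 0 2 \<longrightarrow> (\<exists>G. ((\<lambda>_. a) has_derivative G) (at x) \<and> (\<Sum>i\<in>UNIV. G (axis i 1) $ i) = 0)"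
      by (rule AE_I2) (auto intro!: exI[of _ "\<lambda>_. 0"])
  qed auto
  show ?thesis using green5[OF c] by (simp add: inner_commute)
qed

text \<open>A centred normalized kernel preserves affine functions, and the gradient then follows
  from uniqueness of derivatives without computing second moments.\<close>

lemma moll_affine:
  fixes a :: "real^'n"
  assumes \<delta>: "\<delta> > 0"
  shows "moll \<delta> (\<lambda>x. c + a \<bullet> (x - x0)) z = c + a \<bullet> (z - x0)" (is ?A)
    and "dmoll \<delta> (\<lambda>x. c + a \<bullet> (x - x0)) z = a"
proof -
  have A: "moll \<delta> (\<lambda>x. c + a \<bullet> (x - x0)) z = c + a \<bullet> (z - x0)" for z
  proof -
    define c4 where "c4 = integral\<^sup>L lborel_ball (bump 4 :: real^'n \<Rightarrow> real)"
    have c4: "c4 > 0" unfolding c4_def by (rule integral_bump_pos)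
    have i: "integrable lborel_ball (bump 4 :: real^'n \<Rightarrow> real)" "integrable lborel_ball (\<lambda>y::real^'n. bump 4 y * (a \<bullet> y))"
      by (intro integrable_B1_continuous continuous_on_bump[of _ "\<lambda>x. x"] continuous_on_id, intro integrable_B1_continuous continuous_intros)
    have "integral\<^sup>L lborel_ball (\<lambda>y. bump 4 y * (c + a \<bullet> (z + \<delta> *\<^sub>R y - x0))) = integral\<^sup>L lborel_ball (\<lambda>y. (c + a \<bullet> (z - x0)) * bump 4 y + \<delta> * (bump 4 y * (a \<bullet> y)))"
      by (simp add: inner_add_right inner_diff_right algebra_simps)
    also have "\<dots> = (c + a \<bullet> (z - x0)) * c4" using i bump4_centered[of a] unfolding c4_def by simp
    finally show ?thesis unfolding moll_def c4_def[symmetric] using c4 by simp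
  qed
  show ?A by (rule A)
  have "continuous_on UNIV (\<lambda>x. c + a \<bullet> (x - x0))" by (intro continuous_intros)
  from moll_has_derivative[OF this \<delta>, of z]
  have "((\<lambda>z. c + a \<bullet> (z - x0)) has_derivative (\<lambda>h. dmoll \<delta> (\<lambda>x. c + a \<bullet> (x - x0)) z \<bullet> h)) (at z)" unfolding A[abs_def] .
  moreover have "((\<lambda>z. c + a \<bullet> (z - x0)) has_derivative (\<lambda>h. a \<bullet> h)) (at z)"
    by (auto intro!: derivative_eq_intros)
  ultimately have "(\<lambda>h. dmoll \<delta> (\<lambda>x. c + a \<bullet> (x - x0)) z \<bullet> h) = (\<lambda>h. a \<bullet> h)" by (rule has_derivative_unique)
  then show "dmoll \<delta> (\<lambda>x. c + a \<bullet> (x - x0)) z = a" unfolding fun_eq_iff vector_eq_rdot .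
qed

lemma has_derivative_lipschitz_bound:
  fixes F :: "real^'n \<Rightarrow> real"
  assumes d: "(F has_derivative (\<lambda>h. a \<bullet> h)) (at x)" and lip: "\<And>y. \<bar>F y - F x\<bar> \<le> \<Lambda> * norm (y - x)"
  shows "norm a \<le> \<Lambda>"
proof (cases "a = 0")
  case True
  obtain y :: "real^'n" where "y \<noteq> x" using UNIV_not_singleton by blast
  have "0 \<le> \<Lambda> * norm (y - x)" using lip[of y] by linarith
  then have "0 \<le> \<Lambda>" using \<open>y \<noteq> x\<close> by (simp add: zero_le_mult_iff)
  then show ?thesis using True by simp
next
  case False
  have "((\<lambda>t. x + t *\<^sub>R a) has_derivative (\<lambda>t. t *\<^sub>R a)) (at 0)"
    by (auto intro!: derivative_eq_intros)
  moreover have "(F has_derivative (\<lambda>h. a \<bullet> h)) (at (x + 0 *\<^sub>R a))" using d by simp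
  ultimately have "((\<lambda>t. F (x + t *\<^sub>R a)) has_derivative (\<lambda>t. a \<bullet> (t *\<^sub>R a))) (at 0)"
    by (rule has_derivative_compose)
  then have "((\<lambda>t. F (x + t *\<^sub>R a)) has_real_derivative (a \<bullet> a)) (at 0)"
    by (simp add: has_field_derivative_def mult_commute_abs)
  then have "((\<lambda>h. (F (x + h *\<^sub>R a) - F x) / h) \<longlongrightarrow> a \<bullet> a) (at 0)"
    by (simp add: DERIV_def)
  moreover have "\<forall>\<^sub>F h in at 0. (F (x + h *\<^sub>R a) - F x) / h \<le> \<Lambda> * norm a"
  proof (rule eventually_mono[OF eventually_neq_at_within[of 0]])
    fix h :: real assume h: "h \<noteq> 0"
    have "(F (x + h *\<^sub>R a) - F x) / h \<le> \<bar>F (x + h *\<^sub>R a) - F x\<bar> / \<bar>h\<bar>"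
      using abs_ge_self[of "(F (x + h *\<^sub>R a) - F x) / h"] by simp
    also have "\<dots> \<le> (\<Lambda> * (\<bar>h\<bar> * norm a)) / \<bar>h\<bar>" using lip[of "x + h *\<^sub>R a"] by (intro divide_right_mono) auto
    finally show "(F (x + h *\<^sub>R a) - F x) / h \<le> \<Lambda> * norm a" using h by simp
  qed
  ultimately have "a \<bullet> a \<le> \<Lambda> * norm a" by (rule tendsto_upperbound) simp
  then have "norm a * norm a \<le> \<Lambda> * norm a" by (simp add: dot_square_norm power2_eq_square)
  then show ?thesis using False by simp
qed

section \<open>Whitney jets and their extension\<close>

definition whitney_jet :: "(real^'n) set \<Rightarrow> (real^'n \<Rightarrow> real) \<Rightarrow> (real^'n \<Rightarrow> real^'n) \<Rightarrow> bool" where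
  "whitney_jet E f D \<longleftrightarrow> (\<forall>\<epsilon>>0. \<exists>\<delta>>0. \<forall>x\<in>E. \<forall>y\<in>E. norm (y - x) < \<delta> \<longrightarrow>
     \<bar>f y - f x - D x \<bullet> (y - x)\<bar> \<le> \<epsilon> * norm (y - x) \<and> norm (D y - D x) \<le> \<epsilon>)"

text \<open>The size of a jet, including distant pairs of points. It is the quantity halved by each
  step of the iteration, and it does not change when a constant is added to
  \<open>f\<close>.\<close>

definition jet_bound :: "(real^'n) set \<Rightarrow> (real^'n \<Rightarrow> real) \<Rightarrow> (real^'n \<Rightarrow> real^'n) \<Rightarrow> real \<Rightarrow> bool" where
  "jet_bound E f D K \<longleftrightarrow> (\<forall>x\<in>E. norm (D x) \<le> K) \<and>
     (\<forall>x\<in>E. \<forall>y\<in>E. \<bar>f y - f x - D x \<bullet> (y - x)\<bar> \<le> K * norm (y - x))"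

lemma jet_change:
  fixes D :: "real^'n \<Rightarrow> real^'n"
  shows "(f y + D y \<bullet> (x - y)) - (f z + D z \<bullet> (x - z)) = (f y - f z - D z \<bullet> (y - z)) + (D y - D z) \<bullet> (x - y)"
  by (simp add: inner_diff_left inner_diff_right algebra_simps)

text \<open>The infimum formula is an extension that follows the Taylor polynomials near \<open>E\<close>
  up to the fixed error \<open>\<epsilon>\<close>; the steep part of the penalty keeps far away jets from interfering.\<close>

lemma coarse_extension:
  fixes f :: "real^'n \<Rightarrow> real"
  assumes ne: "E \<noteq> {}" and bd: "jet_bound E f D K" and K: "0 < K" and \<epsilon>: "0 < \<epsilon>" "\<epsilon> \<le> K" and \<delta>: "0 < \<delta>0"
    and cl: "\<And>x y. x \<in> E \<Longrightarrow> y \<in> E \<Longrightarrow> norm (y - x) < \<delta>0 \<Longrightarrow>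
       \<bar>f y - f x - D x \<bullet> (y - x)\<bar> \<le> \<epsilon> * norm (y - x) \<and> norm (D y - D x) \<le> \<epsilon>"
  shows "\<exists>g. (\<forall>x y. \<bar>g x - g y\<bar> \<le> 17 * K * norm (x - y)) \<and>
    (\<forall>x0\<in>E. \<forall>x. norm (x - x0) \<le> \<delta>0 / 4 \<longrightarrow> \<bar>g x - (f x0 + D x0 \<bullet> (x - x0))\<bar> \<le> \<epsilon> * \<delta>0)"
proof -
  define P where "P y x = f y + D y \<bullet> (x - y)" for y x
  \<comment> \<open>The slope 4 \<epsilon> outweighs the mismatch of nearby jets, at most 2
    \<epsilon> t up to a constant; beyond \<open>\<delta>0 / 2\<close> the additional slope 12 K
    outweighs the 3 K and K of \<open>far\<close>. With the gradient bound K the total slope is at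
    most K + 4 K + 12 K = 17 K.\<close>
  define th where "th t = 4 * \<epsilon> * t + 12 * K * max 0 (t - \<delta>0 / 2)" for t
  define T where "T y x = P y x + th (norm (x - y))" for y x
  define g where "g x = (INF y\<in>E. T y x)" for x
  have DK: "norm (D y) \<le> K" if "y \<in> E" for y using bd that unfolding jet_bound_def by blast
  have RK: "\<bar>f y - f x - D x \<bullet> (y - x)\<bar> \<le> K * norm (y - x)" if "x \<in> E" "y \<in> E" for x y
    using bd that unfolding jet_bound_def by blast
  have far: "P y x - P z x \<ge> - (3 * K * norm (x - y) + K * norm (x - z))" if y: "y \<in> E" and z: "z \<in> E" for x y z
  proof -
    have "norm (y - z) \<le> norm (x - y) + norm (x - z)" using norm_triangle_ineq4[of "x - z" "x - y"] by simp
    then have "K * norm (y - z) \<le> K * (norm (x - y) + norm (x - z))" using K by (intro mult_left_mono) auto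
    then have "K * norm (y - z) \<le> K * norm (x - y) + K * norm (x - z)" by (simp add: distrib_left)
    moreover have "\<bar>f y - f z - D z \<bullet> (y - z)\<bar> \<le> K * norm (y - z)" by (rule RK[OF z y])
    moreover have "\<bar>(D y - D z) \<bullet> (x - y)\<bar> \<le> (2 * K) * norm (x - y)"
    proof -
      have "norm (D y - D z) \<le> 2 * K" using norm_triangle_ineq4[of "D y" "D z"] DK[OF y] DK[OF z] by linarith
      then have "norm (D y - D z) * norm (x - y) \<le> (2 * K) * norm (x - y)" by (rule mult_right_mono) simp
      then show ?thesis using Cauchy_Schwarz_ineq2[of "D y - D z" "x - y"] by linarith
    qed
    ultimately show ?thesis using jet_change[of f y D x z] unfolding P_def by linarith
  qed
  have th_ge: "12 * K * t - 6 * K * \<delta>0 \<le> th t" if "0 \<le> t" for t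
  proof -
    have "12 * K * (t - \<delta>0 / 2) \<le> 12 * K * max 0 (t - \<delta>0 / 2)" using K by (intro mult_left_mono) auto
    moreover have "0 \<le> 4 * \<epsilon> * t" using \<epsilon> that by simp
    moreover have "12 * K * (t - \<delta>0 / 2) = 12 * K * t - 6 * K * \<delta>0" by (simp add: algebra_simps)
    ultimately show ?thesis unfolding th_def by linarith
  qed
  have bdd: "bdd_below ((\<lambda>y. T y x) ` E)" for x
  proof -
    obtain z where z: "z \<in> E" using ne by blast
    have "T y x \<ge> P z x - K * norm (x - z) - 6 * K * \<delta>0" if y: "y \<in> E" for y
    proof -
      have "0 \<le> 9 * (K * norm (x - y))" using K by simp
      then show ?thesis using far[OF y z, of x] th_ge[of "norm (x - y)"] unfolding T_def by simp
    qed
    then show ?thesis by (auto intro!: bdd_belowI2)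
  qed
  have Tlip: "T y x \<le> T y x' + 17 * K * norm (x - x')" if y: "y \<in> E" for y x x'
  proof -
    have n: "norm (x - y) \<le> norm (x' - y) + norm (x - x')" using norm_triangle_ineq[of "x' - y" "x - x'"] by simp
    have "P y x - P y x' = D y \<bullet> (x - x')" unfolding P_def by (simp add: inner_diff_right)
    moreover have "D y \<bullet> (x - x') \<le> K * norm (x - x')"
      using norm_cauchy_schwarz[of "D y" "x - x'"] mult_right_mono[OF DK[OF y] norm_ge_zero[of "x - x'"]] by linarith
    moreover have "th (norm (x - y)) \<le> th (norm (x' - y)) + 16 * K * norm (x - x')"
    proof -
      have "4 * \<epsilon> * norm (x - y) \<le> 4 * \<epsilon> * (norm (x' - y) + norm (x - x'))" using n \<epsilon> by (intro mult_left_mono) auto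
      moreover have "4 * \<epsilon> * norm (x - x') \<le> 4 * K * norm (x - x')" using \<epsilon> by (intro mult_right_mono) auto
      moreover have "12 * K * max 0 (norm (x - y) - \<delta>0 / 2) \<le> 12 * K * (max 0 (norm (x' - y) - \<delta>0 / 2) + norm (x - x'))"
        using n K by (intro mult_left_mono) auto
      ultimately show ?thesis unfolding th_def distrib_left by linarith
    qed
    ultimately show ?thesis unfolding T_def by linarith
  qed
  have glip1: "g x \<le> g x' + 17 * K * norm (x - x')" for x x'
  proof -
    have "g x - 17 * K * norm (x - x') \<le> g x'"
      unfolding g_def[of x']
    proof (rule cINF_greatest[OF ne])
      fix y assume y: "y \<in> E"
      have "g x \<le> T y x" unfolding g_def by (rule cINF_lower[OF bdd y])
      then show "g x - 17 * K * norm (x - x') \<le> T y x'" using Tlip[OF y, of x x'] by linarith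
    qed
    then show ?thesis by linarith
  qed
  have glip: "\<bar>g x - g y\<bar> \<le> 17 * K * norm (x - y)" for x y
    using glip1[of x y] glip1[of y x] by (simp add: norm_minus_commute)
  have near: "\<bar>g x - P x0 x\<bar> \<le> \<epsilon> * \<delta>0" if x0: "x0 \<in> E" and x: "norm (x - x0) \<le> \<delta>0 / 4" for x0 x
  proof -
    have ed: "0 \<le> \<epsilon> * \<delta>0" using \<epsilon> \<delta> by simp
    have "g x \<le> T x0 x" unfolding g_def by (rule cINF_lower[OF bdd x0])
    also have "T x0 x = P x0 x + 4 * \<epsilon> * norm (x - x0)" using x \<delta> unfolding T_def th_def by simp
    also have "4 * \<epsilon> * norm (x - x0) \<le> 4 * \<epsilon> * (\<delta>0 / 4)" using x \<epsilon> by (intro mult_left_mono) auto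
    finally have up: "g x \<le> P x0 x + \<epsilon> * \<delta>0" by simp
    have "P x0 x - \<epsilon> * \<delta>0 \<le> g x"
      unfolding g_def
    proof (rule cINF_greatest[OF ne])
      fix y assume y: "y \<in> E"
      define t where "t = norm (x - y)"
      have t0: "0 \<le> t" by (simp add: t_def)
      show "P x0 x - \<epsilon> * \<delta>0 \<le> T y x"
      proof (cases "norm (y - x0) < \<delta>0")
        case True
        note c = cl[OF x0 y True]
        have "norm (y - x0) \<le> t + norm (x - x0)" using norm_triangle_ineq4[of "x - x0" "x - y"] by (simp add: t_def)
        then have "norm (y - x0) \<le> t + \<delta>0 / 4" using x by linarith
        then have "\<epsilon> * norm (y - x0) \<le> \<epsilon> * (t + \<delta>0 / 4)" using \<epsilon> by (intro mult_left_mono) auto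
        moreover have "\<bar>(D y - D x0) \<bullet> (x - y)\<bar> \<le> \<epsilon> * t"
          using Cauchy_Schwarz_ineq2[of "D y - D x0" "x - y"] mult_right_mono[of "norm (D y - D x0)" \<epsilon> t] c t0 by (simp add: t_def)
        moreover have "\<epsilon> * (t + \<delta>0 / 4) = \<epsilon> * t + \<epsilon> * \<delta>0 / 4" by (simp add: algebra_simps)
        ultimately have "P y x - P x0 x \<ge> - (2 * (\<epsilon> * t) + \<epsilon> * \<delta>0 / 4)"
          using c jet_change[of f y D x x0] unfolding P_def by linarith
        moreover have "4 * (\<epsilon> * t) \<le> th t" unfolding th_def using K by simp
        moreover have "0 \<le> \<epsilon> * t" using \<epsilon> t0 by simp
        ultimately show ?thesis using ed unfolding T_def t_def[symmetric] by linarith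
      next
        \<comment> \<open>Here \<open>t\<close> is at least three quarters of
          \<open>\<delta>0\<close>, so that 12 K t - 6 K \<open>\<delta>0\<close> is still at least
          4 K t, which pays for \<open>far\<close>.\<close>
        case False
        have "norm (y - x0) \<le> t + norm (x - x0)" using norm_triangle_ineq4[of "x - x0" "x - y"] by (simp add: t_def)
        then have t34: "3 * \<delta>0 / 4 \<le> t" using False x by linarith
        have "K * norm (x - x0) \<le> K * t" using x t34 \<delta> K by (intro mult_left_mono) auto
        moreover have "K * (8 * t - 6 * \<delta>0) \<ge> 0" using t34 K by simp
        then have "8 * (K * t) - 6 * K * \<delta>0 \<ge> 0" by (simp add: algebra_simps)
        moreover have "12 * K * t = 12 * (K * t)" "3 * K * t = 3 * (K * t)" by simp_all
        ultimately show ?thesis using far[OF y x0, of x] th_ge[OF t0] ed unfolding T_def t_def[symmetric] by linarith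
      qed
    qed
    then show ?thesis using up by linarith
  qed
  show ?thesis
    by (intro exI[of _ g] conjI) (use glip near in \<open>auto simp: P_def\<close>)
qed

text \<open>Mollification at a scale proportional to \<open>\<delta>0\<close> preserves the Taylor
  polynomials. Their distance \<epsilon> \<open>\<delta>0\<close> from the coarse extension, divided
  by that scale, becomes a gradient error of order \<epsilon>. For small \<epsilon>, subtracting the
  result leaves a jet of half the size, while the correction itself has gradient of order K.\<close>

lemma whitney_step:
  fixes f :: "real^'n \<Rightarrow> real"
  assumes y0: "y0 \<in> E" and wj: "whitney_jet E f D" and bd: "jet_bound E f D K" and K: "0 < K"
  shows "\<exists>F dF. (\<forall>x. (F has_derivative (\<lambda>h. dF x \<bullet> h)) (at x)) \<and> (\<forall>x. norm (dF x) \<le> 17 * K) \<and> continuous_on UNIV dF \<and>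
     whitney_jet E (\<lambda>x. f x - F x) (\<lambda>x. D x - dF x) \<and> jet_bound E (\<lambda>x. f x - F x) (\<lambda>x. D x - dF x) (K / 2) \<and> F y0 = f y0"
proof -
  define c where "c = real CARD('n) * (8 * vol_ball TYPE('n) / integral\<^sup>L lborel_ball (bump 4 :: real^'n \<Rightarrow> real))"
  have c0: "0 \<le> c" unfolding c_def using integral_bump_pos[of 4, where 'n='n] by simp
  define C1 where "C1 = 8 * c"
  have C10: "0 \<le> C1" using c0 by (simp add: C1_def)
  \<comment> \<open>Chosen to make \<open>(17 + 2 * C1) * \<epsilon>\<close> equal to K / 2. Close
    pairs of points spend \<epsilon> on the jet and 2 C1 \<epsilon> on the variation of
    \<open>dF\<close>; distant pairs spend 16 \<epsilon> on two value errors and C1 \<epsilon> on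
    the gradient.\<close>
  define \<epsilon> where "\<epsilon> = K / (2 * (17 + 2 * C1))"
  have \<epsilon>0: "0 < \<epsilon>" unfolding \<epsilon>_def using K C10 by simp
  have \<epsilon>K: "\<epsilon> \<le> K" unfolding \<epsilon>_def using K C10 by (simp add: field_simps)
  have \<epsilon>eq: "(17 + 2 * C1) * \<epsilon> = K / 2" unfolding \<epsilon>_def using C10 by (simp add: field_simps)
  obtain \<delta>0 where \<delta>0: "\<delta>0 > 0" and cl: "\<And>x y. x \<in> E \<Longrightarrow> y \<in> E \<Longrightarrow> norm (y - x) < \<delta>0 \<Longrightarrow>
       \<bar>f y - f x - D x \<bullet> (y - x)\<bar> \<le> \<epsilon> * norm (y - x) \<and> norm (D y - D x) \<le> \<epsilon>"
    using wj \<epsilon>0 unfolding whitney_jet_def by metis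
  obtain g where gl: "\<And>x y. \<bar>g x - g y\<bar> \<le> 17 * K * norm (x - y)"
    and gn: "\<And>x0 x. x0 \<in> E \<Longrightarrow> norm (x - x0) \<le> \<delta>0 / 4 \<Longrightarrow> \<bar>g x - (f x0 + D x0 \<bullet> (x - x0))\<bar> \<le> \<epsilon> * \<delta>0"
    using coarse_extension[OF _ bd K \<epsilon>0 \<epsilon>K \<delta>0 cl] y0 by blast
  have gc: "continuous_on UNIV g"
    using gl K by (intro lipschitz_on_continuous_on[where L="17 * K"] lipschitz_onI) (auto simp: dist_norm)
  \<comment> \<open>A point within \<delta> of \<open>x\<close>, averaged over radius \<delta>,
    stays within \<open>\<delta>0 / 4\<close> of \<open>x\<close>, where \<open>gn\<close>
    applies.\<close>
  define \<delta> where "\<delta> = \<delta>0 / 8"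
  have \<delta>: "\<delta> > 0" using \<delta>0 by (simp add: \<delta>_def)
  define F where "F x = moll \<delta> g x" for x
  define dF where "dF x = dmoll \<delta> g x" for x
  have dF: "(F has_derivative (\<lambda>h. dF x \<bullet> h)) (at x)" for x
    unfolding F_def[abs_def] dF_def by (rule moll_has_derivative[OF gc \<delta>])
  have shift: "moll \<delta> g (x + h) = moll \<delta> (\<lambda>z. g (z + h)) x" "dmoll \<delta> g (x + h) = dmoll \<delta> (\<lambda>z. g (z + h)) x" for x h
    unfolding moll_def dmoll_def by (simp_all add: ac_simps)
  have gsc: "continuous_on UNIV (\<lambda>z. g (z + h))" for h
    by (rule continuous_on_compose2[OF gc]) (auto intro!: continuous_intros)
  have Flip: "\<bar>F y - F x\<bar> \<le> 17 * K * norm (y - x)" for x y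
  proof -
    have "F y - F x = moll \<delta> (\<lambda>z. g (z + (y - x)) - g z) x"
      using shift(1)[of x "y - x"] dmoll_diff(2)[OF gsc gc, of \<delta> "y - x" x] by (simp add: F_def)
    moreover have "\<bar>moll \<delta> (\<lambda>z. g (z + (y - x)) - g z) x\<bar> \<le> 17 * K * norm (y - x)"
    proof (rule moll_bound)
      show "continuous_on UNIV (\<lambda>z. g (z + (y - x)) - g z)" by (intro continuous_intros gsc gc)
      fix u :: "real^'n"
      show "\<bar>g (x + \<delta> *\<^sub>R u + (y - x)) - g (x + \<delta> *\<^sub>R u)\<bar> \<le> 17 * K * norm (y - x)"
        using gl[of "x + \<delta> *\<^sub>R u + (y - x)" "x + \<delta> *\<^sub>R u"] by simp
    qed
    ultimately show ?thesis by simp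
  qed
  have ndF: "norm (dF x) \<le> 17 * K" for x by (rule has_derivative_lipschitz_bound[OF dF Flip])
  have dFlip: "norm (dF x - dF y) \<le> c * (17 * K * norm (x - y) / \<delta>)" for x y
  proof -
    have "dF x - dF y = dmoll \<delta> (\<lambda>z. g (z + (x - y)) - g z) y"
      using shift(2)[of y "x - y"] dmoll_diff(1)[OF gsc gc, of \<delta> "x - y" y] by (simp add: dF_def)
    moreover have "norm (dmoll \<delta> (\<lambda>z. g (z + (x - y)) - g z) y) \<le> c * (17 * K * norm (x - y) / \<delta>)"
      unfolding c_def
    proof (rule dmoll_bound[OF _ _ \<delta>])
      show "continuous_on UNIV (\<lambda>z. g (z + (x - y)) - g z)" by (intro continuous_intros gsc gc)
      fix u :: "real^'n"
      show "\<bar>g (y + \<delta> *\<^sub>R u + (x - y)) - g (y + \<delta> *\<^sub>R u)\<bar> \<le> 17 * K * norm (x - y)"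
        using gl[of "y + \<delta> *\<^sub>R u + (x - y)" "y + \<delta> *\<^sub>R u"] by simp
    qed
    ultimately show ?thesis by simp
  qed
  define \<Lambda> where "\<Lambda> = c * (17 * K) / \<delta>"
  have \<Lambda>0: "0 \<le> \<Lambda>" unfolding \<Lambda>_def using c0 K \<delta> by simp
  have dFl: "norm (dF x - dF y) \<le> \<Lambda> * norm (x - y)" for x y using dFlip[of x y] by (simp add: \<Lambda>_def)
  have dFc: "continuous_on UNIV dF"
    using dFl \<Lambda>0 by (intro lipschitz_on_continuous_on[where L=\<Lambda>] lipschitz_onI) (auto simp: dist_norm)
  have close: "norm (dF z - D x) \<le> C1 * \<epsilon>" "z = x \<Longrightarrow> \<bar>F z - f x\<bar> \<le> 8 * \<epsilon> * \<delta>" if x: "x \<in> E" and z: "norm (z - x) \<le> \<delta>" for x z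
  proof -
    define P where "P w = f x + D x \<bullet> (w - x)" for w
    have Pc: "continuous_on UNIV P" unfolding P_def[abs_def] by (intro continuous_intros)
    have gP: "continuous_on UNIV (\<lambda>w. g w - P w)" by (intro continuous_intros gc Pc)
    have b: "\<bar>g (z + \<delta> *\<^sub>R y) - P (z + \<delta> *\<^sub>R y)\<bar> \<le> 8 * \<epsilon> * \<delta>" if "norm y \<le> 1" for y
    proof -
      have "norm (\<delta> *\<^sub>R y) \<le> \<delta>" using that \<delta> by simp
      then have "norm (z + \<delta> *\<^sub>R y - x) \<le> \<delta>0 / 4"
        using z norm_triangle_ineq[of "z - x" "\<delta> *\<^sub>R y"] by (simp add: \<delta>_def algebra_simps)
      from gn[OF x this] show ?thesis by (simp add: P_def \<delta>_def)
    qed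
    have "dF z - D x = dmoll \<delta> (\<lambda>w. g w - P w) z"
      using dmoll_diff(1)[OF gc Pc, of \<delta> z] moll_affine(2)[OF \<delta>, of "f x" "D x" x z] by (simp add: dF_def P_def[abs_def])
    moreover have "norm (dmoll \<delta> (\<lambda>w. g w - P w) z) \<le> c * (8 * \<epsilon> * \<delta> / \<delta>)"
      unfolding c_def by (rule dmoll_bound[OF gP b \<delta>])
    ultimately show "norm (dF z - D x) \<le> C1 * \<epsilon>" using \<delta> by (simp add: C1_def)
    assume zx: "z = x"
    have "F z - P z = moll \<delta> (\<lambda>w. g w - P w) z"
      using dmoll_diff(2)[OF gc Pc, of \<delta> z] moll_affine(1)[OF \<delta>, of "f x" "D x" x z] by (simp add: F_def P_def[abs_def])
    moreover have "\<bar>moll \<delta> (\<lambda>w. g w - P w) z\<bar> \<le> 8 * \<epsilon> * \<delta>" by (rule moll_bound[OF gP b])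
    ultimately show "\<bar>F z - f x\<bar> \<le> 8 * \<epsilon> * \<delta>" using zx by (simp add: P_def)
  qed
  \<comment> \<open>The added constant changes neither derivatives nor increments, but makes the
    residual vanish at \<open>y0\<close>; this anchors the convergence of the series of
    functions.\<close>
  define H where "H x = F x + (f y0 - F y0)" for x
  have dH: "(H has_derivative (\<lambda>h. dF x \<bullet> h)) (at x)" for x
    unfolding H_def[abs_def] using has_derivative_add[OF dF has_derivative_const] by simp
  have RF: "\<bar>F y - F x - dF x \<bullet> (y - x)\<bar> \<le> B * norm (y - x)"
    if B: "\<And>z. z \<in> closed_segment x y \<Longrightarrow> norm (dF z - dF x) \<le> B" for x y B
  proof -
    have "norm (F y - F x - dF x \<bullet> (y - x)) \<le> norm (y - x) * B"
    proof (rule differentiable_bound_linearization[where f'="\<lambda>x h. dF x \<bullet> h" and S="closed_segment x y"])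
      fix t :: real assume "t \<in> {0..1}"
      then show "x + t *\<^sub>R (y - x) \<in> closed_segment x y"
        unfolding in_segment by (intro exI[of _ t]) (auto simp: algebra_simps)
    next
      fix z assume z: "z \<in> closed_segment x y"
      show "(F has_derivative (\<lambda>h. dF z \<bullet> h)) (at z within closed_segment x y)"
        by (rule has_derivative_at_withinI[OF dF])
      from onorm_inner_le[OF B[OF z]]
      show "onorm ((\<lambda>h. dF z \<bullet> h) - (\<lambda>h. dF x \<bullet> h)) \<le> B" by (simp add: fun_diff_def inner_diff_left)
    qed auto
    then show ?thesis by (simp add: mult.commute)
  qed
  have wj': "whitney_jet E (\<lambda>x. f x - H x) (\<lambda>x. D x - dF x)"
    unfolding whitney_jet_def
  proof (intro allI impI)
    fix e :: real assume e: "e > 0"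
    then have e2: "e / 2 > 0" by simp
    obtain d where d: "d > 0" and dd: "\<forall>x\<in>E. \<forall>y\<in>E. norm (y - x) < d \<longrightarrow>
       \<bar>f y - f x - D x \<bullet> (y - x)\<bar> \<le> e / 2 * norm (y - x) \<and> norm (D y - D x) \<le> e / 2"
      using wj e2 unfolding whitney_jet_def by blast
    define d' where "d' = min d (e / (2 * (\<Lambda> + 1)))"
    have d': "d' > 0" unfolding d'_def using d e \<Lambda>0 by simp
    have "\<bar>f y - H y - (f x - H x) - (D x - dF x) \<bullet> (y - x)\<bar> \<le> e * norm (y - x) \<and> norm (D y - dF y - (D x - dF x)) \<le> e"
      if xy: "x \<in> E" "y \<in> E" and n: "norm (y - x) < d'" for x y
    proof -
      have nd: "norm (y - x) < d" "norm (y - x) \<le> e / (2 * (\<Lambda> + 1))" using n by (auto simp: d'_def)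
      note h = dd[rule_format, OF xy nd(1)]
      have l: "\<Lambda> * norm (y - x) \<le> e / 2"
      proof -
        have "(\<Lambda> + 1) * norm (y - x) \<le> (\<Lambda> + 1) * (e / (2 * (\<Lambda> + 1)))" using nd \<Lambda>0 by (intro mult_left_mono) auto
        also have "\<dots> = e / 2" using \<Lambda>0 by (simp add: field_simps)
        finally have "(\<Lambda> + 1) * norm (y - x) \<le> e / 2" .
        then show ?thesis using norm_ge_zero[of "y - x"] unfolding distrib_right by linarith
      qed
      have "\<bar>F y - F x - dF x \<bullet> (y - x)\<bar> \<le> (e / 2) * norm (y - x)"
      proof (rule RF)
        fix z assume z: "z \<in> closed_segment x y"
        have "norm (dF z - dF x) \<le> \<Lambda> * norm (z - x)" by (rule dFl)
        also have "\<dots> \<le> \<Lambda> * norm (y - x)" using segment_bound(1)[OF z] \<Lambda>0 by (intro mult_left_mono) auto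
        finally show "norm (dF z - dF x) \<le> e / 2" using l by linarith
      qed
      moreover have "f y - H y - (f x - H x) - (D x - dF x) \<bullet> (y - x) = (f y - f x - D x \<bullet> (y - x)) - (F y - F x - dF x \<bullet> (y - x))"
        by (simp add: H_def inner_diff_left)
      moreover have "e * norm (y - x) = e / 2 * norm (y - x) + e / 2 * norm (y - x)" by simp
      ultimately have 1: "\<bar>f y - H y - (f x - H x) - (D x - dF x) \<bullet> (y - x)\<bar> \<le> e * norm (y - x)" using h by linarith
      have "norm (D y - dF y - (D x - dF x)) \<le> norm (D y - D x) + norm (dF y - dF x)"
        using norm_triangle_ineq4[of "D y - D x" "dF y - dF x"] by (simp add: algebra_simps)
      also have "\<dots> \<le> e / 2 + e / 2" using h dFl[of y x] l by linarith
      finally show ?thesis using 1 by simp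
    qed
    then show "\<exists>\<delta>>0. \<forall>x\<in>E. \<forall>y\<in>E. norm (y - x) < \<delta> \<longrightarrow>
       \<bar>f y - H y - (f x - H x) - (D x - dF x) \<bullet> (y - x)\<bar> \<le> e * norm (y - x) \<and> norm (D y - dF y - (D x - dF x)) \<le> e"
      using d' by blast
  qed
  have n0: "norm (x - x) \<le> \<delta>" for x :: "real^'n" using \<delta> by simp
  have C1K: "C1 * \<epsilon> \<le> K / 2" 
  proof -
    have "(17 + 2 * C1) * \<epsilon> = 17 * \<epsilon> + 2 * (C1 * \<epsilon>)" by (simp add: algebra_simps)
    moreover have "0 \<le> C1 * \<epsilon>" using \<epsilon>0 C10 by simp
    ultimately show ?thesis using \<epsilon>eq \<epsilon>0 by linarith
  qed
  have bd': "jet_bound E (\<lambda>x. f x - H x) (\<lambda>x. D x - dF x) (K / 2)"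
    unfolding jet_bound_def
  proof (intro conjI ballI)
    fix x assume x: "x \<in> E"
    show "norm (D x - dF x) \<le> K / 2"
      using close(1)[OF x n0] C1K by (simp add: norm_minus_commute)
    fix y assume y: "y \<in> E"
    define r where "r = norm (y - x)"
    have r0: "0 \<le> r" by (simp add: r_def)
    have eq: "f y - H y - (f x - H x) - (D x - dF x) \<bullet> (y - x) = (f y - f x - D x \<bullet> (y - x)) - (F y - F x - dF x \<bullet> (y - x))"
      by (simp add: H_def inner_diff_left)
    have Kr: "K / 2 * r = 17 * (\<epsilon> * r) + 2 * (C1 * \<epsilon> * r)" unfolding \<epsilon>eq[symmetric] by (simp add: algebra_simps)
    have p1: "0 \<le> \<epsilon> * r" "0 \<le> C1 * \<epsilon> * r" using \<epsilon>0 r0 C10 by simp_all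
    show "\<bar>f y - H y - (f x - H x) - (D x - dF x) \<bullet> (y - x)\<bar> \<le> K / 2 * norm (y - x)"
    proof (cases "r \<le> \<delta>")
      case True
      have "r < \<delta>0" using True \<delta>0 by (simp add: \<delta>_def)
      then have 1: "\<bar>f y - f x - D x \<bullet> (y - x)\<bar> \<le> \<epsilon> * r" using cl[OF x y] by (simp add: r_def)
      have 2: "\<bar>F y - F x - dF x \<bullet> (y - x)\<bar> \<le> (2 * (C1 * \<epsilon>)) * norm (y - x)"
      proof (rule RF)
        fix z assume z: "z \<in> closed_segment x y"
        have "norm (z - x) \<le> \<delta>" using segment_bound(1)[OF z] True by (simp add: r_def)
        from close(1)[OF x this] close(1)[OF x n0]
        show "norm (dF z - dF x) \<le> 2 * (C1 * \<epsilon>)"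
          using norm_triangle_ineq4[of "dF z - D x" "dF x - D x"] by simp
      qed
      have "2 * (C1 * \<epsilon>) * norm (y - x) = 2 * (C1 * \<epsilon> * r)" by (simp add: r_def)
      then show ?thesis using 1 2 p1 unfolding eq r_def[symmetric] Kr by linarith
    next
      case False
      have "\<bar>F y - f y\<bar> \<le> 8 * \<epsilon> * \<delta>" "\<bar>F x - f x\<bar> \<le> 8 * \<epsilon> * \<delta>" using close(2)[OF y n0] close(2)[OF x n0] by simp_all
      moreover have "\<epsilon> * \<delta> \<le> \<epsilon> * r" using False \<epsilon>0 by (intro mult_left_mono) auto
      moreover have "8 * \<epsilon> * \<delta> = 8 * (\<epsilon> * \<delta>)" by simp
      moreover have "\<bar>(D x - dF x) \<bullet> (y - x)\<bar> \<le> C1 * \<epsilon> * r"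
      proof -
        have "norm (D x - dF x) * r \<le> C1 * \<epsilon> * r" using close(1)[OF x n0] r0 by (intro mult_right_mono) (auto simp: norm_minus_commute)
        then show ?thesis using Cauchy_Schwarz_ineq2[of "D x - dF x" "y - x"] unfolding r_def by linarith
      qed
      moreover have "f y - H y - (f x - H x) - (D x - dF x) \<bullet> (y - x) = - (F y - f y) + (F x - f x) - (D x - dF x) \<bullet> (y - x)"
        by (simp add: H_def)
      ultimately show ?thesis using p1 unfolding r_def[symmetric] Kr by linarith
    qed
  qed
  show ?thesis
    by (intro exI[of _ H] exI[of _ dF] conjI allI dH ndF dFc wj' bd') (simp add: H_def)
qed

text \<open>Iterating \<open>whitney_step\<close> gives corrections whose gradients are dominated by
  a geometric series, so their sum has a continuous gradient. On \<open>E\<close> the residuals tend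
  to 0, because they vanish at \<open>y0\<close> and have jet bounds K' / 2^n.\<close>

theorem whitney_extension_C1:
  fixes f :: "real^'n \<Rightarrow> real"
  assumes wj: "whitney_jet E f D" and bd: "jet_bound E f D K"
  shows "\<exists>g dg. (\<forall>x. (g has_derivative (\<lambda>h. dg x \<bullet> h)) (at x)) \<and> continuous_on UNIV dg \<and> (\<forall>x\<in>E. g x = f x)"
proof (cases "E = {}")
  case True
  then show ?thesis
    by (intro exI[of _ "\<lambda>_. 0"]) (auto intro!: derivative_eq_intros)
next
  case False
  then obtain y0 where y0: "y0 \<in> E" by blast
  \<comment> \<open>\<open>whitney_step\<close> requires a strictly positive bound.\<close>
  define K' where "K' = \<bar>K\<bar> + 1"
  have K': "K' > 0" by (simp add: K'_def)
  have bd': "jet_bound E f D K'"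
    unfolding jet_bound_def
  proof (intro conjI ballI)
    fix x y assume x: "x \<in> E" and y: "y \<in> E"
    have "norm (D x) \<le> K" using bd x unfolding jet_bound_def by blast
    then show "norm (D x) \<le> K'" by (simp add: K'_def)
    have "\<bar>f y - f x - D x \<bullet> (y - x)\<bar> \<le> K * norm (y - x)" using bd x y unfolding jet_bound_def by blast
    also have "\<dots> \<le> K' * norm (y - x)" unfolding K'_def by (intro mult_right_mono) auto
    finally show "\<bar>f y - f x - D x \<bullet> (y - x)\<bar> \<le> K' * norm (y - x)" .
  qed
  \<comment> \<open>Nothing has been subtracted at stage 0, so vanishing at \<open>y0\<close> holds
    only from stage 1 on.\<close>
  define P where "P n s \<longleftrightarrow> whitney_jet E (fst s) (snd s) \<and> jet_bound E (fst s) (snd s) (K' / 2^n) \<and> (n > 0 \<longrightarrow> fst s y0 = 0)"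
    for n :: nat and s :: "(real^'n \<Rightarrow> real) \<times> (real^'n \<Rightarrow> real^'n)"
  define Rl where "Rl n s t F dF \<longleftrightarrow> (\<forall>x. (F has_derivative (\<lambda>h. dF x \<bullet> h)) (at x)) \<and> (\<forall>x. norm (dF x) \<le> 17 * (K' / 2^n)) \<and> continuous_on UNIV dF
     \<and> fst t = (\<lambda>x. fst s x - F x) \<and> snd t = (\<lambda>x. snd s x - dF x)"
    for n :: nat and s t :: "(real^'n \<Rightarrow> real) \<times> (real^'n \<Rightarrow> real^'n)" and F dF
  define Q where "Q n s t \<longleftrightarrow> (\<exists>p. Rl n s t (fst p) (snd p))" for n s t
  have "\<exists>S. \<forall>n. P n (S n) \<and> Q n (S n) (S (Suc n)) \<and> S 0 = (f, D)"
  proof -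
    have "\<exists>S. \<forall>n. (P n (S n) \<and> (n = 0 \<longrightarrow> S n = (f, D))) \<and> Q n (S n) (S (Suc n))"
    proof (rule dependent_nat_choice)
      show "\<exists>s. P 0 s \<and> (0 = 0 \<longrightarrow> s = (f, D))" using wj bd' by (auto simp: P_def)
      fix s n assume "P n s \<and> (n = 0 \<longrightarrow> s = (f, D))"
      then have s: "whitney_jet E (fst s) (snd s)" "jet_bound E (fst s) (snd s) (K' / 2^n)" by (auto simp: P_def)
      have pos: "0 < K' / 2^n" using K' by simp
      obtain F dF where F: "\<forall>x. (F has_derivative (\<lambda>h. dF x \<bullet> h)) (at x)" "\<forall>x. norm (dF x) \<le> 17 * (K' / 2^n)" "continuous_on UNIV dF"
        "whitney_jet E (\<lambda>x. fst s x - F x) (\<lambda>x. snd s x - dF x)" "jet_bound E (\<lambda>x. fst s x - F x) (\<lambda>x. snd s x - dF x) (K' / 2^n / 2)"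
        "F y0 = fst s y0"
        using whitney_step[OF y0 s pos] by blast
      define t where "t = ((\<lambda>x. fst s x - F x), (\<lambda>x. snd s x - dF x))"
      have "P (Suc n) t" unfolding P_def t_def using F by (simp add: mult.commute)
      moreover have "Q n s t" unfolding Q_def Rl_def t_def using F(1-3) by (intro exI[of _ "(F, dF)"]) simp
      ultimately show "\<exists>t. (P (Suc n) t \<and> (Suc n = 0 \<longrightarrow> t = (f, D))) \<and> Q n s t" by blast
    qed
    then show ?thesis by blast
  qed
  then obtain S where SP: "\<And>n. P n (S n)" and SQ: "\<And>n. Q n (S n) (S (Suc n))" and S0: "S 0 = (f, D)" by blast
  obtain p where p: "\<And>n. Rl n (S n) (S (Suc n)) (fst (p n)) (snd (p n))"
    using SQ unfolding Q_def by metis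
  define F where "F n = fst (p n)" for n
  define dF where "dF n = snd (p n)" for n
  have F: "\<And>n x. (F n has_derivative (\<lambda>h. dF n x \<bullet> h)) (at x)" "\<And>n x. norm (dF n x) \<le> 17 * (K' / 2^n)"
    "\<And>n. continuous_on UNIV (dF n)" "\<And>n. fst (S (Suc n)) = (\<lambda>x. fst (S n) x - F n x)"
    using p unfolding Rl_def F_def dF_def by simp_all
  have rem: "fst (S n) x = f x - (\<Sum>k<n. F k x)" for n x
    by (induction n) (auto simp: S0 F(4))
  have sumsE: "(\<lambda>n. F n x) sums f x" if x: "x \<in> E" for x
  proof -
    define r where "r = norm (x - y0)"
    have "\<bar>fst (S n) x\<bar> \<le> (2 * K' * r) * (1/2)^n" if n: "n > 0" for n
    proof -
      have z: "fst (S n) y0 = 0" and b: "jet_bound E (fst (S n)) (snd (S n)) (K' / 2^n)" using SP[of n] n unfolding P_def by auto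
      have "\<bar>fst (S n) x - fst (S n) y0 - snd (S n) y0 \<bullet> (x - y0)\<bar> \<le> K' / 2^n * r"
        using b x y0 unfolding jet_bound_def r_def by blast
      moreover have "\<bar>snd (S n) y0 \<bullet> (x - y0)\<bar> \<le> K' / 2^n * r"
      proof -
        have "norm (snd (S n) y0) \<le> K' / 2^n" using b y0 unfolding jet_bound_def by blast
        then have "norm (snd (S n) y0) * r \<le> K' / 2^n * r" by (rule mult_right_mono) (simp add: r_def)
        then show ?thesis using Cauchy_Schwarz_ineq2[of "snd (S n) y0" "x - y0"] unfolding r_def by linarith
      qed
      ultimately have "\<bar>fst (S n) x\<bar> \<le> 2 * (K' / 2^n * r)" using z by linarith
      then show ?thesis by (simp add: power_one_over field_simps)
    qed
    then have "\<forall>\<^sub>F n in sequentially. norm (f x - (\<Sum>k<n. F k x)) \<le> (2 * K' * r) * (1/2)^n"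
      unfolding rem[symmetric] real_norm_def by (intro eventually_mono[OF eventually_gt_at_top[of 0]])
    moreover have "(\<lambda>n. (2 * K' * r) * (1/2::real)^n) \<longlonglongrightarrow> 0"
      by (intro tendsto_mult_right_zero LIMSEQ_power_zero) simp
    ultimately have "(\<lambda>n. f x - (\<Sum>k<n. F k x)) \<longlonglongrightarrow> 0" by (rule Lim_null_comparison)
    then have "(\<lambda>n. f x - (f x - (\<Sum>k<n. F k x))) \<longlonglongrightarrow> f x - 0" by (intro tendsto_diff tendsto_const)
    then show ?thesis unfolding sums_def by simp
  qed
  have summ: "summable (\<lambda>n. 17 * K' * (1/2::real)^n)"
    by (intro summable_mult summable_geometric) simp
  have bnd: "norm (dF n x) \<le> 17 * K' * (1/2)^n" for n x using F(2)[of n x] by (simp add: power_one_over)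
  define dg where "dg x = suminf (\<lambda>n. dF n x)" for x
  have ul: "uniform_limit UNIV (\<lambda>n x. \<Sum>i<n. dF i x) dg sequentially"
    unfolding dg_def[abs_def] by (rule Weierstrass_m_test[OF bnd summ])
  have dgc: "continuous_on UNIV dg"
    by (rule uniform_limit_theorem[OF _ ul]) (auto intro!: always_eventually continuous_intros F(3))
  \<comment> \<open>Uniform convergence of the gradients, together with convergence of the functions
    at the single point \<open>y0\<close>, gives convergence everywhere and termwise
    differentiation.\<close>
  have "\<exists>g. \<forall>x\<in>UNIV. (\<lambda>n. F n x) sums g x \<and> (g has_derivative (\<lambda>h. dg x \<bullet> h)) (at x within UNIV)"
  proof (rule has_derivative_series[where f'="\<lambda>n x h. dF n x \<bullet> h" and x=y0 and l="f y0"])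
    fix e :: real assume e: "e > 0"
    have "\<forall>\<^sub>F n in sequentially. \<forall>x\<in>UNIV. dist (\<Sum>i<n. dF i x) (dg x) < e" using ul e unfolding uniform_limit_iff by blast
    then show "\<forall>\<^sub>F n in sequentially. \<forall>x\<in>UNIV. \<forall>h. norm ((\<Sum>i<n. dF i x \<bullet> h) - dg x \<bullet> h) \<le> e * norm h"
    proof eventually_elim
      case (elim n)
      show ?case
      proof (intro ballI allI)
        fix x h :: "real^'n"
        have "(\<Sum>i<n. dF i x \<bullet> h) - dg x \<bullet> h = ((\<Sum>i<n. dF i x) - dg x) \<bullet> h" by (simp add: inner_diff_left inner_sum_left)
        also have "norm \<dots> \<le> norm ((\<Sum>i<n. dF i x) - dg x) * norm h"
          using Cauchy_Schwarz_ineq2[of "(\<Sum>i<n. dF i x) - dg x" h] by simp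
        also have "\<dots> \<le> e * norm h" using elim[rule_format, of x] by (intro mult_right_mono) (auto simp: dist_norm)
        finally show "norm ((\<Sum>i<n. dF i x \<bullet> h) - dg x \<bullet> h) \<le> e * norm h" .
      qed
    qed
  qed (use F(1) sumsE[OF y0] in auto)
  then obtain g where g: "\<And>x. (\<lambda>n. F n x) sums g x" "\<And>x. (g has_derivative (\<lambda>h. dg x \<bullet> h)) (at x)" by auto
  have "g x = f x" if "x \<in> E" for x using sums_unique2[OF g(1) sumsE[OF that]] .
  then show ?thesis using g(2) dgc by blast
qed

section \<open>The singular set\<close>

lemma linear_functional_inner:
  fixes f :: "real^'n \<Rightarrow> real"
  assumes "linear f"
  shows "f h = (\<chi> i. f (axis i 1)) \<bullet> h"
proof -
  have "h = (\<Sum>i\<in>UNIV. h $ i *\<^sub>R axis i 1)"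
    using basis_expansion[of h] by (simp add: scalar_mult_eq_scaleR)
  then have "f h = f (\<Sum>i\<in>UNIV. h $ i *\<^sub>R axis i 1)" by simp
  also have "\<dots> = (\<Sum>i\<in>UNIV. h $ i * f (axis i 1))"
    using assms by (simp add: linear_sum linear_cmul)
  finally show ?thesis by (simp add: inner_vec_def mult.commute)
qed

lemma grad_has_derivative:
  assumes "u differentiable (at x)"
  shows "(u has_derivative (\<lambda>h. grad u x \<bullet> h)) (at x)"
proof -
  have d: "(u has_derivative frechet_derivative u (at x)) (at x)" using assms frechet_derivative_works by blast
  have "frechet_derivative u (at x) = (\<lambda>h. grad u x \<bullet> h)"
    unfolding grad_def using linear_functional_inner[OF has_derivative_linear[OF d]] by blast
  then show ?thesis using d by simp
qed

lemma grad_eqI: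
  fixes u :: "real^'n \<Rightarrow> real"
  assumes "(u has_derivative (\<lambda>h. a \<bullet> h)) (at x)"
  shows "grad u x = a"
proof -
  have "frechet_derivative u (at x) = (\<lambda>h. a \<bullet> h)" using frechet_derivative_at[OF assms] by simp
  then show ?thesis unfolding grad_def by (simp add: vec_eq_iff inner_axis)
qed

text \<open>Evaluation at half a basis vector yields a diagonal entry over 8, and at a quarter of
  the sum of two basis vectors the sum of four entries over 32. The constant is (32 + 8 + 8) /
  2.\<close>

lemma quad_poly_polarize:
  fixes B :: "real^'n^'n"
  assumes sym: "transpose B = B" and q: "\<And>z. norm z \<le> 1/2 \<Longrightarrow> \<bar>quad_poly B z\<bar> \<le> \<delta>"
  shows "\<bar>B $ i $ j\<bar> \<le> 24 * \<delta>"
proof -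
  have s: "B $ j $ i = B $ i $ j" using sym unfolding transpose_def by (metis vec_lambda_beta)
  have d: "\<bar>B $ k $ k\<bar> \<le> 8 * \<delta>" for k
  proof -
    have "quad_poly B ((1/2) *\<^sub>R axis k 1) = B $ k $ k / 8"
      by (simp only: quad_poly_scale) (simp add: quad_poly_alt power2_eq_square flip: matrix_entry_inner)
    then show ?thesis using q[of "(1/2) *\<^sub>R axis k 1"] by simp
  qed
  have "norm (axis i 1 + axis j 1 :: real^'n) \<le> 2" using norm_triangle_ineq[of "axis i 1 :: real^'n" "axis j 1"] by simp
  then have "norm ((1/4) *\<^sub>R (axis i 1 + axis j 1) :: real^'n) \<le> 1/2" by simp
  from q[OF this] have "\<bar>quad_poly B ((1/4) *\<^sub>R (axis i 1 + axis j 1))\<bar> \<le> \<delta>" .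
  moreover have "quad_poly B ((1/4) *\<^sub>R (axis i 1 + axis j 1)) = (B $ i $ i + B $ j $ j + 2 * B $ i $ j) / 32"
    using s by (simp only: quad_poly_scale)
      (simp add: quad_poly_alt power2_eq_square matrix_vector_right_distrib inner_add_left inner_add_right flip: matrix_entry_inner)
  ultimately have "\<bar>B $ i $ i + B $ j $ j + 2 * B $ i $ j\<bar> \<le> 32 * \<delta>" by simp
  then show ?thesis using d[of i] d[of j] by linarith
qed

text \<open>Nonnegativity of the form at h - A h / N, where N bounds the operator norm, gives the
  estimate without a square root of A. It turns a small value of the polynomial at \<open>h\<close>
  into a small A h.\<close>

lemma admissible_matrix_vector_le:
  fixes A :: "real^'n^'n"
  assumes A: "admissible_matrix A"
  shows "(norm (A *v h))\<^sup>2 \<le> 2 * dim_sq TYPE('n) * quad_poly A h"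
proof -
  define N where "N = dim_sq TYPE('n)"
  have N: "N \<ge> 1" unfolding N_def by (rule NB_ge1)
  define w where "w = A *v h"
  define t where "t = 1 / N"
  have t: "t > 0" "t * N = 1" using N by (auto simp: t_def)
  have e: "(h - t *\<^sub>R w) \<bullet> (A *v (h - t *\<^sub>R w)) = h \<bullet> w - 2 * t * (w \<bullet> w) + t\<^sup>2 * (w \<bullet> (A *v w))"
    using admissible_sym[OF A, of h w]
    by (simp add: w_def matrix_vector_mult_diff_distrib matrix_vector_mult_scaleR inner_diff_left inner_diff_right power2_eq_square inner_commute algebra_simps)
  have "0 \<le> (h - t *\<^sub>R w) \<bullet> (A *v (h - t *\<^sub>R w))" using A unfolding admissible_matrix_def by blast
  then have 1: "2 * t * (w \<bullet> w) \<le> h \<bullet> w + t\<^sup>2 * (w \<bullet> (A *v w))" unfolding e by linarith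
  have "w \<bullet> (A *v w) \<le> norm w * norm (A *v w)" by (rule norm_cauchy_schwarz)
  also have "\<dots> \<le> norm w * (N * norm w)" unfolding N_def by (intro mult_left_mono admissible_norm_le A) simp
  also have "\<dots> = N * (w \<bullet> w)" by (simp add: dot_square_norm power2_eq_square)
  finally have "t\<^sup>2 * (w \<bullet> (A *v w)) \<le> t\<^sup>2 * (N * (w \<bullet> w))" by (rule mult_left_mono) simp
  also have "\<dots> = t * (w \<bullet> w)" using t(2) by (simp add: power2_eq_square)
  finally have "t * (w \<bullet> w) \<le> h \<bullet> w" using 1 by linarith
  then have "w \<bullet> w \<le> N * (h \<bullet> w)" using N by (simp add: t_def field_simps)
  then show ?thesis by (simp add: w_def N_def quad_poly_alt power2_norm_eq_inner)
qed

text \<open>All singular points near \<open>x0\<close> are rescaled by the same \<open>R\<close>;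
  they become normalized solutions with a common \<open>L\<close>, to which the two uniform results
  apply. Closeness of the matrices comes from closeness of the rescaled functions. The last estimate
  holds because the rescaling at \<open>x\<close> vanishes in the direction of \<open>y\<close>, so
  the polynomial at \<open>x\<close> is small there.\<close>

lemma stratum_uniform:
  fixes u :: "real^'n \<Rightarrow> real" and \<Omega> :: "(real^'n) set"
  assumes op: "open \<Omega>" and C11: "C11_loc \<Omega> u" and nonneg: "\<forall>x\<in>\<Omega>. u x \<ge> 0" and lap: "laplacian_eq_indicator_ae \<Omega> u"
    and x0: "x0 \<in> \<Omega>"
  obtains R where "R > 0"
    "\<And>\<epsilon>. \<epsilon> > 0 \<Longrightarrow> \<exists>\<delta>>0. \<forall>x y A B. x \<in> ball x0 R \<inter> singular_set \<Omega> u \<and> y \<in> ball x0 R \<inter> singular_set \<Omega> u \<and>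
       admissible_matrix A \<and> conv_C1_loc (\<lambda>r. rescale u x r) (quad_poly A) (at_right 0) \<and>
       admissible_matrix B \<and> conv_C1_loc (\<lambda>r. rescale u y r) (quad_poly B) (at_right 0) \<and> norm (y - x) < \<delta> \<longrightarrow>
       (\<forall>h. norm (A *v h - B *v h) \<le> \<epsilon> * norm h) \<and> norm (A *v (y - x)) \<le> \<epsilon> * norm (y - x)"
proof -
  obtain e where e: "e > 0" "cball x0 e \<subseteq> \<Omega>" using op x0 open_contains_cball by blast
  \<comment> \<open>Centres vary over radius R and each rescaling is needed up to radius 2 R, which
    requires 3 R around \<open>x0\<close>.\<close>
  define R where "R = e / 3"
  have R: "R > 0" using e by (simp add: R_def)
  have Kb: "cball x0 (3 * R) \<subseteq> \<Omega>" using e by (simp add: R_def)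
  obtain L0 where L0: "\<And>x y. x \<in> cball x0 (3*R) \<Longrightarrow> y \<in> cball x0 (3*R) \<Longrightarrow> norm (grad u x - grad u y) \<le> L0 * dist x y"
    using C11 Kb unfolding C11_loc_def by (meson compact_cball)
  define L where "L = max 0 L0"
  have L: "0 \<le> L" by (simp add: L_def)
  have lip: "norm (grad u x - grad u y) \<le> L * norm (x - y)" if "x \<in> cball x0 (3*R)" "y \<in> cball x0 (3*R)" for x y
  proof -
    have "norm (grad u x - grad u y) \<le> L0 * dist x y" by (rule L0[OF that])
    also have "\<dots> \<le> L * dist x y" by (intro mult_right_mono) (auto simp: L_def)
    finally show ?thesis by (simp add: dist_norm)
  qed
  have der: "(u has_derivative (\<lambda>h. grad u x \<bullet> h)) (at x)" if "x \<in> \<Omega>" for x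
    using C11 that unfolding C11_loc_def by (intro grad_has_derivative) blast
  \<comment> \<open>Completing the measure does not affect almost everywhere statements, so
    \<open>lebesgue\<close> may be replaced by \<open>lborel\<close>.\<close>
  have ae: "AE x in lborel. x \<in> \<Omega> \<longrightarrow> (\<exists>G. (grad u has_derivative G) (at x) \<and>
             (\<Sum>i\<in>UNIV. G (axis i 1) $ i) = indicator {y. u y > 0} x)"
    using lap unfolding laplacian_eq_indicator_ae_def AE_completion_iff .
  \<comment> \<open>By continuity the positivity set is open and hence disjoint from its
    frontier.\<close>
  have u0: "u x = 0" if "x \<in> singular_set \<Omega> u" for x
  proof (rule ccontr)
    assume "u x \<noteq> 0"
    have xO: "x \<in> \<Omega>" and fr: "x \<in> frontier {x \<in> \<Omega>. u x > 0}" using that unfolding singular_set_def by auto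
    have "u x > 0" using nonneg xO \<open>u x \<noteq> 0\<close> by force
    have "continuous_on \<Omega> u" by (intro continuous_at_imp_continuous_on ballI has_derivative_continuous[OF der])
    then have "open (\<Omega> \<inter> u -` {0<..})" using op by (intro continuous_open_preimage) auto
    moreover have "\<Omega> \<inter> u -` {0<..} = {x \<in> \<Omega>. u x > 0}" by auto
    ultimately have "x \<in> interior {x \<in> \<Omega>. u x > 0}" using xO \<open>u x > 0\<close> by (simp add: interior_open)
    then show False using fr by (simp add: frontier_def)
  qed
  have sub: "y \<in> cball x0 (3*R)" if "x \<in> ball x0 R" "y \<in> ball x (2*R)" for x y
    using that dist_triangle[of x0 y x] by simp
  define V where "V x = rescale u x R" for x
  define dV where "dV x = drescale (grad u) x R" for x
  have solV: "obstacle_sol L (V x) (dV x)" if x: "x \<in> ball x0 R" and z: "u x = 0" for x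
    unfolding V_def dV_def
  proof (rule sol_rescale[OF R L])
    note s = sub[OF x]
    show "AE y in lborel. y \<in> ball x (2*R) \<longrightarrow>
        (\<exists>G. (grad u has_derivative G) (at y) \<and> (\<Sum>i\<in>UNIV. G (axis i 1) $ i) = indicator {y. u y > 0} y)"
      using ae by (rule eventually_mono) (use s Kb in blast)
    fix y assume y: "y \<in> ball x (2*R)"
    show "(u has_derivative (\<lambda>h. grad u y \<bullet> h)) (at y)" using der s[OF y] Kb by blast
    show "0 \<le> u y" using nonneg s[OF y] Kb by blast
    fix y' assume y': "y' \<in> ball x (2*R)"
    show "norm (grad u y - grad u y') \<le> L * norm (y - y')" by (rule lip[OF s[OF y] s[OF y']])
  qed (rule z)
  have blowsV: "blows_up_to (V x) (dV x) A"
    if x: "x \<in> ball x0 R" and z: "u x = 0" and A: "admissible_matrix A" and c: "conv_C1_loc (\<lambda>r. rescale u x r) (quad_poly A) (at_right 0)" for x A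
    unfolding blows_up_to_def
  proof (intro allI impI)
    fix e :: real assume e: "e > 0"
    have "\<forall>\<^sub>F r in at_right 0. \<forall>y\<in>cball 0 1. \<bar>rescale u x r y - quad_poly A y\<bar> < e \<and> norm (grad (rescale u x r) y - grad (quad_poly A) y) < e"
      using c e unfolding conv_C1_loc_def by (meson compact_cball)
    \<comment> \<open>The rescaling of \<open>V x\<close> at scale r is the rescaling of
      \<open>u\<close> at scale r R.\<close>
    moreover have "filterlim (\<lambda>r. r * R) (at_right 0) (at_right 0)"
    proof -
      have "((\<lambda>r. r * R) \<longlongrightarrow> 0 * R) (at_right 0)" by (intro tendsto_intros)
      moreover have "\<forall>\<^sub>F r in at_right 0. r * R > 0" using R by (auto simp: eventually_at_filter)
      ultimately show ?thesis by (simp add: filterlim_at)  (auto elim: eventually_mono)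
    qed
    ultimately have "\<forall>\<^sub>F r in at_right 0. \<forall>y\<in>cball 0 1. \<bar>rescale u x (r * R) y - quad_poly A y\<bar> < e \<and> norm (grad (rescale u x (r * R)) y - grad (quad_poly A) y) < e"
      by (rule eventually_compose_filterlim)
    moreover have "\<forall>\<^sub>F r in at_right 0. r \<in> {0<..<1::real}" by (rule eventually_at_right_real) simp
    ultimately show "\<forall>\<^sub>F r in at_right 0. \<forall>y\<in>cball 0 1. \<bar>rescale (V x) 0 r y - quad_poly A y\<bar> < e \<and> norm (drescale (dV x) 0 r y - A *v y) < e"
    proof eventually_elim
      case (elim r)
      have s: "obstacle_sol L (rescale (V x) 0 r) (drescale (dV x) 0 r)" by (rule sol_rescale_0[OF solV[OF x z]]) (use elim in auto)
      show ?case
      proof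
        fix y :: "real^'n" assume y: "y \<in> cball 0 1"
        then have yb: "y \<in> ball 0 2" by simp
        have "grad (rescale (V x) 0 r) y = drescale (dV x) 0 r y" by (rule grad_eqI[OF solD(2)[OF s yb]])
        moreover have "grad (quad_poly A) y = A *v y" by (rule grad_eqI[OF c11D(1)[OF c11_quad_poly[OF A] yb]])
        moreover have "rescale (V x) 0 r = rescale u x (r * R)" unfolding V_def by (rule rescale_rescale)
        ultimately show "\<bar>rescale (V x) 0 r y - quad_poly A y\<bar> < e \<and> norm (drescale (dV x) 0 r y - A *v y) < e"
          using elim(1)[rule_format, OF y] by simp
      qed
    qed
  qed
  define G where "G = norm (grad u x0) + L * (3 * R)"
  have G: "norm (grad u x) \<le> G" if "x \<in> cball x0 (3*R)" for x
  proof -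
    have "norm (grad u x) \<le> norm (grad u x0) + norm (grad u x - grad u x0)" using norm_triangle_ineq[of "grad u x0" "grad u x - grad u x0"] by simp
    also have "norm (grad u x - grad u x0) \<le> L * norm (x - x0)" by (rule lip[OF that]) (use R in simp)
    also have "\<dots> \<le> L * (3 * R)" using that L by (intro mult_left_mono) (auto simp: dist_norm norm_minus_commute)
    finally show ?thesis by (simp add: G_def)
  qed
  have G0: "0 \<le> G" unfolding G_def using L R by simp
  have ulip: "\<bar>u x - u y\<bar> \<le> G * norm (x - y)" if "x \<in> cball x0 (3*R)" "y \<in> cball x0 (3*R)" for x y
  proof -
    have "norm (u x - u y) \<le> G * norm (x - y)"
    proof (rule differentiable_bound[where f'="\<lambda>x h. grad u x \<bullet> h" and S="cball x0 (3*R)"])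
      fix z assume z: "z \<in> cball x0 (3*R)"
      then have "z \<in> \<Omega>" using Kb by blast
      from der[OF this] show "(u has_derivative (\<lambda>h. grad u z \<bullet> h)) (at z within cball x0 (3*R))" by (rule has_derivative_at_withinI)
      show "onorm (\<lambda>h. grad u z \<bullet> h) \<le> G" by (rule onorm_inner_le[OF G[OF z]])
    qed (use that in auto)
    then show ?thesis by simp
  qed
  have Vclose: "\<bar>V x z - V y z\<bar> \<le> G / R\<^sup>2 * norm (x - y)" if x: "x \<in> ball x0 R" and y: "y \<in> ball x0 R" and z: "norm z \<le> 1" for x y z
  proof -
    have i: "w + R *\<^sub>R z \<in> cball x0 (3*R)" if w: "w \<in> ball x0 R" for w
    proof (rule sub[OF w])
      have "R * norm z \<le> R * 1" using z R by (intro mult_left_mono) auto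
      then show "w + R *\<^sub>R z \<in> ball w (2*R)" using R by (simp add: dist_norm)
    qed
    have "\<bar>u (x + R *\<^sub>R z) - u (y + R *\<^sub>R z)\<bar> \<le> G * norm (x - y)" using ulip[OF i[OF x] i[OF y]] by simp
    then have "\<bar>u (x + R *\<^sub>R z) - u (y + R *\<^sub>R z)\<bar> / R\<^sup>2 \<le> G * norm (x - y) / R\<^sup>2" by (intro divide_right_mono) auto
    then show ?thesis unfolding V_def rescale_def by (simp add: diff_divide_distrib[symmetric])
  qed
  show ?thesis
  proof (rule that[OF R])
    fix \<epsilon> :: real assume \<epsilon>: "\<epsilon> > 0"
    define N where "N = dim_sq TYPE('n)"
    have N: "N \<ge> 1" unfolding N_def by (rule NB_ge1)
    \<comment> \<open>The 24 comes from \<open>quad_poly_polarize\<close>, the N from passing from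
      entries to the operator norm.\<close>
    define d1 where "d1 = \<epsilon> / (24 * N)"
    have d1: "d1 > 0" unfolding d1_def using \<epsilon> N by simp
    obtain \<theta> where \<theta>: "0 < \<theta>" and cont: "\<And>(v :: real^'n \<Rightarrow> real) dv B v' dv' B' x. obstacle_sol L v dv \<Longrightarrow> admissible_matrix B \<Longrightarrow> blows_up_to v dv B \<Longrightarrow>
       obstacle_sol L v' dv' \<Longrightarrow> admissible_matrix B' \<Longrightarrow> blows_up_to v' dv' B' \<Longrightarrow> (\<forall>x. norm x \<le> 1 \<longrightarrow> \<bar>v x - v' x\<bar> \<le> \<theta>) \<Longrightarrow>
       norm x \<le> 1/2 \<Longrightarrow> \<bar>quad_poly B x - quad_poly B' x\<bar> \<le> d1"
      by (rule blowup_uniform_continuity[OF d1 L]) (rule that, assumption+)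
    \<comment> \<open>Chosen to make 2 N (2 |h|)^2 \<open>d2\<close> equal to the square of
      \<epsilon> |h|, as \<open>admissible_matrix_vector_le\<close> requires.\<close>
    define d2 where "d2 = \<epsilon>\<^sup>2 / (8 * N)"
    have d2: "d2 > 0" unfolding d2_def using \<epsilon> N by simp
    obtain \<rho> where \<rho>: "0 < \<rho>" and rate: "\<And>(v :: real^'n \<Rightarrow> real) dv B s x. obstacle_sol L v dv \<Longrightarrow> admissible_matrix B \<Longrightarrow> blows_up_to v dv B \<Longrightarrow>
       0 < s \<Longrightarrow> s \<le> \<rho> \<Longrightarrow> norm x \<le> 1/2 \<Longrightarrow> \<bar>rescale v 0 s x - quad_poly B x\<bar> \<le> d2"
      by (rule blowup_uniform_rate[OF d2 L]) (rule that, assumption+)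
    \<comment> \<open>The first bound makes the rescaled functions at \<open>x\<close> and
      \<open>y\<close> \<theta>-close, through the Lipschitz constant G of \<open>u\<close>; the
      second keeps the scale \<open>s\<close> below \<rho>.\<close>
    define \<delta> where "\<delta> = min (\<theta> * R\<^sup>2 / (G + 1)) (\<rho> * R / 2)"
    have \<delta>: "\<delta> > 0" unfolding \<delta>_def using \<theta> R G0 \<rho> by simp
    have main: "(\<forall>h. norm (A *v h - B *v h) \<le> \<epsilon> * norm h) \<and> norm (A *v (y - x)) \<le> \<epsilon> * norm (y - x)"
      if x: "x \<in> ball x0 R \<inter> singular_set \<Omega> u" and y: "y \<in> ball x0 R \<inter> singular_set \<Omega> u"
       and A: "admissible_matrix A" and cA: "conv_C1_loc (\<lambda>r. rescale u x r) (quad_poly A) (at_right 0)"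
       and B: "admissible_matrix B" and cB: "conv_C1_loc (\<lambda>r. rescale u y r) (quad_poly B) (at_right 0)" and n: "norm (y - x) < \<delta>" for x y A B
    proof
      have xb: "x \<in> ball x0 R" and yb: "y \<in> ball x0 R" and ux: "u x = 0" and uy: "u y = 0" using x y u0 by auto
      note sx = solV[OF xb ux] and sy = solV[OF yb uy]
      note bx = blowsV[OF xb ux A cA] and bY = blowsV[OF yb uy B cB]
      have vc: "\<bar>V x z - V y z\<bar> \<le> \<theta>" if "norm z \<le> 1" for z
      proof -
        have "norm (x - y) \<le> \<theta> * R\<^sup>2 / (G + 1)" using n by (simp add: \<delta>_def norm_minus_commute)
        then have "(G + 1) * norm (x - y) \<le> \<theta> * R\<^sup>2" using G0 by (simp add: pos_le_divide_eq mult.commute)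
        then have "G * norm (x - y) \<le> \<theta> * R\<^sup>2" unfolding distrib_right using norm_ge_zero[of "x - y"] by linarith
        then have "G / R\<^sup>2 * norm (x - y) \<le> \<theta>" using R by (simp add: pos_divide_le_eq)
        then show ?thesis using Vclose[OF xb yb that] by linarith
      qed
      have qd: "\<bar>quad_poly (A - B) z\<bar> \<le> d1" if "norm z \<le> 1/2" for z
        unfolding quad_poly_diff by (rule cont[OF sx A bx sy B bY _ that]) (use vc in blast)
      have "transpose (A - B) = A - B"
        using A B unfolding admissible_matrix_def transpose_def by (auto simp: vec_eq_iff)
      then have "\<bar>(A - B) $ i $ j\<bar> \<le> 24 * d1" for i j by (rule quad_poly_polarize[OF _ qd])
      then have "norm ((A - B) *v h) \<le> 24 * d1 * N * norm h" for h unfolding N_def by (rule entries_le_imp_norm_le)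
      moreover have "24 * d1 * N = \<epsilon>" using N by (simp add: d1_def)
      ultimately show "\<forall>h. norm (A *v h - B *v h) \<le> \<epsilon> * norm h" by (simp add: matrix_vector_mult_diff_rdistrib)
      show "norm (A *v (y - x)) \<le> \<epsilon> * norm (y - x)"
      proof (cases "y = x")
        case False
        define h where "h = y - x"
        have h0: "norm h > 0" using False by (simp add: h_def)
        \<comment> \<open>At this scale \<open>y\<close> appears at the point \<open>z\<close> of
          norm 1/2, the edge of the half ball in which \<open>rate\<close> holds.\<close>
        define s where "s = 2 * norm h / R"
        have s: "0 < s" unfolding s_def using h0 R by simp
        have "norm h \<le> \<rho> * R / 2" using n by (simp add: \<delta>_def h_def)
        then have s\<rho>: "s \<le> \<rho>" unfolding s_def using R by (simp add: pos_divide_le_eq)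
        define z where "z = (1 / (2 * norm h)) *\<^sub>R h"
        have nz: "norm z \<le> 1/2" unfolding z_def using h0 by simp
        have sR: "s * R = 2 * norm h" unfolding s_def using R by simp
        have "rescale (V x) 0 s z = rescale u x (2 * norm h) z" unfolding V_def rescale_rescale sR ..
        also have "\<dots> = 0" unfolding rescale_def z_def using h0 uy by (simp add: h_def)
        finally have "quad_poly A z \<le> d2" using rate[OF sx A bx s s\<rho> nz] by simp
        moreover have "h = (2 * norm h) *\<^sub>R z" unfolding z_def using h0 by simp
        then have "quad_poly A h = (2 * norm h)\<^sup>2 * quad_poly A z" by (metis quad_poly_scale)
        ultimately have "quad_poly A h \<le> (2 * norm h)\<^sup>2 * d2" by (simp add: mult_left_mono)
        then have "2 * N * quad_poly A h \<le> 2 * N * ((2 * norm h)\<^sup>2 * d2)" using N by (intro mult_left_mono) auto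
        also have "\<dots> = (\<epsilon> * norm h)\<^sup>2" unfolding d2_def using N by (simp add: power2_eq_square)
        finally have "(norm (A *v h))\<^sup>2 \<le> (\<epsilon> * norm h)\<^sup>2" using admissible_matrix_vector_le[OF A, of h] unfolding N_def by linarith
        then have "norm (A *v h) \<le> \<epsilon> * norm h" by (rule power2_le_imp_le) (use \<epsilon> in simp)
        then show ?thesis by (simp add: h_def)
      qed simp
    qed
    show "\<exists>\<delta>>0. \<forall>x y A B. x \<in> ball x0 R \<inter> singular_set \<Omega> u \<and> y \<in> ball x0 R \<inter> singular_set \<Omega> u \<and>
       admissible_matrix A \<and> conv_C1_loc (\<lambda>r. rescale u x r) (quad_poly A) (at_right 0) \<and>
       admissible_matrix B \<and> conv_C1_loc (\<lambda>r. rescale u y r) (quad_poly B) (at_right 0) \<and> norm (y - x) < \<delta> \<longrightarrow>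
       (\<forall>h. norm (A *v h - B *v h) \<le> \<epsilon> * norm h) \<and> norm (A *v (y - x)) \<le> \<epsilon> * norm (y - x)"
      using \<delta> main by blast
  qed
qed

section \<open>The stratum as a graph over a kernel\<close>

lemma orthogonal_projection_exists:
  fixes L :: "(real^'n) set"
  assumes L: "subspace L"
  obtains P where "linear P" "\<And>x. P x \<in> L" "\<And>w. w \<in> L \<Longrightarrow> P w = w" "\<And>x w. w \<in> L \<Longrightarrow> (x - P x) \<bullet> w = 0"
    "\<And>x. norm (P x) \<le> norm x" "\<And>x. norm (x - P x) \<le> norm x"
proof -
  obtain B where B: "B \<subseteq> L" "pairwise orthogonal B" "\<And>x. x \<in> B \<Longrightarrow> norm x = 1" "independent B" "span B = L"
    using orthonormal_basis_subspace[OF L] by metis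
  have fB: "finite B" using B(4) by (rule independent_imp_finite)
  define P where "P x = (\<Sum>b\<in>B. (b \<bullet> x) *\<^sub>R b)" for x
  have lin: "linear P"
    unfolding P_def[abs_def]
    by (rule linearI) (simp_all add: inner_add_right scaleR_add_left sum.distrib scaleR_sum_right)
  have PL: "P x \<in> L" for x
    unfolding P_def using B(1) by (intro subspace_sum[OF L] subspace_scale[OF L]) auto
  have orthB: "(x - P x) \<bullet> c = 0" if c: "c \<in> B" for x c
  proof -
    have "P x \<bullet> c = (\<Sum>b\<in>B. (b \<bullet> x) * (b \<bullet> c))" unfolding P_def by (simp add: inner_sum_left)
    also have "\<dots> = (\<Sum>b\<in>B. if b = c then c \<bullet> x else 0)"
    proof (rule sum.cong)
      fix b assume b: "b \<in> B"
      show "(b \<bullet> x) * (b \<bullet> c) = (if b = c then c \<bullet> x else 0)"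
      proof (cases "b = c")
        case True
        then show ?thesis using B(3)[OF c] by (simp add: dot_square_norm)
      next
        case False
        then have "b \<bullet> c = 0" using B(2) b c unfolding pairwise_def orthogonal_def by blast
        then show ?thesis using False by simp
      qed
    qed simp
    also have "\<dots> = c \<bullet> x" using fB c by simp
    finally show ?thesis using inner_commute[of c x] by (simp add: inner_diff_left)
  qed
  have orth: "(x - P x) \<bullet> w = 0" if w: "w \<in> L" for x w
  proof -
    have "w \<in> span B" using w B(5) by simp
    then show ?thesis
      by (induction rule: span_induct_alt) (auto simp: inner_add_right orthB)
  qed
  have id: "P w = w" if w: "w \<in> L" for w
  proof -
    have "w - P w \<in> L" using w PL L by (simp add: subspace_diff)
    then have "(w - P w) \<bullet> (w - P w) = 0" by (rule orth)
    then show ?thesis by simp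
  qed
  have pyth: "(norm x)\<^sup>2 = (norm (P x))\<^sup>2 + (norm (x - P x))\<^sup>2" for x
  proof -
    have "(x - P x) \<bullet> P x = 0" by (rule orth[OF PL])
    then have "x \<bullet> P x = P x \<bullet> P x" by (simp add: inner_diff_left)
    then show ?thesis
      unfolding power2_norm_eq_inner inner_diff_left inner_diff_right inner_commute[of "P x" x] by simp
  qed
  have n: "norm (P x) \<le> norm x" "norm (x - P x) \<le> norm x" for x
  proof -
    have "(norm (P x))\<^sup>2 \<le> (norm x)\<^sup>2" "(norm (x - P x))\<^sup>2 \<le> (norm x)\<^sup>2" unfolding pyth[of x] by simp_all
    then show "norm (P x) \<le> norm x" "norm (x - P x) \<le> norm x" by (auto dest: power2_le_imp_le)
  qed
  show ?thesis by (rule that[OF lin PL id orth n])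
qed

text \<open>A global graph needs a single chart, with the whole space as its open set.\<close>

lemma C1_submanifold_graph:
  assumes L: "subspace L" "dim L = m"
    and g: "\<And>x. (g has_derivative blinfun_apply (G x)) (at x)" "continuous_on UNIV G" "\<And>x v. v \<in> L \<Longrightarrow> g x \<bullet> v = 0"
  shows "C1_submanifold m {y + g y | y. y \<in> L}"
  unfolding C1_submanifold_def using L g
  by (intro ballI exI[of _ UNIV] exI[of _ L] exI[of _ g] exI[of _ G]) auto

text \<open>With \<open>P\<close> the projection to \<open>ker (A x0)\<close> and \<open>J = 1 - P\<close>, the map \<open>T x = J \<circ> A x + P\<close> is invertible near
  \<open>x0\<close>, and \<open>J \<circ> (T x)\<inverse> \<circ> P\<close> is the derivative of the graph at \<open>x\<close>.\<close>

lemma graph_over_kernel: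
  fixes E :: "(real^'n) set" and A :: "real^'n \<Rightarrow> real^'n^'n"
  assumes x0: "x0 \<in> E" and adm: "admissible_matrix (A x0)" and dimL: "dim {v. A x0 *v v = 0} = m"
    and unif: "\<And>\<epsilon>. \<epsilon> > 0 \<Longrightarrow> \<exists>\<delta>>0. \<forall>x\<in>E. \<forall>y\<in>E. norm (y - x) < \<delta> \<longrightarrow>
       (\<forall>h. norm (A x *v h - A y *v h) \<le> \<epsilon> * norm h) \<and> norm (A x *v (y - x)) \<le> \<epsilon> * norm (y - x)"
  shows "\<exists>U M. open U \<and> x0 \<in> U \<and> C1_submanifold m M \<and> E \<inter> U \<subseteq> M"
proof -
  define L where "L = {v. A x0 *v v = 0}"
  have L: "subspace L" unfolding L_def subspace_def
    by (auto simp: matrix_vector_right_distrib matrix_vector_mult_scaleR)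
  obtain P where P: "linear P" "\<And>x. P x \<in> L" "\<And>w. w \<in> L \<Longrightarrow> P w = w" "\<And>x w. w \<in> L \<Longrightarrow> (x - P x) \<bullet> w = 0"
    "\<And>x. norm (P x) \<le> norm x" "\<And>x. norm (x - P x) \<le> norm x"
    using orthogonal_projection_exists[OF L] by metis
  define J where "J x = x - P x" for x
  have linJ: "linear J" unfolding J_def[abs_def] by (intro linear_compose_sub linear_ident P(1))
  have linA: "linear (\<lambda>v. A x *v v)" for x by (rule matrix_vector_mul_linear)
  have J: "norm (J x) \<le> norm x" "P (P x) = P x" "J (P x) = 0" "w \<in> L \<Longrightarrow> J x \<bullet> w = 0" for x w
    using P by (auto simp: J_def)
  define T where "T x v = J (A x *v v) + P v" for x v
  have linT: "linear (T x)" for x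
    unfolding T_def[abs_def] using linear_compose_add[OF linear_compose[OF linA linJ] P(1), of x] by (simp add: o_def)
  \<comment> \<open>By symmetry the range of A x0 is orthogonal to its kernel L. The two summands of
    \<open>T x0 v\<close> are therefore orthogonal and vanish separately, which puts
    \<open>v\<close> into L and makes its projection 0.\<close>
  have inj0: "inj (T x0)"
  proof -
    have "v = 0" if "T x0 v = 0" for v
    proof -
      have "(A x0 *v v) \<bullet> w = 0" if "w \<in> L" for w
        using admissible_sym[OF adm, of v w] that by (simp add: L_def)
      then have "P (A x0 *v v) \<bullet> P (A x0 *v v) = 0"
        using P(4)[OF P(2)[of "A x0 *v v"], of "A x0 *v v"] P(2)[of "A x0 *v v"] by (simp add: inner_diff_left)
      then have p0: "P (A x0 *v v) = 0" by simp
      then have eq: "A x0 *v v + P v = 0" using that by (simp add: T_def J_def)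
      have "(A x0 *v v) \<bullet> P v = 0" using P(4)[OF P(2)[of v], of "A x0 *v v"] p0 by simp
      then have "(A x0 *v v + P v) \<bullet> P v = P v \<bullet> P v" by (simp add: inner_add_left)
      then have pv: "P v = 0" using eq by simp
      then have "v \<in> L" using eq by (simp add: L_def)
      then show "v = 0" using P(3)[of v] pv by simp
    qed
    then show ?thesis using linear_injective_0[OF linT] by blast
  qed
  obtain c where c: "c > 0" and cT: "\<And>v. c * norm v \<le> norm (T x0 v)"
    using linear_inj_bounded_below_pos[OF linT inj0] by blast
  \<comment> \<open>A perturbation of size c / 2 leaves half of the lower bound c; thus
    \<open>k\<close> bounds the inverses \<open>S x\<close> uniformly over
    \<open>E'\<close>.\<close>
  define k where "k = 2 / c"
  have k: "k > 0" using c by (simp add: k_def)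
  have Tdiff: "norm (T x v - T y v) \<le> norm (A x *v v - A y *v v)" for x y v
  proof -
    have "T x v - T y v = J (A x *v v - A y *v v)" unfolding T_def by (simp add: linear_diff[OF linJ])
    then show ?thesis using J(1) by simp
  qed
  obtain \<delta>1 where \<delta>1: "\<delta>1 > 0" and u1: "\<And>x h. x \<in> E \<Longrightarrow> norm (x - x0) < \<delta>1 \<Longrightarrow> norm (A x0 *v h - A x *v h) \<le> c / 2 * norm h"
    using unif[of "c / 2"] c x0 by (metis half_gt_zero)
  \<comment> \<open>With the factor \<open>1 / (2 * k)\<close> the error in \<open>Dapprox\<close>
    is at most half of |h|, which can be absorbed in \<open>Plow\<close>.\<close>
  obtain \<delta>2 where \<delta>2: "\<delta>2 > 0" and u2: "\<And>x y. x \<in> E \<Longrightarrow> y \<in> E \<Longrightarrow> norm (y - x) < \<delta>2 \<Longrightarrow> norm (A x *v (y - x)) \<le> (1 / (2 * k)) * norm (y - x)"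
    using unif[of "1 / (2 * k)"] k by (metis divide_pos_pos mult_pos_pos zero_less_one zero_less_numeral)
  define \<rho> where "\<rho> = min \<delta>1 (\<delta>2 / 2)"
  have \<rho>: "\<rho> > 0" using \<delta>1 \<delta>2 by (simp add: \<rho>_def)
  define E' where "E' = E \<inter> ball x0 \<rho>"
  have E'E: "x \<in> E" if "x \<in> E'" for x using that by (simp add: E'_def)
  have E'd: "norm (y - x) < \<delta>2" if "x \<in> E'" "y \<in> E'" for x y
  proof -
    have "norm (y - x) \<le> dist x0 y + dist x0 x" using dist_triangle3[of y x x0] by (simp add: dist_norm)
    then show ?thesis using that by (simp add: E'_def \<rho>_def)
  qed
  have lower: "norm v \<le> k * norm (T x v)" if x: "x \<in> E'" for x v
  proof -
    have "norm (x - x0) < \<delta>1" using x by (simp add: E'_def \<rho>_def dist_norm norm_minus_commute)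
    from u1[OF E'E[OF x] this] have "norm (T x0 v - T x v) \<le> c / 2 * norm v" using Tdiff[of x0 v x] by (rule order_trans[rotated])
    then have "c / 2 * norm v \<le> norm (T x v)"
      using cT[of v] norm_triangle_ineq2[of "T x0 v" "T x0 v - T x v"] by simp
    then show ?thesis using c by (simp add: k_def field_simps)
  qed
  have "\<exists>S. linear S \<and> (\<forall>v. S (T x v) = v) \<and> (\<forall>w. T x (S w) = w)" if x: "x \<in> E'" for x
  proof -
    have "v = 0" if "T x v = 0" for v using lower[OF x, of v] that by simp
    then have inj: "inj (T x)" using linear_injective_0[OF linT] by blast
    obtain S where S: "linear S" "S \<circ> T x = id" using linear_injective_left_inverse[OF linT inj] by blast
    then have l: "S (T x v) = v" for v by (metis comp_apply id_apply)
    have "surj (T x)" by (rule linear_inj_imp_surj[OF linT inj])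
    then have "T x (S w) = w" for w using l by (metis surjD)
    then show ?thesis using S(1) l by blast
  qed
  then obtain S where S: "\<And>x. x \<in> E' \<Longrightarrow> linear (S x)" "\<And>x v. x \<in> E' \<Longrightarrow> S x (T x v) = v" "\<And>x w. x \<in> E' \<Longrightarrow> T x (S x w) = w"
    by metis
  have Sb: "norm (S x w) \<le> k * norm w" if "x \<in> E'" for x w using lower[OF that, of "S x w"] S(3)[OF that] by simp
  \<comment> \<open>If A x h is small, then T x h is close to P h and h to S x (P h). So
    \<open>D x\<close> predicts the normal part of a displacement from its projection.\<close>
  define D where "D x w = J (S x (P w))" for x w
  have linD: "linear (D x)" if "x \<in> E'" for x
    unfolding D_def[abs_def] using linear_compose[OF linear_compose[OF P(1) S(1)[OF that]] linJ] by (simp add: o_def)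
  have DP: "D x (P w) = D x w" for x w by (simp add: D_def J(2))
  have Db: "norm (D x w) \<le> k * norm w" if x: "x \<in> E'" for x w
  proof -
    have "norm (D x w) \<le> k * norm (P w)" unfolding D_def using J(1) Sb[OF x] by (rule order_trans)
    also have "\<dots> \<le> k * norm w" using k P(5) by (intro mult_left_mono) auto
    finally show ?thesis .
  qed
  \<comment> \<open>The resolvent identity: S x - S y is S x (T y - T x) S y, with both inverses
    bounded by \<open>k\<close>.\<close>
  have Ddiff: "norm (D x w - D y w) \<le> k * (\<epsilon> * (k * norm w))"
    if x: "x \<in> E'" and y: "y \<in> E'" and e: "\<And>h. norm (A x *v h - A y *v h) \<le> \<epsilon> * norm h" "0 \<le> \<epsilon>" for x y w \<epsilon>
  proof -
    define q where "q = S y (P w)"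
    have "S x (P w) - q = S x (T y q - T x q)"
      using S(2)[OF x, of q] S(3)[OF y, of "P w"] by (simp add: q_def linear_diff[OF S(1)[OF x]])
    then have "norm (S x (P w) - q) \<le> k * norm (T x q - T y q)" using Sb[OF x, of "T y q - T x q"] norm_minus_commute[of "T y q" "T x q"] by simp
    also have "\<dots> \<le> k * (\<epsilon> * norm q)" using k order_trans[OF Tdiff e(1)] by (intro mult_left_mono) auto
    also have "\<dots> \<le> k * (\<epsilon> * (k * norm w))"
    proof -
      have "norm q \<le> k * norm (P w)" unfolding q_def by (rule Sb[OF y])
      also have "\<dots> \<le> k * norm w" using k P(5) by (intro mult_left_mono) auto
      finally show ?thesis using k e(2) by (intro mult_left_mono) auto
    qed
    finally have "norm (S x (P w) - q) \<le> k * (\<epsilon> * (k * norm w))" .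
    moreover have "D x w - D y w = J (S x (P w) - q)" unfolding D_def q_def by (simp add: linear_diff[OF linJ])
    ultimately show ?thesis using J(1)[of "S x (P w) - q"] by simp
  qed
  have Dapprox: "norm (J h - D x h) \<le> k * norm (A x *v h)" if x: "x \<in> E'" for x h
  proof -
    have "h - S x (P h) = S x (T x h - P h)" using S(2)[OF x] by (simp add: linear_diff[OF S(1)[OF x]])
    also have "T x h - P h = J (A x *v h)" by (simp add: T_def)
    finally have e: "h - S x (P h) = S x (J (A x *v h))" .
    have "J h - D x h = J (h - S x (P h))" unfolding D_def by (simp add: linear_diff[OF linJ])
    then have "norm (J h - D x h) \<le> norm (h - S x (P h))" using J(1) by simp
    also have "\<dots> \<le> k * norm (J (A x *v h))" unfolding e by (rule Sb[OF x])
    also have "\<dots> \<le> k * norm (A x *v h)" using k J(1) by (intro mult_left_mono) auto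
    finally show ?thesis .
  qed
  \<comment> \<open>From |h| at most |P h| + |J h| and |J h| at most |h| / 2 + k |P h|, after
    absorbing |h| / 2.\<close>
  define q where "q = 2 * (1 + k)"
  have q: "q > 0" using k by (simp add: q_def)
  have Plow: "norm (y - x) \<le> q * norm (P y - P x)" if x: "x \<in> E'" and y: "y \<in> E'" for x y
  proof -
    define h where "h = y - x"
    have Ph: "P h = P y - P x" unfolding h_def by (rule linear_diff[OF P(1)])
    have "norm (A x *v h) \<le> (1 / (2 * k)) * norm h" unfolding h_def by (rule u2[OF E'E[OF x] E'E[OF y] E'd[OF x y]])
    then have "k * norm (A x *v h) \<le> k * ((1 / (2 * k)) * norm h)" using k by (intro mult_left_mono) auto
    then have "norm (J h - D x h) \<le> norm h / 2" using Dapprox[OF x, of h] k by simp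
    moreover have "norm (D x h) \<le> k * norm (P h)" using Db[OF x, of "P h"] by (simp add: DP)
    moreover have "norm h \<le> norm (P h) + norm (J h)" using norm_triangle_ineq[of "P h" "J h"] by (simp add: J_def)
    moreover have "norm (J h) \<le> norm (J h - D x h) + norm (D x h)" using norm_triangle_ineq[of "J h - D x h" "D x h"] by simp
    ultimately have "norm h \<le> 2 * norm (P h) + 2 * (k * norm (P h))" by linarith
    then show ?thesis unfolding Ph[symmetric] h_def[symmetric] q_def by (simp add: algebra_simps)
  qed
  \<comment> \<open>By \<open>Plow\<close> the projection is injective on \<open>E'\<close>, and
    \<open>X\<close> recovers a point from its projection. The components of J (X p) are the
    functions on F to be extended, one at a time.\<close>
  define X where "X = inv_into E' P"
  have inj: "inj_on P E'"
    by (rule inj_onI) (use Plow in fastforce)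
  have X: "X (P x) = x" if "x \<in> E'" for x unfolding X_def by (rule inv_into_f_f[OF inj that])
  define F where "F = P ` E'"
  define n where "n = real CARD('n)"
  have n0: "n \<ge> 0" by (simp add: n_def)
  have "\<exists>g dg. (\<forall>x. (g has_derivative (\<lambda>h. dg x \<bullet> h)) (at x)) \<and> continuous_on UNIV dg \<and> (\<forall>x\<in>F. g x = J (X x) $ i)" for i
  proof (rule whitney_extension_C1)
    let ?f = "\<lambda>p. J (X p) $ i"
    define d where "d p = (\<chi> j. D (X p) (axis j 1) $ i)" for p
    have din: "d (P x) \<bullet> w = D x w $ i" if "x \<in> E'" for x w
    proof -
      have "linear (\<lambda>w. D x w $ i)"
        using linear_compose[OF linD[OF that] bounded_linear.linear[OF bounded_linear_vec_nth[of i]]] by (simp add: o_def)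
      from linear_functional_inner[OF this, of w] show ?thesis by (simp add: d_def X[OF that])
    qed
    have dn: "norm (d (P x)) \<le> n * k" if x: "x \<in> E'" for x
    proof -
      have "norm (d (P x)) \<le> (\<Sum>j\<in>UNIV. \<bar>d (P x) $ j\<bar>)" by (rule norm_le_l1_cart)
      also have "\<dots> \<le> (\<Sum>j\<in>(UNIV::'n set). k)"
      proof (rule sum_mono)
        fix j :: 'n
        have "\<bar>D x (axis j 1) $ i\<bar> \<le> norm (D x (axis j 1))" by (rule component_le_norm_cart)
        then show "\<bar>d (P x) $ j\<bar> \<le> k" using Db[OF x, of "axis j 1"] by (simp add: d_def X[OF x])
      qed
      finally show ?thesis by (simp add: n_def)
    qed
    have rem: "?f (P y) - ?f (P x) - d (P x) \<bullet> (P y - P x) = (J (y - x) - D x (y - x)) $ i" if x: "x \<in> E'" and y: "y \<in> E'" for x y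
    proof -
      have "P y - P x = P (y - x)" by (simp add: linear_diff[OF P(1)])
      then show ?thesis using X[OF x] X[OF y] by (simp add: din[OF x] DP linear_diff[OF linJ])
    qed
    show "whitney_jet F ?f d"
      unfolding whitney_jet_def
    proof (intro allI impI)
      fix e :: real assume e: "e > 0"
      \<comment> \<open>The first bound serves the Taylor remainder, in which |y - x| is replaced by
        q |P y - P x|; the second serves the sum over the n components of the difference of
        derivatives.\<close>
      define \<epsilon> where "\<epsilon> = min (e / (k * q)) (e / (n * (k * k) + 1))"
      have \<epsilon>: "\<epsilon> > 0" "\<epsilon> \<le> e / (k * q)" "\<epsilon> \<le> e / (n * (k * k) + 1)"
        unfolding \<epsilon>_def using e k q n0 by (auto simp: add_nonneg_pos)
      have e1: "k * \<epsilon> * q \<le> e" using \<epsilon>(2) k q by (simp add: pos_le_divide_eq ac_simps)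
      have "\<epsilon> * (n * (k * k) + 1) \<le> e" using \<epsilon>(3) n0 k by (simp add: pos_le_divide_eq add_nonneg_pos)
      then have e2: "n * (k * (\<epsilon> * k)) \<le> e" using \<epsilon>(1) by (simp add: algebra_simps)
      obtain \<delta> where \<delta>: "\<delta> > 0" and u: "\<And>x y. x \<in> E \<Longrightarrow> y \<in> E \<Longrightarrow> norm (y - x) < \<delta> \<Longrightarrow>
         (\<forall>h. norm (A x *v h - A y *v h) \<le> \<epsilon> * norm h) \<and> norm (A x *v (y - x)) \<le> \<epsilon> * norm (y - x)"
        using unif[OF \<epsilon>(1)] by metis
      have "\<bar>?f b - ?f a - d a \<bullet> (b - a)\<bar> \<le> e * norm (b - a) \<and> norm (d b - d a) \<le> e"
        if ab: "a \<in> F" "b \<in> F" and nab: "norm (b - a) < \<delta> / q" for a b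
      proof -
        obtain x y where x: "x \<in> E'" "a = P x" and y: "y \<in> E'" "b = P y" using ab by (auto simp: F_def)
        have "norm (y - x) \<le> q * norm (b - a)" using Plow[OF x(1) y(1)] x y by simp
        moreover have "q * norm (b - a) < \<delta>" using nab q by (simp add: pos_less_divide_eq mult.commute)
        ultimately have nd: "norm (y - x) < \<delta>" and nq: "norm (y - x) \<le> q * norm (b - a)" by linarith+
        note uu = u[OF E'E[OF x(1)] E'E[OF y(1)] nd]
        have "\<bar>?f b - ?f a - d a \<bullet> (b - a)\<bar> \<le> norm (J (y - x) - D x (y - x))"
          using rem[OF x(1) y(1)] component_le_norm_cart[of "J (y - x) - D x (y - x)" i] x y by simp
        also have "\<dots> \<le> k * (\<epsilon> * norm (y - x))" using Dapprox[OF x(1), of "y - x"] uu k mult_left_mono[of "norm (A x *v (y - x))" "\<epsilon> * norm (y - x)" k] by linarith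
        also have "\<dots> \<le> k * (\<epsilon> * (q * norm (b - a)))" using k \<epsilon>(1) nq by (intro mult_left_mono) auto
        also have "\<dots> = (k * \<epsilon> * q) * norm (b - a)" by simp
        also have "\<dots> \<le> e * norm (b - a)" using e1 by (intro mult_right_mono) auto
        finally have 1: "\<bar>?f b - ?f a - d a \<bullet> (b - a)\<bar> \<le> e * norm (b - a)" .
        have "norm (d b - d a) \<le> (\<Sum>j\<in>UNIV. \<bar>(d b - d a) $ j\<bar>)" by (rule norm_le_l1_cart)
        also have "\<dots> \<le> (\<Sum>j\<in>(UNIV::'n set). k * (\<epsilon> * k))"
        proof (rule sum_mono)
          fix j :: 'n
          have "(d b - d a) $ j = (D y (axis j 1) - D x (axis j 1)) $ i" using X[OF x(1)] X[OF y(1)] by (simp add: d_def x(2) y(2))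
          then have "\<bar>(d b - d a) $ j\<bar> \<le> norm (D y (axis j 1) - D x (axis j 1))" using component_le_norm_cart by metis
          also have "\<dots> = norm (D x (axis j 1) - D y (axis j 1))" by (rule norm_minus_commute)
          also have "\<dots> \<le> k * (\<epsilon> * (k * norm (axis j (1::real) :: real^'n)))" by (rule Ddiff[OF x(1) y(1)]) (use uu \<epsilon> in auto)
          finally show "\<bar>(d b - d a) $ j\<bar> \<le> k * (\<epsilon> * k)" by simp
        qed
        also have "\<dots> = n * (k * (\<epsilon> * k))" by (simp add: n_def)
        finally show ?thesis using 1 e2 by linarith
      qed
      then show "\<exists>\<delta>>0. \<forall>a\<in>F. \<forall>b\<in>F. norm (b - a) < \<delta> \<longrightarrow> \<bar>?f b - ?f a - d a \<bullet> (b - a)\<bar> \<le> e * norm (b - a) \<and> norm (d b - d a) \<le> e"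
        using \<delta> q by (intro exI[of _ "\<delta> / q"]) auto
    qed
    show "jet_bound F ?f d (n * k + q * (1 + k))"
      unfolding jet_bound_def
    proof (intro conjI ballI)
      fix a assume "a \<in> F"
      then obtain x where x: "x \<in> E'" "a = P x" by (auto simp: F_def)
      have qk: "0 \<le> q * (1 + k)" and nk: "0 \<le> n * k" using q k n0 by auto
      show "norm (d a) \<le> n * k + q * (1 + k)" using dn[OF x(1)] x(2) qk by simp
      fix b assume "b \<in> F"
      then obtain y where y: "y \<in> E'" "b = P y" by (auto simp: F_def)
      have "\<bar>?f b - ?f a - d a \<bullet> (b - a)\<bar> \<le> norm (J (y - x) - D x (y - x))"
        using rem[OF x(1) y(1)] component_le_norm_cart[of "J (y - x) - D x (y - x)" i] x y by simp
      also have "\<dots> \<le> norm (y - x) + k * norm (y - x)"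
        using norm_triangle_ineq4[of "J (y - x)" "D x (y - x)"] J(1)[of "y - x"] Db[OF x(1), of "y - x"] by linarith
      also have "\<dots> = (1 + k) * norm (y - x)" by (simp add: algebra_simps)
      also have "\<dots> \<le> (1 + k) * (q * norm (b - a))" using Plow[OF x(1) y(1)] x y k by (intro mult_left_mono) auto
      also have "\<dots> = (q * (1 + k)) * norm (b - a)" by simp
      also have "\<dots> \<le> (n * k + q * (1 + k)) * norm (b - a)" using nk by (intro mult_right_mono) auto
      finally show "\<bar>?f b - ?f a - d a \<bullet> (b - a)\<bar> \<le> (n * k + q * (1 + k)) * norm (b - a)" .
    qed
  qed
  then obtain g dg where g: "\<And>i x. (g i has_derivative (\<lambda>h. dg i x \<bullet> h)) (at x)" "\<And>i. continuous_on UNIV (dg i)"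
    "\<And>i x. x \<in> F \<Longrightarrow> g i x = J (X x) $ i" by metis
  define H where "H x = (\<chi> i. g i x)" for x
  define dH where "dH x h = (\<chi> i. dg i x \<bullet> h)" for x h
  have dH: "(H has_derivative dH x) (at x)" for x
    unfolding H_def[abs_def] dH_def
    by (subst has_derivative_componentwise_within) (auto simp: Basis_vec_def inner_axis g(1))
  have blJ: "bounded_linear J" by (rule linear_conv_bounded_linear[THEN iffD1, OF linJ])
  \<comment> \<open>Composition with \<open>J\<close> makes the extended map orthogonal to L, as
    \<open>C1_submanifold\<close> demands. On F nothing changes, since the values there lie in the
    range of \<open>J\<close> already.\<close>
  define G where "G x = Blinfun (\<lambda>h. J (dH x h))" for x
  have bl: "bounded_linear (\<lambda>h. J (dH x h))" for x
    by (rule bounded_linear_compose[OF blJ has_derivative_bounded_linear[OF dH]])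
  have Ga: "blinfun_apply (G x) = (\<lambda>h. J (dH x h))" for x unfolding G_def by (rule bounded_linear_Blinfun_apply[OF bl])
  have dG: "((\<lambda>x. J (H x)) has_derivative blinfun_apply (G x)) (at x)" for x
    unfolding Ga by (rule bounded_linear.has_derivative[OF blJ dH])
  have Gc: "continuous_on UNIV G"
  proof (rule continuous_on_blinfun_componentwise)
    fix b :: "real^'n"
    have "continuous_on UNIV (\<lambda>x. dH x b)" unfolding dH_def by (intro continuous_intros g(2))
    then show "continuous_on UNIV (\<lambda>x. blinfun_apply (G x) b)" unfolding Ga
      by (rule bounded_linear.continuous_on[OF blJ])
  qed
  define M where "M = {y + J (H y) | y. y \<in> L}"
  have "C1_submanifold m M" unfolding M_def
    by (rule C1_submanifold_graph[OF L _ dG Gc]) (use dimL J(4) in \<open>auto simp: L_def\<close>)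
  moreover have "E \<inter> ball x0 \<rho> \<subseteq> M"
  proof
    fix x assume "x \<in> E \<inter> ball x0 \<rho>"
    then have x: "x \<in> E'" by (simp add: E'_def)
    then have "P x \<in> F" by (simp add: F_def)
    then have "H (P x) = J (X (P x))" unfolding H_def by (simp add: g(3) vec_eq_iff)
    then have "H (P x) = J x" by (simp only: X[OF x])
    moreover have "J (J x) = J x" by (simp add: J_def linear_diff[OF P(1)] J(2))
    ultimately have "x = P x + J (H (P x))" by (simp add: J_def)
    then show "x \<in> M" unfolding M_def using P(2)[of x] by blast
  qed
  moreover have "x0 \<in> ball x0 \<rho>" using \<rho> by simp
  ultimately show ?thesis using open_ball by blast
qed

theorem theorem9p1:
  fixes \<Omega> :: "(real^'n) set" and u :: "real^'n \<Rightarrow> real" and m :: nat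
  assumes "open \<Omega>"
    and "C11_loc \<Omega> u"
    and "\<forall>x\<in>\<Omega>. u x \<ge> 0"
    and "laplacian_eq_indicator_ae \<Omega> u"
    and "m < CARD('n)"
  shows "\<forall>x0\<in>singular_stratum \<Omega> u m. \<exists>U M. open U \<and> x0 \<in> U \<and> C1_submanifold m M \<and>
           singular_stratum \<Omega> u m \<inter> U \<subseteq> M"
proof
  fix x0 assume x0: "x0 \<in> singular_stratum \<Omega> u m"
  then have x0\<Omega>: "x0 \<in> \<Omega>" unfolding singular_stratum_def singular_set_def by blast
  obtain R where R: "R > 0" and unif: "\<And>\<epsilon>. \<epsilon> > 0 \<Longrightarrow> \<exists>\<delta>>0. \<forall>x y A B. x \<in> ball x0 R \<inter> singular_set \<Omega> u \<and> y \<in> ball x0 R \<inter> singular_set \<Omega> u \<and>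
       admissible_matrix A \<and> conv_C1_loc (\<lambda>r. rescale u x r) (quad_poly A) (at_right 0) \<and>
       admissible_matrix B \<and> conv_C1_loc (\<lambda>r. rescale u y r) (quad_poly B) (at_right 0) \<and> norm (y - x) < \<delta> \<longrightarrow>
       (\<forall>h. norm (A *v h - B *v h) \<le> \<epsilon> * norm h) \<and> norm (A *v (y - x)) \<le> \<epsilon> * norm (y - x)"
    using stratum_uniform[OF assms(1-4) x0\<Omega>] by blast
  have "\<forall>x\<in>singular_stratum \<Omega> u m. \<exists>A. admissible_matrix A \<and> conv_C1_loc (\<lambda>r. rescale u x r) (quad_poly A) (at_right 0) \<and> dim {v. A *v v = 0} = m"
    unfolding singular_stratum_def by blast
  \<comment> \<open>One matrix is chosen for each point; \<open>stratum_uniform\<close> speaks of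
    all pairs of candidate matrices, so any choice is covered.\<close>
  then obtain A where A: "\<And>x. x \<in> singular_stratum \<Omega> u m \<Longrightarrow> admissible_matrix (A x)"
    "\<And>x. x \<in> singular_stratum \<Omega> u m \<Longrightarrow> conv_C1_loc (\<lambda>r. rescale u x r) (quad_poly (A x)) (at_right 0)"
    "\<And>x. x \<in> singular_stratum \<Omega> u m \<Longrightarrow> dim {v. A x *v v = 0} = m"
    by metis
  define E where "E = singular_stratum \<Omega> u m \<inter> ball x0 R"
  have ES: "singular_stratum \<Omega> u m \<subseteq> singular_set \<Omega> u" unfolding singular_stratum_def by blast
  have x0E: "x0 \<in> E" using x0 R by (simp add: E_def)
  have "\<exists>\<delta>>0. \<forall>x\<in>E. \<forall>y\<in>E. norm (y - x) < \<delta> \<longrightarrow>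
       (\<forall>h. norm (A x *v h - A y *v h) \<le> \<epsilon> * norm h) \<and> norm (A x *v (y - x)) \<le> \<epsilon> * norm (y - x)" if \<epsilon>: "\<epsilon> > 0" for \<epsilon>
  proof -
    obtain \<delta> where \<delta>: "\<delta> > 0" and u: "\<And>x y A B. x \<in> ball x0 R \<inter> singular_set \<Omega> u \<and> y \<in> ball x0 R \<inter> singular_set \<Omega> u \<and>
       admissible_matrix A \<and> conv_C1_loc (\<lambda>r. rescale u x r) (quad_poly A) (at_right 0) \<and>
       admissible_matrix B \<and> conv_C1_loc (\<lambda>r. rescale u y r) (quad_poly B) (at_right 0) \<and> norm (y - x) < \<delta> \<longrightarrow>
       (\<forall>h. norm (A *v h - B *v h) \<le> \<epsilon> * norm h) \<and> norm (A *v (y - x)) \<le> \<epsilon> * norm (y - x)"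
      using unif[OF \<epsilon>] by blast
    have "(\<forall>h. norm (A x *v h - A y *v h) \<le> \<epsilon> * norm h) \<and> norm (A x *v (y - x)) \<le> \<epsilon> * norm (y - x)"
      if x: "x \<in> E" and y: "y \<in> E" and n: "norm (y - x) < \<delta>" for x y
    proof -
      have xs: "x \<in> singular_stratum \<Omega> u m" "y \<in> singular_stratum \<Omega> u m" and b: "x \<in> ball x0 R" "y \<in> ball x0 R"
        using x y by (auto simp: E_def)
      show ?thesis by (rule u[rule_format]) (use xs b ES A(1,2)[OF xs(1)] A(1,2)[OF xs(2)] n in blast)
    qed
    then show ?thesis using \<delta> by blast
  qed
  from graph_over_kernel[OF x0E A(1)[OF x0] A(3)[OF x0] this]
  obtain U M where U: "open U" "x0 \<in> U" "C1_submanifold m M" "E \<inter> U \<subseteq> M" by blast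
  show "\<exists>U M. open U \<and> x0 \<in> U \<and> C1_submanifold m M \<and> singular_stratum \<Omega> u m \<inter> U \<subseteq> M"
    by (rule exI[of _ "U \<inter> ball x0 R"], rule exI[of _ M]) (use U R in \<open>auto simp: E_def\<close>)
qed

end
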